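(* Let $\Omega\subset\mathbb R^n$ be a bounded domain with $C^{m+2,\alpha}$ boundary, $m\in\mathbb N_0$, $0<\alpha<1$, and let $a_1,a_2\in C^{2m+1,\alpha}(\overline\Omega\times\mathbb R\times\mathbb R^n)$ be positive. Let $\phi\in C^{m+2,\alpha}(\partial\Omega)$ and let $\Phi\in C^{m+2,\alpha}(\overline\Omega)$ be strictly convex, with $D^2\Phi\ge c_0I_n$ in $\overline\Omega$ for some $c_0>0$, and such that $\det D^2\Phi=a_j(x,\Phi,\nabla\Phi)$ in $\Omega$, $\Phi=\phi$ on $\partial\Omega$, for both $j=1,2$; assume $\partial_za_j(x,\Phi,\nabla\Phi)\ge0$ for $j=1,2$. Suppose the first linearizations of $a_1$ and $a_2$ along $(\Phi,\nabla\Phi)$ agree, so that $L_\Phi:=L^1_\Phi=L^2_\Phi$. Let $2\le k\le m+1$ and assume $$d^r_{(z,p)}a_1(x,\Phi,\nabla\Phi)=d^r_{(z,p)}a_2(x,\Phi,\nabla\Phi)\quad\text{in }\Omega,\qquad1\le r\le k-1.$$ Assume moreover that the following product-density implication holds: if a (continuous on $\overline\Omega$) field of symmetric $k$-linear forms $A(x)\in\operatorname{Sym}^k(\mathbb R\times\mathbb R^n)^*$ satisfies $$\int_\Omega A(x)\big[(v_1,\nabla v_1),\dots,(v_k,\nabla v_k)\big]\,w\,dx=0$$ for all solutions $v_1,\dots,v_k\in C^{m+2,\alpha}(\overline\Omega)$ of $L_\Phi v_\ell=0$ in $\Omega$ and all weak solutions $w\in H^1(\Omega)$ of $L_\Phi^*w=0$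 in $\Omega$, then $A=0$ in $\Omega$. If the nonlinear Cauchy data sets of $a_1$ and $a_2$ have the same variations up to order $k$ at the background $\Phi$, i.e. for all $1\le r\le k$ and all $h_1,\dots,h_r\in C^{m+2,\alpha}(\partial\Omega)$ $$\partial_\nu\big(d^r\mathcal S_1(\phi)[h_1,\dots,h_r]\big)=\partial_\nu\big(d^r\mathcal S_2(\phi)[h_1,\dots,h_r]\big)\quad\text{on }\partial\Omega,$$ then $$d^k_{(z,p)}a_1(x,\Phi,\nabla\Phi)=d^k_{(z,p)}a_2(x,\Phi,\nabla\Phi)\quad\text{in }\Omega.$$
   Context: Nonlinearities are written $a=a(x,z,p)$, $x\in\overline\Omega$, $z\in\mathbb R$, $p\in\mathbb R^n$; $d^r_{(z,p)}a$ is the $r$-th derivative in $(z,p)\in\mathbb R\times\mathbb R^n$, a symmetric $r$-linear form. $C^{k,\alpha}(\overline\Omega)$ is the usual Hölder space (norms required finite on unbounded sets); $C^{k,\alpha}(\partial\Omega)$ carries the quotient norm over extensions. $\partial_\nu$ is the exterior normal derivative. Linearized operator: $$L^j_\Phi v=\operatorname{tr}(\mathcal C_\Phi D^2v)-b^j_\Phi\cdot\nabla v-q^j_\Phi v=\operatorname{div}(\mathcal C_\Phi\nabla v)-b^j_\Phi\cdot\nabla v-q^j_\Phi v,$$ with $\mathcal C_\Phi=\operatorname{cof}D^2\Phi$ (cofactor matrix), $b^j_\Phi=\nabla_pa_j(x,\Phi,\nabla\Phi)$, $q^j_\Phi=\partial_za_j(x,\Phi,\nabla\Phi)$. "First linearizations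 agree" means $b^1_\Phi=b^2_\Phi=:b_\Phi$ and $q^1_\Phi=q^2_\Phi=:q_\Phi$. $L_\Phi^*$ is the $L^2$-adjoint; $w\in H^1(\Omega)$ is a weak solution of $L_\Phi^*w=0$ if $\int_\Omega(\mathcal C_\Phi\nabla w\cdot\nabla\chi+w\,b_\Phi\cdot\nabla\chi+q_\Phi w\chi)\,dx=0$ for all $\chi\in H^1_0(\Omega)$. Solution operators: local well-posedness provides, for $j=1,2$, $\delta>0$ and a neighbourhood $V$ of $\Phi$ in $C^{m+2,\alpha}(\overline\Omega)$ such that for every $\eta\in C^{m+2,\alpha}(\partial\Omega)$ with $\|\eta-\phi\|_{C^{m+2,\alpha}(\partial\Omega)}<\delta$ the problem $\det D^2u=a_j(x,u,\nabla u)$ in $\Omega$, $u=\eta$ on $\partial\Omega$ has a unique solution $u=:\mathcal S_j(\eta)\in V$, and $\mathcal S_j$ is of class $C^{m+1}$ (Fréchet, into $C^{m+2,\alpha}(\overline\Omega)$) near $\phi$ with $\mathcal S_j(\phi)=\Phi$. $d^r\mathcal S_j(\phi)[h_1,\dots,h_r]$ is its $r$-th Fréchet derivative. The nonlinear Cauchy data set of $a_j$ around the background is $\{(\eta,\partial_\nu\mathcal S_j(\eta)|_{\partial\Omega}):\|\eta-\phi\|<\delta\}$. *)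

theory Defs
  imports "HOL-Analysis.Analysis" "HOL-Library.Multiset"
begin

section \<open>Derivatives\<close>

text \<open>\<open>nderiv [v1, \<dots>, vr] f x\<close> is the \<open>r\<close>-th derivative \<open>d^r f(x)[v1, \<dots>, vr]\<close>; it is used only where
  \<open>f\<close> is \<open>r\<close> times continuously differentiable near \<open>x\<close>, so the order of the directions is immaterial.\<close>

fun nderiv :: "'a::real_normed_vector list \<Rightarrow> ('a \<Rightarrow> 'b::real_normed_vector) \<Rightarrow> 'a \<Rightarrow> 'b" where
  "nderiv [] f = f"
| "nderiv (v # vs) f = (\<lambda>x. frechet_derivative (nderiv vs f) (at x) v)"

definition grad :: "(real^'n \<Rightarrow> real) \<Rightarrow> real^'n \<Rightarrow> real^'n" where
  "grad u x = (\<chi> i. nderiv [axis i 1] u x)"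

definition hess :: "(real^'n \<Rightarrow> real) \<Rightarrow> real^'n \<Rightarrow> real^'n^'n" where
  "hess u x = (\<chi> i j. nderiv [axis i 1, axis j 1] u x)"

text \<open>Derivatives of a function in \<open>C^k(closure U)\<close> are taken in the open set \<open>U\<close>; their boundary values
  are those of the continuous extension.\<close>

definition bdry_ext :: "'a::topological_space set \<Rightarrow> ('a \<Rightarrow> 'b::t2_space) \<Rightarrow> 'a \<Rightarrow> 'b" where
  "bdry_ext U g x = (if x \<in> U then g x else Lim (at x within U) g)"

section \<open>Hoelder spaces\<close>

text \<open>Functions are total; only their values on \<open>closure U\<close> (respectively on the frontier) matter.
  Multi-indices are lists of basis vectors.\<close>

definition mindex :: "nat \<Rightarrow> 'a::euclidean_space list set" where
  "mindex r = {vs. set vs \<subseteq> Basis \<and> length vs = r}"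

definition Ck_closure :: "nat \<Rightarrow> 'a::euclidean_space set \<Rightarrow> ('a \<Rightarrow> real) \<Rightarrow> bool" where
  "Ck_closure k U f \<longleftrightarrow>
     continuous_on (closure U) f \<and>
     (\<forall>r<k. \<forall>vs\<in>mindex r. \<forall>x\<in>U. nderiv vs f differentiable (at x)) \<and>
     (\<forall>r\<le>k. \<forall>vs\<in>mindex r. \<exists>g. continuous_on (closure U) g \<and> (\<forall>x\<in>U. g x = nderiv vs f x))"

text \<open>A space of real functions with a seminorm; functions at seminorm distance 0 are identified.\<close>

record 'a fspace =
  fcarrier :: "('a \<Rightarrow> real) set"
  fnorm :: "('a \<Rightarrow> real) \<Rightarrow> real"

definition holder_seminorm :: "real \<Rightarrow> 'a::metric_space set \<Rightarrow> ('a \<Rightarrow> real) \<Rightarrow> real" where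
  "holder_seminorm \<alpha> U g =
     Sup {\<bar>g x - g y\<bar> / dist x y powr \<alpha> | x y. x \<in> U \<and> y \<in> U \<and> x \<noteq> y}"

definition holder_space :: "nat \<Rightarrow> real \<Rightarrow> 'a::euclidean_space set \<Rightarrow> 'a fspace" where
  "holder_space k \<alpha> U =
    \<lparr> fcarrier = {f. Ck_closure k U f \<and>
        (\<forall>r\<le>k. \<forall>vs\<in>mindex r. bounded (nderiv vs f ` U)) \<and>
        (\<forall>vs\<in>mindex k. \<exists>C. \<forall>x\<in>U. \<forall>y\<in>U.
            \<bar>nderiv vs f x - nderiv vs f y\<bar> \<le> C * dist x y powr \<alpha>)},
      fnorm = (\<lambda>f. (\<Sum>r\<le>k. \<Sum>vs\<in>mindex r. SUP x\<in>U. \<bar>nderiv vs f x\<bar>) +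
                   (\<Sum>vs\<in>mindex k. holder_seminorm \<alpha> U (nderiv vs f))) \<rparr>"

definition holder_bdry_space :: "nat \<Rightarrow> real \<Rightarrow> 'a::euclidean_space set \<Rightarrow> 'a fspace" where
  "holder_bdry_space k \<alpha> U =
    \<lparr> fcarrier = {h. \<exists>f\<in>fcarrier (holder_space k \<alpha> U). \<forall>x\<in>frontier U. f x = h x},
      fnorm = (\<lambda>h. Inf {fnorm (holder_space k \<alpha> U) f | f.
                 f \<in> fcarrier (holder_space k \<alpha> U) \<and> (\<forall>x\<in>frontier U. f x = h x)}) \<rparr>"

section \<open>Domains with Hoelder boundary\<close>

text \<open>Near \<open>x0\<close>, the set \<open>\<Omega>\<close> is the strict epigraph, in the direction \<open>e\<close>, of a function on the
  hyperplane orthogonal to \<open>e\<close>. That function is encoded as a function \<open>\<gamma>\<close> on the whole space that is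
  invariant under translations along \<open>e\<close>.\<close>

definition bdry_graph ::
  "(real^'n) set \<Rightarrow> real^'n \<Rightarrow> real^'n \<Rightarrow> real \<Rightarrow> (real^'n \<Rightarrow> real) \<Rightarrow> bool" where
  "bdry_graph \<Omega> x0 e r \<gamma> \<longleftrightarrow>
     norm e = 1 \<and> 0 < r \<and> (\<forall>x t. \<gamma> (x + t *\<^sub>R e) = \<gamma> x) \<and>
     \<Omega> \<inter> ball x0 r = {x \<in> ball x0 r. \<gamma> x < x \<bullet> e}"

definition holder_domain :: "nat \<Rightarrow> real \<Rightarrow> (real^'n) set \<Rightarrow> bool" where
  "holder_domain k \<alpha> \<Omega> \<longleftrightarrow>
     open \<Omega> \<and> connected \<Omega> \<and> \<Omega> \<noteq> {} \<and> bounded \<Omega> \<and>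
     (\<forall>x0\<in>frontier \<Omega>. \<exists>e r \<gamma>. bdry_graph \<Omega> x0 e r \<gamma> \<and> \<gamma> \<in> fcarrier (holder_space k \<alpha> (ball x0 r)))"

text \<open>The exterior unit normal computed in a local \<open>C^1\<close> graph representation; it does not depend on the
  representation.\<close>

definition exterior_normal :: "(real^'n) set \<Rightarrow> real^'n \<Rightarrow> real^'n" where
  "exterior_normal \<Omega> x0 = (SOME \<nu>. \<exists>e r \<gamma>. bdry_graph \<Omega> x0 e r \<gamma> \<and> Ck_closure 1 (ball x0 r) \<gamma> \<and>
     \<nu> = (grad \<gamma> x0 - e) /\<^sub>R norm (grad \<gamma> x0 - e))"

definition normal_deriv :: "(real^'n) set \<Rightarrow> (real^'n \<Rightarrow> real) \<Rightarrow> real^'n \<Rightarrow> real" where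
  "normal_deriv \<Omega> u x = exterior_normal \<Omega> x \<bullet> bdry_ext \<Omega> (grad u) x"

section \<open>The Monge-Ampere problem and its linearization\<close>

definition MA_solution ::
  "(real^'n) set \<Rightarrow> (real^'n \<Rightarrow> real \<Rightarrow> real^'n \<Rightarrow> real) \<Rightarrow> (real^'n \<Rightarrow> real) \<Rightarrow> (real^'n \<Rightarrow> real) \<Rightarrow> bool" where
  "MA_solution \<Omega> a \<eta> u \<longleftrightarrow>
     (\<forall>x\<in>\<Omega>. det (hess u x) = a x (u x) (grad u x)) \<and> (\<forall>x\<in>frontier \<Omega>. u x = \<eta> x)"

text \<open>\<open>dzp vs a x z p = d^r_{(z,p)} a(x,z,p)[vs]\<close> with \<open>r = length vs\<close>.\<close>

definition dzp ::
  "(real \<times> (real^'n)) list \<Rightarrow> (real^'n \<Rightarrow> real \<Rightarrow> real^'n \<Rightarrow> real) \<Rightarrow> real^'n \<Rightarrow> real \<Rightarrow> real^'n \<Rightarrow> real" where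
  "dzp vs a x z p = nderiv vs (\<lambda>(z', p'). a x z' p') (z, p)"

text \<open>The \<open>(i,j)\<close> cofactor is the determinant with the \<open>i\<close>-th row replaced by the \<open>j\<close>-th unit vector
  (the index type carries no order, so signs \<open>(-1)^(i+j)\<close> are not available).\<close>

definition cof :: "real^'n^'n \<Rightarrow> real^'n^'n" where
  "cof M = (\<chi> i j. det (\<chi> k. if k = i then axis j 1 else M $ k))"

definition C_lin :: "(real^'n \<Rightarrow> real) \<Rightarrow> real^'n \<Rightarrow> real^'n^'n" where
  "C_lin \<Phi> x = cof (hess \<Phi> x)"

definition b_lin ::
  "(real^'n \<Rightarrow> real \<Rightarrow> real^'n \<Rightarrow> real) \<Rightarrow> (real^'n \<Rightarrow> real) \<Rightarrow> real^'n \<Rightarrow> real^'n" where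
  "b_lin a \<Phi> x = (\<chi> i. dzp [(0, axis i 1)] a x (\<Phi> x) (grad \<Phi> x))"

definition q_lin ::
  "(real^'n \<Rightarrow> real \<Rightarrow> real^'n \<Rightarrow> real) \<Rightarrow> (real^'n \<Rightarrow> real) \<Rightarrow> real^'n \<Rightarrow> real" where
  "q_lin a \<Phi> x = dzp [(1, 0)] a x (\<Phi> x) (grad \<Phi> x)"

definition L_lin ::
  "(real^'n \<Rightarrow> real \<Rightarrow> real^'n \<Rightarrow> real) \<Rightarrow> (real^'n \<Rightarrow> real) \<Rightarrow> (real^'n \<Rightarrow> real) \<Rightarrow> real^'n \<Rightarrow> real" where
  "L_lin a \<Phi> v x = trace (C_lin \<Phi> x ** hess v x) - b_lin a \<Phi> x \<bullet> grad v x - q_lin a \<Phi> x * v x"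

section \<open>Sobolev functions and weak solutions of the adjoint equation\<close>

text \<open>As in Gilbarg--Trudinger, the test functions for first-order weak derivatives, and the dense
  subset defining \<open>H^1_0\<close>, are the compactly supported \<open>C^1\<close> functions.\<close>

definition test_fun :: "(real^'n) set \<Rightarrow> (real^'n \<Rightarrow> real) \<Rightarrow> bool" where
  "test_fun \<Omega> \<psi> \<longleftrightarrow>
     (\<forall>x. \<psi> differentiable (at x)) \<and> continuous_on UNIV (grad \<psi>) \<and>
     (\<exists>K. compact K \<and> K \<subseteq> \<Omega> \<and> (\<forall>x. x \<notin> K \<longrightarrow> \<psi> x = 0))"

definition L2_fun :: "(real^'n) set \<Rightarrow> (real^'n \<Rightarrow> 'b::euclidean_space) \<Rightarrow> bool" where
  "L2_fun \<Omega> f \<longleftrightarrow> f \<in> borel_measurable (lebesgue_on \<Omega>) \<and> integrable (lebesgue_on \<Omega>) (\<lambda>x. (norm (f x))\<^sup>2)"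

text \<open>\<open>H1 \<Omega> w g\<close>: \<open>w\<close> lies in \<open>H^1(\<Omega>)\<close> and \<open>g\<close> is its weak gradient (unique almost everywhere).\<close>

definition H1 :: "(real^'n) set \<Rightarrow> (real^'n \<Rightarrow> real) \<Rightarrow> (real^'n \<Rightarrow> real^'n) \<Rightarrow> bool" where
  "H1 \<Omega> w g \<longleftrightarrow> L2_fun \<Omega> w \<and> L2_fun \<Omega> g \<and>
     (\<forall>\<psi>. test_fun \<Omega> \<psi> \<longrightarrow>
        (\<forall>i. (LINT x|lebesgue_on \<Omega>. w x * grad \<psi> x $ i) = - (LINT x|lebesgue_on \<Omega>. g x $ i * \<psi> x)))"

definition H10 :: "(real^'n) set \<Rightarrow> (real^'n \<Rightarrow> real) \<Rightarrow> (real^'n \<Rightarrow> real^'n) \<Rightarrow> bool" where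
  "H10 \<Omega> w g \<longleftrightarrow> H1 \<Omega> w g \<and>
     (\<exists>\<psi>. (\<forall>j::nat. test_fun \<Omega> (\<psi> j)) \<and>
        (\<lambda>j. (LINT x|lebesgue_on \<Omega>. (\<psi> j x - w x)\<^sup>2) +
             (LINT x|lebesgue_on \<Omega>. (norm (grad (\<psi> j) x - g x))\<^sup>2)) \<longlonglongrightarrow> 0)"

definition adjoint_weak_solution ::
  "(real^'n) set \<Rightarrow> (real^'n \<Rightarrow> real \<Rightarrow> real^'n \<Rightarrow> real) \<Rightarrow> (real^'n \<Rightarrow> real) \<Rightarrow> (real^'n \<Rightarrow> real) \<Rightarrow> bool" where
  "adjoint_weak_solution \<Omega> a \<Phi> w \<longleftrightarrow>
     (\<exists>g. H1 \<Omega> w g \<and>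
        (\<forall>\<zeta> d. H10 \<Omega> \<zeta> d \<longrightarrow>
           (LINT x|lebesgue_on \<Omega>. (C_lin \<Phi> x *v g x) \<bullet> d x + w x * (b_lin a \<Phi> x \<bullet> d x)
                                   + q_lin a \<Phi> x * w x * \<zeta> x) = 0))"

section \<open>Multilinear forms and the product-density property\<close>

definition sym_multilinear :: "nat \<Rightarrow> ('a::real_vector list \<Rightarrow> real) \<Rightarrow> bool" where
  "sym_multilinear k T \<longleftrightarrow>
     (\<forall>vs i. length vs = k \<and> i < k \<longrightarrow> linear (\<lambda>v. T (vs[i := v]))) \<and>
     (\<forall>vs ws. length vs = k \<and> mset vs = mset ws \<longrightarrow> T vs = T ws)"

definition product_density ::
  "nat \<Rightarrow> real \<Rightarrow> nat \<Rightarrow> (real^'n) set \<Rightarrow> (real^'n \<Rightarrow> real \<Rightarrow> real^'n \<Rightarrow> real) \<Rightarrow> (real^'n \<Rightarrow> real) \<Rightarrow> bool" where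
  "product_density m \<alpha> k \<Omega> a \<Phi> \<longleftrightarrow>
     (\<forall>A :: real^'n \<Rightarrow> (real \<times> (real^'n)) list \<Rightarrow> real.
        (\<forall>x\<in>closure \<Omega>. sym_multilinear k (A x)) \<longrightarrow>
        (\<forall>vs. length vs = k \<longrightarrow> continuous_on (closure \<Omega>) (\<lambda>x. A x vs)) \<longrightarrow>
        (\<forall>v w. (\<forall>l<k. v l \<in> fcarrier (holder_space (m + 2) \<alpha> \<Omega>) \<and> (\<forall>x\<in>\<Omega>. L_lin a \<Phi> (v l) x = 0)) \<longrightarrow>
               adjoint_weak_solution \<Omega> a \<Phi> w \<longrightarrow>
               (LINT x|lebesgue_on \<Omega>. A x (map (\<lambda>l. (v l x, grad (v l) x)) [0..<k]) * w x) = 0) \<longrightarrow>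
        (\<forall>x\<in>\<Omega>. \<forall>vs. length vs = k \<longrightarrow> A x vs = 0))"

section \<open>Frechet derivatives between function spaces\<close>

definition bounded_multilinear ::
  "'a fspace \<Rightarrow> 'b fspace \<Rightarrow> nat \<Rightarrow> (('a \<Rightarrow> real) list \<Rightarrow> ('b \<Rightarrow> real)) \<Rightarrow> bool" where
  "bounded_multilinear X Y r T \<longleftrightarrow>
     (\<forall>hs. set hs \<subseteq> fcarrier X \<and> length hs = r \<longrightarrow> T hs \<in> fcarrier Y) \<and>
     (\<forall>hs i. set hs \<subseteq> fcarrier X \<and> length hs = r \<and> i < r \<longrightarrow>
        (\<forall>h\<in>fcarrier X. \<forall>h'\<in>fcarrier X. \<forall>c.
           fnorm Y (\<lambda>y. T (hs[i := (\<lambda>x. h x + c * h' x)]) y - (T (hs[i := h]) y + c * T (hs[i := h']) y)) = 0)) \<and>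
     (\<exists>C. \<forall>hs. set hs \<subseteq> fcarrier X \<and> length hs = r \<longrightarrow> fnorm Y (T hs) \<le> C * prod_list (map (fnorm X) hs))"

text \<open>\<open>has_frechet_derivs N X Y \<phi> S D\<close>: near \<open>\<phi>\<close> the map \<open>S\<close> is of class \<open>C^N\<close> from \<open>X\<close> to \<open>Y\<close>, and
  \<open>D r \<eta> [h1, \<dots>, hr]\<close> is its \<open>r\<close>-th Frechet derivative at \<open>\<eta>\<close> for \<open>r \<le> N\<close>. The third clause says that
  \<open>D (r + 1)\<close> is the Frechet derivative of \<open>D r\<close> in the operator norm of \<open>r\<close>-linear maps, the last one
  that \<open>D N\<close> is continuous in that norm.\<close>

definition has_frechet_derivs ::
  "nat \<Rightarrow> 'a fspace \<Rightarrow> 'b fspace \<Rightarrow> ('a \<Rightarrow> real) \<Rightarrow> (('a \<Rightarrow> real) \<Rightarrow> ('b \<Rightarrow> real)) \<Rightarrow>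
     (nat \<Rightarrow> ('a \<Rightarrow> real) \<Rightarrow> ('a \<Rightarrow> real) list \<Rightarrow> ('b \<Rightarrow> real)) \<Rightarrow> bool" where
  "has_frechet_derivs N X Y \<phi> S D \<longleftrightarrow>
     (\<exists>\<rho>>0. \<forall>\<eta>\<in>fcarrier X. fnorm X (\<lambda>x. \<eta> x - \<phi> x) < \<rho> \<longrightarrow>
        S \<eta> \<in> fcarrier Y \<and> fnorm Y (\<lambda>y. D 0 \<eta> [] y - S \<eta> y) = 0 \<and>
        (\<forall>r\<le>N. bounded_multilinear X Y r (D r \<eta>)) \<and>
        (\<forall>r<N. \<forall>\<epsilon>>0. \<exists>d>0. \<forall>h\<in>fcarrier X. fnorm X h < d \<longrightarrow>
           (\<forall>hs. set hs \<subseteq> fcarrier X \<and> length hs = r \<longrightarrow>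
              fnorm Y (\<lambda>y. D r (\<lambda>x. \<eta> x + h x) hs y - D r \<eta> hs y - D (Suc r) \<eta> (h # hs) y)
                \<le> \<epsilon> * fnorm X h * prod_list (map (fnorm X) hs))) \<and>
        (\<forall>\<epsilon>>0. \<exists>d>0. \<forall>h\<in>fcarrier X. fnorm X h < d \<longrightarrow>
           (\<forall>hs. set hs \<subseteq> fcarrier X \<and> length hs = N \<longrightarrow>
              fnorm Y (\<lambda>y. D N (\<lambda>x. \<eta> x + h x) hs y - D N \<eta> hs y) \<le> \<epsilon> * prod_list (map (fnorm X) hs))))"

text \<open>\<open>S\<close> is the solution operator furnished by local well-posedness (with its \<open>\<delta>\<close> and the
  neighbourhood \<open>V\<close> of \<open>\<Phi>\<close>), and \<open>dS\<close> are its Frechet derivatives near \<open>\<phi>\<close>.\<close>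

definition solution_operator ::
  "nat \<Rightarrow> real \<Rightarrow> (real^'n) set \<Rightarrow> (real^'n \<Rightarrow> real \<Rightarrow> real^'n \<Rightarrow> real) \<Rightarrow> (real^'n \<Rightarrow> real) \<Rightarrow> (real^'n \<Rightarrow> real) \<Rightarrow>
   real \<Rightarrow> (real^'n \<Rightarrow> real) set \<Rightarrow> ((real^'n \<Rightarrow> real) \<Rightarrow> (real^'n \<Rightarrow> real)) \<Rightarrow>
   (nat \<Rightarrow> (real^'n \<Rightarrow> real) \<Rightarrow> (real^'n \<Rightarrow> real) list \<Rightarrow> (real^'n \<Rightarrow> real)) \<Rightarrow> bool" where
  "solution_operator m \<alpha> \<Omega> a \<phi> \<Phi> \<delta> V S dS \<longleftrightarrow>
     (let X = holder_bdry_space (m + 2) \<alpha> \<Omega>; Y = holder_space (m + 2) \<alpha> \<Omega> in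
        0 < \<delta> \<and> V \<subseteq> fcarrier Y \<and>
        (\<exists>\<rho>>0. \<forall>u\<in>fcarrier Y. fnorm Y (\<lambda>x. u x - \<Phi> x) < \<rho> \<longrightarrow> u \<in> V) \<and>
        (\<forall>\<eta>\<in>fcarrier X. fnorm X (\<lambda>x. \<eta> x - \<phi> x) < \<delta> \<longrightarrow>
           S \<eta> \<in> V \<and> MA_solution \<Omega> a \<eta> (S \<eta>) \<and>
           (\<forall>u\<in>V. MA_solution \<Omega> a \<eta> u \<longrightarrow> (\<forall>x\<in>closure \<Omega>. u x = S \<eta> x))) \<and>
        (\<forall>x\<in>closure \<Omega>. S \<phi> x = \<Phi> x) \<and>
        has_frechet_derivs (m + 1) X Y \<phi> S dS)"

end

theory Submission
  imports Defs
begin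

text \<open>Let \<open>h\<close> be a boundary datum and \<open>W\<^sub>r\<close> the difference of the \<open>r\<close>-th derivatives of the two solution
  operators in the direction \<open>(h, \<dots>, h)\<close>. If \<open>W\<^sub>i = 0\<close> for \<open>i < r\<close>, comparing the two equations along
  \<open>\<phi> + t h\<close> to order \<open>t\<^sup>r\<close> gives \<open>L W\<^sub>r = d\<^sup>r(a\<^sub>1 - a\<^sub>2)[(v, \<nabla>v), \<dots>, (v, \<nabla>v)]\<close>, where \<open>v\<close> is the first
  variation. For \<open>r < k\<close> the right-hand side vanishes and so does \<open>W\<^sub>r\<close>, by the maximum principle. For
  \<open>r = k\<close>, equality of the Cauchy data makes \<open>W\<^sub>k\<close> vanish together with its gradient on the boundary, so
  integrating against a weak solution \<open>w\<close> of the adjoint equation, with the Piola identity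
  \<open>div (cof D\<^sup>2\<Phi>) = 0\<close>, yields \<open>\<integral> A[(v, \<nabla>v)\<^sup>k] w = 0\<close> for \<open>A = d\<^sup>k(a\<^sub>1 - a\<^sub>2)\<close>. Every solution of
  \<open>L v = 0\<close> is a first variation, so polarization and the product-density property give \<open>A = 0\<close>.\<close>

section \<open>Iterated directional derivatives\<close>

text \<open>The hypotheses concern Frechet derivatives between Hoelder spaces, whose elements are
  fixed only up to seminorm 0, while the equation is pointwise. Everything is therefore tested with
  bounded functionals: interior derivatives of order at most \<open>m + 2\<close> and values on the
  closure. Along \<open>\<phi> + t h\<close> each of them becomes a real function of
  \<open>t\<close> with a Taylor expansion. Only repeated directions are expanded, and only
  differences of two solution families, so intermediate orders enter solely as terms that cancel.

  The bound \<open>2 \<le> k\<close> does two jobs. It forces \<open>1 \<le> m\<close>, so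
  \<open>\<Phi>\<close> is C^3 and its cofactors are C^1; and it puts order 1 below
  \<open>k\<close>, so both operators have the same first variation.

  Boundary terms are handled by cutting off small values: a function that vanishes continuously on
  the boundary then becomes compactly supported, and the test-function identities pass to the limit.
  The full gradient of \<open>W\<close> vanishes on the boundary because its tangential part is
  controlled by \<open>W = 0\<close> and its normal part by the Cauchy data.\<close>

definition Ck_on :: "nat \<Rightarrow> 'a::euclidean_space set \<Rightarrow> ('a \<Rightarrow> real) \<Rightarrow> bool" where
  "Ck_on k U f \<longleftrightarrow>
     (\<forall>r<k. \<forall>vs\<in>mindex r. \<forall>x\<in>U. nderiv vs f differentiable (at x)) \<and>
     (\<forall>r\<le>k. \<forall>vs\<in>mindex r. continuous_on U (nderiv vs f))"

lemma frechet_derivative_cong_open: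
  assumes "open U" "x \<in> U" "\<And>y. y \<in> U \<Longrightarrow> f y = g y"
  shows "frechet_derivative f (at x) = frechet_derivative g (at x)"
proof -
  have "(f has_derivative f') (at x) \<longleftrightarrow> (g has_derivative f') (at x)" for f'
    using assms has_derivative_transform_within_open[of f f' x UNIV U g]
      has_derivative_transform_within_open[of g f' x UNIV U f] by auto
  then show ?thesis by (simp add: frechet_derivative_def)
qed

lemma nderiv_cong_open:
  assumes "open U" "\<And>y. y \<in> U \<Longrightarrow> f y = g y" "x \<in> U"
  shows "nderiv vs f x = nderiv vs g x"
  using assms(3)
proof (induction vs arbitrary: x)
  case (Cons v vs)
  then show ?case
    using frechet_derivative_cong_open[OF assms(1), of x "nderiv vs f" "nderiv vs g"] by simp
qed (use assms in simp)

lemma nderiv_append: "nderiv (us @ vs) f = nderiv us (nderiv vs f)"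
  by (induction us) auto

lemma frechet_derivative_eqI:
  assumes "(f has_derivative f') (at x)" shows "frechet_derivative f (at x) v = f' v"
  using frechet_derivative_at[OF assms] by simp

lemma nderiv_Cons_expand:
  fixes f :: "'a::euclidean_space \<Rightarrow> real"
  assumes "nderiv vs f differentiable (at x)"
  shows "nderiv (v # vs) f x = (\<Sum>b\<in>Basis. (v \<bullet> b) * nderiv (b # vs) f x)"
proof -
  have l: "linear (frechet_derivative (nderiv vs f) (at x))"
    using assms by (rule linear_frechet_derivative)
  have "frechet_derivative (nderiv vs f) (at x) (\<Sum>b\<in>Basis. (v \<bullet> b) *\<^sub>R b)
     = (\<Sum>b\<in>Basis. (v \<bullet> b) *\<^sub>R frechet_derivative (nderiv vs f) (at x) b)"
    using l by (simp add: linear_sum linear_scale)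
  then show ?thesis by (simp add: euclidean_representation)
qed

lemma mindex_0 [simp]: "mindex 0 = {[]}"
  by (auto simp: mindex_def)

lemma mindex_Suc: "mindex (Suc r) = (\<lambda>(b, vs). b # vs) ` (Basis \<times> mindex r)"
  by (auto simp: mindex_def image_iff length_Suc_conv)

lemma finite_mindex [simp]: "finite (mindex r)"
  by (induction r) (auto simp: mindex_Suc)

lemma sum_mindex_Suc:
  "(\<Sum>vs\<in>mindex (Suc r). h vs) = (\<Sum>b\<in>Basis. \<Sum>vs\<in>mindex r. h (b # vs))"
proof -
  have "(\<Sum>vs\<in>mindex (Suc r). h vs) = (\<Sum>p\<in>Basis \<times> mindex r. h ((\<lambda>(b, vs). b # vs) p))"
    unfolding mindex_Suc by (rule sum.reindex_cong[of "\<lambda>(b, vs). b # vs"]) (auto simp: inj_on_def)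
  then show ?thesis by (simp add: sum.cartesian_product case_prod_unfold)
qed

lemma Ck_onD:
  assumes "Ck_on k U f" "vs \<in> mindex r"
  shows "r < k \<Longrightarrow> x \<in> U \<Longrightarrow> nderiv vs f differentiable (at x)"
    and "r \<le> k \<Longrightarrow> continuous_on U (nderiv vs f)"
  using assms by (auto simp: Ck_on_def)

lemma Ck_on_mono: "Ck_on k U f \<Longrightarrow> j \<le> k \<Longrightarrow> Ck_on j U f"
  unfolding Ck_on_def by (meson le_trans order_less_le_trans)

lemma Ck_on_subset: "Ck_on k U f \<Longrightarrow> V \<subseteq> U \<Longrightarrow> Ck_on k V f"
  unfolding Ck_on_def by (meson continuous_on_subset subsetD)

text \<open>\<open>Ck_on\<close> and \<open>Ck_closure\<close> quantify over basis directions only;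
  this expansion carries them to arbitrary directions. It holds on the whole open set
  \<open>U\<close>, so it may be differentiated once more, which is the induction step.\<close>

lemma nderiv_expand:
  assumes U: "open U" and f: "Ck_on k U f" and "length vs \<le> k" "x \<in> U"
  shows "nderiv vs f x = (\<Sum>bs\<in>mindex (length vs). prod_list (map2 (\<bullet>) vs bs) * nderiv bs f x)"
  using assms(3,4)
proof (induction vs arbitrary: x)
  case (Cons v vs)
  let ?r = "length vs"
  let ?G = "\<lambda>y. \<Sum>bs\<in>mindex ?r. prod_list (map2 (\<bullet>) vs bs) * nderiv bs f y"
  have d: "(nderiv bs f has_derivative frechet_derivative (nderiv bs f) (at x)) (at x)"
    if "bs \<in> mindex ?r" for bs
    using Ck_onD(1)[OF f that] Cons.prems frechet_derivative_works by auto
  have "nderiv (v # vs) f x = frechet_derivative ?G (at x) v"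
    using frechet_derivative_cong_open[OF U, of x "nderiv vs f" ?G] Cons by simp
  also have "\<dots> = (\<Sum>bs\<in>mindex ?r. prod_list (map2 (\<bullet>) vs bs) * frechet_derivative (nderiv bs f) (at x) v)"
    by (rule frechet_derivative_eqI) (intro has_derivative_sum has_derivative_mult_right d)
  also have "\<dots> = (\<Sum>bs\<in>mindex ?r. prod_list (map2 (\<bullet>) vs bs) * (\<Sum>b\<in>Basis. (v \<bullet> b) * nderiv (b # bs) f x))"
    using Ck_onD(1)[OF f] nderiv_Cons_expand[of _ f x v] Cons.prems by (intro sum.cong refl) (auto 0 3)
  also have "\<dots> = (\<Sum>bs\<in>mindex (length (v # vs)). prod_list (map2 (\<bullet>) (v # vs) bs) * nderiv bs f x)"
    unfolding length_Cons sum_mindex_Suc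
    by (subst sum.swap) (simp add: sum_distrib_left ac_simps)
  finally show ?case .
qed simp

lemma Ck_on_differentiable:
  assumes U: "open U" and f: "Ck_on k U f" and "length vs < k" "x \<in> U"
  shows "nderiv vs f differentiable (at x)"
proof -
  let ?G = "\<lambda>y. \<Sum>bs\<in>mindex (length vs). prod_list (map2 (\<bullet>) vs bs) * nderiv bs f y"
  have "?G differentiable (at x)"
    using Ck_onD(1)[OF f] assms by (intro differentiable_sum differentiable_mult) auto
  then obtain D where "(?G has_derivative D) (at x)" by (auto simp: differentiable_def)
  then have "(nderiv vs f has_derivative D) (at x)"
    by (rule has_derivative_transform_within_open[OF _ U])
       (use nderiv_expand[OF U f] assms in auto)
  then show ?thesis by (auto simp: differentiable_def)
qed

lemma Ck_on_continuous:
  assumes U: "open U" and f: "Ck_on k U f" and "length vs \<le> k"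
  shows "continuous_on U (nderiv vs f)"
proof -
  have "continuous_on U (\<lambda>y. \<Sum>bs\<in>mindex (length vs). prod_list (map2 (\<bullet>) vs bs) * nderiv bs f y)"
    using assms(3) by (intro continuous_on_sum continuous_on_mult_left Ck_onD(2)[OF f])
  then show ?thesis by (rule continuous_on_eq) (use nderiv_expand[OF U f] assms in auto)
qed

lemma Ck_on_nderiv:
  assumes U: "open U" and f: "Ck_on k U f" and "length vs + j \<le> k"
  shows "Ck_on j U (nderiv vs f)"
  unfolding Ck_on_def mindex_def using assms
  by (auto simp flip: nderiv_append intro!: Ck_on_differentiable[OF U f] Ck_on_continuous[OF U f])

text \<open>The combination \<open>f + c * g\<close> is the one linear operation treated here and in
  the function spaces below: \<open>c = -1\<close> gives differences, and \<open>g = f\<close> with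
  coefficient \<open>c - 1\<close> gives multiples by \<open>c\<close>.\<close>

lemma nderiv_lincomb:
  assumes U: "open U" and f: "Ck_on k U f" and g: "Ck_on k U g" and "length vs \<le> k" "x \<in> U"
  shows "nderiv vs (\<lambda>x. f x + c * g x) x = nderiv vs f x + c * nderiv vs g x"
  using assms(4,5)
proof (induction vs arbitrary: x)
  case (Cons v vs)
  have "nderiv (v # vs) (\<lambda>x. f x + c * g x) x
      = frechet_derivative (\<lambda>x. nderiv vs f x + c * nderiv vs g x) (at x) v"
    using frechet_derivative_cong_open[OF U, of x "nderiv vs (\<lambda>x. f x + c * g x)"] Cons by simp
  also have "\<dots> = nderiv (v # vs) f x + c * nderiv (v # vs) g x"
    unfolding nderiv.simps
    by (rule frechet_derivative_eqI,
        intro has_derivative_add has_derivative_mult_right frechet_derivative_works[THEN iffD1]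
          Ck_on_differentiable[OF U f] Ck_on_differentiable[OF U g])
       (use Cons.prems in auto)
  finally show ?case .
qed simp

lemma Ck_on_lincomb:
  assumes U: "open U" and f: "Ck_on k U f" and g: "Ck_on k U g"
  shows "Ck_on k U (\<lambda>x. f x + c * g x)"
  unfolding Ck_on_def
proof (intro conjI allI impI ballI)
  fix r x and vs :: "'a list" assume r: "r < k" and vs: "vs \<in> mindex r" and x: "x \<in> U"
  have l: "length vs = r" using vs by (simp add: mindex_def)
  have "(\<lambda>x. nderiv vs f x + c * nderiv vs g x) differentiable (at x)"
    using Ck_on_differentiable[OF U f] Ck_on_differentiable[OF U g] r x l
    by (intro differentiable_add differentiable_mult) auto
  then obtain D where "((\<lambda>x. nderiv vs f x + c * nderiv vs g x) has_derivative D) (at x)"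
    by (auto simp: differentiable_def)
  then have "(nderiv vs (\<lambda>x. f x + c * g x) has_derivative D) (at x)"
    by (rule has_derivative_transform_within_open[OF _ U x])
      (use nderiv_lincomb[OF U f g] r l in auto)
  then show "nderiv vs (\<lambda>x. f x + c * g x) differentiable (at x)" by (auto simp: differentiable_def)
next
  fix r and vs :: "'a list" assume r: "r \<le> k" and vs: "vs \<in> mindex r"
  have l: "length vs = r" using vs by (simp add: mindex_def)
  have "continuous_on U (\<lambda>x. nderiv vs f x + c * nderiv vs g x)"
    using Ck_on_continuous[OF U f] Ck_on_continuous[OF U g] r l by (intro continuous_intros) auto
  then show "continuous_on U (nderiv vs (\<lambda>x. f x + c * g x))"
    by (rule continuous_on_eq) (use nderiv_lincomb[OF U f g] r l in auto)
qed

lemma linear_prod_list_map2: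
  fixes vs bs :: "'a::real_inner list"
  assumes "length bs = length vs" "i < length vs"
  shows "linear (\<lambda>v. prod_list (map2 (\<bullet>) (vs[i := v]) bs))"
  using assms
proof (induction vs arbitrary: bs i)
  case (Cons w vs)
  then obtain b bs' where bs: "bs = b # bs'" by (cases bs) auto
  show ?case
  proof (cases i)
    case 0
    then show ?thesis by (auto simp: bs linear_iff inner_simps algebra_simps)
  next
    case (Suc j)
    have "linear (\<lambda>v. prod_list (map2 (\<bullet>) (vs[j := v]) bs'))" using Cons bs Suc by auto
    then show ?thesis by (simp add: Suc bs linear_iff algebra_simps)
  qed
qed simp

lemma nderiv_linear_nth:
  assumes U: "open U" and f: "Ck_on k U f" and "length vs \<le> k" "x \<in> U" "i < length vs"
  shows "linear (\<lambda>v. nderiv (vs[i := v]) f x)"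
proof -
  have eq: "(\<lambda>v. nderiv (vs[i := v]) f x)
     = (\<lambda>v. \<Sum>bs\<in>mindex (length vs). prod_list (map2 (\<bullet>) (vs[i := v]) bs) * nderiv bs f x)"
    using nderiv_expand[OF U f] assms by auto
  have "linear (\<lambda>v. prod_list (map2 (\<bullet>) (vs[i := v]) bs) * nderiv bs f x)"
    if "bs \<in> mindex (length vs)" for bs
    using linear_prod_list_map2[of bs vs i] that assms by (auto simp: mindex_def linear_iff algebra_simps)
  then show ?thesis unfolding eq by (intro linear_compose_sum) auto
qed

section \<open>Mean values along lines and the symmetry of higher derivatives\<close>

lemma has_real_derivative_along_line:
  assumes "f differentiable (at (x + t *\<^sub>R v))"
  shows "((\<lambda>t. f (x + t *\<^sub>R v)) has_real_derivative nderiv [v] f (x + t *\<^sub>R v)) (at t)"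
proof -
  let ?D = "frechet_derivative f (at (x + t *\<^sub>R v))"
  have "(f has_derivative ?D) (at (x + t *\<^sub>R v))" using assms frechet_derivative_works by blast
  then have "((\<lambda>t. f (x + t *\<^sub>R v)) has_derivative (\<lambda>h. ?D (h *\<^sub>R v))) (at t)"
    by (rule has_derivative_compose[rotated]) (auto intro!: derivative_eq_intros)
  moreover have "?D (h *\<^sub>R v) = h * ?D v" for h
    using linear_frechet_derivative[OF assms] by (simp add: linear_scale)
  moreover have "nderiv [v] f (x + t *\<^sub>R v) = ?D v" by simp
  ultimately show ?thesis by (simp add: has_field_derivative_def mult_commute_abs)
qed

text \<open>Two mean value steps: one in direction \<open>v\<close> for the increment of
  \<open>f\<close> by \<open>t w\<close>, then one in direction \<open>w\<close> for
  \<open>nderiv [v] f\<close>. The left-hand side is symmetric in \<open>v\<close> and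
  \<open>w\<close>, which is the whole point.\<close>

lemma second_difference_eq:
  assumes U: "open U" and f: "Ck_on 2 U f" and t: "0 < t"
    and ball: "cball x (t * (norm v + norm w)) \<subseteq> U"
  shows "\<exists>\<xi>. dist x \<xi> \<le> t * (norm v + norm w) \<and>
    f (x + t *\<^sub>R v + t *\<^sub>R w) - f (x + t *\<^sub>R v) - f (x + t *\<^sub>R w) + f x = t * t * nderiv [w, v] f \<xi>"
proof -
  have near: "dist x (x + s *\<^sub>R v + r *\<^sub>R w) \<le> t * (norm v + norm w)"
    if "0 \<le> s" "s \<le> t" "0 \<le> r" "r \<le> t" for s r
  proof -
    have "norm (s *\<^sub>R v + r *\<^sub>R w) \<le> s * norm v + r * norm w"
      using norm_triangle_ineq[of "s *\<^sub>R v" "r *\<^sub>R w"] that by simp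
    also have "\<dots> \<le> t * norm v + t * norm w"
      using that by (intro add_mono mult_right_mono) auto
    finally show ?thesis by (simp add: dist_norm algebra_simps norm_minus_commute)
  qed
  have inU: "x + s *\<^sub>R v + r *\<^sub>R w \<in> U" if "0 \<le> s" "s \<le> t" "0 \<le> r" "r \<le> t" for s r
    using near[OF that] ball by (auto simp: subset_iff)
  have d0: "f differentiable (at y)" if "y \<in> U" for y
    using Ck_on_differentiable[OF U f, of "[]" y] that by simp
  have d1: "nderiv [v] f differentiable (at y)" if "y \<in> U" for y
    using Ck_on_differentiable[OF U f, of "[v]" y] that by simp
  let ?g = "\<lambda>s. f (x + t *\<^sub>R w + s *\<^sub>R v) - f (x + s *\<^sub>R v)"
  have "\<exists>s. 0 < s \<and> s < t \<and> ?g t - ?g 0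
      = (t - 0) * (nderiv [v] f (x + t *\<^sub>R w + s *\<^sub>R v) - nderiv [v] f (x + s *\<^sub>R v))"
  proof (rule MVT2[OF t])
    fix s assume s: "0 \<le> s" "s \<le> t"
    show "(?g has_real_derivative nderiv [v] f (x + t *\<^sub>R w + s *\<^sub>R v) - nderiv [v] f (x + s *\<^sub>R v)) (at s)"
      using inU[of s t] inU[of s 0] s t d0
      by (intro DERIV_diff has_real_derivative_along_line) (auto simp: ac_simps)
  qed
  then obtain s where s: "0 < s" "s < t" and
    e1: "?g t - ?g 0 = t * (nderiv [v] f (x + t *\<^sub>R w + s *\<^sub>R v) - nderiv [v] f (x + s *\<^sub>R v))" by auto
  let ?k = "\<lambda>r. nderiv [v] f ((x + s *\<^sub>R v) + r *\<^sub>R w)"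
  have "\<exists>r. 0 < r \<and> r < t \<and> ?k t - ?k 0 = (t - 0) * nderiv [w] (nderiv [v] f) ((x + s *\<^sub>R v) + r *\<^sub>R w)"
    using inU s d1 by (intro MVT2[OF t] has_real_derivative_along_line) auto
  then obtain r where r: "0 < r" "r < t" and
    e2: "?k t - ?k 0 = t * nderiv [w, v] f ((x + s *\<^sub>R v) + r *\<^sub>R w)" by auto
  have "f (x + t *\<^sub>R v + t *\<^sub>R w) - f (x + t *\<^sub>R v) - f (x + t *\<^sub>R w) + f x = ?g t - ?g 0"
    by (simp add: ac_simps)
  also have "\<dots> = t * (?k t - ?k 0)" using e1 by (simp add: ac_simps)
  also have "\<dots> = t * t * nderiv [w, v] f ((x + s *\<^sub>R v) + r *\<^sub>R w)" using e2 by simp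
  finally show ?thesis using near[of s r] s r by (intro exI[of _ "x + s *\<^sub>R v + r *\<^sub>R w"]) auto
qed

text \<open>The same second difference equals \<open>t * t\<close> times either mixed derivative,
  each at some point near \<open>x\<close>. Continuity of both derivatives then leaves no gap
  between their values at \<open>x\<close>.\<close>

lemma nderiv_commute2:
  assumes U: "open U" and f: "Ck_on 2 U f" and x: "x \<in> U"
  shows "nderiv [v, w] f x = nderiv [w, v] f x"
proof (rule ccontr)
  assume ne: "\<not> ?thesis"
  define e where "e = \<bar>nderiv [v, w] f x - nderiv [w, v] f x\<bar> / 2"
  have e: "e > 0" using ne by (simp add: e_def)
  have c: "isCont (nderiv us f) x" if "length us = 2" for us
    using Ck_on_continuous[OF U f, of us] that U x by (simp add: continuous_on_eq_continuous_at)
  obtain d1 where d1: "d1 > 0" "\<And>y. dist y x < d1 \<Longrightarrow> dist (nderiv [v, w] f y) (nderiv [v, w] f x) < e"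
    using c[of "[v, w]"] e unfolding continuous_at_eps_delta by auto
  obtain d2 where d2: "d2 > 0" "\<And>y. dist y x < d2 \<Longrightarrow> dist (nderiv [w, v] f y) (nderiv [w, v] f x) < e"
    using c[of "[w, v]"] e unfolding continuous_at_eps_delta by auto
  obtain d3 where d3: "d3 > 0" "ball x d3 \<subseteq> U" using U x open_contains_ball by blast
  define d where "d = min d1 (min d2 d3)"
  \<comment> \<open>Both intermediate points must lie within \<open>d\<close> of \<open>x\<close>;
    the summand 1 keeps the denominator positive when \<open>v\<close> and \<open>w\<close> are
    zero.\<close>
  define t where "t = d / (2 * (norm v + norm w + 1))"
  have d: "d > 0" using d1 d2 d3 by (auto simp: d_def)
  have p: "norm v + norm w + 1 > 0" by (simp add: add_nonneg_pos)
  have t: "t > 0" using d p by (simp add: t_def)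
  have "t * (norm v + norm w + 1) < d" using d p by (simp add: t_def divide_simps)
  then have lt: "t * (norm v + norm w) < d" using t by (simp add: algebra_simps)
  have b: "cball x (t * (norm v + norm w)) \<subseteq> U" using lt d3 by (auto simp: d_def subset_iff)
  obtain \<xi> where xi: "dist x \<xi> \<le> t * (norm v + norm w)"
    "f (x + t *\<^sub>R v + t *\<^sub>R w) - f (x + t *\<^sub>R v) - f (x + t *\<^sub>R w) + f x = t * t * nderiv [w, v] f \<xi>"
    using second_difference_eq[OF U f t b] by auto
  obtain \<zeta> where ze: "dist x \<zeta> \<le> t * (norm w + norm v)"
    "f (x + t *\<^sub>R w + t *\<^sub>R v) - f (x + t *\<^sub>R w) - f (x + t *\<^sub>R v) + f x = t * t * nderiv [v, w] f \<zeta>"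
    using second_difference_eq[OF U f t, of x w v] b by (auto simp: ac_simps)
  have "t * t * nderiv [w, v] f \<xi> = t * t * nderiv [v, w] f \<zeta>" 
  proof -
    have "x + t *\<^sub>R w + t *\<^sub>R v = x + t *\<^sub>R v + t *\<^sub>R w" by (simp add: ac_simps)
    then have "f (x + t *\<^sub>R w + t *\<^sub>R v) = f (x + t *\<^sub>R v + t *\<^sub>R w)" by (rule arg_cong)
    then show ?thesis using xi(2) ze(2) by linarith
  qed
  then have eq: "nderiv [w, v] f \<xi> = nderiv [v, w] f \<zeta>" using t by simp
  have "dist (nderiv [v, w] f \<zeta>) (nderiv [v, w] f x) < e"
    using d1(2)[of \<zeta>] ze(1) lt by (simp add: d_def dist_commute add.commute)
  moreover have "dist (nderiv [w, v] f \<xi>) (nderiv [w, v] f x) < e"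
    using d2(2)[of \<xi>] xi(1) lt by (simp add: d_def dist_commute)
  ultimately have "\<bar>nderiv [v, w] f x - nderiv [w, v] f x\<bar> < 2 * e" using eq by (simp add: dist_real_def)
  then show False by (simp add: e_def)
qed

text \<open>One adjacent transposition at a time: after the induction step \<open>u\<close> and
  \<open>v\<close> are the two outermost derivatives of \<open>nderiv (us @ ws) f\<close>, which is
  still C^2, so the second order case exchanges them.\<close>

lemma nderiv_bubble:
  assumes U: "open U" and f: "Ck_on k U f" and "length us + length ws < k" "x \<in> U"
  shows "nderiv (us @ v # ws) f x = nderiv (v # us @ ws) f x"
  using assms(3,4)
proof (induction us arbitrary: x)
  case (Cons u us)
  have "nderiv ((u # us) @ v # ws) f x = nderiv (u # v # us @ ws) f x"
    using frechet_derivative_cong_open[OF U, of x "nderiv (us @ v # ws) f" "nderiv (v # us @ ws) f"] Cons by simp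
  also have "\<dots> = nderiv [u, v] (nderiv (us @ ws) f) x" by simp
  also have "\<dots> = nderiv [v, u] (nderiv (us @ ws) f) x"
    using Cons.prems by (intro nderiv_commute2[OF U Ck_on_nderiv[OF U f]]) auto
  finally show ?case by simp
qed simp

lemma nderiv_mset_cong:
  assumes U: "open U" and f: "Ck_on k U f" and "length vs \<le> k" "mset vs = mset ws" "x \<in> U"
  shows "nderiv vs f x = nderiv ws f x"
  using assms(3-5)
proof (induction vs arbitrary: ws x)
  case (Cons v vs)
  have "v \<in> set ws" using Cons.prems(2) by (metis list.set_intros(1) mset_eq_setD)
  then obtain w1 w2 where ws: "ws = w1 @ v # w2" by (meson split_list)
  have m: "mset vs = mset (w1 @ w2)" using Cons.prems(2) by (simp add: ws)
  have l: "length w1 + length w2 = length vs" using mset_eq_length[OF m] by simp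
  have "nderiv ws f x = nderiv (v # w1 @ w2) f x"
    unfolding ws using Cons.prems l by (intro nderiv_bubble[OF U f]) auto
  also have "\<dots> = nderiv (v # vs) f x"
    using frechet_derivative_cong_open[OF U, of x "nderiv vs f" "nderiv (w1 @ w2) f"] Cons m by simp
  finally show ?case by simp
qed simp

lemma nderiv_sym_multilinear:
  assumes U: "open U" and f: "Ck_on k U f" and x: "x \<in> U"
  shows "sym_multilinear k (\<lambda>vs. nderiv vs f x)"
  unfolding sym_multilinear_def
  using nderiv_linear_nth[OF U f] nderiv_mset_cong[OF U f] x by (metis order_refl)

section \<open>Cofactors\<close>

definition row_upd :: "real^'n^'n \<Rightarrow> 'n \<Rightarrow> real^'n \<Rightarrow> real^'n^'n" where
  "row_upd M i v = (\<chi> k. if k = i then v else M $ k)"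

lemma cof_nth: "cof M $ i $ j = det (row_upd M i (axis j 1))"
  by (simp add: cof_def row_upd_def)

lemma det_row_upd_expand: "det (row_upd M i v) = (\<Sum>j\<in>UNIV. v $ j * det (row_upd M i (axis j 1)))"
proof -
  have "det (row_upd M i v) = det (\<chi> k. if k = i then (\<Sum>j\<in>UNIV. v $ j *s axis j 1) else M $ k)"
    by (simp add: row_upd_def basis_expansion cong: if_cong)
  also have "\<dots> = (\<Sum>j\<in>UNIV. det (\<chi> k. if k = i then v $ j *s axis j 1 else M $ k))"
    by (rule det_linear_row_sum) simp
  also have "\<dots> = (\<Sum>j\<in>UNIV. v $ j * det (row_upd M i (axis j 1)))"
    by (simp add: det_row_mul row_upd_def)
  finally show ?thesis .
qed

lemma det_row_upd_cof: "det (row_upd M i v) = (\<Sum>j\<in>UNIV. cof M $ i $ j * v $ j)"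
  unfolding cof_nth by (subst det_row_upd_expand) (rule sum.cong[OF refl mult.commute])

text \<open>Jacobi's formula, row by row: differentiating factor \<open>i\<close> of each Leibniz
  product gives the Leibniz product of the matrix whose row \<open>i\<close> has been replaced by
  that of \<open>H\<close>.\<close>

lemma has_derivative_det:
  fixes M :: "real^'n^'n"
  shows "(det has_derivative (\<lambda>H. \<Sum>i\<in>UNIV. det (row_upd M i (H $ i)))) (at M)"
proof -
  let ?P = "{p. p permutes (UNIV :: 'n set)}"
  have e: "((\<lambda>A::real^'n^'n. A $ i $ p) has_derivative (\<lambda>H. H $ i $ p)) (at M)" for i p
    by (rule bounded_linear_imp_has_derivative)
       (intro bounded_linear_compose[OF bounded_linear_vec_nth bounded_linear_vec_nth])
  have "(det has_derivative (\<lambda>H. \<Sum>p\<in>?P. of_int (sign p) *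
      (\<Sum>i\<in>UNIV. H $ i $ p i * (\<Prod>j\<in>UNIV - {i}. M $ j $ p j)))) (at M)"
    unfolding det_def[abs_def]
    by (intro has_derivative_sum has_derivative_mult_right has_derivative_prod e)
  moreover have "(\<Sum>p\<in>?P. of_int (sign p) * (\<Sum>i\<in>UNIV. H $ i $ p i * (\<Prod>j\<in>UNIV - {i}. M $ j $ p j)))
     = (\<Sum>i\<in>UNIV. det (row_upd M i (H $ i)))" for H
  proof -
    have pr: "(\<Prod>k\<in>UNIV. row_upd M i (H $ i) $ k $ p k) = H $ i $ p i * (\<Prod>j\<in>UNIV - {i}. M $ j $ p j)" for i p
      by (subst prod.remove[of _ i]) (auto simp: row_upd_def intro!: prod.cong)
    show ?thesis unfolding det_def pr sum_distrib_left by (rule sum.swap)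
  qed
  ultimately show ?thesis by simp
qed

lemma has_derivative_det_cof:
  fixes M :: "real^'n^'n"
  shows "(det has_derivative (\<lambda>H. \<Sum>i\<in>UNIV. \<Sum>j\<in>UNIV. cof M $ i $ j * H $ i $ j)) (at M)"
  using has_derivative_det[of M] unfolding det_row_upd_cof .

lemma continuous_on_det: "continuous_on UNIV (det :: real^'n^'n \<Rightarrow> real)"
  by (intro continuous_at_imp_continuous_on ballI has_derivative_continuous[OF has_derivative_det])

lemma continuous_on_cof: "continuous_on UNIV (\<lambda>M :: real^'n^'n. cof M $ i $ j)"
proof -
  have "continuous_on UNIV (\<lambda>M :: real^'n^'n. row_upd M i (axis j 1))"
    unfolding row_upd_def
  proof (intro continuous_on_vec_lambda)
    show "continuous_on UNIV (\<lambda>M :: real^'n^'n. if k = i then axis j 1 else M $ k)" for k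
      by (cases "k = i") (auto intro!: continuous_intros)
  qed
  then show ?thesis unfolding cof_nth
    by (rule continuous_on_compose2[OF continuous_on_det]) simp
qed

text \<open>The second cofactors, that is the partial derivatives of \<open>cof M $ i $ j\<close>
  with respect to \<open>M $ k $ l\<close>. They are 0 for \<open>k = i\<close> because row
  \<open>i\<close> of \<open>M\<close> has been overwritten.\<close>

definition cof2 :: "real^'n^'n \<Rightarrow> 'n \<Rightarrow> 'n \<Rightarrow> 'n \<Rightarrow> 'n \<Rightarrow> real" where
  "cof2 M i j k l = (if k = i then 0 else det (row_upd (row_upd M i (axis j 1)) k (axis l 1)))"

text \<open>Exchanging \<open>j\<close> and \<open>l\<close> exchanges rows \<open>i\<close> and
  \<open>k\<close> of the modified matrix, and a transposition of rows changes the sign of the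
  determinant.\<close>

lemma cof2_antisym: "cof2 M i j k l = - cof2 M i l k j"
proof (cases "k = i")
  case False
  let ?A = "row_upd (row_upd M i (axis j 1)) k (axis l 1)"
  have "row_upd (row_upd M i (axis l 1)) k (axis j 1) = (\<chi> r. ?A $ Transposition.transpose i k r)"
    using False by (auto simp: vec_eq_iff row_upd_def Transposition.transpose_def)
  then have "det (row_upd (row_upd M i (axis l 1)) k (axis j 1)) = - det ?A"
    using False det_permute_rows[of "Transposition.transpose i k" ?A]
    by (simp add: permutes_swap_id sign_swap_id)
  then show ?thesis using False by (simp add: cof2_def)
qed (simp add: cof2_def)

text \<open>Overwriting a row is an affine map: its linear part clears row \<open>i\<close>, its
  constant part contains only the new row. The chain rule with Jacobi's formula then gives the
  second cofactors.\<close>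

lemma has_derivative_cof:
  fixes M :: "real^'n^'n"
  shows "((\<lambda>M. cof M $ i $ j) has_derivative (\<lambda>H. \<Sum>k\<in>UNIV. \<Sum>l\<in>UNIV. cof2 M i j k l * H $ k $ l)) (at M)"
proof -
  let ?g = "\<lambda>M. row_upd M i (axis j 1)"
  have "linear (\<lambda>M. row_upd M i 0)" by (simp add: linear_iff row_upd_def vec_eq_iff)
  then have "((\<lambda>M. row_upd M i 0 + row_upd 0 i (axis j 1)) has_derivative (\<lambda>H. row_upd H i 0)) (at M)"
    by (intro has_derivative_add_const linear_imp_has_derivative)
  moreover have "(\<lambda>M. row_upd M i 0 + row_upd 0 i (axis j 1)) = ?g"
    by (simp add: fun_eq_iff row_upd_def vec_eq_iff)
  ultimately have "(?g has_derivative (\<lambda>H. row_upd H i 0)) (at M)" by simp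
  from has_derivative_compose[OF this has_derivative_det]
  have "((\<lambda>M. cof M $ i $ j) has_derivative
     (\<lambda>H. \<Sum>k\<in>UNIV. det (row_upd (?g M) k (row_upd H i 0 $ k)))) (at M)"
    by (simp add: cof_nth)
  moreover have "det (row_upd (?g M) k (row_upd H i 0 $ k)) = (\<Sum>l\<in>UNIV. cof2 M i j k l * H $ k $ l)" for H k
    by (subst det_row_upd_expand) (auto simp: cof2_def row_upd_def mult.commute)
  ultimately show ?thesis by simp
qed

text \<open>The algebra behind the Piola identity: \<open>T k l j\<close> stands for \<open>\<partial>\<^sub>j M\<^sub>k\<^sub>l\<close>, and contracting a form that
  is symmetric in \<open>j, l\<close> against one that is antisymmetric gives zero.\<close>

lemma cof_divergence_zero:
  assumes "\<And>k l j. T k l j = T k j l"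
  shows "(\<Sum>j\<in>UNIV. \<Sum>k\<in>UNIV. \<Sum>l\<in>UNIV. cof2 M i j k l * T k l j) = (0::real)"
proof -
  let ?S = "\<lambda>k. \<Sum>j\<in>UNIV. \<Sum>l\<in>UNIV. cof2 M i j k l * T k l j"
  have "?S k = - ?S k" for k
  proof -
    have "?S k = (\<Sum>l\<in>UNIV. \<Sum>j\<in>UNIV. cof2 M i j k l * T k l j)" by (rule sum.swap)
    also have "\<dots> = - ?S k"
      unfolding sum_negf[symmetric]
      by (intro sum.cong refl, subst cof2_antisym, subst assms) simp
    finally show ?thesis .
  qed
  then have "?S k = 0" for k by (simp add: equal_neg_zero)
  then show ?thesis by (subst sum.swap) simp
qed

section \<open>The adjugate identity and definiteness of cofactor matrices\<close>

lemma sum_row_cof: "(\<Sum>j\<in>UNIV. M $ k $ j * cof M $ i $ j) = (if k = i then det M else 0)"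
proof -
  have "(\<Sum>j\<in>UNIV. M $ k $ j * cof M $ i $ j) = det (row_upd M i (M $ k))"
    by (simp add: det_row_upd_expand[of M i "M $ k"] cof_nth)
  also have "\<dots> = (if k = i then det M else 0)"
  proof (cases "k = i")
    case True
    then have "row_upd M i (M $ k) = M" by (simp add: row_upd_def vec_eq_iff)
    then show ?thesis using True by simp
  next
    case False
    then show ?thesis using det_identical_rows[of k i "row_upd M i (M $ k)"]
      by (simp add: row_def row_upd_def)
  qed
  finally show ?thesis .
qed

lemma matrix_mul_transpose_cof: "M ** transpose (cof M) = (\<chi> k i. if k = i then det M else 0)"
  using sum_row_cof[of M] by (simp add: matrix_matrix_mult_def transpose_def vec_eq_iff)

text \<open>For symmetric \<open>M\<close>, transposing the adjugate identity gives the same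
  diagonal matrix for \<open>cof M ** M\<close>. Bracketing
  \<open>cof M ** M ** transpose (cof M)\<close> in the two possible ways and cancelling
  \<open>det M\<close> identifies the two outer factors.\<close>

lemma transpose_cof_sym:
  fixes M :: "real^'n^'n"
  assumes sym: "transpose M = M" and d: "det M \<noteq> 0"
  shows "transpose (cof M) = cof M"
proof -
  let ?D = "(\<chi> k i. if k = i then det M else 0) :: real^'n^'n"
  have l: "M ** transpose (cof M) = ?D" by (rule matrix_mul_transpose_cof)
  have "transpose (M ** transpose (cof M)) = transpose ?D" using l by simp
  then have r: "cof M ** M = ?D"
    using sym by (simp add: matrix_transpose_mul) (simp add: transpose_def vec_eq_iff)
  have D: "?D = mat (det M)" by (simp add: mat_def)
  have s1: "mat (det M) ** A = det M *\<^sub>R A" for A :: "real^'n^'n"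
    by (simp add: mat_def matrix_matrix_mult_def vec_eq_iff if_distrib[of "\<lambda>x. x * _"] cong: if_cong)
  have s2: "A ** mat (det M) = det M *\<^sub>R A" for A :: "real^'n^'n"
    by (simp add: mat_def matrix_matrix_mult_def vec_eq_iff if_distrib[of "\<lambda>x. _ * x"] mult.commute cong: if_cong)
  have "det M *\<^sub>R transpose (cof M) = (cof M ** M) ** transpose (cof M)" by (simp add: r D s1)
  also have "\<dots> = cof M ** (M ** transpose (cof M))" by (simp add: matrix_mul_assoc)
  also have "\<dots> = det M *\<^sub>R cof M" by (simp add: l D s2)
  finally show ?thesis using d by simp
qed

text \<open>With \<open>y = cof M *v x\<close> one has \<open>M *v y = det M *\<^sub>R x\<close>, so
  the form of \<open>M\<close> at \<open>y\<close> is \<open>det M\<close> times the form of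
  \<open>cof M\<close> at \<open>x\<close>.\<close>

lemma cof_positive:
  fixes M :: "real^'n^'n"
  assumes sym: "transpose M = M" and d: "det M > 0"
    and pos: "\<And>\<xi>. \<xi> \<noteq> 0 \<Longrightarrow> 0 < \<xi> \<bullet> (M *v \<xi>)" and x: "x \<noteq> 0"
  shows "0 < x \<bullet> (cof M *v x)"
proof -
  let ?y = "cof M *v x"
  have "M *v ?y = (M ** cof M) *v x" by (simp add: matrix_vector_mul_assoc)
  also have "M ** cof M = mat (det M)"
    using matrix_mul_transpose_cof[of M] transpose_cof_sym[OF sym] d by (simp add: mat_def)
  finally have e: "M *v ?y = det M *\<^sub>R x"
    by (simp add: mat_def matrix_vector_mult_def vec_eq_iff if_distrib[of "\<lambda>x. x * _"] cong: if_cong)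
  have "?y \<noteq> 0" using e d x by (metis less_irrefl matrix_vector_mult_0_right scaleR_eq_0_iff)
  then have "0 < ?y \<bullet> (M *v ?y)" by (rule pos)
  then show ?thesis using d by (simp add: e inner_commute zero_less_mult_iff)
qed

lemma transpose_eq_nth:
  assumes "transpose M = M" shows "M $ i $ j = M $ j $ i"
proof -
  have "transpose M $ i $ j = M $ j $ i" by (simp add: transpose_def)
  then show ?thesis by (simp add: assms)
qed

text \<open>On the line \<open>axis q 1 + t *\<^sub>R axis p 1\<close> the quadratic form is affine
  in \<open>t\<close> with slope \<open>2 * C $ p $ q\<close>; an affine function bounded below is
  constant.\<close>

lemma psd_zero_diagonal:
  fixes C :: "real^'n^'n"
  assumes sym: "transpose C = C" and psd: "\<And>x. 0 \<le> x \<bullet> (C *v x)" and z: "C $ p $ p = 0"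
  shows "C $ p $ q = 0"
proof (rule ccontr)
  assume ne: "\<not> ?thesis"
  have s: "C $ q $ p = C $ p $ q" by (rule transpose_eq_nth[OF sym])
  have c: "(C *v axis j 1) $ i = C $ i $ j" for i j
    by (simp add: matrix_vector_mult_basis column_def)
  \<comment> \<open>The value of \<open>t\<close> at which that affine function equals -1.\<close>
  define t where "t = - (C $ q $ q + 1) / (2 * C $ p $ q)"
  have "(axis q 1 + t *\<^sub>R axis p 1) \<bullet> (C *v (axis q 1 + t *\<^sub>R axis p 1)) = C $ q $ q + 2 * t * C $ p $ q"
    using z s by (simp add: matrix_vector_right_distrib matrix_vector_mult_scaleR inner_add_left
        inner_add_right inner_axis' c algebra_simps)
  also have "\<dots> = -1" using ne by (simp add: t_def field_simps)
  finally show False using psd[of "axis q 1 + t *\<^sub>R axis p 1"] by simp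
qed

text \<open>Symmetric Gaussian elimination: subtracting a rank-one matrix built from one column
  leaves a positive semidefinite matrix with fewer nonzero diagonal entries. Each rank-one part
  contracts with \<open>H\<close> to a nonnegative multiple of the form of \<open>H\<close> at a
  vector.\<close>

lemma psd_contract_nonpos:
  fixes C H :: "real^'n^'n"
  assumes "transpose C = C" "\<And>x. 0 \<le> x \<bullet> (C *v x)" "\<And>x. x \<bullet> (H *v x) \<le> 0"
  shows "(\<Sum>i\<in>UNIV. \<Sum>j\<in>UNIV. C $ i $ j * H $ i $ j) \<le> 0"
  using assms(1,2)
proof (induction "card {i. C $ i $ i \<noteq> 0}" arbitrary: C rule: less_induct)
  case less
  show ?case
  proof (cases "\<exists>p. C $ p $ p \<noteq> 0")
    case False
    then have "C $ p $ q = 0" for p q using psd_zero_diagonal[OF less.prems, of p q] by simp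
    then show ?thesis by simp
  next
    case True
    then obtain p where p: "C $ p $ p \<noteq> 0" by blast
    have s: "C $ i $ j = C $ j $ i" for i j by (rule transpose_eq_nth[OF less.prems(1)])
    have col: "(C *v axis j 1) $ i = C $ i $ j" for i j
      by (simp add: matrix_vector_mult_basis column_def)
    define c where "c = C *v axis p 1"
    have cn: "c $ i = C $ i $ p" for i by (simp add: c_def col)
    have cp: "C $ p $ p > 0"
      using less.prems(2)[of "axis p 1"] p by (simp add: inner_axis' col)
    \<comment> \<open>The Schur complement of the pivot \<open>C $ p $ p\<close>; its row and column
      \<open>p\<close> vanish.\<close>
    define C' where "C' = (\<chi> i j. C $ i $ j - c $ i * c $ j / C $ p $ p)"
    have C'v: "C' *v x = C *v x - ((c \<bullet> x) / C $ p $ p) *\<^sub>R c" for x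
      by (simp add: C'_def matrix_vector_mult_def vec_eq_iff inner_vec_def algebra_simps sum_subtractf
          sum_distrib_left sum_divide_distrib)
    have cx: "c \<bullet> x = (C *v x) $ p" for x
      by (simp add: cn inner_vec_def matrix_vector_mult_def s[of _ p])
    have t': "transpose C' = C'" by (simp add: C'_def transpose_def vec_eq_iff s mult.commute)
    have psd': "0 \<le> x \<bullet> (C' *v x)" for x
    proof -
      \<comment> \<open>This \<open>t\<close> minimises the form of \<open>C\<close> along
        \<open>x - t *\<^sub>R axis p 1\<close>. The minimum is the form of \<open>C'\<close> at
        \<open>x\<close>, hence nonnegative.\<close>
      define t where "t = (c \<bullet> x) / C $ p $ p"
      have "(x - t *\<^sub>R axis p 1) \<bullet> (C *v (x - t *\<^sub>R axis p 1))
          = x \<bullet> (C *v x) - t * (c \<bullet> x) - t * (c \<bullet> x) + t * t * C $ p $ p"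
        by (simp add: matrix_vector_mult_diff_distrib matrix_vector_mult_scaleR inner_diff_left
            inner_diff_right inner_axis' cx[symmetric] c_def[symmetric] cn inner_commute[of x c] algebra_simps)
      also have "\<dots> = x \<bullet> (C *v x) - t * (c \<bullet> x)" using p by (simp add: t_def)
      also have "\<dots> = x \<bullet> (C' *v x)" by (simp add: C'v inner_diff_right t_def inner_commute)
      finally show ?thesis using less.prems(2)[of "x - t *\<^sub>R axis p 1"] by simp
    qed
    have sub: "{i. C' $ i $ i \<noteq> 0} \<subset> {i. C $ i $ i \<noteq> 0}"
    proof -
      have "C' $ p $ p = 0" using p by (simp add: C'_def cn)
      moreover have "C' $ i $ i = 0" if "C $ i $ i = 0" for i
        using psd_zero_diagonal[OF less.prems that, of p] that by (simp add: C'_def cn)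
      ultimately show ?thesis using p by auto
    qed
    have "(\<Sum>i\<in>UNIV. \<Sum>j\<in>UNIV. C' $ i $ j * H $ i $ j) \<le> 0"
      using less.hyps[OF psubset_card_mono[OF _ sub] t' psd'] by simp
    moreover have "c \<bullet> (H *v c) = (\<Sum>i\<in>UNIV. \<Sum>j\<in>UNIV. c $ i * c $ j * H $ i $ j)"
      by (simp add: inner_vec_def matrix_vector_mult_def sum_distrib_left ac_simps)
    moreover have "(\<Sum>i\<in>UNIV. \<Sum>j\<in>UNIV. C $ i $ j * H $ i $ j)
       = (\<Sum>i\<in>UNIV. \<Sum>j\<in>UNIV. C' $ i $ j * H $ i $ j)
       + (\<Sum>i\<in>UNIV. \<Sum>j\<in>UNIV. c $ i * c $ j * H $ i $ j) / C $ p $ p"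
      unfolding sum_divide_distrib sum.distrib[symmetric]
      by (intro sum.cong refl) (simp add: C'_def algebra_simps)
    moreover have "(c \<bullet> (H *v c)) / C $ p $ p \<le> 0"
      using assms(3)[of c] cp by (simp add: divide_nonpos_pos)
    ultimately show ?thesis by simp
  qed
qed

lemma trace_mul_sym:
  fixes C H :: "real^'n^'n"
  assumes "transpose C = C"
  shows "trace (C ** H) = (\<Sum>i\<in>UNIV. \<Sum>j\<in>UNIV. C $ i $ j * H $ i $ j)"
proof -
  have "C $ i $ j = C $ j $ i" for i j by (rule transpose_eq_nth[OF assms])
  then have "trace (C ** H) = (\<Sum>i\<in>UNIV. \<Sum>j\<in>UNIV. C $ j $ i * H $ j $ i)"
    by (simp add: trace_def matrix_matrix_mult_def)
  also have "\<dots> = (\<Sum>j\<in>UNIV. \<Sum>i\<in>UNIV. C $ j $ i * H $ j $ i)" by (rule sum.swap)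
  finally show ?thesis .
qed

section \<open>Hoelder spaces and bounded evaluations\<close>

text \<open>The extension clause of \<open>Ck_closure\<close> as a predicate of its own. On a
  bounded set it yields a bound, and on an open one continuity and hence measurability; the
  coefficients of the integrals below are tracked through it.\<close>

definition has_cext :: "'a::topological_space set \<Rightarrow> ('a \<Rightarrow> 'b::t2_space) \<Rightarrow> bool" where
  "has_cext U f \<longleftrightarrow> (\<exists>g. continuous_on (closure U) g \<and> (\<forall>x\<in>U. g x = f x))"

text \<open>A point of the closure outside \<open>U\<close> is a limit point of \<open>U\<close>, so
  the filter inside \<open>Lim\<close> is nontrivial and the limit is the value of any continuous
  extension.\<close>

lemma bdry_ext_eq:
  fixes U :: "'a::{perfect_space,metric_space} set"
  assumes "continuous_on (closure U) g" "\<And>x. x \<in> U \<Longrightarrow> g x = f x" "x \<in> closure U"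
  shows "bdry_ext U f x = g x"
proof (cases "x \<in> U")
  case True
  then show ?thesis using assms by (simp add: bdry_ext_def)
next
  case False
  then have "x islimpt U" using assms(3) by (simp add: closure_def)
  then have nt: "at x within U \<noteq> bot" by (simp add: trivial_limit_within)
  have "(g \<longlongrightarrow> g x) (at x within closure U)" using assms by (simp add: continuous_on_def)
  then have "(g \<longlongrightarrow> g x) (at x within U)" by (rule tendsto_within_subset) (rule closure_subset)
  then have "(f \<longlongrightarrow> g x) (at x within U)"
    by (rule Lim_transform_eventually) (auto simp: eventually_at_filter assms(2))
  then show ?thesis using False tendsto_Lim[OF nt] by (simp add: bdry_ext_def)
qed

lemma bdry_ext_continuous:
  fixes U :: "'a::{perfect_space,metric_space} set"
  assumes "has_cext U f"
  shows "continuous_on (closure U) (bdry_ext U f)"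
proof -
  obtain g where g: "continuous_on (closure U) g" "\<And>x. x \<in> U \<Longrightarrow> g x = f x"
    using assms by (auto simp: has_cext_def)
  show ?thesis by (rule continuous_on_eq[OF g(1)]) (use bdry_ext_eq[OF g] in auto)
qed

lemma bdry_ext_inside: "x \<in> U \<Longrightarrow> bdry_ext U f x = f x"
  by (simp add: bdry_ext_def)

lemma has_cext_lincomb:
  fixes f g :: "'a::topological_space \<Rightarrow> real"
  assumes "has_cext U f" "has_cext U g" shows "has_cext U (\<lambda>x. f x + c * g x)"
proof -
  obtain f' g' where "continuous_on (closure U) f'" "\<forall>x\<in>U. f' x = f x"
    "continuous_on (closure U) g'" "\<forall>x\<in>U. g' x = g x" using assms by (auto simp: has_cext_def)
  then show ?thesis unfolding has_cext_def
    by (intro exI[of _ "\<lambda>x. f' x + c * g' x"]) (auto intro!: continuous_intros)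
qed

lemma has_cext_const: "has_cext U (\<lambda>x. c)"
  unfolding has_cext_def by (intro exI[of _ "\<lambda>x. c"]) auto

lemma has_cext_cong: "has_cext U f \<Longrightarrow> (\<And>x. x \<in> U \<Longrightarrow> f x = g x) \<Longrightarrow> has_cext U g"
  by (auto simp: has_cext_def)

lemma has_cext_sum:
  fixes f :: "'i \<Rightarrow> 'a::topological_space \<Rightarrow> real"
  assumes "finite I" "\<And>i. i \<in> I \<Longrightarrow> has_cext U (f i)" shows "has_cext U (\<lambda>x. \<Sum>i\<in>I. f i x)"
  using assms
proof (induction I)
  case (insert i I)
  then have "has_cext U (\<lambda>x. (\<Sum>i\<in>I. f i x) + 1 * f i x)" by (intro has_cext_lincomb) auto
  then show ?case using insert by (simp add: add.commute)
qed (simp add: has_cext_const)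

lemma has_cext_mult:
  fixes f g :: "'a::topological_space \<Rightarrow> real"
  assumes "has_cext U f" "has_cext U g" shows "has_cext U (\<lambda>x. f x * g x)"
proof -
  obtain f' g' where "continuous_on (closure U) f'" "\<forall>x\<in>U. f' x = f x"
    "continuous_on (closure U) g'" "\<forall>x\<in>U. g' x = g x" using assms by (auto simp: has_cext_def)
  then show ?thesis unfolding has_cext_def
    by (intro exI[of _ "\<lambda>x. f' x * g' x"]) (auto intro!: continuous_intros)
qed

lemma has_cext_bounded:
  fixes f :: "'a::heine_borel \<Rightarrow> real"
  assumes "has_cext U f" "bounded U"
  obtains B where "B \<ge> 0" "\<And>x. x \<in> U \<Longrightarrow> \<bar>f x\<bar> \<le> B"
proof -
  obtain g where g: "continuous_on (closure U) g" "\<forall>x\<in>U. g x = f x"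
    using assms(1) by (auto simp: has_cext_def)
  have "compact (g ` closure U)"
    using g(1) assms(2) by (intro compact_continuous_image) auto
  then obtain B where B: "\<forall>y\<in>g ` closure U. norm y \<le> B" using compact_imp_bounded bounded_iff by blast
  show thesis
  proof (rule that[of "max B 0"])
    fix x assume "x \<in> U"
    then have "\<bar>g x\<bar> \<le> B" using B closure_subset[of U] by (force simp: image_iff)
    then show "\<bar>f x\<bar> \<le> max B 0" using g(2) \<open>x \<in> U\<close> by auto
  qed simp
qed

lemma Ck_closure_imp_Ck_on: "Ck_closure k U f \<Longrightarrow> Ck_on k U f"
  unfolding Ck_closure_def Ck_on_def
  by (metis (no_types, lifting) closure_subset continuous_on_cong continuous_on_subset)

lemma Ck_closure_cext:
  assumes U: "open U" and f: "Ck_closure k U f" and l: "length vs \<le> k"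
  shows "has_cext U (nderiv vs f)"
proof -
  have "has_cext U (\<lambda>x. prod_list (map2 (\<bullet>) vs bs) * nderiv bs f x)" if "bs \<in> mindex (length vs)" for bs
  proof -
    have "has_cext U (nderiv bs f)" using f that l by (auto simp: Ck_closure_def has_cext_def)
    then show ?thesis by (intro has_cext_mult has_cext_const)
  qed
  then have "has_cext U (\<lambda>x. \<Sum>bs\<in>mindex (length vs). prod_list (map2 (\<bullet>) vs bs) * nderiv bs f x)"
    by (intro has_cext_sum) auto
  then show ?thesis
    by (rule has_cext_cong) (use nderiv_expand[OF U Ck_closure_imp_Ck_on[OF f] l] in auto)
qed

lemma holder_spaceD:
  assumes "f \<in> fcarrier (holder_space k \<alpha> U)"
  shows "Ck_closure k U f" and "vs \<in> mindex r \<Longrightarrow> r \<le> k \<Longrightarrow> bounded (nderiv vs f ` U)"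
    and "vs \<in> mindex k \<Longrightarrow> \<exists>C. \<forall>x\<in>U. \<forall>y\<in>U. \<bar>nderiv vs f x - nderiv vs f y\<bar> \<le> C * dist x y powr \<alpha>"
  using assms by (auto simp: holder_space_def)

lemma holder_space_Ck_on: "f \<in> fcarrier (holder_space k \<alpha> U) \<Longrightarrow> Ck_on k U f"
  using Ck_closure_imp_Ck_on holder_spaceD(1) by blast

lemma nderiv_cmult:
  assumes "open U" "Ck_on k U f" "length vs \<le> k" "x \<in> U"
  shows "nderiv vs (\<lambda>x. c * f x) x = c * nderiv vs f x"
  using nderiv_lincomb[OF assms(1,2,2,3,4), of "c - 1"] by (simp add: algebra_simps)

lemma holder_space_lincomb:
  assumes U: "open U" and f: "f \<in> fcarrier (holder_space k \<alpha> U)" and g: "g \<in> fcarrier (holder_space k \<alpha> U)"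
  shows "(\<lambda>x. f x + c * g x) \<in> fcarrier (holder_space k \<alpha> U)"
proof -
  let ?h = "\<lambda>x. f x + c * g x"
  note cf = holder_space_Ck_on[OF f] and cg = holder_space_Ck_on[OF g]
  have ch: "Ck_on k U ?h" by (rule Ck_on_lincomb[OF U cf cg])
  have nd: "nderiv vs ?h x = nderiv vs f x + c * nderiv vs g x" if "vs \<in> mindex r" "r \<le> k" "x \<in> U" for vs r x
    using nderiv_lincomb[OF U cf cg] that by (auto simp: mindex_def)
  have "Ck_closure k U ?h"
    unfolding Ck_closure_def
  proof (intro conjI allI impI ballI)
    show "continuous_on (closure U) ?h"
      using holder_spaceD(1)[OF f] holder_spaceD(1)[OF g] by (auto simp: Ck_closure_def intro!: continuous_intros)
    fix r and vs :: "'a list" assume r: "r \<le> k" and vs: "vs \<in> mindex r"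
    have "has_cext U (\<lambda>x. nderiv vs f x + c * nderiv vs g x)"
      using Ck_closure_cext[OF U] holder_spaceD(1)[OF f] holder_spaceD(1)[OF g] r vs
      by (intro has_cext_lincomb) (auto simp: mindex_def)
    then have "has_cext U (nderiv vs ?h)" by (rule has_cext_cong) (use nd[OF vs r] in auto)
    then show "\<exists>g. continuous_on (closure U) g \<and> (\<forall>x\<in>U. g x = nderiv vs ?h x)"
      by (simp add: has_cext_def)
  qed (use ch in \<open>auto simp: Ck_on_def\<close>)
  moreover have "bounded (nderiv vs ?h ` U)" if r: "r \<le> k" and vs: "vs \<in> mindex r" for r vs
  proof -
    obtain A B where "\<forall>x\<in>U. \<bar>nderiv vs f x\<bar> \<le> A" "\<forall>x\<in>U. \<bar>nderiv vs g x\<bar> \<le> B"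
      using holder_spaceD(2)[OF f vs r] holder_spaceD(2)[OF g vs r] by (auto simp: bounded_iff)
    then have "\<bar>nderiv vs ?h x\<bar> \<le> A + \<bar>c\<bar> * B" if "x \<in> U" for x
      using nd[OF vs r that] that
      by (auto intro!: order_trans[OF abs_triangle_ineq] add_mono mult_left_mono simp: abs_mult)
    then show ?thesis unfolding bounded_iff by (intro exI[of _ "A + \<bar>c\<bar> * B"]) auto
  qed
  moreover have "\<exists>C. \<forall>x\<in>U. \<forall>y\<in>U. \<bar>nderiv vs ?h x - nderiv vs ?h y\<bar> \<le> C * dist x y powr \<alpha>"
    if vs: "vs \<in> mindex k" for vs
  proof -
    obtain A B where A: "\<And>x y. x \<in> U \<Longrightarrow> y \<in> U \<Longrightarrow> \<bar>nderiv vs f x - nderiv vs f y\<bar> \<le> A * dist x y powr \<alpha>"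
      and B: "\<And>x y. x \<in> U \<Longrightarrow> y \<in> U \<Longrightarrow> \<bar>nderiv vs g x - nderiv vs g y\<bar> \<le> B * dist x y powr \<alpha>"
      using holder_spaceD(3)[OF f vs] holder_spaceD(3)[OF g vs] by meson
    have "\<bar>nderiv vs ?h x - nderiv vs ?h y\<bar> \<le> (A + \<bar>c\<bar> * B) * dist x y powr \<alpha>" if "x \<in> U" "y \<in> U" for x y
    proof -
      have "nderiv vs ?h x - nderiv vs ?h y
          = (nderiv vs f x - nderiv vs f y) + c * (nderiv vs g x - nderiv vs g y)"
        using nd[OF vs order_refl] that by (simp add: algebra_simps)
      also have "\<bar>\<dots>\<bar> \<le> A * dist x y powr \<alpha> + \<bar>c\<bar> * (B * dist x y powr \<alpha>)"
        using A[OF that] B[OF that]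
        by (intro order_trans[OF abs_triangle_ineq] add_mono) (auto simp: abs_mult intro!: mult_left_mono)
      finally show ?thesis by (simp add: algebra_simps)
    qed
    then show ?thesis by blast
  qed
  ultimately show ?thesis by (auto simp: holder_space_def)
qed

lemma holder_space_cmult:
  assumes "open U" "f \<in> fcarrier (holder_space k \<alpha> U)"
  shows "(\<lambda>x. c * f x) \<in> fcarrier (holder_space k \<alpha> U)"
  using holder_space_lincomb[OF assms(1,2,2), of "c - 1"] by (simp add: algebra_simps)

text \<open>\<open>holder_seminorm\<close> is a supremum over pairs of distinct points; this makes
  the set of quotients nonempty, without which \<open>Sup\<close> could not be estimated.\<close>

lemma open_two_points:
  fixes U :: "'a::euclidean_space set"
  assumes "open U" "U \<noteq> {}" obtains x y where "x \<in> U" "y \<in> U" "x \<noteq> y"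
proof -
  obtain x where x: "x \<in> U" using assms by auto
  have "x islimpt U" using interior_limit_point[of x U] x assms(1) by (simp add: interior_open)
  then obtain y where "y \<in> U" "y \<noteq> x" using x assms(1) by (auto simp: islimpt_def)
  then show thesis using that x by blast
qed

lemma holder_quotients_bdd:
  assumes f: "f \<in> fcarrier (holder_space k \<alpha> U)" and vs: "vs \<in> mindex k"
  shows "bdd_above {\<bar>nderiv vs f x - nderiv vs f y\<bar> / dist x y powr \<alpha> | x y. x \<in> U \<and> y \<in> U \<and> x \<noteq> y}"
proof -
  obtain C where C: "\<And>x y. x \<in> U \<Longrightarrow> y \<in> U \<Longrightarrow> \<bar>nderiv vs f x - nderiv vs f y\<bar> \<le> C * dist x y powr \<alpha>"
    using holder_spaceD(3)[OF f vs] by meson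
  show ?thesis
    by (rule bdd_aboveI[of _ C]) (auto simp: divide_le_eq intro!: C)
qed

lemma holder_seminorm_nonneg:
  assumes U: "open U" "U \<noteq> {}" and f: "f \<in> fcarrier (holder_space k \<alpha> U)" and vs: "vs \<in> mindex k"
  shows "0 \<le> holder_seminorm \<alpha> U (nderiv vs f)"
proof -
  obtain x y where "x \<in> U" "y \<in> U" "x \<noteq> y" using open_two_points[OF U] .
  then show ?thesis unfolding holder_seminorm_def
    by (intro cSup_upper2[OF _ _ holder_quotients_bdd[OF f vs], of "\<bar>nderiv vs f x - nderiv vs f y\<bar> / dist x y powr \<alpha>"]) auto
qed

lemma holder_space_bdd:
  assumes "f \<in> fcarrier (holder_space k \<alpha> U)" "vs \<in> mindex r" "r \<le> k"
  shows "bdd_above ((\<lambda>x. \<bar>nderiv vs f x\<bar>) ` U)"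
  using holder_spaceD(2)[OF assms] by (auto simp: bounded_iff bdd_above_def)

lemma sup_norm_nonneg:
  assumes "U \<noteq> {}" "f \<in> fcarrier (holder_space k \<alpha> U)" "vs \<in> mindex r" "r \<le> k"
  shows "0 \<le> (SUP x\<in>U. \<bar>nderiv vs f x\<bar>)"
proof -
  obtain x where "x \<in> U" using assms(1) by blast
  then show ?thesis by (intro cSUP_upper2[OF holder_space_bdd[OF assms(2-4)]]) auto
qed

lemma fnorm_holder_nonneg:
  assumes U: "open U" "U \<noteq> {}" and f: "f \<in> fcarrier (holder_space k \<alpha> U)"
  shows "0 \<le> fnorm (holder_space k \<alpha> U) f"
  unfolding holder_space_def
  using sup_norm_nonneg[OF U(2) f] holder_seminorm_nonneg[OF U f]
  by (auto intro!: add_nonneg_nonneg sum_nonneg)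

lemma nderiv_le_fnorm:
  assumes U: "open U" "U \<noteq> {}" and f: "f \<in> fcarrier (holder_space k \<alpha> U)"
    and vs: "vs \<in> mindex r" and r: "r \<le> k" and x: "x \<in> U"
  shows "\<bar>nderiv vs f x\<bar> \<le> fnorm (holder_space k \<alpha> U) f"
proof -
  have "\<bar>nderiv vs f x\<bar> \<le> (SUP x\<in>U. \<bar>nderiv vs f x\<bar>)"
    by (rule cSUP_upper[OF x holder_space_bdd[OF f vs r]])
  also have "\<dots> \<le> (\<Sum>vs\<in>mindex r. SUP x\<in>U. \<bar>nderiv vs f x\<bar>)"
    using vs r sup_norm_nonneg[OF U(2) f]
    by (intro member_le_sum[of vs _ "\<lambda>vs. SUP x\<in>U. \<bar>nderiv vs f x\<bar>"]) auto
  also have "\<dots> \<le> (\<Sum>r\<le>k. \<Sum>vs\<in>mindex r. SUP x\<in>U. \<bar>nderiv vs f x\<bar>)"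
    using r sup_norm_nonneg[OF U(2) f]
    by (intro member_le_sum[of r _ "\<lambda>r. \<Sum>vs\<in>mindex r. SUP x\<in>U. \<bar>nderiv vs f x\<bar>"]) (auto intro!: sum_nonneg)
  also have "\<dots> \<le> fnorm (holder_space k \<alpha> U) f"
    using holder_seminorm_nonneg[OF U f] by (auto simp: holder_space_def intro!: sum_nonneg)
  finally show ?thesis .
qed

lemma fnorm_holder_cmult_le:
  assumes U: "open U" "U \<noteq> {}" and f: "f \<in> fcarrier (holder_space k \<alpha> U)"
  shows "fnorm (holder_space k \<alpha> U) (\<lambda>x. c * f x) \<le> \<bar>c\<bar> * fnorm (holder_space k \<alpha> U) f"
proof -
  have nd: "nderiv vs (\<lambda>x. c * f x) x = c * nderiv vs f x" if "vs \<in> mindex r" "r \<le> k" "x \<in> U" for vs r x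
    using nderiv_cmult[OF U(1) holder_space_Ck_on[OF f]] that by (auto simp: mindex_def)
  have "(SUP x\<in>U. \<bar>nderiv vs (\<lambda>x. c * f x) x\<bar>) \<le> \<bar>c\<bar> * (SUP x\<in>U. \<bar>nderiv vs f x\<bar>)"
    if vs: "vs \<in> mindex r" and r: "r \<le> k" for vs r
    using U(2)
    by (rule cSUP_least)
       (auto simp: nd[OF vs r] abs_mult intro!: mult_left_mono cSUP_upper[OF _ holder_space_bdd[OF f vs r]])
  moreover have "holder_seminorm \<alpha> U (nderiv vs (\<lambda>x. c * f x)) \<le> \<bar>c\<bar> * holder_seminorm \<alpha> U (nderiv vs f)"
    if vs: "vs \<in> mindex k" for vs
    unfolding holder_seminorm_def
  proof (rule cSup_least)
    obtain x y where "x \<in> U" "y \<in> U" "x \<noteq> y" using open_two_points[OF U] .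
    then show "{\<bar>nderiv vs (\<lambda>x. c * f x) x - nderiv vs (\<lambda>x. c * f x) y\<bar> / dist x y powr \<alpha> |x y.
       x \<in> U \<and> y \<in> U \<and> x \<noteq> y} \<noteq> {}" by auto
    fix z assume "z \<in> {\<bar>nderiv vs (\<lambda>x. c * f x) x - nderiv vs (\<lambda>x. c * f x) y\<bar> / dist x y powr \<alpha> |x y.
       x \<in> U \<and> y \<in> U \<and> x \<noteq> y}"
    then obtain x y where xy: "x \<in> U" "y \<in> U" "x \<noteq> y"
      and z: "z = \<bar>nderiv vs (\<lambda>x. c * f x) x - nderiv vs (\<lambda>x. c * f x) y\<bar> / dist x y powr \<alpha>" by blast
    have "z = \<bar>c\<bar> * (\<bar>nderiv vs f x - nderiv vs f y\<bar> / dist x y powr \<alpha>)"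
      using xy by (simp add: z nd[OF vs order_refl] flip: abs_mult right_diff_distrib)
    also have "\<dots> \<le> \<bar>c\<bar> * Sup {\<bar>nderiv vs f x - nderiv vs f y\<bar> / dist x y powr \<alpha> |x y. x \<in> U \<and> y \<in> U \<and> x \<noteq> y}"
      using xy by (intro mult_left_mono cSup_upper[OF _ holder_quotients_bdd[OF f vs]]) auto
    finally show "z \<le> \<dots>" .
  qed
  ultimately show ?thesis
    by (auto simp: holder_space_def distrib_left sum_distrib_left intro!: add_mono sum_mono)
qed

section \<open>The quotient norm on boundary data\<close>

lemma holder_bdry_spaceD:
  assumes "h \<in> fcarrier (holder_bdry_space k \<alpha> U)"
  obtains f where "f \<in> fcarrier (holder_space k \<alpha> U)" "\<And>x. x \<in> frontier U \<Longrightarrow> f x = h x"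
  using assms by (auto simp: holder_bdry_space_def)

lemma holder_bdry_spaceI: "f \<in> fcarrier (holder_space k \<alpha> U) \<Longrightarrow> f \<in> fcarrier (holder_bdry_space k \<alpha> U)"
  by (auto simp: holder_bdry_space_def)

lemma holder_bdry_space_lincomb:
  assumes "open U" "f \<in> fcarrier (holder_bdry_space k \<alpha> U)" "g \<in> fcarrier (holder_bdry_space k \<alpha> U)"
  shows "(\<lambda>x. f x + c * g x) \<in> fcarrier (holder_bdry_space k \<alpha> U)"
proof -
  obtain f' where f': "f' \<in> fcarrier (holder_space k \<alpha> U)" "\<And>x. x \<in> frontier U \<Longrightarrow> f' x = f x"
    using holder_bdry_spaceD[OF assms(2)] by blast
  obtain g' where g': "g' \<in> fcarrier (holder_space k \<alpha> U)" "\<And>x. x \<in> frontier U \<Longrightarrow> g' x = g x"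
    using holder_bdry_spaceD[OF assms(3)] by blast
  have "(\<lambda>x. f' x + c * g' x) \<in> fcarrier (holder_space k \<alpha> U)"
    using holder_space_lincomb[OF assms(1) f'(1) g'(1)] .
  then show ?thesis unfolding holder_bdry_space_def
    by (simp, intro bexI[of _ "\<lambda>x. f' x + c * g' x"]) (auto simp: f' g')
qed

lemma fnorm_bdry_bdd_below:
  assumes U: "open U" "U \<noteq> {}"
  shows "bdd_below {fnorm (holder_space k \<alpha> U) f | f.
       f \<in> fcarrier (holder_space k \<alpha> U) \<and> (\<forall>x\<in>frontier U. f x = h x)}"
  by (rule bdd_belowI[of _ 0]) (auto intro: fnorm_holder_nonneg[OF U])

lemma fnorm_bdry_nonneg:
  assumes U: "open U" "U \<noteq> {}" and h: "h \<in> fcarrier (holder_bdry_space k \<alpha> U)"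
  shows "0 \<le> fnorm (holder_bdry_space k \<alpha> U) h"
  using h by (auto simp: holder_bdry_space_def intro!: cInf_greatest fnorm_holder_nonneg[OF U])

text \<open>Multiplying an extension of \<open>h\<close> by \<open>c\<close> gives an extension of
  \<open>c * h\<close>, so the bound passes to the infimum. The case \<open>c = 0\<close> is apart
  because the other one divides by \<open>\<bar>c\<bar>\<close>.\<close>

lemma fnorm_bdry_cmult_le:
  assumes U: "open U" "U \<noteq> {}" and h: "h \<in> fcarrier (holder_bdry_space k \<alpha> U)"
  shows "fnorm (holder_bdry_space k \<alpha> U) (\<lambda>x. c * h x) \<le> \<bar>c\<bar> * fnorm (holder_bdry_space k \<alpha> U) h"
proof -
  let ?S = "\<lambda>h. {fnorm (holder_space k \<alpha> U) f | f.
       f \<in> fcarrier (holder_space k \<alpha> U) \<and> (\<forall>x\<in>frontier U. f x = h x)}"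
  have eq: "fnorm (holder_bdry_space k \<alpha> U) h = Inf (?S h)" for h
    by (simp add: holder_bdry_space_def)
  have ne: "?S h \<noteq> {}" using h by (auto simp: holder_bdry_space_def)
  have le: "Inf (?S (\<lambda>x. c * h x)) \<le> \<bar>c\<bar> * y" if yS: "y \<in> ?S h" for y
  proof -
    obtain f where f: "f \<in> fcarrier (holder_space k \<alpha> U)" "\<forall>x\<in>frontier U. f x = h x"
      and y: "y = fnorm (holder_space k \<alpha> U) f" using yS by blast
    have "Inf (?S (\<lambda>x. c * h x)) \<le> fnorm (holder_space k \<alpha> U) (\<lambda>x. c * f x)"
      using holder_space_cmult[OF U(1) f(1), of c] f(2)
      by (intro cInf_lower fnorm_bdry_bdd_below[OF U]) auto
    also have "\<dots> \<le> \<bar>c\<bar> * y" unfolding y by (rule fnorm_holder_cmult_le[OF U f(1)])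
    finally show ?thesis .
  qed
  show ?thesis
  proof (cases "c = 0")
    case True
    then show ?thesis using le ne by (auto simp: eq)
  next
    case False
    then have "Inf (?S (\<lambda>x. c * h x)) / \<bar>c\<bar> \<le> Inf (?S h)"
      using le by (intro cInf_greatest[OF ne]) (auto simp: divide_le_eq mult.commute)
    then show ?thesis using False by (simp add: eq divide_le_eq mult.commute)
  qed
qed

text \<open>The window through which the Hoelder spaces are observed. The bound by
  \<open>fnorm\<close> makes such a functional vanish on functions of seminorm 0, so identities that
  hold only modulo the seminorm become equalities of real numbers.\<close>

definition bounded_functional :: "'a fspace \<Rightarrow> (('a \<Rightarrow> real) \<Rightarrow> real) \<Rightarrow> bool" where
  "bounded_functional Y ev \<longleftrightarrow>
     (\<forall>f\<in>fcarrier Y. \<forall>g\<in>fcarrier Y. \<forall>c. ev (\<lambda>x. f x + c * g x) = ev f + c * ev g) \<and>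
     (\<exists>K\<ge>0. \<forall>f\<in>fcarrier Y. \<bar>ev f\<bar> \<le> K * fnorm Y f)"

lemma bounded_functional_nderiv:
  assumes U: "open U" and x: "x \<in> U" and l: "length vs \<le> k"
  shows "bounded_functional (holder_space k \<alpha> U) (\<lambda>f. nderiv vs f x)"
  unfolding bounded_functional_def
proof (intro conjI ballI allI exI[of _ "\<Sum>bs\<in>mindex (length vs). \<bar>prod_list (map2 (\<bullet>) vs bs)\<bar>"])
  fix f g c assume "f \<in> fcarrier (holder_space k \<alpha> U)" "g \<in> fcarrier (holder_space k \<alpha> U)"
  then show "nderiv vs (\<lambda>x. f x + c * g x) x = nderiv vs f x + c * nderiv vs g x"
    by (intro nderiv_lincomb[OF U _ _ l x] holder_space_Ck_on)
next
  fix f assume f: "f \<in> fcarrier (holder_space k \<alpha> U)"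
  have ne: "U \<noteq> {}" using x by auto
  have "nderiv vs f x = (\<Sum>bs\<in>mindex (length vs). prod_list (map2 (\<bullet>) vs bs) * nderiv bs f x)"
    by (rule nderiv_expand[OF U holder_space_Ck_on[OF f] l x])
  also have "\<bar>\<dots>\<bar> \<le> (\<Sum>bs\<in>mindex (length vs). \<bar>prod_list (map2 (\<bullet>) vs bs)\<bar> * fnorm (holder_space k \<alpha> U) f)"
    by (intro order_trans[OF sum_abs] sum_mono)
       (auto simp: abs_mult intro!: mult_left_mono nderiv_le_fnorm[OF U ne f _ l x])
  finally show "\<bar>nderiv vs f x\<bar>
      \<le> (\<Sum>bs\<in>mindex (length vs). \<bar>prod_list (map2 (\<bullet>) vs bs)\<bar>) * fnorm (holder_space k \<alpha> U) f"
    by (simp add: sum_distrib_right)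
qed (auto intro: sum_nonneg)

text \<open>The norm bounds \<open>f\<close> on \<open>U\<close>; the set where
  \<open>\<bar>f y\<bar>\<close> stays below a constant is closed in the closure, so the bound
  extends to boundary points, where the Dirichlet data are read off.\<close>

lemma bounded_functional_closure:
  assumes U: "open U" "U \<noteq> {}" and x: "x \<in> closure U"
  shows "bounded_functional (holder_space k \<alpha> U) (\<lambda>f. f x)"
  unfolding bounded_functional_def
proof (intro conjI ballI allI exI[of _ 1])
  fix f assume f: "f \<in> fcarrier (holder_space k \<alpha> U)"
  have "closed {y \<in> closure U. \<bar>f y\<bar> \<le> fnorm (holder_space k \<alpha> U) f}"
    using holder_spaceD(1)[OF f]
    by (intro continuous_on_closed_Collect_le closed_closure continuous_intros) (simp add: Ck_closure_def)
  moreover have "U \<subseteq> {y \<in> closure U. \<bar>f y\<bar> \<le> fnorm (holder_space k \<alpha> U) f}"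
    using nderiv_le_fnorm[OF U f, of "[]" 0] closure_subset by auto
  ultimately have "closure U \<subseteq> {y \<in> closure U. \<bar>f y\<bar> \<le> fnorm (holder_space k \<alpha> U) f}"
    by (rule closure_minimal[rotated])
  then show "\<bar>f x\<bar> \<le> 1 * fnorm (holder_space k \<alpha> U) f" using x by auto
qed auto

section \<open>Expansions along lines and curves\<close>

text \<open>The mean value theorem in the role of integration; the factor \<open>1 / (k + 1)\<close>
  that an integral would gain is given away.\<close>

lemma peano_remainder_step:
  fixes R :: "real \<Rightarrow> real"
  assumes R0: "R 0 = 0" and \<tau>: "0 < \<tau>"
    and d: "\<And>t. \<bar>t\<bar> < \<tau> \<Longrightarrow> (R has_real_derivative R' t) (at t)"
    and b: "\<And>t. \<bar>t\<bar> < \<tau> \<Longrightarrow> \<bar>R' t\<bar> \<le> e * \<bar>t\<bar> ^ k" and t: "\<bar>t\<bar> < \<tau>" and e: "0 \<le> e"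
  shows "\<bar>R t\<bar> \<le> e * \<bar>t\<bar> ^ Suc k"
proof (cases "t = 0")
  case False
  have "\<exists>\<xi>. \<bar>\<xi>\<bar> \<le> \<bar>t\<bar> \<and> \<bar>R t\<bar> = \<bar>t\<bar> * \<bar>R' \<xi>\<bar>"
  proof (cases "t > 0")
    case True
    then have "\<exists>\<xi>. 0 < \<xi> \<and> \<xi> < t \<and> R t - R 0 = (t - 0) * R' \<xi>"
      using d t by (intro MVT2) auto
    then obtain \<xi> where "0 < \<xi>" "\<xi> < t" "R t = t * R' \<xi>" using R0 by auto
    then show ?thesis by (intro exI[of _ \<xi>]) (auto simp: abs_mult)
  next
    case neg: False
    then have "\<exists>\<xi>. t < \<xi> \<and> \<xi> < 0 \<and> R 0 - R t = (0 - t) * R' \<xi>"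
      using d t False by (intro MVT2) auto
    then obtain \<xi> where "t < \<xi>" "\<xi> < 0" "R t = t * R' \<xi>" using R0 by auto
    then show ?thesis by (intro exI[of _ \<xi>]) (auto simp: abs_mult)
  qed
  then obtain \<xi> where xi: "\<bar>\<xi>\<bar> \<le> \<bar>t\<bar>" "\<bar>R t\<bar> = \<bar>t\<bar> * \<bar>R' \<xi>\<bar>" by blast
  have "\<bar>R' \<xi>\<bar> \<le> e * \<bar>\<xi>\<bar> ^ k" using b xi t by auto
  also have "\<dots> \<le> e * \<bar>t\<bar> ^ k" using xi e by (intro mult_left_mono power_mono) auto
  finally have "\<bar>t\<bar> * \<bar>R' \<xi>\<bar> \<le> \<bar>t\<bar> * (e * \<bar>t\<bar> ^ k)" by (intro mult_left_mono) auto
  then show ?thesis using xi by (simp add: mult.left_commute)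
qed (use R0 e in simp)

text \<open>Peano's form of the remainder: the top member \<open>g (Suc k)\<close> is never assumed
  continuous. The base case is the definition of the derivative at 0; the step applies the induction
  hypothesis to the shifted family and integrates its remainder.\<close>

lemma taylor_peano:
  fixes g :: "nat \<Rightarrow> real \<Rightarrow> real"
  assumes "0 < \<tau>" "\<And>r t. r \<le> k \<Longrightarrow> \<bar>t\<bar> < \<tau> \<Longrightarrow> (g r has_real_derivative g (Suc r) t) (at t)" "0 < e"
  shows "\<exists>d>0. \<forall>t. \<bar>t\<bar> < d \<longrightarrow> \<bar>g 0 t - (\<Sum>r\<le>Suc k. g r 0 / fact r * t ^ r)\<bar> \<le> e * \<bar>t\<bar> ^ Suc k"
  using assms
proof (induction k arbitrary: g)
  case 0
  have "(g 0 has_real_derivative g 1 0) (at 0)" using 0 by simp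
  then have "((\<lambda>h. (g 0 h - g 0 0) / h) \<longlongrightarrow> g 1 0) (at 0)" by (simp add: DERIV_def)
  then obtain d where d: "d > 0" "\<And>t. t \<noteq> 0 \<Longrightarrow> \<bar>t\<bar> < d \<Longrightarrow> \<bar>(g 0 t - g 0 0) / t - g 1 0\<bar> < e"
    using 0(3) unfolding LIM_eq by auto
  have "\<bar>g 0 t - (\<Sum>r\<le>Suc 0. g r 0 / fact r * t ^ r)\<bar> \<le> e * \<bar>t\<bar> ^ Suc 0" if t: "\<bar>t\<bar> < d" for t
  proof (cases "t = 0")
    case False
    have "g 0 t - (\<Sum>r\<le>Suc 0. g r 0 / fact r * t ^ r) = t * ((g 0 t - g 0 0) / t - g 1 0)"
      using False by (simp add: field_simps)
    also have "\<bar>\<dots>\<bar> \<le> \<bar>t\<bar> * e" unfolding abs_mult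
      using d(2)[OF False t] by (intro mult_left_mono) auto
    finally show ?thesis by (simp add: mult.commute)
  qed simp
  then show ?case using d(1) by blast
next
  case (Suc k)
  obtain d where d: "d > 0" "\<And>t. \<bar>t\<bar> < d \<Longrightarrow>
      \<bar>g (Suc 0) t - (\<Sum>r\<le>Suc k. g (Suc r) 0 / fact r * t ^ r)\<bar> \<le> e * \<bar>t\<bar> ^ Suc k"
    using Suc.IH[of "\<lambda>r. g (Suc r)"] Suc.prems by auto
  let ?R = "\<lambda>t. g 0 t - (\<Sum>r\<le>Suc (Suc k). g r 0 / fact r * t ^ r)"
  let ?R' = "\<lambda>t. g (Suc 0) t - (\<Sum>r\<le>Suc k. g (Suc r) 0 / fact r * t ^ r)"
  have deriv: "(?R has_real_derivative ?R' t) (at t)" if "\<bar>t\<bar> < \<tau>" for t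
  proof -
    have "((\<lambda>t. \<Sum>r\<le>Suc (Suc k). g r 0 / fact r * t ^ r) has_real_derivative
        (\<Sum>r\<le>Suc (Suc k). g r 0 / fact r * (real r * t ^ (r - Suc 0)))) (at t)"
      by (intro DERIV_sum DERIV_cmult DERIV_pow)
    moreover have "(\<Sum>r\<le>Suc (Suc k). g r 0 / fact r * (real r * t ^ (r - Suc 0)))
        = (\<Sum>r\<le>Suc k. g (Suc r) 0 / fact r * t ^ r)"
    proof -
      have "g (Suc r) 0 / fact (Suc r) * (real (Suc r) * t ^ (Suc r - Suc 0)) = g (Suc r) 0 / fact r * t ^ r" for r
        by (simp add: fact_Suc del: of_nat_Suc)
      then show ?thesis by (subst sum.atMost_Suc_shift) (simp del: sum.atMost_Suc of_nat_Suc)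
    qed
    moreover have "(g 0 has_real_derivative g (Suc 0) t) (at t)" using Suc.prems that by simp
    ultimately show ?thesis by (simp only: DERIV_diff)
  qed
  have "\<bar>?R t\<bar> \<le> e * \<bar>t\<bar> ^ Suc (Suc k)" if "\<bar>t\<bar> < min d \<tau>" for t
  proof (rule peano_remainder_step[where R' = ?R'])
    show "?R 0 = 0" by (subst sum.atMost_Suc_shift) simp
    show "0 < min d \<tau>" "0 \<le> e" "\<bar>t\<bar> < min d \<tau>" using that d(1) Suc.prems(1,3) by auto
    show "(?R has_real_derivative ?R' t) (at t)" if "\<bar>t\<bar> < min d \<tau>" for t
      using that by (intro deriv) simp
    show "\<bar>?R' t\<bar> \<le> e * \<bar>t\<bar> ^ Suc k" if "\<bar>t\<bar> < min d \<tau>" for t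
      using that by (intro d(2)) simp
  qed
  moreover have "0 < min d \<tau>" using d(1) Suc.prems(1) by simp
  ultimately show ?case by (intro exI[of _ "min d \<tau>"] conjI allI impI)
qed

section \<open>Restricting a Frechet differentiable map to a line\<close>

lemma quotient_error_less:
  fixes s :: real
  assumes "s \<noteq> 0" "\<bar>a - b - s * c\<bar> < \<bar>s\<bar> * e"
  shows "\<bar>(a - b) / s - c\<bar> < e"
proof -
  have "(a - b) / s - c = (a - b - s * c) / s" using assms(1) by (simp add: field_simps)
  then show ?thesis using assms by (simp add: abs_divide divide_less_eq mult.commute)
qed

text \<open>Fixes one direction \<open>h\<close> and one functional \<open>ev\<close>, so that C^N
  regularity in operator norms turns into differentiability of real functions of \<open>t\<close>.
  Since \<open>fspace\<close> is a bare record, the vector space and norm facts that are used appear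
  as assumptions.\<close>

locale frechet_line =
  fixes N :: nat and X :: "'a fspace" and Y :: "'b fspace" and \<phi> h :: "'a \<Rightarrow> real"
    and S :: "('a \<Rightarrow> real) \<Rightarrow> 'b \<Rightarrow> real" and D and ev :: "('b \<Rightarrow> real) \<Rightarrow> real"
  assumes fd: "has_frechet_derivs N X Y \<phi> S D"
    and Xlin: "\<And>f g c. f \<in> fcarrier X \<Longrightarrow> g \<in> fcarrier X \<Longrightarrow> (\<lambda>x. f x + c * g x) \<in> fcarrier X"
    and Xnonneg: "\<And>f. f \<in> fcarrier X \<Longrightarrow> 0 \<le> fnorm X f"
    and Xscale: "\<And>f c. f \<in> fcarrier X \<Longrightarrow> fnorm X (\<lambda>x. c * f x) \<le> \<bar>c\<bar> * fnorm X f"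
    and Ylin: "\<And>f g c. f \<in> fcarrier Y \<Longrightarrow> g \<in> fcarrier Y \<Longrightarrow> (\<lambda>x. f x + c * g x) \<in> fcarrier Y"
    and phi: "\<phi> \<in> fcarrier X" and h: "h \<in> fcarrier X"
    and ev: "bounded_functional Y ev"
begin

definition \<eta> :: "real \<Rightarrow> 'a \<Rightarrow> real" where "\<eta> t = (\<lambda>x. \<phi> x + t * h x)"

lemma X_scaled: "(\<lambda>x. c * h x) \<in> fcarrier X"
  using Xlin[OF h h, of "c - 1"] by (simp add: algebra_simps)

lemma X_eta: "\<eta> t \<in> fcarrier X"
  unfolding \<eta>_def by (rule Xlin[OF phi h])

lemma eta_near:
  assumes "0 < \<rho>"
  shows "\<exists>\<tau>>0. \<forall>t. \<bar>t\<bar> < \<tau> \<longrightarrow> fnorm X (\<lambda>x. t * h x) < \<rho>"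
proof -
  have B: "0 \<le> fnorm X h" by (rule Xnonneg[OF h])
  have "fnorm X (\<lambda>x. t * h x) < \<rho>" if "\<bar>t\<bar> < \<rho> / (fnorm X h + 1)" for t
  proof -
    have "fnorm X (\<lambda>x. t * h x) \<le> \<bar>t\<bar> * fnorm X h" by (rule Xscale[OF h])
    also have "\<dots> \<le> \<bar>t\<bar> * (fnorm X h + 1)" by (intro mult_left_mono) auto
    also have "\<dots> < \<rho>" using that B by (simp add: less_divide_eq)
    finally show ?thesis .
  qed
  then show ?thesis using assms B by (intro exI[of _ "\<rho> / (fnorm X h + 1)"]) auto
qed

lemma prod_list_replicate_norm: "prod_list (map (fnorm X) (replicate r h)) = fnorm X h ^ r"
  by (induction r) auto

lemma ev_lin: "f \<in> fcarrier Y \<Longrightarrow> g \<in> fcarrier Y \<Longrightarrow> ev (\<lambda>x. f x + c * g x) = ev f + c * ev g"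
  using ev by (auto simp: bounded_functional_def)

lemma ev_diff: "f \<in> fcarrier Y \<Longrightarrow> g \<in> fcarrier Y \<Longrightarrow> ev (\<lambda>x. f x - g x) = ev f - ev g"
  using ev_lin[of f g "-1"] by simp

lemma Y_diff: "f \<in> fcarrier Y \<Longrightarrow> g \<in> fcarrier Y \<Longrightarrow> (\<lambda>x. f x - g x) \<in> fcarrier Y"
  using Ylin[of f g "-1"] by simp

lemma ev_zero:
  assumes "f \<in> fcarrier Y" "fnorm Y f = 0" shows "ev f = 0"
  using ev assms by (auto simp: bounded_functional_def)

text \<open>The differentiability clause of \<open>has_frechet_derivs\<close>, taken with increment
  \<open>s * h\<close> and arguments \<open>replicate r h\<close>, pushed through \<open>ev\<close>
  and divided by \<open>s\<close>. The radius \<open>\<tau>\<close> keeps the line inside the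
  neighbourhood where that clause holds.\<close>

lemma has_derivative_along:
  "\<exists>\<tau>>0. (\<forall>t. \<bar>t\<bar> < \<tau> \<longrightarrow> ev (D 0 (\<eta> t) []) = ev (S (\<eta> t))) \<and>
    (\<forall>r t. r < N \<longrightarrow> \<bar>t\<bar> < \<tau> \<longrightarrow> ((\<lambda>t. ev (D r (\<eta> t) (replicate r h))) has_real_derivative
        ev (D (Suc r) (\<eta> t) (replicate (Suc r) h))) (at t))"
proof -
  obtain \<rho> where rho: "\<rho> > 0" "\<forall>\<eta>\<in>fcarrier X. fnorm X (\<lambda>x. \<eta> x - \<phi> x) < \<rho> \<longrightarrow>
        S \<eta> \<in> fcarrier Y \<and> fnorm Y (\<lambda>y. D 0 \<eta> [] y - S \<eta> y) = 0 \<and>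
        (\<forall>r\<le>N. bounded_multilinear X Y r (D r \<eta>)) \<and>
        (\<forall>r<N. \<forall>\<epsilon>>0. \<exists>d>0. \<forall>h\<in>fcarrier X. fnorm X h < d \<longrightarrow>
           (\<forall>hs. set hs \<subseteq> fcarrier X \<and> length hs = r \<longrightarrow>
              fnorm Y (\<lambda>y. D r (\<lambda>x. \<eta> x + h x) hs y - D r \<eta> hs y - D (Suc r) \<eta> (h # hs) y)
                \<le> \<epsilon> * fnorm X h * prod_list (map (fnorm X) hs))) \<and>
        (\<forall>\<epsilon>>0. \<exists>d>0. \<forall>h\<in>fcarrier X. fnorm X h < d \<longrightarrow>
           (\<forall>hs. set hs \<subseteq> fcarrier X \<and> length hs = N \<longrightarrow>
              fnorm Y (\<lambda>y. D N (\<lambda>x. \<eta> x + h x) hs y - D N \<eta> hs y) \<le> \<epsilon> * prod_list (map (fnorm X) hs)))"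
    using fd unfolding has_frechet_derivs_def by (elim exE conjE) (rule that)
  obtain \<tau> where tau1: "0 < \<tau>" "\<forall>t. \<bar>t\<bar> < \<tau> \<longrightarrow> fnorm X (\<lambda>x. t * h x) < \<rho>"
    using eta_near[OF rho(1)] by blast
  have tau: "fnorm X (\<lambda>x. \<eta> t x - \<phi> x) < \<rho>" if "\<bar>t\<bar> < \<tau>" for t
    using tau1(2) that by (simp add: \<eta>_def)
  note near = bspec[OF rho(2) X_eta, THEN mp, OF tau]
  note near1 = near[THEN conjunct1] and near2 = near[THEN conjunct2, THEN conjunct1]
    and near3 = near[THEN conjunct2, THEN conjunct2, THEN conjunct1, rule_format]
    and near4 = near[THEN conjunct2, THEN conjunct2, THEN conjunct2, THEN conjunct1, rule_format]
  have Dcar: "D r (\<eta> t) hs \<in> fcarrier Y"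
    if "\<bar>t\<bar> < \<tau>" "r \<le> N" "set hs \<subseteq> fcarrier X" "length hs = r" for r t hs
  proof -
    have "\<forall>hs. set hs \<subseteq> fcarrier X \<and> length hs = r \<longrightarrow> D r (\<eta> t) hs \<in> fcarrier Y"
      using near3[OF that(1,2)] unfolding bounded_multilinear_def by (elim conjE)
    then show ?thesis using that(3,4) by simp
  qed
  have rep: "set (replicate r h) \<subseteq> fcarrier X" for r using h by auto
  \<comment> \<open>Linearity in the first slot is available only for \<open>h + c * h'\<close> and
    only up to seminorm 0. Homogeneity is its instance \<open>h' = h\<close>,
    \<open>c = s - 1\<close>, read through \<open>ev\<close>.\<close>
  have Dscale: "ev (D (Suc r) (\<eta> t) ((\<lambda>x. s * h x) # replicate r h)) = s * ev (D (Suc r) (\<eta> t) (replicate (Suc r) h))"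
    if "\<bar>t\<bar> < \<tau>" "r < N" for r t s
  proof -
    let ?T = "D (Suc r) (\<eta> t)"
    have lin: "\<forall>hs i. set hs \<subseteq> fcarrier X \<and> length hs = Suc r \<and> i < Suc r \<longrightarrow>
        (\<forall>h\<in>fcarrier X. \<forall>h'\<in>fcarrier X. \<forall>c.
           fnorm Y (\<lambda>y. ?T (hs[i := (\<lambda>x. h x + c * h' x)]) y - (?T (hs[i := h]) y + c * ?T (hs[i := h']) y)) = 0)"
      using near3[OF that(1) Suc_leI[OF that(2)]] unfolding bounded_multilinear_def by (elim conjE)
    have Tc: "?T (g # replicate r h) \<in> fcarrier Y" if "g \<in> fcarrier X" for g
      using that rep \<open>r < N\<close> by (intro Dcar[OF \<open>\<bar>t\<bar> < \<tau>\<close>]) auto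
    have z: "fnorm Y (\<lambda>y. ?T ((\<lambda>x. h x + (s - 1) * h x) # replicate r h) y
        - (?T (h # replicate r h) y + (s - 1) * ?T (h # replicate r h) y)) = 0"
      using lin[rule_format, of "h # replicate r h" 0 h h "s - 1"] h rep by simp
    have e: "(\<lambda>x. h x + (s - 1) * h x) = (\<lambda>x. s * h x)" by (simp add: algebra_simps)
    have "ev (\<lambda>y. ?T ((\<lambda>x. s * h x) # replicate r h) y
        - (?T (h # replicate r h) y + (s - 1) * ?T (h # replicate r h) y)) = 0"
      using z unfolding e by (intro ev_zero Y_diff Ylin Tc X_scaled h)
    then have "ev (?T ((\<lambda>x. s * h x) # replicate r h))
        = ev (?T (h # replicate r h)) + (s - 1) * ev (?T (h # replicate r h))"
      by (simp add: ev_diff ev_lin Ylin Tc X_scaled h)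
    then show ?thesis by (simp add: algebra_simps)
  qed
  obtain K where K: "K \<ge> 0" "\<And>f. f \<in> fcarrier Y \<Longrightarrow> \<bar>ev f\<bar> \<le> K * fnorm Y f"
    using ev by (auto simp: bounded_functional_def)
  have deriv: "((\<lambda>t. ev (D r (\<eta> t) (replicate r h))) has_real_derivative
        ev (D (Suc r) (\<eta> t) (replicate (Suc r) h))) (at t)" if r: "r < N" and t: "\<bar>t\<bar> < \<tau>" for r t
    unfolding DERIV_def LIM_eq
  proof (intro allI impI)
    let ?g = "\<lambda>t. ev (D r (\<eta> t) (replicate r h))" and ?g' = "ev (D (Suc r) (\<eta> t) (replicate (Suc r) h))"
    fix e :: real assume e: "0 < e"
    let ?B = "fnorm X h"
    have B: "0 \<le> ?B" by (rule Xnonneg[OF h])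
    \<comment> \<open>\<open>K\<close> times the norm of \<open>h\<close> to the power
      \<open>r + 1\<close> is the factor lost in passing from the operator norm to
      \<open>ev\<close>; adding 1 makes it positive, so \<open>\<epsilon>\<close> can be
      \<open>e / (2 * c)\<close>. The factor 2 leaves room for a strict inequality.\<close>
    define c where "c = K * (?B * ?B ^ r) + 1"
    have pos: "c > 0" unfolding c_def using K(1) B by (intro add_nonneg_pos mult_nonneg_nonneg) auto
    define \<epsilon> where "\<epsilon> = e / (2 * c)"
    have \<epsilon>: "\<epsilon> > 0" using e pos by (simp add: \<epsilon>_def)
    obtain d where d: "d > 0" "\<And>k hs. k \<in> fcarrier X \<Longrightarrow> fnorm X k < d \<Longrightarrow> set hs \<subseteq> fcarrier X \<Longrightarrow> length hs = r \<Longrightarrow>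
        fnorm Y (\<lambda>y. D r (\<lambda>x. \<eta> t x + k x) hs y - D r (\<eta> t) hs y - D (Suc r) (\<eta> t) (k # hs) y)
                \<le> \<epsilon> * fnorm X k * prod_list (map (fnorm X) hs)"
      using near4[OF t r \<epsilon>] by blast
    obtain \<sigma> where sig: "0 < \<sigma>" "\<forall>s. \<bar>s\<bar> < \<sigma> \<longrightarrow> fnorm X (\<lambda>x. s * h x) < d"
      using eta_near[OF d(1)] by blast
    show "\<exists>s>0. \<forall>x. x \<noteq> 0 \<and> norm (x - 0) < s \<longrightarrow> norm ((?g (t + x) - ?g t) / x - ?g') < e"
    proof (intro exI[of _ "min \<sigma> (\<tau> - \<bar>t\<bar>)"] conjI allI impI)
      show "0 < min \<sigma> (\<tau> - \<bar>t\<bar>)" using sig t by auto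
      fix s :: real assume "s \<noteq> 0 \<and> norm (s - 0) < min \<sigma> (\<tau> - \<bar>t\<bar>)"
      then have s: "s \<noteq> 0" "\<bar>s\<bar> < \<sigma>" "\<bar>t + s\<bar> < \<tau>" by auto
      have eqs: "(\<lambda>x. \<eta> t x + s * h x) = \<eta> (t + s)" by (simp add: \<eta>_def fun_eq_iff algebra_simps)
      let ?F = "\<lambda>y. D r (\<eta> (t + s)) (replicate r h) y - D r (\<eta> t) (replicate r h) y
          - D (Suc r) (\<eta> t) ((\<lambda>x. s * h x) # replicate r h) y"
      have c1: "D r (\<eta> (t + s)) (replicate r h) \<in> fcarrier Y" "D r (\<eta> t) (replicate r h) \<in> fcarrier Y"
        using Dcar[OF s(3), of r] Dcar[OF t, of r] rep r by auto
      have c2: "D (Suc r) (\<eta> t) ((\<lambda>x. s * h x) # replicate r h) \<in> fcarrier Y"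
        using rep r X_scaled by (intro Dcar[OF t]) auto
      have "fnorm Y ?F \<le> \<epsilon> * fnorm X (\<lambda>x. s * h x) * ?B ^ r"
        using d(2)[OF X_scaled sig(2)[rule_format, OF s(2)] rep, of r] unfolding eqs prod_list_replicate_norm by simp
      also have "\<dots> \<le> \<epsilon> * (\<bar>s\<bar> * ?B) * ?B ^ r"
        using \<epsilon> B Xscale[OF h] by (intro mult_right_mono mult_left_mono) auto
      finally have F: "fnorm Y ?F \<le> \<epsilon> * (\<bar>s\<bar> * ?B) * ?B ^ r" .
      have "\<bar>ev ?F\<bar> \<le> K * fnorm Y ?F"
        by (intro K(2) Y_diff c1 c2)
      also have "\<dots> \<le> K * (\<epsilon> * (\<bar>s\<bar> * ?B) * ?B ^ r)" by (intro mult_left_mono F K(1))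
      also have "\<dots> = \<bar>s\<bar> * (\<epsilon> * (K * (?B * ?B ^ r)))" by (simp add: ac_simps)
      also have "\<dots> \<le> \<bar>s\<bar> * (\<epsilon> * c)" unfolding c_def using \<epsilon> by (intro mult_left_mono) auto
      also have "\<dots> = \<bar>s\<bar> * (e / 2)" using pos by (simp add: \<epsilon>_def)
      finally have "\<bar>ev ?F\<bar> \<le> \<bar>s\<bar> * (e / 2)" .
      moreover have "\<bar>s\<bar> * (e / 2) < \<bar>s\<bar> * e" using s(1) e by (intro mult_strict_left_mono) auto
      moreover have "ev ?F = ?g (t + s) - ?g t - s * ?g'"
        unfolding ev_diff[OF Y_diff[OF c1] c2] ev_diff[OF c1] Dscale[OF t r] ..
      ultimately have "\<bar>?g (t + s) - ?g t - s * ?g'\<bar> < \<bar>s\<bar> * e" by linarith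
      from quotient_error_less[OF s(1) this] show "norm ((?g (t + s) - ?g t) / s - ?g') < e"
        by (simp only: real_norm_def)
    qed
  qed
  have "ev (D 0 (\<eta> t) []) = ev (S (\<eta> t))" if "\<bar>t\<bar> < \<tau>" for t
  proof -
    have c: "S (\<eta> t) \<in> fcarrier Y" "D 0 (\<eta> t) [] \<in> fcarrier Y" using near1[OF that] Dcar[OF that, of 0 "[]"] by auto
    have "ev (\<lambda>y. D 0 (\<eta> t) [] y - S (\<eta> t) y) = 0" by (intro ev_zero Y_diff c near2[OF that])
    then show ?thesis using c by (simp add: ev_diff)
  qed
  then show ?thesis using tau1(1) deriv by (intro exI[of _ \<tau>] conjI allI impI)
qed

lemma taylor_along:
  assumes r: "1 \<le> r" "r \<le> N" and e: "0 < e"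
  shows "\<exists>d>0. \<forall>t. \<bar>t\<bar> < d \<longrightarrow>
    \<bar>ev (S (\<eta> t)) - (\<Sum>i\<le>r. ev (D i \<phi> (replicate i h)) / fact i * t ^ i)\<bar> \<le> e * \<bar>t\<bar> ^ r"
proof -
  obtain \<tau> where tau: "0 < \<tau>"
    "\<forall>t. \<bar>t\<bar> < \<tau> \<longrightarrow> ev (D 0 (\<eta> t) []) = ev (S (\<eta> t))"
    "\<forall>r t. r < N \<longrightarrow> \<bar>t\<bar> < \<tau> \<longrightarrow> ((\<lambda>t. ev (D r (\<eta> t) (replicate r h))) has_real_derivative
        ev (D (Suc r) (\<eta> t) (replicate (Suc r) h))) (at t)"
    using has_derivative_along by (elim exE conjE) (rule that)
  obtain k where k: "r = Suc k" using r by (cases r) auto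
  have e0: "\<eta> 0 = \<phi>" by (simp add: \<eta>_def)
  have "\<exists>d>0. \<forall>t. \<bar>t\<bar> < d \<longrightarrow> \<bar>ev (D 0 (\<eta> t) (replicate 0 h))
      - (\<Sum>i\<le>Suc k. ev (D i (\<eta> 0) (replicate i h)) / fact i * t ^ i)\<bar> \<le> e * \<bar>t\<bar> ^ Suc k"
    by (rule taylor_peano[OF tau(1) _ e, of k "\<lambda>r t. ev (D r (\<eta> t) (replicate r h))"])
       (rule tau(3)[rule_format], use r k in auto)
  then obtain d where d: "d > 0" "\<forall>t. \<bar>t\<bar> < d \<longrightarrow>
     \<bar>ev (D 0 (\<eta> t) []) - (\<Sum>i\<le>r. ev (D i \<phi> (replicate i h)) / fact i * t ^ i)\<bar> \<le> e * \<bar>t\<bar> ^ r"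
    unfolding k e0 by (auto simp only: replicate_0)
  show ?thesis
  proof (intro exI[of _ "min d \<tau>"] conjI allI impI)
    show "0 < min d \<tau>" using d(1) tau(1) by simp
    fix t assume "\<bar>t\<bar> < min d \<tau>"
    then have t: "\<bar>t\<bar> < d" "\<bar>t\<bar> < \<tau>" by auto
    show "\<bar>ev (S (\<eta> t)) - (\<Sum>i\<le>r. ev (D i \<phi> (replicate i h)) / fact i * t ^ i)\<bar> \<le> e * \<bar>t\<bar> ^ r"
      using d(2)[rule_format, OF t(1)] unfolding tau(2)[rule_format, OF t(2)] .
  qed
qed

end

lemma quotient_tendstoI:
  fixes u :: "real \<Rightarrow> real"
  assumes "\<And>e. 0 < e \<Longrightarrow> \<exists>d>0. \<forall>t. \<bar>t\<bar> < d \<longrightarrow> \<bar>u t - c * t ^ r\<bar> \<le> e * \<bar>t\<bar> ^ r"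
  shows "((\<lambda>t. u t / t ^ r) \<longlongrightarrow> c) (at 0)"
  unfolding LIM_eq
proof (intro allI impI)
  fix e :: real assume e: "0 < e"
  obtain d where d: "d > 0" "\<And>t. \<bar>t\<bar> < d \<Longrightarrow> \<bar>u t - c * t ^ r\<bar> \<le> e / 2 * \<bar>t\<bar> ^ r"
    using assms[of "e / 2"] e by auto
  have "norm (u t / t ^ r - c) < e" if t: "t \<noteq> 0" "norm (t - 0) < d" for t
  proof -
    have "u t / t ^ r - c = (u t - c * t ^ r) / t ^ r" using t by (simp add: field_simps)
    also have "\<bar>\<dots>\<bar> \<le> e / 2" using d(2)[of t] t by (simp add: abs_divide power_abs divide_le_eq)
    finally show ?thesis using e by simp
  qed
  then show "\<exists>s>0. \<forall>x. x \<noteq> 0 \<and> norm (x - 0) < s \<longrightarrow> norm (u x / x ^ r - c) < e" using d(1) by blast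
qed

text \<open>Both families have Taylor polynomials of degree \<open>r\<close>; those agree below
  degree \<open>r\<close>, so in the difference only the top coefficients survive. This is how
  equality of lower variations is exploited at every order.\<close>

lemma frechet_difference_quotient:
  assumes 1: "frechet_line N X Y \<phi> h S1 D1 ev" and 2: "frechet_line N X Y \<phi> h S2 D2 ev"
    and r: "1 \<le> r" "r \<le> N"
    and agree: "\<And>i. i < r \<Longrightarrow> ev (D1 i \<phi> (replicate i h)) = ev (D2 i \<phi> (replicate i h))"
  shows "((\<lambda>t. (ev (S1 (\<lambda>x. \<phi> x + t * h x)) - ev (S2 (\<lambda>x. \<phi> x + t * h x))) / t ^ r)
     \<longlongrightarrow> (ev (D1 r \<phi> (replicate r h)) - ev (D2 r \<phi> (replicate r h))) / fact r) (at 0)"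
proof (rule quotient_tendstoI)
  fix e :: real assume "0 < e"
  then have e: "0 < e / 2" by simp
  let ?u1 = "\<lambda>t. ev (S1 (\<lambda>x. \<phi> x + t * h x))" and ?u2 = "\<lambda>t. ev (S2 (\<lambda>x. \<phi> x + t * h x))"
  let ?c1 = "\<lambda>i. ev (D1 i \<phi> (replicate i h)) / fact i" and ?c2 = "\<lambda>i. ev (D2 i \<phi> (replicate i h)) / fact i"
  have eta: "frechet_line.\<eta> \<phi> h t = (\<lambda>x. \<phi> x + t * h x)" for t
    using frechet_line.\<eta>_def[OF 1] by simp
  obtain d1 where d1: "d1 > 0" "\<And>t. \<bar>t\<bar> < d1 \<Longrightarrow> \<bar>?u1 t - (\<Sum>i\<le>r. ?c1 i * t ^ i)\<bar> \<le> e / 2 * \<bar>t\<bar> ^ r"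
    using frechet_line.taylor_along[OF 1 r e] unfolding eta by auto
  obtain d2 where d2: "d2 > 0" "\<And>t. \<bar>t\<bar> < d2 \<Longrightarrow> \<bar>?u2 t - (\<Sum>i\<le>r. ?c2 i * t ^ i)\<bar> \<le> e / 2 * \<bar>t\<bar> ^ r"
    using frechet_line.taylor_along[OF 2 r e] unfolding eta by auto
  have "\<bar>?u1 t - ?u2 t - (ev (D1 r \<phi> (replicate r h)) - ev (D2 r \<phi> (replicate r h))) / fact r * t ^ r\<bar> \<le> e * \<bar>t\<bar> ^ r"
    if t: "\<bar>t\<bar> < min d1 d2" for t
  proof -
    have split: "(\<Sum>i\<le>r. f i) = (\<Sum>i<r. f i) + f r" for f :: "nat \<Rightarrow> real"
      by (simp add: lessThan_Suc_atMost[symmetric])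
    have "(\<Sum>i<r. ?c1 i * t ^ i) = (\<Sum>i<r. ?c2 i * t ^ i)" using agree by simp
    then have "(\<Sum>i\<le>r. ?c1 i * t ^ i) - (\<Sum>i\<le>r. ?c2 i * t ^ i)
       = (ev (D1 r \<phi> (replicate r h)) - ev (D2 r \<phi> (replicate r h))) / fact r * t ^ r"
      by (simp add: split diff_divide_distrib left_diff_distrib)
    moreover have "\<bar>?u1 t - (\<Sum>i\<le>r. ?c1 i * t ^ i)\<bar> \<le> e / 2 * \<bar>t\<bar> ^ r" "\<bar>?u2 t - (\<Sum>i\<le>r. ?c2 i * t ^ i)\<bar> \<le> e / 2 * \<bar>t\<bar> ^ r"
      using d1(2)[of t] d2(2)[of t] t by auto
    ultimately show ?thesis by linarith
  qed
  then show "\<exists>d>0. \<forall>t. \<bar>t\<bar> < d \<longrightarrow> \<bar>?u1 t - ?u2 t -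
      (ev (D1 r \<phi> (replicate r h)) - ev (D2 r \<phi> (replicate r h))) / fact r * t ^ r\<bar> \<le> e * \<bar>t\<bar> ^ r"
    using d1(1) d2(1) by (intro exI[of _ "min d1 d2"]) auto
qed

lemma frechet_first_quotient:
  assumes 1: "frechet_line N X Y \<phi> h S D ev" and N: "1 \<le> N" and D0: "ev (D 0 \<phi> []) = c"
  shows "((\<lambda>t. (ev (S (\<lambda>x. \<phi> x + t * h x)) - c) / t) \<longlongrightarrow> ev (D 1 \<phi> [h])) (at 0)"
proof -
  have eta: "frechet_line.\<eta> \<phi> h t = (\<lambda>x. \<phi> x + t * h x)" for t
    using frechet_line.\<eta>_def[OF 1] by simp
  have "((\<lambda>t. (ev (S (\<lambda>x. \<phi> x + t * h x)) - c) / t ^ 1) \<longlongrightarrow> ev (D 1 \<phi> [h])) (at 0)"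
  proof (rule quotient_tendstoI)
    fix e :: real assume e: "0 < e"
    have "(\<Sum>i\<le>1. ev (D i \<phi> (replicate i h)) / fact i * t ^ i) = c + ev (D 1 \<phi> [h]) * t" for t
      using D0 by (simp add: atMost_Suc)
    then show "\<exists>d>0. \<forall>t. \<bar>t\<bar> < d \<longrightarrow>
        \<bar>ev (S (\<lambda>x. \<phi> x + t * h x)) - c - ev (D 1 \<phi> [h]) * t ^ 1\<bar> \<le> e * \<bar>t\<bar> ^ 1"
      using frechet_line.taylor_along[OF 1 order_refl N e] unfolding eta by (simp add: algebra_simps)
  qed
  then show ?thesis by simp
qed

section \<open>Difference quotients between two moving points\<close>

lemma tendsto_prod_list_inner:
  fixes e :: "real \<Rightarrow> 'a::euclidean_space"
  assumes "(e \<longlongrightarrow> y) F"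
  shows "((\<lambda>t. prod_list (map (\<lambda>b. e t \<bullet> b) bs)) \<longlongrightarrow> prod_list (map (\<lambda>b. y \<bullet> b) bs)) F"
  by (induction bs) (auto intro!: tendsto_intros assms)

lemma map2_replicate: "length bs = k \<Longrightarrow> map2 f (replicate k e) bs = map (f e) bs"
  by (induction bs arbitrary: k) auto

lemma mean_value_line:
  fixes F :: "'a::real_normed_vector \<Rightarrow> real"
  assumes "\<And>x. (F has_derivative F' x) (at x)"
  shows "\<exists>s. 0 < s \<and> s < 1 \<and> F y - F z = F' (z + s *\<^sub>R (y - z)) (y - z)"
proof -
  have "\<exists>s. 0 < s \<and> s < 1 \<and> F (z + 1 *\<^sub>R (y - z)) - F (z + 0 *\<^sub>R (y - z)) = (1 - 0) * F' (z + s *\<^sub>R (y - z)) (y - z)"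
  proof (rule MVT2)
    fix s :: real
    interpret bounded_linear "F' (z + s *\<^sub>R (y - z))" using assms by (rule has_derivative_bounded_linear)
    have "((\<lambda>s. F (z + s *\<^sub>R (y - z))) has_derivative (\<lambda>h. F' (z + s *\<^sub>R (y - z)) (h *\<^sub>R (y - z)))) (at s)"
      by (rule has_derivative_compose[OF _ assms]) (auto intro!: derivative_eq_intros)
    then show "((\<lambda>s. F (z + s *\<^sub>R (y - z))) has_real_derivative F' (z + s *\<^sub>R (y - z)) (y - z)) (at s)"
      by (simp add: has_field_derivative_def scaleR mult_commute_abs)
  qed simp
  then show ?thesis by simp
qed

text \<open>Meant for the intermediate points of the mean value theorem: the parameter
  \<open>s t\<close> may depend on \<open>t\<close> in any way, since only its boundedness
  matters.\<close>

lemma segment_tendsto: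
  fixes y z :: "real \<Rightarrow> 'a::real_normed_vector"
  assumes y: "(y \<longlongrightarrow> p) F" and z: "(z \<longlongrightarrow> p) F" and s: "\<And>t. 0 \<le> s t \<and> s t \<le> (1::real)"
  shows "((\<lambda>t. z t + s t *\<^sub>R (y t - z t)) \<longlongrightarrow> p) F"
proof -
  have "((\<lambda>t. y t - z t) \<longlongrightarrow> 0) F" using tendsto_diff[OF y z] by simp
  then have "((\<lambda>t. s t *\<^sub>R (y t - z t)) \<longlongrightarrow> 0) F"
  proof (rule Lim_null_comparison[rotated, OF tendsto_norm_zero])
    show "\<forall>\<^sub>F t in F. norm (s t *\<^sub>R (y t - z t)) \<le> norm (y t - z t)"
      using s by (auto intro!: always_eventually mult_left_le_one_le)
  qed
  from tendsto_add[OF z this] show ?thesis by simp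
qed

text \<open>Strict differentiability: both arguments move, and neither is the limit point
  \<open>p\<close>. Hypothesis \<open>G'c\<close> states joint continuity of the derivative in base
  point and direction along curves, the form in which it is met for \<open>det\<close> and for
  smooth functions.\<close>

lemma strict_difference_quotient:
  fixes G :: "'a::euclidean_space \<Rightarrow> real" and y z :: "real \<Rightarrow> 'a"
  assumes G: "\<And>x. (G has_derivative G' x) (at x)"
    and G'c: "\<And>\<xi> w. (\<xi> \<longlongrightarrow> p) (at 0) \<Longrightarrow> (w \<longlongrightarrow> Z) (at 0) \<Longrightarrow> ((\<lambda>t. G' (\<xi> t) (w t)) \<longlongrightarrow> G' p Z) (at (0::real))"
    and y: "(y \<longlongrightarrow> p) (at 0)" and z: "(z \<longlongrightarrow> p) (at 0)"
    and q: "((\<lambda>t. (y t - z t) /\<^sub>R t ^ r) \<longlongrightarrow> Z) (at 0)"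
  shows "((\<lambda>t. (G (y t) - G (z t)) / t ^ r) \<longlongrightarrow> G' p Z) (at 0)"
proof -
  have "\<forall>t. \<exists>s. 0 < s \<and> s < 1 \<and> G (y t) - G (z t) = G' (z t + s *\<^sub>R (y t - z t)) (y t - z t)"
    using mean_value_line[OF G] by blast
  from choice[OF this] obtain s where s: "\<forall>t. 0 < s t \<and> s t < 1 \<and> G (y t) - G (z t) = G' (z t + s t *\<^sub>R (y t - z t)) (y t - z t)"
    by blast
  let ?\<xi> = "\<lambda>t. z t + s t *\<^sub>R (y t - z t)"
  have "(?\<xi> \<longlongrightarrow> p) (at 0)" using s by (intro segment_tendsto y z) (auto intro: less_imp_le)
  from G'c[OF this q] have "((\<lambda>t. G' (?\<xi> t) ((y t - z t) /\<^sub>R t ^ r)) \<longlongrightarrow> G' p Z) (at 0)" .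
  moreover have "G' (?\<xi> t) ((y t - z t) /\<^sub>R t ^ r) = (G (y t) - G (z t)) / t ^ r" for t
    using linear_scale[OF has_derivative_linear[OF G]] s
    by (simp add: divide_inverse_commute)
  ultimately show ?thesis by simp
qed

lemma smooth_difference_quotient:
  fixes a :: "'a::euclidean_space \<Rightarrow> real"
  assumes a: "Ck_on k UNIV a" "1 \<le> k"
    and y: "(y \<longlongrightarrow> p) (at 0)" and z: "(z \<longlongrightarrow> p) (at 0)"
    and q: "((\<lambda>t. (y t - z t) /\<^sub>R t ^ r) \<longlongrightarrow> Z) (at 0)"
  shows "((\<lambda>t. (a (y t) - a (z t)) / t ^ r) \<longlongrightarrow> nderiv [Z] a p) (at 0)"
proof (rule strict_difference_quotient[OF _ _ y z q, where G' = "\<lambda>x v. nderiv [v] a x"])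
  have d: "a differentiable (at x)" for x
    using Ck_on_differentiable[OF open_UNIV a(1), of "[]" x] a(2) by simp
  then show "(a has_derivative (\<lambda>v. nderiv [v] a x)) (at x)" for x
    by (simp add: frechet_derivative_works)
  fix \<xi> w :: "real \<Rightarrow> 'a" assume xi: "(\<xi> \<longlongrightarrow> p) (at 0)" and w: "(w \<longlongrightarrow> Z) (at 0)"
  have "isCont (nderiv [b] a) p" for b
    using Ck_on_continuous[OF open_UNIV a(1), of "[b]"] a(2) continuous_on_eq_continuous_at by force
  then have "((\<lambda>t. nderiv [b] a (\<xi> t)) \<longlongrightarrow> nderiv [b] a p) (at 0)" for b
    by (rule isCont_tendsto_compose[OF _ xi])
  then have lim: "((\<lambda>t. \<Sum>b\<in>Basis. (w t \<bullet> b) * nderiv [b] a (\<xi> t)) \<longlongrightarrow> (\<Sum>b\<in>Basis. (Z \<bullet> b) * nderiv [b] a p)) (at 0)"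
    by (intro tendsto_intros w)
  have eq: "nderiv [v] a x = (\<Sum>b\<in>Basis. (v \<bullet> b) * nderiv [b] a x)" for v x
    by (rule nderiv_Cons_expand) (simp add: d)
  have e1: "(\<lambda>t. nderiv [w t] a (\<xi> t)) = (\<lambda>t. \<Sum>b\<in>Basis. (w t \<bullet> b) * nderiv [b] a (\<xi> t))"
    by (rule ext) (rule eq)
  show "((\<lambda>t. nderiv [w t] a (\<xi> t)) \<longlongrightarrow> nderiv [Z] a p) (at 0)"
    unfolding e1 by (subst eq) (rule lim)
qed

text \<open>With all lower derivatives zero at \<open>p\<close>, Lagrange's remainder along the
  segment to \<open>z t\<close> is the whole value. Its \<open>k\<close> direction slots absorb
  \<open>t ^ k\<close> by homogeneity, and expansion in the basis separates the converging
  directions from the converging base point.\<close>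

lemma taylor_leading_term:
  fixes a :: "'a::euclidean_space \<Rightarrow> real"
  assumes a: "Ck_on k UNIV a" and k: "1 \<le> k"
    and z: "((\<lambda>t. (z t - p) /\<^sub>R t) \<longlongrightarrow> v) (at 0)" and zp: "(z \<longlongrightarrow> p) (at 0)"
    and low: "\<And>vs. length vs < k \<Longrightarrow> nderiv vs a p = 0"
  shows "((\<lambda>t. a (z t) / t ^ k) \<longlongrightarrow> nderiv (replicate k v) a p / fact k) (at 0)"
proof -
  have ex: "\<exists>s. 0 \<le> s \<and> s \<le> 1 \<and> a (p + e) = nderiv (replicate k e) a (p + s *\<^sub>R e) / fact k" for e
  proof -
    let ?g = "\<lambda>r s. nderiv (replicate r e) a (p + s *\<^sub>R e)"
    have "\<exists>t>0. t < 1 \<and> ?g 0 1 = (\<Sum>m<k. ?g m 0 / fact m * 1 ^ m) + ?g k t / fact k * 1 ^ k"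
    proof (rule Maclaurin)
      have "(?g m has_real_derivative nderiv [e] (nderiv (replicate m e) a) (p + t *\<^sub>R e)) (at t)" if "m < k" for m t
        using that by (intro has_real_derivative_along_line Ck_on_differentiable[OF open_UNIV a]) auto
      then show "\<forall>m t. m < k \<and> 0 \<le> t \<and> t \<le> 1 \<longrightarrow> (?g m has_real_derivative ?g (Suc m) t) (at t)"
        by simp
    qed (use k in auto)
    then obtain t where t: "t > 0" "t < 1" "?g 0 1 = (\<Sum>m<k. ?g m 0 / fact m * 1 ^ m) + ?g k t / fact k * 1 ^ k"
      by blast
    have "(\<Sum>m<k. ?g m 0 / fact m * 1 ^ m) = 0" using low by (intro sum.neutral) auto
    then show ?thesis using t by (intro exI[of _ t]) auto
  qed
  define e where "e t = z t - p" for t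
  have "\<forall>t. \<exists>s. 0 \<le> s \<and> s \<le> 1 \<and> a (z t) = nderiv (replicate k (e t)) a (p + s *\<^sub>R e t) / fact k"
    using ex[of "e _"] by (simp add: e_def)
  from choice[OF this] obtain s where s: "\<forall>t. 0 \<le> s t \<and> s t \<le> 1 \<and> a (z t) = nderiv (replicate k (e t)) a (p + s t *\<^sub>R e t) / fact k"
    by blast
  let ?\<xi> = "\<lambda>t. p + s t *\<^sub>R e t"
  have xi: "(?\<xi> \<longlongrightarrow> p) (at 0)" unfolding e_def
    using s by (intro segment_tendsto[of z p _ "\<lambda>_. p"] zp) auto
  have expand: "nderiv (replicate k w) a x = (\<Sum>bs\<in>mindex k. prod_list (map ((\<bullet>) w) bs) * nderiv bs a x)" for w x
  proof -
    have "nderiv (replicate k w) a x = (\<Sum>bs\<in>mindex k. prod_list (map2 (\<bullet>) (replicate k w) bs) * nderiv bs a x)"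
      using nderiv_expand[OF open_UNIV a, of "replicate k w" x] by simp
    also have "\<dots> = (\<Sum>bs\<in>mindex k. prod_list (map ((\<bullet>) w) bs) * nderiv bs a x)"
      by (intro sum.cong refl) (simp add: map2_replicate mindex_def)
    finally show ?thesis .
  qed
  have c0: "isCont (nderiv bs a) p" if "bs \<in> mindex k" for bs
    using Ck_on_continuous[OF open_UNIV a, of bs] that by (simp add: mindex_def continuous_on_eq_continuous_at)
  have c: "((\<lambda>t. nderiv bs a (?\<xi> t)) \<longlongrightarrow> nderiv bs a p) (at 0)" if "bs \<in> mindex k" for bs
    by (rule isCont_tendsto_compose[OF c0[OF that] xi])
  have "((\<lambda>t. (\<Sum>bs\<in>mindex k. prod_list (map ((\<bullet>) (e t /\<^sub>R t)) bs) * nderiv bs a (?\<xi> t)) / fact k)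
     \<longlongrightarrow> (\<Sum>bs\<in>mindex k. prod_list (map ((\<bullet>) v) bs) * nderiv bs a p) / fact k) (at 0)"
    using z unfolding e_def[symmetric]
    by (intro tendsto_divide tendsto_sum tendsto_mult tendsto_prod_list_inner tendsto_const c) auto
  then have lim: "((\<lambda>t. (\<Sum>bs\<in>mindex k. prod_list (map ((\<bullet>) (e t /\<^sub>R t)) bs) * nderiv bs a (?\<xi> t)) / fact k)
     \<longlongrightarrow> nderiv (replicate k v) a p / fact k) (at 0)" by (simp add: expand)
  have scale: "prod_list (map ((\<bullet>) (w /\<^sub>R t)) bs) = prod_list (map ((\<bullet>) w) bs) / t ^ length bs" for w :: 'a and t bs
    by (induction bs) (auto simp: field_simps)
  have "(\<Sum>bs\<in>mindex k. prod_list (map ((\<bullet>) (e t /\<^sub>R t)) bs) * nderiv bs a (?\<xi> t)) / fact k = a (z t) / t ^ k" for t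
  proof -
    have "(\<Sum>bs\<in>mindex k. prod_list (map ((\<bullet>) (e t /\<^sub>R t)) bs) * nderiv bs a (?\<xi> t))
      = nderiv (replicate k (e t)) a (?\<xi> t) / t ^ k"
      unfolding expand sum_divide_distrib by (intro sum.cong refl) (auto simp: scale mindex_def)
    then show ?thesis using s by simp
  qed
  with lim show ?thesis by simp
qed

section \<open>Uniqueness for the Dirichlet problem\<close>

lemma sum_Basis_vec:
  fixes f :: "real^'n \<Rightarrow> 'b::comm_monoid_add"
  shows "(\<Sum>b\<in>Basis. f b) = (\<Sum>i\<in>UNIV. f (axis i 1))"
proof -
  have B: "Basis = range (\<lambda>i::'n. axis i (1::real))" by (auto simp: Basis_vec_def)
  have "inj (\<lambda>i::'n. axis i (1::real))" by (auto simp: inj_on_def axis_eq_axis)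
  then show ?thesis unfolding B by (subst sum.reindex) (auto simp: o_def)
qed

lemma nderiv_grad:
  fixes u :: "real^'n \<Rightarrow> real"
  assumes "u differentiable (at x)" shows "nderiv [v] u x = grad u x \<bullet> v"
proof -
  have "nderiv [v] u x = (\<Sum>b\<in>Basis. (v \<bullet> b) * nderiv [b] u x)"
    by (rule nderiv_Cons_expand) (simp add: assms)
  also have "\<dots> = grad u x \<bullet> v"
    unfolding sum_Basis_vec inner_axis by (simp add: grad_def inner_vec_def mult.commute)
  finally show ?thesis .
qed

lemma nderiv_hess:
  fixes u :: "real^'n \<Rightarrow> real"
  assumes "open U" "Ck_on 2 U u" "x \<in> U" shows "nderiv [v, w] u x = v \<bullet> (hess u x *v w)"
proof -
  have "nderiv [v, w] u x = (\<Sum>bs\<in>mindex (length [v, w]). prod_list (map2 (\<bullet>) [v, w] bs) * nderiv bs u x)"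
    by (rule nderiv_expand[OF assms(1,2) _ assms(3)]) simp
  also have "\<dots> = (\<Sum>i\<in>UNIV. \<Sum>j\<in>UNIV. (v $ i * w $ j) * nderiv [axis i 1, axis j 1] u x)"
    by (simp add: sum_mindex_Suc sum_Basis_vec inner_axis del: nderiv.simps)
  also have "\<dots> = v \<bullet> (hess u x *v w)"
    by (simp add: hess_def inner_vec_def matrix_vector_mult_def sum_distrib_left ac_simps del: nderiv.simps)
  finally show ?thesis .
qed

lemma transpose_hess:
  fixes u :: "real^'n \<Rightarrow> real"
  assumes "open U" "Ck_on 2 U u" "x \<in> U" shows "transpose (hess u x) = hess u x"
  using nderiv_commute2[OF assms] by (simp add: hess_def transpose_def vec_eq_iff del: nderiv.simps)

text \<open>If \<open>D\<close> were positive, \<open>f'\<close> would be positive just to the right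
  of its zero at 0, and the mean value theorem would make \<open>f\<close> exceed its
  maximum.\<close>

lemma second_derivative_at_max:
  fixes f f' :: "real \<Rightarrow> real"
  assumes d: "0 < d" and f: "\<And>t. \<bar>t\<bar> < d \<Longrightarrow> (f has_real_derivative f' t) (at t)"
    and f': "(f' has_real_derivative D) (at 0)" and max: "\<And>t. \<bar>t\<bar> < d \<Longrightarrow> f t \<le> f 0"
  shows "f' 0 = 0" "D \<le> 0"
proof -
  show z: "f' 0 = 0"
    by (rule DERIV_local_max[OF f, of 0 d]) (use d max in auto)
  show "D \<le> 0"
  proof (rule ccontr)
    assume "\<not> D \<le> 0"
    then obtain e where e: "e > 0" "\<And>h. 0 < h \<Longrightarrow> h < e \<Longrightarrow> f' 0 < f' (0 + h)"
      using DERIV_pos_inc_right[OF f'] by auto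
    define t where "t = min d e / 2"
    have t: "0 < t" "t < d" "t < e" using d e by (auto simp: t_def)
    have "\<exists>s. 0 < s \<and> s < t \<and> f t - f 0 = (t - 0) * f' s"
      using t by (intro MVT2 f) auto
    then obtain s where s: "0 < s" "s < t" "f t - f 0 = t * f' s" by auto
    have "f' s > 0" using e(2)[of s] s t z by auto
    then have "t * f' s > 0" using t(1) by simp
    then have "f t > f 0" using s(3) by linarith
    then show False using max[of t] t by auto
  qed
qed

text \<open>The barrier \<open>exp (\<kappa> * x $ p)\<close> makes the inequality strict, after
  which the first and second order conditions at an interior maximum contradict it. The lower bound
  on a single diagonal entry is all the barrier needs of ellipticity; semidefiniteness handles the
  rest.\<close>

lemma weak_maximum_principle:
  fixes \<Omega> :: "(real^'n) set" and u :: "real^'n \<Rightarrow> real" and C :: "real^'n \<Rightarrow> real^'n^'n"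
  assumes \<Omega>: "open \<Omega>" "bounded \<Omega>" and u: "Ck_on 2 \<Omega> u" "continuous_on (closure \<Omega>) u"
    and bdry: "\<And>x. x \<in> frontier \<Omega> \<Longrightarrow> u x = 0"
    and sym: "\<And>x. x \<in> \<Omega> \<Longrightarrow> transpose (C x) = C x"
    and psd: "\<And>x \<xi>. x \<in> \<Omega> \<Longrightarrow> 0 \<le> \<xi> \<bullet> (C x *v \<xi>)"
    and c: "0 < c" "\<And>x. x \<in> \<Omega> \<Longrightarrow> c \<le> C x $ p $ p"
    and b: "\<And>x. x \<in> \<Omega> \<Longrightarrow> \<bar>b x $ p\<bar> \<le> B"
    and q: "\<And>x. x \<in> \<Omega> \<Longrightarrow> 0 \<le> q x" "\<And>x. x \<in> \<Omega> \<Longrightarrow> q x \<le> Q"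
    and sub: "\<And>x. x \<in> \<Omega> \<Longrightarrow> 0 \<le> trace (C x ** hess u x) - b x \<bullet> grad u x - q x * u x"
    and x0: "x0 \<in> \<Omega>"
  shows "u x0 \<le> 0"
proof (rule ccontr)
  assume "\<not> u x0 \<le> 0"
  then have pos: "u x0 > 0" by simp
  have B0: "0 \<le> B" using b[OF x0] by linarith
  have Q0: "0 \<le> Q" using q[OF x0] by linarith
  \<comment> \<open>Chosen with \<open>\<kappa> \<ge> 1\<close> and
    \<open>\<kappa> * c > B + Q\<close>: the operator applied to the barrier is at least
    \<open>\<kappa> * (\<kappa> * c - B - Q)\<close> times the barrier, hence positive.\<close>
  define \<kappa> where "\<kappa> = (B + Q + 1) / c + 1"
  have l1: "\<kappa> \<ge> 1" using B0 Q0 c(1) by (simp add: \<kappa>_def)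
  have "\<kappa> * c = B + Q + 1 + c" using c(1) by (simp add: \<kappa>_def field_simps)
  then have lc: "\<kappa> * c - B - Q > 0" using c(1) by simp
  define w where "w = (\<lambda>x::real^'n. exp (\<kappa> * x $ p))"
  have wpos: "w x > 0" for x by (simp add: w_def)
  have wc: "continuous_on S w" for S unfolding w_def by (intro continuous_intros)
  have comp: "compact (closure \<Omega>)" using \<Omega>(2) by simp
  obtain M where M: "\<And>x. x \<in> closure \<Omega> \<Longrightarrow> w x \<le> M"
    using compact_imp_bounded[OF compact_continuous_image[OF wc comp]]
    unfolding bounded_iff by (auto simp: image_iff) (meson abs_le_D1)
  have x0c: "x0 \<in> closure \<Omega>" using x0 closure_subset by blast
  have M0: "M > 0" using M[OF x0c] wpos[of x0] by linarith
  \<comment> \<open>The barrier then contributes at most half of \<open>u x0\<close> on the closure,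
    so boundary values of \<open>v\<close> stay below \<open>u x0\<close> and the maximum of
    \<open>v\<close> lies inside.\<close>
  define \<epsilon> where "\<epsilon> = u x0 / (2 * M)"
  have eps: "\<epsilon> > 0" using pos M0 by (simp add: \<epsilon>_def)
  have epsM: "\<epsilon> * M = u x0 / 2" using M0 by (simp add: \<epsilon>_def)
  define v where "v = (\<lambda>x. u x + \<epsilon> * w x)"
  have "continuous_on (closure \<Omega>) v" unfolding v_def by (intro continuous_intros u wc)
  then have "\<exists>y\<in>closure \<Omega>. \<forall>x\<in>closure \<Omega>. v x \<le> v y"
    using x0c by (intro continuous_attains_sup comp) auto
  then obtain y where y: "y \<in> closure \<Omega>" "\<forall>x\<in>closure \<Omega>. v x \<le> v y" by blast
  have "\<epsilon> * w x0 > 0" using eps wpos[of x0] by simp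
  then have "v x0 > u x0" by (simp add: v_def)
  then have vy: "v y > u x0" using bspec[OF y(2) x0c] by linarith
  have yO: "y \<in> \<Omega>"
  proof (rule ccontr)
    assume "y \<notin> \<Omega>"
    then have "u y = 0" using bdry[of y] y(1) \<Omega>(1) by (simp add: frontier_def interior_open)
    then have "v y \<le> \<epsilon> * M" using M[OF y(1)] eps by (simp add: v_def)
    then show False using vy epsM pos by simp
  qed
  obtain d where d: "d > 0" "ball y d \<subseteq> \<Omega>" using \<Omega>(1) yO open_contains_ball by blast
  let ?g = "\<epsilon> * \<kappa> * w y"
  \<comment> \<open>The maximum conditions for \<open>v\<close> along every line through
    \<open>y\<close>: \<open>?g\<close> is the derivative of the barrier term in coordinate
    \<open>p\<close>, and \<open>\<kappa> * ?g\<close> its second derivative.\<close>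
  have second: "nderiv [\<xi>] u y + ?g * \<xi> $ p = 0 \<and> nderiv [\<xi>, \<xi>] u y + \<kappa> * ?g * (\<xi> $ p)\<^sup>2 \<le> 0" for \<xi>
  proof -
    define \<delta> where "\<delta> = d / (norm \<xi> + 1)"
    have dp: "\<delta> > 0" using d by (simp add: \<delta>_def add_nonneg_pos)
    have inO: "y + t *\<^sub>R \<xi> \<in> \<Omega>" if "\<bar>t\<bar> < \<delta>" for t
    proof -
      have "\<bar>t\<bar> * (norm \<xi> + 1) < d"
        using that by (simp add: \<delta>_def less_divide_eq add_nonneg_pos)
      then have "\<bar>t\<bar> * norm \<xi> < d" by (simp add: algebra_simps)
      then show ?thesis using d(2) by (auto simp: subset_iff dist_norm)
    qed
    let ?f = "\<lambda>t. v (y + t *\<^sub>R \<xi>)"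
    let ?f' = "\<lambda>t. nderiv [\<xi>] u (y + t *\<^sub>R \<xi>) + \<epsilon> * (w (y + t *\<^sub>R \<xi>) * (\<kappa> * \<xi> $ p))"
    have wd: "((\<lambda>t. w (y + t *\<^sub>R \<xi>)) has_real_derivative w (y + t *\<^sub>R \<xi>) * (\<kappa> * \<xi> $ p)) (at t)" for t
      unfolding w_def by (auto intro!: derivative_eq_intros)
    have 1: "(?f has_real_derivative ?f' t) (at t)" if "\<bar>t\<bar> < \<delta>" for t
      unfolding v_def
      by (intro DERIV_add DERIV_cmult wd has_real_derivative_along_line)
         (use Ck_on_differentiable[OF \<Omega>(1) u(1), of "[]"] inO[OF that] in simp)
    have 2: "(?f' has_real_derivative nderiv [\<xi>] (nderiv [\<xi>] u) (y + 0 *\<^sub>R \<xi>)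
        + \<epsilon> * (w (y + 0 *\<^sub>R \<xi>) * (\<kappa> * \<xi> $ p) * (\<kappa> * \<xi> $ p))) (at 0)"
      by (intro DERIV_add DERIV_cmult DERIV_cmult_right wd has_real_derivative_along_line)
         (use Ck_on_differentiable[OF \<Omega>(1) u(1), of "[\<xi>]"] yO in simp)
    have 3: "?f t \<le> ?f 0" if "\<bar>t\<bar> < \<delta>" for t
      using y(2) inO[OF that] closure_subset[of \<Omega>] by auto
    show ?thesis using second_derivative_at_max[OF dp 1 2 3]
      by (simp add: power2_eq_square ac_simps)
  qed
  \<comment> \<open>The Hessian of \<open>v\<close> at \<open>y\<close>: the barrier depends on
    coordinate \<open>p\<close> alone and so changes only the entry \<open>(p, p)\<close>.\<close>
  define H where "H = hess u y + (\<chi> i j. if i = p \<and> j = p then \<kappa> * ?g else 0)"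
  have "\<xi> \<bullet> (H *v \<xi>) = nderiv [\<xi>, \<xi>] u y + \<kappa> * ?g * (\<xi> $ p)\<^sup>2" for \<xi>
  proof -
    have r: "((\<chi> i j. if i = p \<and> j = p then \<kappa> * ?g else 0) *v \<xi>) = axis p (\<kappa> * ?g * \<xi> $ p)"
      by (auto simp: matrix_vector_mult_def vec_eq_iff axis_def if_distrib[of "\<lambda>z. z * _"] cong: if_cong)
    show ?thesis unfolding H_def matrix_vector_mult_add_rdistrib inner_add_right r
      nderiv_hess[OF \<Omega>(1) u(1) yO] by (simp add: inner_axis power2_eq_square)
  qed
  then have nsd: "\<xi> \<bullet> (H *v \<xi>) \<le> 0" for \<xi> using second by simp
  have "(\<Sum>i\<in>UNIV. \<Sum>j\<in>UNIV. C y $ i $ j * H $ i $ j) \<le> 0"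
    by (rule psd_contract_nonpos[OF sym[OF yO] psd[OF yO] nsd])
  also have "(\<Sum>i\<in>UNIV. \<Sum>j\<in>UNIV. C y $ i $ j * H $ i $ j)
      = trace (C y ** hess u y) + (\<Sum>i\<in>UNIV. \<Sum>j\<in>UNIV. C y $ i $ j * (if i = p \<and> j = p then \<kappa> * ?g else 0))"
    unfolding trace_mul_sym[OF sym[OF yO]] H_def by (simp add: distrib_left sum.distrib)
  also have "(\<Sum>i\<in>UNIV. \<Sum>j\<in>UNIV. C y $ i $ j * (if i = p \<and> j = p then \<kappa> * ?g else 0)) = C y $ p $ p * (\<kappa> * ?g)"
  proof -
    have "(\<Sum>j\<in>UNIV. C y $ i $ j * (if i = p \<and> j = p then \<kappa> * ?g else 0))
       = (if i = p then C y $ p $ p * (\<kappa> * ?g) else 0)" for i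
      by (cases "i = p") (simp_all add: if_distrib[of "\<lambda>z. _ * z"] cong: if_cong)
    then show ?thesis by simp
  qed
  finally have tr: "trace (C y ** hess u y) + C y $ p $ p * (\<kappa> * ?g) \<le> 0" .
  have "grad u y \<bullet> \<xi> = - ?g * \<xi> $ p" for \<xi>
    using second[of \<xi>] nderiv_grad[of u y \<xi>] Ck_on_differentiable[OF \<Omega>(1) u(1), of "[]" y] yO
    by (simp del: nderiv.simps(2))
  then have bg: "b y \<bullet> grad u y = - ?g * b y $ p" by (simp add: inner_commute)
  have gp: "?g > 0" using eps l1 wpos[of y] by simp
  have "0 < \<epsilon> * w y * (\<kappa> * (\<kappa> * c - B - Q))" using eps wpos[of y] l1 lc by simp
  also have "\<dots> \<le> c * (\<kappa> * ?g) - ?g * B - Q * (\<epsilon> * w y)"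
  proof -
    have "Q \<le> \<kappa> * Q" using mult_right_mono[OF l1 Q0] by simp
    then have "\<epsilon> * w y * Q \<le> \<epsilon> * w y * (\<kappa> * Q)" using eps wpos[of y] by (intro mult_left_mono) auto
    moreover have "\<epsilon> * w y * (\<kappa> * (\<kappa> * c - B - Q)) = c * (\<kappa> * ?g) - ?g * B - \<epsilon> * w y * (\<kappa> * Q)"
      by (simp add: right_diff_distrib mult.commute mult.left_commute)
    ultimately show ?thesis by (simp add: mult.commute)
  qed
  also have "\<dots> \<le> C y $ p $ p * (\<kappa> * ?g) - ?g * b y $ p - q y * (\<epsilon> * w y)"
  proof (intro diff_mono)
    show "c * (\<kappa> * ?g) \<le> C y $ p $ p * (\<kappa> * ?g)"
      by (rule mult_right_mono[OF c(2)[OF yO]]) (use gp l1 in simp)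
    show "?g * b y $ p \<le> ?g * B"
      by (rule mult_left_mono) (use b[OF yO] gp in linarith)+
    show "q y * (\<epsilon> * w y) \<le> Q * (\<epsilon> * w y)"
      by (rule mult_right_mono[OF q(2)[OF yO]]) (use eps wpos[of y] in simp)
  qed
  finally have A: "0 < C y $ p $ p * (\<kappa> * ?g) - ?g * b y $ p - q y * (\<epsilon> * w y)" .
  \<comment> \<open>Here the sign of \<open>q\<close> enters: the maximum value of \<open>v\<close>
    is positive, so the zeroth order term has a favourable sign.\<close>
  have "0 \<le> q y * v y" using q(1)[OF yO] vy pos by simp
  then have qv: "0 \<le> q y * u y + q y * (\<epsilon> * w y)" by (simp add: v_def distrib_left)
  have "b y \<bullet> grad u y = - (?g * b y $ p)" using bg by (simp only: mult_minus_left)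
  with sub[OF yO] tr A qv show False by linarith
qed

lemma dirichlet_uniqueness:
  fixes \<Omega> :: "(real^'n) set" and u :: "real^'n \<Rightarrow> real" and C :: "real^'n \<Rightarrow> real^'n^'n"
  assumes \<Omega>: "open \<Omega>" "bounded \<Omega>" and u: "Ck_on 2 \<Omega> u" "continuous_on (closure \<Omega>) u"
    and bdry: "\<And>x. x \<in> frontier \<Omega> \<Longrightarrow> u x = 0"
    and sym: "\<And>x. x \<in> \<Omega> \<Longrightarrow> transpose (C x) = C x"
    and psd: "\<And>x \<xi>. x \<in> \<Omega> \<Longrightarrow> 0 \<le> \<xi> \<bullet> (C x *v \<xi>)"
    and c: "0 < c" "\<And>x. x \<in> \<Omega> \<Longrightarrow> c \<le> C x $ p $ p"
    and b: "\<And>x. x \<in> \<Omega> \<Longrightarrow> \<bar>b x $ p\<bar> \<le> B"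
    and q: "\<And>x. x \<in> \<Omega> \<Longrightarrow> 0 \<le> q x" "\<And>x. x \<in> \<Omega> \<Longrightarrow> q x \<le> Q"
    and eq: "\<And>x. x \<in> \<Omega> \<Longrightarrow> trace (C x ** hess u x) - b x \<bullet> grad u x - q x * u x = 0"
    and x0: "x0 \<in> \<Omega>"
  shows "u x0 = 0"
proof -
  have sub: "0 \<le> trace (C x ** hess u x) - b x \<bullet> grad u x - q x * u x" if "x \<in> \<Omega>" for x
    using eq[OF that] by simp
  have le: "u x0 \<le> 0"
    by (rule weak_maximum_principle[OF \<Omega> u bdry sym psd c b q sub x0])
  let ?v = "\<lambda>x. (-1) * u x"
  have nd: "nderiv vs ?v x = - nderiv vs u x" if "length vs \<le> 2" "x \<in> \<Omega>" for vs x
    using nderiv_cmult[OF \<Omega>(1) u(1) that, of "-1"] by simp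
  have v: "Ck_on 2 \<Omega> ?v"
    using Ck_on_lincomb[OF \<Omega>(1) u(1) u(1), of "-2"] by (simp add: algebra_simps)
  have h: "hess ?v x = - hess u x" "grad ?v x = - grad u x" if "x \<in> \<Omega>" for x
    using nd that by (simp_all add: hess_def grad_def vec_eq_iff del: nderiv.simps)
  have mm: "trace (A ** (- M)) = - trace (A ** M)" for A M :: "real^'n^'n"
    by (simp add: trace_def matrix_matrix_mult_def sum_negf)
  have "?v x0 \<le> 0"
  proof (rule weak_maximum_principle[OF \<Omega> v _ _ sym psd c b q _ x0])
    show "continuous_on (closure \<Omega>) ?v" by (intro continuous_intros u)
    show "?v x = 0" if "x \<in> frontier \<Omega>" for x using bdry[OF that] by simp
    show "0 \<le> trace (C x ** hess ?v x) - b x \<bullet> grad ?v x - q x * ?v x" if "x \<in> \<Omega>" for x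
      using eq[OF that] unfolding h[OF that] mm by simp
  qed
  with le show ?thesis by simp
qed

section \<open>Truncation and Sobolev functions\<close>

text \<open>Rolle's theorem: two zeros of \<open>f\<close> on a line parallel to \<open>e\<close>
  would produce, between them and inside the convex ball, a zero of the derivative along
  \<open>e\<close>.\<close>

lemma level_set_translates_disjoint:
  fixes f :: "real^'n \<Rightarrow> real"
  assumes d: "\<And>y. y \<in> ball x d \<Longrightarrow> f differentiable (at y)"
    and nz: "\<And>y. y \<in> ball x d \<Longrightarrow> nderiv [e] f y \<noteq> 0"
    and y: "y \<in> ball x d" "f y = 0" and z: "y + c *\<^sub>R e \<in> ball x d" "f (y + c *\<^sub>R e) = 0" and c: "0 < c"
  shows False
proof -
  have inb: "y + t *\<^sub>R e \<in> ball x d" if "0 \<le> t" "t \<le> c" for t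
  proof -
    have "(1 - t / c) *\<^sub>R y + (t / c) *\<^sub>R (y + c *\<^sub>R e) \<in> ball x d"
      using that c by (intro convexD_alt[OF convex_ball y(1) z(1)]) auto
    moreover have "(1 - t / c) *\<^sub>R y + (t / c) *\<^sub>R (y + c *\<^sub>R e) = y + t *\<^sub>R e"
      using c by (simp add: algebra_simps)
    ultimately show ?thesis by (simp only:)
  qed
  have "\<exists>t. 0 < t \<and> t < c \<and> f (y + c *\<^sub>R e) - f (y + 0 *\<^sub>R e) = (c - 0) * nderiv [e] f (y + t *\<^sub>R e)"
    by (rule MVT2[OF c]) (intro has_real_derivative_along_line d inb)
  then obtain t where "0 < t" "t < c" "c * nderiv [e] f (y + t *\<^sub>R e) = 0"
    using y z by (auto simp del: nderiv.simps)
  then show False using nz[OF inb[of t]] c by (simp del: nderiv.simps)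
qed

text \<open>Infinitely many short translates along \<open>e\<close> are pairwise disjoint, have
  equal measure and fit into one bounded ball, so that common measure is 0.\<close>

lemma negligible_if_translates_disjoint:
  fixes T :: "(real^'n) set"
  assumes T: "T \<in> lmeasurable" "bounded T" and e: "norm e = 1"
    and disj: "\<And>y c. y \<in> T \<Longrightarrow> 0 < c \<Longrightarrow> y + c *\<^sub>R e \<in> T \<Longrightarrow> False"
  shows "negligible T"
proof -
  obtain R where R: "T \<subseteq> ball 0 R" using bounded_subset_ballD[OF T(2)] by blast
  \<comment> \<open>Pairwise distinct shifts of length at most 1, so that every translate stays in
    the ball of radius \<open>R + 1\<close>.\<close>
  define s where "s i = inverse (real (Suc i))" for i
  define F where "F i = (+) (s i *\<^sub>R e) ` T" for i
  have s: "0 < s i" "s i \<le> 1" for i by (auto simp: s_def inverse_le_1_iff)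
  have Fm: "F i \<in> lmeasurable" "measure lebesgue (F i) = measure lebesgue T" for i
    unfolding F_def by (auto intro: measurable_translation T simp: measure_translation)
  have sub: "F i \<subseteq> ball 0 (R + 1)" for i
  proof
    fix z assume "z \<in> F i"
    then obtain y where y: "y \<in> T" "z = s i *\<^sub>R e + y" by (auto simp: F_def)
    have "norm z \<le> s i + norm y" unfolding y(2) using norm_triangle_ineq[of "s i *\<^sub>R e" y] e s(1)[of i] by simp
    moreover have "norm y < R" using R y(1) by auto
    ultimately show "z \<in> ball 0 (R + 1)" using s(2)[of i] by simp
  qed
  have dis: "disjnt (F i) (F j)" if "s i < s j" for i j
    unfolding disjnt_iff
  proof (intro allI notI, elim conjE)
    fix z assume "z \<in> F i" "z \<in> F j"
    then obtain y y' where y: "y \<in> T" "y' \<in> T" "s i *\<^sub>R e + y = s j *\<^sub>R e + y'" by (auto simp: F_def)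
    then have "y = y' + (s j - s i) *\<^sub>R e" by (simp add: algebra_simps)
    then show False using disj[of y' "s j - s i"] y that by simp
  qed
  have pw: "pairwise (\<lambda>i j. disjnt (F i) (F j)) {..<N}" for N
  proof (rule pairwiseI)
    fix i j :: nat assume "i \<noteq> j"
    then have "s i < s j \<or> s j < s i" by (auto simp: s_def)
    then show "disjnt (F i) (F j)" using dis disjnt_sym by blast
  qed
  have bound: "real N * measure lebesgue T \<le> measure lebesgue (ball (0::real^'n) (R + 1))" for N
  proof -
    have "real N * measure lebesgue T = (\<Sum>i<N. measure lebesgue (F i))" by (simp add: Fm)
    also have "\<dots> = measure lebesgue (\<Union>(F ` {..<N}))"
      by (rule measure_UNION'[symmetric]) (use Fm pw in auto)
    also have "\<dots> \<le> measure lebesgue (ball (0::real^'n) (R + 1))"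
      using Fm sub by (intro measure_mono_fmeasurable) (auto intro!: sets.finite_UN simp: fmeasurableD)
    finally show ?thesis .
  qed
  have "measure lebesgue T = 0"
  proof (rule ccontr)
    assume "measure lebesgue T \<noteq> 0"
    then have "measure lebesgue T > 0" by (simp add: zero_less_measure_iff)
    then obtain N where "measure lebesgue (ball (0::real^'n) (R + 1)) < real N * measure lebesgue T"
      using reals_Archimedean3 by blast
    then show False using bound[of N] by simp
  qed
  then show ?thesis using T(1) by (simp add: negligible_iff_measure)
qed

text \<open>Truncating a function spoils convergence of gradients exactly where the function is 0
  and its gradient is not; this shows that set to be null. Near each of its points the derivative
  stays nonzero, so the zero set meets each line parallel to \<open>e\<close> at most once
  there.\<close>

lemma negligible_zero_set_nonzero_deriv:
  fixes f :: "real^'n \<Rightarrow> real"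
  assumes \<Omega>: "open \<Omega>" and f: "Ck_on 1 \<Omega> f" and e: "norm e = 1"
  shows "negligible {x \<in> \<Omega>. f x = 0 \<and> nderiv [e] f x \<noteq> 0}" (is "negligible ?S")
  unfolding locally_negligible_alt[of ?S]
proof
  fix x assume x: "x \<in> ?S"
  have df: "f differentiable (at y)" if "y \<in> \<Omega>" for y
    using Ck_on_differentiable[OF \<Omega> f, of "[]" y] that by simp
  have "isCont (nderiv [e] f) x"
    using Ck_on_continuous[OF \<Omega> f, of "[e]"] x \<Omega> by (simp add: continuous_on_eq_continuous_at del: nderiv.simps)
  moreover have "\<bar>nderiv [e] f x\<bar> > 0" using x by (simp del: nderiv.simps)
  ultimately obtain d1 where d1: "d1 > 0"
    "\<And>y. dist y x < d1 \<Longrightarrow> dist (nderiv [e] f y) (nderiv [e] f x) < \<bar>nderiv [e] f x\<bar>"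
    unfolding continuous_at_eps_delta by meson
  obtain d2 where d2: "d2 > 0" "ball x d2 \<subseteq> \<Omega>" using \<Omega> x open_contains_ball by blast
  define d where "d = min d1 d2"
  have bO: "ball x d \<subseteq> \<Omega>" using d2 by (auto simp: d_def)
  have nz: "nderiv [e] f y \<noteq> 0" if "y \<in> ball x d" for y
  proof
    assume "nderiv [e] f y = 0"
    then show False using d1(2)[of y] that by (simp add: d_def dist_commute dist_real_def del: nderiv.simps)
  qed
  let ?T = "{y \<in> ball x d. f y = 0}"
  have "continuous_on (ball x d) f"
    using Ck_on_continuous[OF \<Omega> f, of "[]"] bO continuous_on_subset by auto
  then have "\<forall>B. open B \<longrightarrow> open (f -` B \<inter> ball x d)"
    using continuous_on_open_vimage[OF open_ball] by blast
  then have "open (f -` (- {0}) \<inter> ball x d)" by (elim allE[of _ "- {0}"]) (simp add: open_Compl)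
  moreover have "bounded (f -` (- {0}) \<inter> ball x d)" by (rule bounded_subset[OF bounded_ball]) blast
  ultimately have "ball x d - (f -` (- {0}) \<inter> ball x d) \<in> lmeasurable"
    by (intro fmeasurable_Diff) (auto intro: lmeasurable_open fmeasurableD)
  moreover have "ball x d - (f -` (- {0}) \<inter> ball x d) = ?T" by auto
  ultimately have Tm: "?T \<in> lmeasurable" by (simp only:)
  have "negligible ?T"
  proof (rule negligible_if_translates_disjoint[OF Tm _ e])
    show "bounded ?T" by (rule bounded_subset[OF bounded_ball]) blast
    fix y c assume "y \<in> ?T" "0 < c" "y + c *\<^sub>R e \<in> ?T"
    then show False
      by (intro level_set_translates_disjoint[of x d f e y c] df nz) (use bO in auto)
  qed
  then have "negligible (?S \<inter> ball x d)" by (rule negligible_subset) auto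
  moreover have "openin (top_of_set ?S) (?S \<inter> ball x d)" by (simp add: openin_open_Int)
  moreover have "x \<in> ?S \<inter> ball x d" using x d1(1) d2(1) by (simp add: d_def)
  ultimately show "\<exists>U. openin (top_of_set ?S) U \<and> x \<in> U \<and> negligible U" by blast
qed

text \<open>A \<open>C\<^sup>1\<close> truncation: it vanishes for \<open>\<bar>s\<bar> \<le> \<epsilon>\<close>, so composing it with a function that is zero on the
  boundary produces a compactly supported function.\<close>

definition trunc :: "real \<Rightarrow> real \<Rightarrow> real" where
  "trunc \<epsilon> s = s * ((max 0 (s\<^sup>2 - \<epsilon>\<^sup>2))\<^sup>2 / (s\<^sup>2 + \<epsilon>\<^sup>2)\<^sup>2)"

definition trunc' :: "real \<Rightarrow> real \<Rightarrow> real" where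
  "trunc' \<epsilon> s = (max 0 (s\<^sup>2 - \<epsilon>\<^sup>2))\<^sup>2 / (s\<^sup>2 + \<epsilon>\<^sup>2)\<^sup>2
     + s * ((4 * s * max 0 (s\<^sup>2 - \<epsilon>\<^sup>2)) / (s\<^sup>2 + \<epsilon>\<^sup>2)\<^sup>2
          - (max 0 (s\<^sup>2 - \<epsilon>\<^sup>2))\<^sup>2 * (4 * s) / (s\<^sup>2 + \<epsilon>\<^sup>2) ^ 3)"

text \<open>Squaring smooths the corner of \<open>max 0\<close>, which is why \<open>trunc\<close>
  contains a squared positive part. At 0 the difference quotient is \<open>max 0 h\<close>
  itself.\<close>

lemma DERIV_max_square: "((\<lambda>r::real. (max 0 r)\<^sup>2) has_real_derivative 2 * max 0 r) (at r)"
proof -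
  consider "r < 0" | "r = 0" | "r > 0" by linarith
  then show ?thesis
  proof cases
    case 1
    have "((\<lambda>r::real. 0) has_real_derivative 0) (at r)" by simp
    then have "((\<lambda>r::real. (max 0 r)\<^sup>2) has_real_derivative 0) (at r)"
      by (rule has_field_derivative_transform_within_open[where S = "{..<0}"]) (use 1 in auto)
    then show ?thesis using 1 by simp
  next
    case 2
    have "((\<lambda>h::real. max 0 h) \<longlongrightarrow> max 0 0) (at 0)" by (intro tendsto_intros)
    then have "((\<lambda>h::real. max 0 h) \<longlongrightarrow> 0) (at 0)" by simp
    then have "((\<lambda>h::real. ((max 0 (0 + h))\<^sup>2 - (max 0 0)\<^sup>2) / h) \<longlongrightarrow> 0) (at 0)"
      by (rule Lim_transform_eventually) (auto simp: eventually_at_filter max_def power2_eq_square)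
    then show ?thesis using 2 by (simp add: DERIV_def)
  next
    case 3
    have "((\<lambda>r::real. r\<^sup>2) has_real_derivative 2 * r) (at r)" by (auto intro!: derivative_eq_intros)
    then have "((\<lambda>r::real. (max 0 r)\<^sup>2) has_real_derivative 2 * r) (at r)"
      by (rule has_field_derivative_transform_within_open[where S = "{0<..}"]) (use 3 in auto)
    then show ?thesis using 3 by simp
  qed
qed

lemma DERIV_trunc:
  assumes "0 < \<epsilon>" shows "(trunc \<epsilon> has_real_derivative trunc' \<epsilon> s) (at s)"
proof -
  let ?p = "s\<^sup>2 + \<epsilon>\<^sup>2" and ?m = "max 0 (s\<^sup>2 - \<epsilon>\<^sup>2)"
  have p: "?p > 0" using assms by (simp add: add_nonneg_pos)
  have "((\<lambda>s. s\<^sup>2 - \<epsilon>\<^sup>2) has_real_derivative 2 * s) (at s)" by (auto intro!: derivative_eq_intros)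
  from DERIV_chain2[OF DERIV_max_square this]
  have m: "((\<lambda>s. (max 0 (s\<^sup>2 - \<epsilon>\<^sup>2))\<^sup>2) has_real_derivative 2 * ?m * (2 * s)) (at s)" .
  have d: "((\<lambda>s. (s\<^sup>2 + \<epsilon>\<^sup>2)\<^sup>2) has_real_derivative 2 * ?p * (2 * s)) (at s)"
    by (auto intro!: derivative_eq_intros)
  have "(trunc \<epsilon> has_real_derivative 1 * (?m\<^sup>2 / ?p\<^sup>2)
      + ((2 * ?m * (2 * s)) * ?p\<^sup>2 - ?m\<^sup>2 * (2 * ?p * (2 * s))) / (?p\<^sup>2 * ?p\<^sup>2) * s) (at s)"
    unfolding trunc_def[abs_def] using p by (intro DERIV_mult DERIV_ident DERIV_divide m d) auto
  moreover have "1 * (?m\<^sup>2 / ?p\<^sup>2) + ((2 * ?m * (2 * s)) * ?p\<^sup>2 - ?m\<^sup>2 * (2 * ?p * (2 * s))) / (?p\<^sup>2 * ?p\<^sup>2) * s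
      = trunc' \<epsilon> s"
  proof -
    have e: "(2 * M * (2 * s)) * P\<^sup>2 / (P\<^sup>2 * P\<^sup>2) = (4 * s * M) / P\<^sup>2"
      "M\<^sup>2 * (2 * P * (2 * s)) / (P\<^sup>2 * P\<^sup>2) = M\<^sup>2 * (4 * s) / P ^ 3" if "P > 0" for M P :: real
      using that by (simp_all add: divide_simps power2_eq_square power3_eq_cube)
    have d: "(A - B) / c * s = s * (A / c - B / c)" for A B c :: real by (simp add: diff_divide_distrib)
    show ?thesis unfolding trunc'_def d e[OF p] mult_1 ..
  qed
  ultimately show ?thesis by simp
qed

lemma continuous_trunc': "0 < \<epsilon> \<Longrightarrow> continuous_on S (trunc' \<epsilon>)"
  unfolding trunc'_def[abs_def] using sum_power2_gt_zero_iff
  by (intro continuous_intros) (auto simp: sum_power2_eq_zero_iff)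

lemma trunc_ratio:
  fixes s \<epsilon> :: real
  assumes "0 < \<epsilon>"
  shows "0 \<le> max 0 (s\<^sup>2 - \<epsilon>\<^sup>2)" "max 0 (s\<^sup>2 - \<epsilon>\<^sup>2) \<le> s\<^sup>2 + \<epsilon>\<^sup>2" "0 < s\<^sup>2 + \<epsilon>\<^sup>2" "s\<^sup>2 \<le> s\<^sup>2 + \<epsilon>\<^sup>2"
proof -
  have e: "0 < \<epsilon>\<^sup>2" "0 \<le> s\<^sup>2" using assms by auto
  show "0 \<le> max 0 (s\<^sup>2 - \<epsilon>\<^sup>2)" "max 0 (s\<^sup>2 - \<epsilon>\<^sup>2) \<le> s\<^sup>2 + \<epsilon>\<^sup>2" "0 < s\<^sup>2 + \<epsilon>\<^sup>2" "s\<^sup>2 \<le> s\<^sup>2 + \<epsilon>\<^sup>2"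
    using e by linarith+
qed

lemma abs_trunc_le: assumes "0 < \<epsilon>" shows "\<bar>trunc \<epsilon> s\<bar> \<le> \<bar>s\<bar>"
proof -
  have "(max 0 (s\<^sup>2 - \<epsilon>\<^sup>2))\<^sup>2 \<le> (s\<^sup>2 + \<epsilon>\<^sup>2)\<^sup>2" by (rule power_mono[OF trunc_ratio(2,1)[OF assms]])
  then have "(max 0 (s\<^sup>2 - \<epsilon>\<^sup>2))\<^sup>2 / (s\<^sup>2 + \<epsilon>\<^sup>2)\<^sup>2 \<le> 1"
    using zero_less_power[OF trunc_ratio(3)[OF assms], of s 2] by (simp only: pos_divide_le_eq mult_1)
  then show ?thesis unfolding trunc_def abs_mult
    by (intro mult_left_le) auto
qed

text \<open>The derivative splits into three terms with coefficients 1, 4 and -4, each multiplying a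
  ratio in the unit interval, whence 9 = 1 + 4 + 4. What matters is that the bound is uniform in
  \<open>\<epsilon>\<close>, for dominated convergence.\<close>

lemma abs_trunc'_le: assumes "0 < \<epsilon>" shows "\<bar>trunc' \<epsilon> s\<bar> \<le> 9"
proof -
  define M where "M = max 0 (s\<^sup>2 - \<epsilon>\<^sup>2)"
  define P where "P = s\<^sup>2 + \<epsilon>\<^sup>2"
  have b: "0 \<le> M" "M \<le> P" "0 < P" "s\<^sup>2 \<le> P" "0 \<le> s\<^sup>2" using trunc_ratio[OF assms, of s] by (auto simp: M_def P_def)
  have e: "trunc' \<epsilon> s = M\<^sup>2 / P\<^sup>2 + 4 * (s\<^sup>2 * M / P\<^sup>2) - 4 * (s\<^sup>2 * M\<^sup>2 / P ^ 3)"
    unfolding trunc'_def M_def[symmetric] P_def[symmetric] by (simp add: algebra_simps power2_eq_square)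
  have "M\<^sup>2 \<le> P\<^sup>2" using b by (intro power_mono) auto
  then have 1: "0 \<le> M\<^sup>2 / P\<^sup>2" "M\<^sup>2 / P\<^sup>2 \<le> 1" using b by auto
  have "s\<^sup>2 * M \<le> P * P" using b by (intro mult_mono) auto
  then have 2: "0 \<le> s\<^sup>2 * M / P\<^sup>2" "s\<^sup>2 * M / P\<^sup>2 \<le> 1" using b by (auto simp: power2_eq_square)
  have "s\<^sup>2 * M\<^sup>2 \<le> P * P\<^sup>2" using b by (intro mult_mono power_mono) auto
  then have 3: "0 \<le> s\<^sup>2 * M\<^sup>2 / P ^ 3" "s\<^sup>2 * M\<^sup>2 / P ^ 3 \<le> 1" using b
    by (auto simp: power2_eq_square power3_eq_cube)
  show ?thesis unfolding e using 1 2 3 by linarith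
qed

lemma trunc_zero: assumes "\<bar>s\<bar> \<le> \<epsilon>" shows "trunc \<epsilon> s = 0"
proof -
  have "\<bar>s\<bar>\<^sup>2 \<le> \<epsilon>\<^sup>2" using assms by (intro power_mono) auto
  then show ?thesis by (simp add: trunc_def)
qed

lemma inverse_Suc_tendsto: "(\<lambda>j. (inverse (real (Suc j)))\<^sup>2) \<longlonglongrightarrow> 0"
  using tendsto_power[OF LIMSEQ_inverse_real_of_nat, of 2] by simp

lemma trunc_tendsto: "(\<lambda>j. trunc (inverse (real (Suc j))) s) \<longlonglongrightarrow> s"
proof (cases "s = 0")
  case False
  have "(\<lambda>j. trunc (inverse (real (Suc j))) s) \<longlonglongrightarrow> s * ((max 0 (s\<^sup>2 - 0))\<^sup>2 / (s\<^sup>2 + 0)\<^sup>2)"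
    unfolding trunc_def using False by (intro tendsto_intros inverse_Suc_tendsto) auto
  then show ?thesis using False by simp
qed (simp add: trunc_def)

text \<open>At \<open>s = 0\<close> the limit would be 0 instead of 1, since
  \<open>trunc' \<epsilon> 0 = 0\<close>. This is the source of the exceptional null set in the
  approximation of gradients.\<close>

lemma trunc'_tendsto:
  assumes "s \<noteq> 0" shows "(\<lambda>j. trunc' (inverse (real (Suc j))) s) \<longlonglongrightarrow> 1"
proof -
  have "(\<lambda>j. trunc' (inverse (real (Suc j))) s) \<longlonglongrightarrow> (max 0 (s\<^sup>2 - 0))\<^sup>2 / (s\<^sup>2 + 0)\<^sup>2
     + s * ((4 * s * max 0 (s\<^sup>2 - 0)) / (s\<^sup>2 + 0)\<^sup>2 - (max 0 (s\<^sup>2 - 0))\<^sup>2 * (4 * s) / (s\<^sup>2 + 0) ^ 3)"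
    unfolding trunc'_def using assms by (intro tendsto_intros inverse_Suc_tendsto) auto
  moreover have "(max 0 (s\<^sup>2 - 0))\<^sup>2 / (s\<^sup>2 + 0)\<^sup>2
     + s * ((4 * s * max 0 (s\<^sup>2 - 0)) / (s\<^sup>2 + 0)\<^sup>2 - (max 0 (s\<^sup>2 - 0))\<^sup>2 * (4 * s) / (s\<^sup>2 + 0) ^ 3) = 1"
    using assms by (simp add: power2_eq_square power3_eq_cube)
  ultimately show ?thesis by simp
qed

section \<open>First order calculus and test functions\<close>

lemma Ck_on_1I:
  fixes f :: "'a::euclidean_space \<Rightarrow> real"
  assumes d: "\<And>x. x \<in> U \<Longrightarrow> f differentiable (at x)"
    and c: "\<And>b. b \<in> Basis \<Longrightarrow> continuous_on U (nderiv [b] f)"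
  shows "Ck_on 1 U f"
  unfolding Ck_on_def
proof (intro conjI allI impI ballI)
  fix r x and vs :: "'a list" assume "r < 1" "vs \<in> mindex r" "x \<in> U"
  then show "nderiv vs f differentiable (at x)" using d by simp
next
  fix r and vs :: "'a list" assume r: "r \<le> 1" and vs: "vs \<in> mindex r"
  have cf: "continuous_on U f"
    using d by (intro continuous_at_imp_continuous_on ballI differentiable_imp_continuous_within)
  from r consider "r = 0" | "r = Suc 0" by linarith
  then show "continuous_on U (nderiv vs f)"
  proof cases
    case 1
    then show ?thesis using vs cf by simp
  next
    case 2
    then obtain b where "b \<in> Basis" "vs = [b]" using vs by (auto simp: mindex_def length_Suc_conv)
    then show ?thesis using c by (simp del: nderiv.simps)
  qed
qed

lemma Ck_on_1_compose:
  fixes f :: "'a::euclidean_space \<Rightarrow> real"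
  assumes U: "open U" and f: "Ck_on 1 U f" and T: "\<And>s. (T has_real_derivative T' s) (at s)" "continuous_on UNIV T'"
  shows "Ck_on 1 U (\<lambda>x. T (f x))" and "x \<in> U \<Longrightarrow> nderiv [v] (\<lambda>x. T (f x)) x = T' (f x) * nderiv [v] f x"
proof -
  have df: "f differentiable (at x)" if "x \<in> U" for x
    using Ck_on_differentiable[OF U f, of "[]" x] that by simp
  have hd: "((\<lambda>x. T (f x)) has_derivative (\<lambda>v. T' (f x) * nderiv [v] f x)) (at x)" if "x \<in> U" for x
  proof -
    have 1: "(f has_derivative (\<lambda>v. nderiv [v] f x)) (at x)"
      using df[OF that] by (simp add: frechet_derivative_works)
    have 2: "(T has_derivative (*) (T' (f x))) (at (f x))" using T(1) by (simp add: has_field_derivative_def)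
    show ?thesis using has_derivative_compose[OF 1 2] .
  qed
  have nd: "nderiv [v] (\<lambda>x. T (f x)) x = T' (f x) * nderiv [v] f x" if "x \<in> U" for x v
    using frechet_derivative_eqI[OF hd[OF that]] by simp
  then show "x \<in> U \<Longrightarrow> nderiv [v] (\<lambda>x. T (f x)) x = T' (f x) * nderiv [v] f x" .
  show "Ck_on 1 U (\<lambda>x. T (f x))"
  proof (rule Ck_on_1I)
    show "(\<lambda>x. T (f x)) differentiable (at x)" if "x \<in> U" for x using hd[OF that] by (auto simp: differentiable_def)
    fix b :: 'a
    have "continuous_on U (\<lambda>x. T' (f x) * nderiv [b] f x)"
      using Ck_on_continuous[OF U f, of "[]"] Ck_on_continuous[OF U f, of "[b]"]
      by (intro continuous_on_mult continuous_on_compose2[OF T(2)]) auto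
    then show "continuous_on U (nderiv [b] (\<lambda>x. T (f x)))"
      by (rule continuous_on_eq) (simp only: nd)
  qed
qed

lemma Ck_on_1_mult:
  fixes f g :: "'a::euclidean_space \<Rightarrow> real"
  assumes U: "open U" and f: "Ck_on 1 U f" and g: "Ck_on 1 U g"
  shows "Ck_on 1 U (\<lambda>x. f x * g x)"
    and "x \<in> U \<Longrightarrow> nderiv [v] (\<lambda>x. f x * g x) x = f x * nderiv [v] g x + nderiv [v] f x * g x"
proof -
  have df: "(h has_derivative (\<lambda>v. nderiv [v] h x)) (at x)" if "Ck_on 1 U h" "x \<in> U" for x and h :: "'a \<Rightarrow> real"
    using Ck_on_differentiable[OF U that(1), of "[]" x] that by (simp add: frechet_derivative_works)
  have hd: "((\<lambda>x. f x * g x) has_derivative (\<lambda>v. f x * nderiv [v] g x + nderiv [v] f x * g x)) (at x)" if "x \<in> U" for x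
    using has_derivative_mult[OF df[OF f that] df[OF g that]] .
  have nd: "nderiv [v] (\<lambda>x. f x * g x) x = f x * nderiv [v] g x + nderiv [v] f x * g x" if "x \<in> U" for x v
    using frechet_derivative_eqI[OF hd[OF that]] by simp
  then show "x \<in> U \<Longrightarrow> nderiv [v] (\<lambda>x. f x * g x) x = f x * nderiv [v] g x + nderiv [v] f x * g x" .
  show "Ck_on 1 U (\<lambda>x. f x * g x)"
  proof (rule Ck_on_1I)
    show "(\<lambda>x. f x * g x) differentiable (at x)" if "x \<in> U" for x using hd[OF that] by (auto simp: differentiable_def)
    fix b :: 'a
    have "continuous_on U (\<lambda>x. f x * nderiv [b] g x + nderiv [b] f x * g x)"
      using Ck_on_continuous[OF U f, of "[]"] Ck_on_continuous[OF U f, of "[b]"]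
         Ck_on_continuous[OF U g, of "[]"] Ck_on_continuous[OF U g, of "[b]"]
      by (intro continuous_on_mult continuous_on_add) auto
    then show "continuous_on U (nderiv [b] (\<lambda>x. f x * g x))"
      by (rule continuous_on_eq) (simp only: nd)
  qed
qed

lemma grad_nth: "grad u x $ i = nderiv [axis i 1] u x"
  by (simp add: grad_def)

lemma continuous_on_grad:
  fixes f :: "real^'n \<Rightarrow> real"
  assumes "open U" "Ck_on 1 U f" shows "continuous_on U (grad f)"
  unfolding grad_def using Ck_on_continuous[OF assms, of "[axis _ 1]"] by (intro continuous_on_vec_lambda) simp

text \<open>Extension by zero is C^1 because the two open sets \<open>\<Omega>\<close> and
  \<open>- K\<close> cover the space, and on each of them the extension coincides with a C^1
  function.\<close>

lemma test_fun_glue: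
  fixes g :: "real^'n \<Rightarrow> real"
  assumes \<Omega>: "open \<Omega>" and K: "compact K" "K \<subseteq> \<Omega>" and g: "Ck_on 1 \<Omega> g" and z: "\<And>x. x \<in> \<Omega> \<Longrightarrow> x \<notin> K \<Longrightarrow> g x = 0"
  defines "\<psi> \<equiv> \<lambda>x. if x \<in> \<Omega> then g x else 0"
  shows "test_fun \<Omega> \<psi>" and "x \<in> \<Omega> \<Longrightarrow> grad \<psi> x = grad g x" and "x \<notin> \<Omega> \<Longrightarrow> grad \<psi> x = 0"
proof -
  have cK: "open (- K)" using K(1) compact_imp_closed by auto
  have z0: "\<psi> y = 0" if "y \<in> - K" for y using that z by (auto simp: \<psi>_def)
  have g1: "grad \<psi> x = grad g x" if "x \<in> \<Omega>" for x
    using nderiv_cong_open[OF \<Omega>, of \<psi> g x] that by (simp add: grad_def \<psi>_def vec_eq_iff del: nderiv.simps)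
  have g2: "grad \<psi> x = 0" if "x \<in> - K" for x
  proof -
    have "nderiv [v] \<psi> x = nderiv [v] (\<lambda>x. 0) x" for v
      by (rule nderiv_cong_open[OF cK _ that]) (rule z0)
    then show ?thesis by (simp add: grad_def vec_eq_iff)
  qed
  show "x \<in> \<Omega> \<Longrightarrow> grad \<psi> x = grad g x" by (rule g1)
  show "x \<notin> \<Omega> \<Longrightarrow> grad \<psi> x = 0" using g2 K(2) by blast
  have U: "UNIV = \<Omega> \<union> - K" using K(2) by auto
  have d: "\<psi> differentiable (at x)" for x
  proof (cases "x \<in> \<Omega>")
    case True
    then obtain D where "(g has_derivative D) (at x)"
      using Ck_on_differentiable[OF \<Omega> g, of "[]" x] by (auto simp: differentiable_def)
    then have "(\<psi> has_derivative D) (at x)"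
      by (rule has_derivative_transform_within_open[OF _ \<Omega> True]) (simp add: \<psi>_def)
    then show ?thesis by (auto simp: differentiable_def)
  next
    case False
    then have "x \<in> - K" using K(2) by auto
    have "((\<lambda>x. 0) has_derivative (\<lambda>v. 0)) (at x)" by simp
    then have "(\<psi> has_derivative (\<lambda>v. 0)) (at x)"
      by (rule has_derivative_transform_within_open[OF _ cK \<open>x \<in> - K\<close>]) (simp add: z0)
    then show ?thesis by (auto simp: differentiable_def)
  qed
  have "continuous_on (\<Omega> \<union> - K) (grad \<psi>)"
  proof (rule continuous_on_open_Un[OF \<Omega> cK])
    show "continuous_on \<Omega> (grad \<psi>)" by (rule continuous_on_eq[OF continuous_on_grad[OF \<Omega> g]]) (simp add: g1)
    show "continuous_on (- K) (grad \<psi>)" by (rule continuous_on_eq[OF continuous_on_const[of _ 0]]) (simp add: g2)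
  qed
  then show "test_fun \<Omega> \<psi>" unfolding test_fun_def U[symmetric] using d K z0 by blast
qed

lemma integral_lborel_translate:
  fixes f :: "real^'n \<Rightarrow> real"
  assumes "f \<in> borel_measurable borel"
  shows "(LINT x|lborel. f (x + a)) = (LINT x|lborel. f x)"
proof -
  have "(LINT x|lborel. f x) = (LINT x|distr lborel borel ((+) a). f x)" by (simp add: lborel_distr_plus)
  also have "\<dots> = (LINT x|lborel. f (a + x))" using assms by (intro integral_distr) auto
  finally show ?thesis by (simp add: add.commute)
qed

text \<open>Difference quotients of an integrable function have integral 0 by translation
  invariance, and they converge dominatedly to the derivative. This is the seed of every integration
  by parts below.\<close>

lemma test_fun_integral_grad:
  fixes \<psi> :: "real^'n \<Rightarrow> real"
  assumes \<psi>: "test_fun \<Omega> \<psi>"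
  shows "(LINT x|lebesgue. grad \<psi> x $ i) = 0"
proof -
  obtain K where K: "compact K" "\<And>x. x \<notin> K \<Longrightarrow> \<psi> x = 0" using \<psi> by (auto simp: test_fun_def)
  have d: "\<psi> differentiable (at x)" for x using \<psi> by (simp add: test_fun_def)
  have cg: "continuous_on UNIV (\<lambda>x. grad \<psi> x $ i)" using \<psi> by (auto simp: test_fun_def intro!: continuous_intros)
  have c\<psi>: "continuous_on UNIV \<psi>" using d by (intro continuous_at_imp_continuous_on ballI differentiable_imp_continuous_within)
  let ?e = "axis i (1::real)"
  have gz: "grad \<psi> x $ i = 0" if "x \<notin> K" for x
  proof -
    have "nderiv [?e] \<psi> x = nderiv [?e] (\<lambda>x. 0) x"
      by (rule nderiv_cong_open[of "- K"]) (use K compact_imp_closed that in auto)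
    then show ?thesis by (simp add: grad_nth)
  qed
  obtain R where R: "K \<subseteq> ball 0 R" using bounded_subset_ballD[OF compact_imp_bounded[OF K(1)]] by blast
  have "compact ((\<lambda>x. grad \<psi> x $ i) ` cball 0 R)"
    by (rule compact_continuous_image[OF continuous_on_subset[OF cg]]) auto
  from compact_imp_bounded[OF this] obtain B where B: "\<forall>x\<in>cball 0 R. \<bar>grad \<psi> x $ i\<bar> \<le> B"
    unfolding bounded_iff by auto
  have B': "\<bar>grad \<psi> x $ i\<bar> \<le> max B 0" for x
    using bspec[OF B, of x] gz[of x] R by (cases "x \<in> K") (auto simp: subset_iff le_max_iff_disj)
  define h where "h j = inverse (real (Suc j))" for j
  have h: "h j > 0" "h j \<le> 1" for j by (auto simp: h_def inverse_le_1_iff)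
  let ?s = "\<lambda>j x. (\<psi> (x + h j *\<^sub>R ?e) - \<psi> x) / h j"
  \<comment> \<open>The steps \<open>h j\<close> are at most 1, so outside radius
    \<open>R + 1\<close> neither \<open>x\<close> nor its shift meets the support; inside, the mean
    value theorem bounds the quotient by the gradient.\<close>
  let ?w = "\<lambda>x::real^'n. indicator (cball 0 (R + 1)) x *\<^sub>R max B 0"
  have m\<psi>: "\<psi> \<in> borel_measurable borel" by (rule borel_measurable_continuous_onI[OF c\<psi>])
  have m2: "(\<lambda>x. \<psi> (x + a)) \<in> borel_measurable borel" for a
    by (rule borel_measurable_continuous_onI) (intro continuous_on_compose2[OF c\<psi>] continuous_intros, auto)
  have i\<psi>: "integrable lborel \<psi>"
  proof -
    have "integrable lborel (\<lambda>x. indicator (cball 0 R) x *\<^sub>R \<psi> x)"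
      by (rule borel_integrable_compact) (auto intro: continuous_on_subset[OF c\<psi>])
    moreover have "indicator (cball 0 R) x *\<^sub>R \<psi> x = \<psi> x" for x
      using K(2)[of x] R by (cases "x \<in> K") (auto simp: indicator_def)
    ultimately show ?thesis by (simp only:)
  qed
  have i2: "integrable lborel (\<lambda>x. \<psi> (x + a))" for a
  proof -
    have "integrable (distr lborel borel ((+) a)) \<psi>" using i\<psi> by (simp add: lborel_distr_plus)
    then have "integrable lborel (\<lambda>x. \<psi> (a + x))"
      by (subst (asm) integrable_distr_eq) (use m\<psi> in auto)
    then show ?thesis by (simp add: add.commute)
  qed
  have s0: "(LINT x|lborel. ?s j x) = 0" for j
    using integral_lborel_translate[OF m\<psi>, of "h j *\<^sub>R ?e"] i\<psi> i2[of "h j *\<^sub>R ?e"] by simp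
  have "(\<lambda>j. LINT x|lborel. ?s j x) \<longlonglongrightarrow> (LINT x|lborel. grad \<psi> x $ i)"
  proof (rule integral_dominated_convergence[where w = ?w])
    show "(\<lambda>x. grad \<psi> x $ i) \<in> borel_measurable lborel" using borel_measurable_continuous_onI[OF cg] by simp
    show "?s j \<in> borel_measurable lborel" for j using m2 m\<psi> by simp
    show "integrable lborel ?w" by (rule borel_integrable_compact) auto
    show "AE x in lborel. (\<lambda>j. ?s j x) \<longlonglongrightarrow> grad \<psi> x $ i"
    proof (rule AE_I2)
      fix x
      have "((\<lambda>t. \<psi> (x + t *\<^sub>R ?e)) has_real_derivative nderiv [?e] \<psi> (x + 0 *\<^sub>R ?e)) (at 0)"
        by (rule has_real_derivative_along_line[OF d])
      then have "((\<lambda>t. (\<psi> (x + t *\<^sub>R ?e) - \<psi> x) / t) \<longlongrightarrow> grad \<psi> x $ i) (at 0)"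
        by (simp add: DERIV_def grad_nth)
      moreover have "h \<longlonglongrightarrow> 0" unfolding h_def by (rule LIMSEQ_inverse_real_of_nat)
      moreover have "\<forall>j. h j \<noteq> 0" using h(1) by (metis less_irrefl)
      ultimately show "(\<lambda>j. ?s j x) \<longlonglongrightarrow> grad \<psi> x $ i"
        using LIMSEQ_SEQ_conv[of 0 "\<lambda>t. (\<psi> (x + t *\<^sub>R ?e) - \<psi> x) / t" "grad \<psi> x $ i"] by blast
    qed
    show "AE x in lborel. norm (?s j x) \<le> ?w x" for j
    proof (rule AE_I2)
      fix x
      show "norm (?s j x) \<le> ?w x"
      proof (cases "x \<in> cball 0 (R + 1)")
        case True
        have "\<exists>t. 0 < t \<and> t < h j \<and> \<psi> (x + h j *\<^sub>R ?e) - \<psi> (x + 0 *\<^sub>R ?e) = (h j - 0) * nderiv [?e] \<psi> (x + t *\<^sub>R ?e)"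
          by (rule MVT2[OF h(1)]) (rule has_real_derivative_along_line[OF d])
        then obtain t where "\<psi> (x + h j *\<^sub>R ?e) - \<psi> x = h j * (grad \<psi> (x + t *\<^sub>R ?e) $ i)"
          by (auto simp: grad_nth simp del: nderiv.simps)
        then have "?s j x = grad \<psi> (x + t *\<^sub>R ?e) $ i" using h(1)[of j] by simp
        then show ?thesis using True B' by simp
      next
        case False
        then have n: "norm x > R + 1" by simp
        have "norm x \<le> norm (x + h j *\<^sub>R ?e) + norm (h j *\<^sub>R ?e)"
          using norm_triangle_ineq4[of "x + h j *\<^sub>R ?e" "h j *\<^sub>R ?e"] by simp
        then have "norm (x + h j *\<^sub>R ?e) > R" using n h[of j] by simp
        then have "x \<notin> K" "x + h j *\<^sub>R ?e \<notin> K" using R n by auto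
        then show ?thesis using K(2) by simp
      qed
    qed
  qed
  then have "(LINT x|lborel. grad \<psi> x $ i) = 0" unfolding s0 using LIMSEQ_unique tendsto_const by blast
  moreover have "(\<lambda>x. grad \<psi> x $ i) \<in> borel_measurable lborel" using borel_measurable_continuous_onI[OF cg] by simp
  ultimately show ?thesis by (simp add: integral_completion)
qed

section \<open>Integrability on bounded open sets and approximation by test functions\<close>

lemma finite_measure_bounded_open:
  fixes \<Omega> :: "(real^'n) set"
  assumes "open \<Omega>" "bounded \<Omega>" shows "finite_measure (lebesgue_on \<Omega>)"
  by (rule finite_measure_lebesgue_on) (rule lmeasurable_open[OF assms(2,1)])

lemma continuous_on_measurable:
  fixes f :: "real^'n \<Rightarrow> 'b::euclidean_space"
  assumes "open \<Omega>" "continuous_on \<Omega> f" shows "f \<in> borel_measurable (lebesgue_on \<Omega>)"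
  using assms by (intro continuous_imp_measurable_on_sets_lebesgue) auto

lemma integrable_bounded:
  fixes f :: "real^'n \<Rightarrow> 'b::euclidean_space"
  assumes \<Omega>: "open \<Omega>" "bounded \<Omega>" and f: "f \<in> borel_measurable (lebesgue_on \<Omega>)"
    and B: "\<And>x. x \<in> \<Omega> \<Longrightarrow> norm (f x) \<le> B"
  shows "integrable (lebesgue_on \<Omega>) f"
proof -
  interpret finite_measure "lebesgue_on \<Omega>" by (rule finite_measure_bounded_open[OF \<Omega>])
  show ?thesis
    by (rule integrable_const_bound[where B = B, OF _ f]) (auto intro!: AE_I2 B)
qed

lemma L2_fun_integrable:
  fixes f :: "real^'n \<Rightarrow> 'b::euclidean_space"
  assumes \<Omega>: "open \<Omega>" "bounded \<Omega>" and f: "L2_fun \<Omega> f"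
  shows "integrable (lebesgue_on \<Omega>) f"
proof -
  interpret finite_measure "lebesgue_on \<Omega>" by (rule finite_measure_bounded_open[OF \<Omega>])
  have i: "integrable (lebesgue_on \<Omega>) (\<lambda>x. 1 + (norm (f x))\<^sup>2)"
    using f by (intro Bochner_Integration.integrable_add) (auto simp: L2_fun_def)
  have le: "t \<le> 1 + t\<^sup>2" for t :: real
    using zero_le_power2[of "t - 1 / 2"] by (simp add: power2_eq_square algebra_simps)
  show ?thesis
    by (rule Bochner_Integration.integrable_bound[OF i]) (use f le in \<open>auto simp: L2_fun_def intro!: AE_I2\<close>)
qed

lemma integrable_mult_bounded:
  fixes w h :: "'a \<Rightarrow> real"
  assumes w: "integrable M w" and h: "h \<in> borel_measurable M" and B: "\<And>x. x \<in> space M \<Longrightarrow> \<bar>h x\<bar> \<le> B"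
  shows "integrable M (\<lambda>x. w x * h x)"
proof -
  have i: "integrable M (\<lambda>x. B * w x)" using w by simp
  have "norm (w x * h x) \<le> norm (B * w x)" if "x \<in> space M" for x
  proof -
    have "\<bar>w x\<bar> * \<bar>h x\<bar> \<le> \<bar>w x\<bar> * \<bar>B\<bar>" using B[OF that] by (intro mult_left_mono) auto
    then show ?thesis by (simp add: abs_mult mult.commute)
  qed
  then show ?thesis
    using w h by (intro Bochner_Integration.integrable_bound[OF i]) (auto intro!: AE_I2)
qed

lemma L2_fun_bounded:
  fixes f :: "real^'n \<Rightarrow> 'b::euclidean_space"
  assumes \<Omega>: "open \<Omega>" "bounded \<Omega>" and f: "f \<in> borel_measurable (lebesgue_on \<Omega>)"
    and B: "\<And>x. x \<in> \<Omega> \<Longrightarrow> norm (f x) \<le> B"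
  shows "L2_fun \<Omega> f"
  unfolding L2_fun_def
proof (intro conjI f integrable_bounded[OF \<Omega>, where B = "B\<^sup>2"])
  show "(\<lambda>x. (norm (f x))\<^sup>2) \<in> borel_measurable (lebesgue_on \<Omega>)" using f by simp
  show "norm ((norm (f x))\<^sup>2) \<le> B\<^sup>2" if "x \<in> \<Omega>" for x using B[OF that] by (simp add: power_mono)
qed

lemma AE_lebesgue_on_negligible:
  fixes \<Omega> :: "(real^'n) set"
  assumes \<Omega>: "open \<Omega>" and N: "negligible N" and P: "\<And>x. x \<in> \<Omega> \<Longrightarrow> x \<notin> N \<Longrightarrow> P x"
  shows "AE x in lebesgue_on \<Omega>. P x"
proof -
  have "AE x in lebesgue. x \<notin> N" using N by (intro AE_not_in) (simp add: negligible_iff_null_sets)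
  then have "AE x in lebesgue. x \<in> \<Omega> \<longrightarrow> P x" by (rule AE_mp) (auto intro!: AE_I2 P)
  then show ?thesis using \<Omega> by (subst AE_restrict_space_iff) auto
qed

text \<open>The truncated function lives on the set where \<open>\<bar>F\<bar>\<close> is at least
  \<open>\<epsilon> j\<close>. This is compact, and it avoids the frontier because \<open>F\<close>
  vanishes there: zero boundary values are all that makes the approximants compactly
  supported.\<close>

lemma trunc_approximation:
  fixes f F :: "real^'n \<Rightarrow> real"
  assumes \<Omega>: "open \<Omega>" "bounded \<Omega>" and f: "Ck_on 1 \<Omega> f"
    and F: "continuous_on (closure \<Omega>) F" "\<forall>x\<in>\<Omega>. F x = f x" "\<forall>x\<in>frontier \<Omega>. F x = 0"
  shows "\<exists>\<psi>. (\<forall>j. test_fun \<Omega> (\<psi> j)) \<and> (\<forall>j. \<forall>x\<in>\<Omega>. \<bar>\<psi> j x\<bar> \<le> \<bar>f x\<bar>) \<and>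
     (\<forall>j. \<forall>x\<in>\<Omega>. norm (grad (\<psi> j) x) \<le> 9 * norm (grad f x)) \<and>
     (\<forall>x\<in>\<Omega>. (\<lambda>j::nat. \<psi> j x) \<longlonglongrightarrow> f x) \<and>
     (AE x in lebesgue_on \<Omega>. (\<lambda>j. grad (\<psi> j) x) \<longlonglongrightarrow> grad f x)"
proof -
  define \<epsilon> where "\<epsilon> j = inverse (real (Suc j))" for j
  have eps: "\<epsilon> j > 0" for j by (simp add: \<epsilon>_def)
  define \<psi> where "\<psi> j = (\<lambda>x. if x \<in> \<Omega> then trunc (\<epsilon> j) (f x) else 0)" for j
  define K where "K j = {x \<in> closure \<Omega>. \<epsilon> j \<le> \<bar>F x\<bar>}" for j
  have K: "compact (K j)" "K j \<subseteq> \<Omega>" for j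
  proof -
    have "closed (K j)" unfolding K_def
      by (intro continuous_on_closed_Collect_le continuous_intros F) auto
    moreover have "bounded (K j)" using \<Omega>(2) by (rule bounded_subset[OF bounded_closure]) (auto simp: K_def)
    ultimately show "compact (K j)" by (simp add: compact_eq_bounded_closed)
    show "K j \<subseteq> \<Omega>"
    proof
      fix x assume x: "x \<in> K j"
      then have "x \<notin> frontier \<Omega>" using F(3) eps[of j] by (auto simp: K_def)
      then show "x \<in> \<Omega>" using x \<Omega>(1) by (simp add: K_def frontier_def interior_open)
    qed
  qed
  have Ck: "Ck_on 1 \<Omega> (\<lambda>x. trunc (\<epsilon> j) (f x))" for j
    by (rule Ck_on_1_compose(1)[OF \<Omega>(1) f DERIV_trunc[OF eps] continuous_trunc'[OF eps]])
  have z: "trunc (\<epsilon> j) (f x) = 0" if "x \<in> \<Omega>" "x \<notin> K j" for x j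
  proof -
    have "x \<in> closure \<Omega>" using that(1) closure_subset by blast
    then have "\<not> \<epsilon> j \<le> \<bar>F x\<bar>" using that(2) by (simp add: K_def)
    then show ?thesis using bspec[OF F(2) that(1)] by (intro trunc_zero) simp
  qed
  have tf: "test_fun \<Omega> (\<psi> j)" for j
    unfolding \<psi>_def by (rule test_fun_glue(1)[OF \<Omega>(1) K Ck z])
  have g: "grad (\<psi> j) x = trunc' (\<epsilon> j) (f x) *\<^sub>R grad f x" if "x \<in> \<Omega>" for j x
  proof -
    have "grad (\<psi> j) x = grad (\<lambda>x. trunc (\<epsilon> j) (f x)) x"
      unfolding \<psi>_def by (rule test_fun_glue(2)[OF \<Omega>(1) K Ck z that])
    then show ?thesis
      using Ck_on_1_compose(2)[OF \<Omega>(1) f DERIV_trunc[OF eps] continuous_trunc'[OF eps] that]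
      by (simp add: vec_eq_iff grad_nth del: nderiv.simps)
  qed
  \<comment> \<open>Off this null set the only remaining danger, \<open>f x = 0\<close>, comes with
    a zero gradient, so the gradients of the truncations are 0 there as well and converge
    trivially.\<close>
  define N where "N = (\<Union>i\<in>UNIV. {x \<in> \<Omega>. f x = 0 \<and> nderiv [axis i 1] f x \<noteq> 0})"
  have N: "negligible N" unfolding N_def
    by (intro negligible_Union) (auto intro!: negligible_zero_set_nonzero_deriv[OF \<Omega>(1) f] simp del: nderiv.simps)
  have "AE x in lebesgue_on \<Omega>. (\<lambda>j. grad (\<psi> j) x) \<longlonglongrightarrow> grad f x"
  proof (rule AE_lebesgue_on_negligible[OF \<Omega>(1) N])
    fix x assume x: "x \<in> \<Omega>" "x \<notin> N"
    show "(\<lambda>j. grad (\<psi> j) x) \<longlonglongrightarrow> grad f x"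
    proof (cases "f x = 0")
      case True
      then have "nderiv [axis i 1] f x = 0" for i using x by (auto simp: N_def simp del: nderiv.simps)
      then have "grad f x = 0" by (simp add: vec_eq_iff grad_nth del: nderiv.simps)
      then show ?thesis by (simp add: g[OF x(1)])
    next
      case False
      have "(\<lambda>j. trunc' (\<epsilon> j) (f x) *\<^sub>R grad f x) \<longlonglongrightarrow> 1 *\<^sub>R grad f x"
        unfolding \<epsilon>_def by (intro tendsto_intros trunc'_tendsto False)
      then show ?thesis by (simp add: g[OF x(1)])
    qed
  qed
  moreover have "\<forall>x\<in>\<Omega>. (\<lambda>j. \<psi> j x) \<longlonglongrightarrow> f x"
    unfolding \<psi>_def \<epsilon>_def using trunc_tendsto by (simp del: of_nat_Suc)
  moreover have "\<bar>\<psi> j x\<bar> \<le> \<bar>f x\<bar>" if "x \<in> \<Omega>" for j x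
    using abs_trunc_le[OF eps] that by (simp add: \<psi>_def)
  moreover have "norm (grad (\<psi> j) x) \<le> 9 * norm (grad f x)" if "x \<in> \<Omega>" for j x
    using abs_trunc'_le[OF eps[of j], of "f x"] by (simp add: g[OF that] mult_right_mono)
  ultimately show ?thesis using tf by blast
qed

lemma test_fun_props:
  fixes \<psi> :: "real^'n \<Rightarrow> real"
  assumes \<psi>: "test_fun \<Omega> \<psi>" and \<Omega>: "bounded \<Omega>"
  shows "Ck_on 1 UNIV \<psi>" and "continuous_on UNIV \<psi>" and "continuous_on UNIV (grad \<psi>)"
    and "\<exists>B. \<forall>x\<in>\<Omega>. \<bar>\<psi> x\<bar> \<le> B" and "\<exists>B. \<forall>x\<in>\<Omega>. norm (grad \<psi> x) \<le> B"
proof -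
  have d: "\<psi> differentiable (at x)" for x using \<psi> by (simp add: test_fun_def)
  show cg: "continuous_on UNIV (grad \<psi>)" using \<psi> by (simp add: test_fun_def)
  show c: "continuous_on UNIV \<psi>" using d by (intro continuous_at_imp_continuous_on ballI differentiable_imp_continuous_within)
  show "Ck_on 1 UNIV \<psi>"
  proof (rule Ck_on_1I[OF d])
    fix b :: "real^'n" assume "b \<in> Basis"
    then obtain i where "b = axis i 1" by (auto simp: Basis_vec_def)
    then have "nderiv [b] \<psi> = (\<lambda>x. grad \<psi> x $ i)" by (simp add: grad_nth fun_eq_iff del: nderiv.simps)
    then show "continuous_on UNIV (nderiv [b] \<psi>)" using cg by (auto intro!: continuous_intros)
  qed
  have bd: "\<exists>B. \<forall>x\<in>\<Omega>. norm (h x) \<le> B" if "continuous_on UNIV h" for h :: "real^'n \<Rightarrow> 'b::real_normed_vector"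
  proof -
    have "compact (h ` closure \<Omega>)"
      using \<Omega> by (intro compact_continuous_image continuous_on_subset[OF that]) auto
    from compact_imp_bounded[OF this] obtain B where "\<forall>x\<in>closure \<Omega>. norm (h x) \<le> B"
      unfolding bounded_iff by auto
    then show ?thesis using closure_subset by blast
  qed
  show "\<exists>B. \<forall>x\<in>\<Omega>. \<bar>\<psi> x\<bar> \<le> B" using bd[OF c] by simp
  show "\<exists>B. \<forall>x\<in>\<Omega>. norm (grad \<psi> x) \<le> B" by (rule bd[OF cg])
qed

text \<open>The definition of the weak gradient tests with compactly supported functions; truncation
  extends it to functions that merely vanish on the boundary. Both sides converge dominatedly, as
  \<open>w\<close> and \<open>g\<close> are integrable and \<open>f\<close> is bounded together with
  its gradient.\<close>

lemma H1_by_parts: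
  fixes f F w :: "real^'n \<Rightarrow> real"
  assumes \<Omega>: "open \<Omega>" "bounded \<Omega>" and w: "H1 \<Omega> w g" and f: "Ck_on 1 \<Omega> f"
    and F: "continuous_on (closure \<Omega>) F" "\<And>x. x \<in> \<Omega> \<Longrightarrow> F x = f x" "\<And>x. x \<in> frontier \<Omega> \<Longrightarrow> F x = 0"
    and B: "\<And>x. x \<in> \<Omega> \<Longrightarrow> \<bar>f x\<bar> \<le> B" "\<And>x. x \<in> \<Omega> \<Longrightarrow> norm (grad f x) \<le> B"
  shows "(LINT x|lebesgue_on \<Omega>. w x * grad f x $ i) = - (LINT x|lebesgue_on \<Omega>. g x $ i * f x)"
proof -
  have F': "\<forall>x\<in>\<Omega>. F x = f x" "\<forall>x\<in>frontier \<Omega>. F x = 0" using F(2,3) by auto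
  obtain \<psi> where \<psi>0: "\<forall>j. test_fun \<Omega> (\<psi> j)" "\<forall>j. \<forall>x\<in>\<Omega>. \<bar>\<psi> j x\<bar> \<le> \<bar>f x\<bar>"
     "\<forall>j. \<forall>x\<in>\<Omega>. norm (grad (\<psi> j) x) \<le> 9 * norm (grad f x)"
     "\<forall>x\<in>\<Omega>. (\<lambda>j::nat. \<psi> j x) \<longlonglongrightarrow> f x"
     "AE x in lebesgue_on \<Omega>. (\<lambda>j. grad (\<psi> j) x) \<longlonglongrightarrow> grad f x"
    using trunc_approximation[OF \<Omega> f F(1) F'] by (elim exE conjE) (rule that)
  note \<psi> = \<psi>0(1-4)[rule_format] \<psi>0(5)
  have iw: "integrable (lebesgue_on \<Omega>) w" using w L2_fun_integrable[OF \<Omega>] by (auto simp: H1_def)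
  have "integrable (lebesgue_on \<Omega>) g" using w L2_fun_integrable[OF \<Omega>] by (auto simp: H1_def)
  then have ig: "integrable (lebesgue_on \<Omega>) (\<lambda>x. g x $ i)"
    using integrable_iff_component[of \<Omega> g] \<Omega>(1) by auto
  have mw: "w \<in> borel_measurable (lebesgue_on \<Omega>)" and mg: "(\<lambda>x. g x $ i) \<in> borel_measurable (lebesgue_on \<Omega>)"
    using iw ig by auto
  have mf: "f \<in> borel_measurable (lebesgue_on \<Omega>)"
    using Ck_on_continuous[OF \<Omega>(1) f, of "[]"] by (intro continuous_on_measurable[OF \<Omega>(1)]) simp
  have mgf: "(\<lambda>x. grad f x $ i) \<in> borel_measurable (lebesgue_on \<Omega>)"
    by (intro continuous_on_measurable[OF \<Omega>(1)] continuous_intros continuous_on_grad[OF \<Omega>(1) f])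
  have mp: "\<psi> j \<in> borel_measurable (lebesgue_on \<Omega>)" for j
    by (intro continuous_on_measurable[OF \<Omega>(1)] continuous_on_subset[OF test_fun_props(2)[OF \<psi>(1) \<Omega>(2)]]) auto
  have mgp: "(\<lambda>x. grad (\<psi> j) x $ i) \<in> borel_measurable (lebesgue_on \<Omega>)" for j
    by (intro continuous_on_measurable[OF \<Omega>(1)] continuous_intros
        continuous_on_subset[OF test_fun_props(3)[OF \<psi>(1) \<Omega>(2)]]) auto
  have 1: "(\<lambda>j. LINT x|lebesgue_on \<Omega>. w x * grad (\<psi> j) x $ i) \<longlonglongrightarrow> (LINT x|lebesgue_on \<Omega>. w x * grad f x $ i)"
  proof (rule integral_dominated_convergence[where w = "\<lambda>x. 9 * B * \<bar>w x\<bar>"])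
    show "integrable (lebesgue_on \<Omega>) (\<lambda>x. 9 * B * \<bar>w x\<bar>)" using iw by simp
    show "AE x in lebesgue_on \<Omega>. (\<lambda>j. w x * grad (\<psi> j) x $ i) \<longlonglongrightarrow> w x * grad f x $ i"
      using \<psi>(5)
    proof (rule AE_mp, intro AE_I2 impI)
      fix x assume "(\<lambda>j. grad (\<psi> j) x) \<longlonglongrightarrow> grad f x"
      then show "(\<lambda>j. w x * grad (\<psi> j) x $ i) \<longlonglongrightarrow> w x * grad f x $ i" by (intro tendsto_intros)
    qed
    show "AE x in lebesgue_on \<Omega>. norm (w x * grad (\<psi> j) x $ i) \<le> 9 * B * \<bar>w x\<bar>" for j
    proof (rule AE_I2)
      fix x assume "x \<in> space (lebesgue_on \<Omega>)"
      then have x: "x \<in> \<Omega>" by simp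
      have "\<bar>grad (\<psi> j) x $ i\<bar> \<le> norm (grad (\<psi> j) x)" by (rule component_le_norm_cart)
      also have "\<dots> \<le> 9 * B" using \<psi>(3)[OF x, of j] B(2)[OF x] by simp
      finally have "\<bar>w x\<bar> * \<bar>grad (\<psi> j) x $ i\<bar> \<le> \<bar>w x\<bar> * (9 * B)" by (rule mult_left_mono) simp
      then show "norm (w x * grad (\<psi> j) x $ i) \<le> 9 * B * \<bar>w x\<bar>" by (simp only: real_norm_def abs_mult mult.commute)
    qed
  qed (use mw mgf mgp in auto)
  have 2: "(\<lambda>j. LINT x|lebesgue_on \<Omega>. g x $ i * \<psi> j x) \<longlonglongrightarrow> (LINT x|lebesgue_on \<Omega>. g x $ i * f x)"
  proof (rule integral_dominated_convergence[where w = "\<lambda>x. B * \<bar>g x $ i\<bar>"])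
    show "integrable (lebesgue_on \<Omega>) (\<lambda>x. B * \<bar>g x $ i\<bar>)" using ig by simp
    show "AE x in lebesgue_on \<Omega>. (\<lambda>j. g x $ i * \<psi> j x) \<longlonglongrightarrow> g x $ i * f x"
      by (intro AE_I2 tendsto_intros \<psi>(4)) simp
    show "AE x in lebesgue_on \<Omega>. norm (g x $ i * \<psi> j x) \<le> B * \<bar>g x $ i\<bar>" for j
    proof (rule AE_I2)
      fix x assume "x \<in> space (lebesgue_on \<Omega>)"
      then have x: "x \<in> \<Omega>" by simp
      have "\<bar>g x $ i\<bar> * \<bar>\<psi> j x\<bar> \<le> \<bar>g x $ i\<bar> * B"
        using \<psi>(2)[OF x, of j] B(1)[OF x] by (intro mult_left_mono) auto
      then show "norm (g x $ i * \<psi> j x) \<le> B * \<bar>g x $ i\<bar>" by (simp only: real_norm_def abs_mult mult.commute)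
    qed
  qed (use mf mg mp in auto)
  have "(LINT x|lebesgue_on \<Omega>. w x * grad (\<psi> j) x $ i) = - (LINT x|lebesgue_on \<Omega>. g x $ i * \<psi> j x)" for j
    using w \<psi>(1) by (auto simp: H1_def)
  then have "(\<lambda>j. LINT x|lebesgue_on \<Omega>. w x * grad (\<psi> j) x $ i) \<longlonglongrightarrow> - (LINT x|lebesgue_on \<Omega>. g x $ i * f x)"
    using tendsto_minus[OF 2] by simp
  then show ?thesis using LIMSEQ_unique[OF 1] by blast
qed

text \<open>The product of \<open>W\<close> with a test function, extended by zero, is again a test
  function. Its partial derivatives have integral 0, and the product rule turns that into the weak
  gradient identity.\<close>

lemma H1_of_C1:
  fixes W :: "real^'n \<Rightarrow> real"
  assumes \<Omega>: "open \<Omega>" "bounded \<Omega>" and W: "Ck_on 1 \<Omega> W"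
    and B: "\<And>x. x \<in> \<Omega> \<Longrightarrow> \<bar>W x\<bar> \<le> B" "\<And>x. x \<in> \<Omega> \<Longrightarrow> norm (grad W x) \<le> B"
  shows "H1 \<Omega> W (grad W)"
  unfolding H1_def
proof (intro conjI allI impI)
  have mW: "W \<in> borel_measurable (lebesgue_on \<Omega>)"
    using Ck_on_continuous[OF \<Omega>(1) W, of "[]"] by (intro continuous_on_measurable[OF \<Omega>(1)]) simp
  have mG: "grad W \<in> borel_measurable (lebesgue_on \<Omega>)"
    by (intro continuous_on_measurable[OF \<Omega>(1)] continuous_on_grad[OF \<Omega>(1) W])
  show "L2_fun \<Omega> W" by (rule L2_fun_bounded[OF \<Omega> mW, of B]) (use B in auto)
  show "L2_fun \<Omega> (grad W)" by (rule L2_fun_bounded[OF \<Omega> mG B(2)])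
  fix \<psi> i assume \<psi>: "test_fun \<Omega> \<psi>"
  note p = test_fun_props[OF \<psi> \<Omega>(2)]
  have p1: "Ck_on 1 \<Omega> \<psi>" by (rule Ck_on_subset[OF p(1)]) simp
  obtain K where K: "compact K" "K \<subseteq> \<Omega>" "\<And>x. x \<notin> K \<Longrightarrow> \<psi> x = 0" using \<psi> by (auto simp: test_fun_def)
  let ?\<chi> = "\<lambda>x. if x \<in> \<Omega> then W x * \<psi> x else 0"
  have Ck: "Ck_on 1 \<Omega> (\<lambda>x. W x * \<psi> x)" by (rule Ck_on_1_mult(1)[OF \<Omega>(1) W p1])
  have z: "W x * \<psi> x = 0" if "x \<in> \<Omega>" "x \<notin> K" for x using K(3)[OF that(2)] by simp
  have "(LINT x|lebesgue. grad ?\<chi> x $ i) = 0"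
    by (rule test_fun_integral_grad[OF test_fun_glue(1)[OF \<Omega>(1) K(1,2) Ck z]])
  moreover have "grad ?\<chi> x $ i = (if x \<in> \<Omega> then W x * grad \<psi> x $ i + grad W x $ i * \<psi> x else 0)" for x
  proof (cases "x \<in> \<Omega>")
    case True
    have "grad ?\<chi> x = grad (\<lambda>x. W x * \<psi> x) x" by (rule test_fun_glue(2)[OF \<Omega>(1) K(1,2) Ck z True])
    then show ?thesis using Ck_on_1_mult(2)[OF \<Omega>(1) W p1 True] True by (simp add: grad_nth del: nderiv.simps)
  next
    case False
    have "grad ?\<chi> x = 0" by (rule test_fun_glue(3)[OF \<Omega>(1) K(1,2) Ck z False])
    then show ?thesis using False by simp
  qed
  ultimately have "(LINT x|lebesgue. (if x \<in> \<Omega> then W x * grad \<psi> x $ i + grad W x $ i * \<psi> x else 0)) = 0" by simp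
  then have s: "(LINT x|lebesgue_on \<Omega>. W x * grad \<psi> x $ i + grad W x $ i * \<psi> x) = 0"
    using Lebesgue_Measure.integral_restrict_UNIV[of \<Omega> "\<lambda>x. W x * grad \<psi> x $ i + grad W x $ i * \<psi> x"] \<Omega>(1)
    by simp
  have iW: "integrable (lebesgue_on \<Omega>) W" by (rule integrable_bounded[OF \<Omega> mW, of B]) (use B in auto)
  have "integrable (lebesgue_on \<Omega>) (grad W)" by (rule integrable_bounded[OF \<Omega> mG B(2)])
  then have iG: "integrable (lebesgue_on \<Omega>) (\<lambda>x. grad W x $ i)"
    using integrable_iff_component[of \<Omega> "grad W"] \<Omega>(1) by auto
  obtain B1 where B1: "\<forall>x\<in>\<Omega>. \<bar>\<psi> x\<bar> \<le> B1" using p(4) by blast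
  obtain B2 where B2: "\<forall>x\<in>\<Omega>. norm (grad \<psi> x) \<le> B2" using p(5) by blast
  have i1: "integrable (lebesgue_on \<Omega>) (\<lambda>x. W x * grad \<psi> x $ i)"
  proof (rule integrable_mult_bounded[OF iW])
    show "(\<lambda>x. grad \<psi> x $ i) \<in> borel_measurable (lebesgue_on \<Omega>)"
      by (intro continuous_on_measurable[OF \<Omega>(1)] continuous_intros continuous_on_subset[OF p(3)]) auto
    show "\<bar>grad \<psi> x $ i\<bar> \<le> B2" if "x \<in> space (lebesgue_on \<Omega>)" for x
      using B2 that component_le_norm_cart[of "grad \<psi> x" i] by fastforce
  qed
  have i2: "integrable (lebesgue_on \<Omega>) (\<lambda>x. grad W x $ i * \<psi> x)"
  proof (rule integrable_mult_bounded[OF iG])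
    show "\<psi> \<in> borel_measurable (lebesgue_on \<Omega>)"
      by (intro continuous_on_measurable[OF \<Omega>(1)] continuous_on_subset[OF p(2)]) auto
    show "\<bar>\<psi> x\<bar> \<le> B1" if "x \<in> space (lebesgue_on \<Omega>)" for x using B1 that by simp
  qed
  show "(LINT x|lebesgue_on \<Omega>. W x * grad \<psi> x $ i) = - (LINT x|lebesgue_on \<Omega>. grad W x $ i * \<psi> x)"
    using s unfolding Bochner_Integration.integral_add[OF i1 i2] by simp
qed

text \<open>The truncations of \<open>W\<close> converge to it in the H^1 norm. The dominating
  constants come from \<open>\<bar>\<psi> j\<bar> \<le> \<bar>W\<bar>\<close>, giving
  \<open>2 * B\<close>, and from the gradient factor 9, giving \<open>10 * B\<close>.\<close>

lemma H10_of_zero_boundary: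
  fixes W F :: "real^'n \<Rightarrow> real"
  assumes \<Omega>: "open \<Omega>" "bounded \<Omega>" and W: "Ck_on 1 \<Omega> W"
    and F: "continuous_on (closure \<Omega>) F" "\<And>x. x \<in> \<Omega> \<Longrightarrow> F x = W x" "\<And>x. x \<in> frontier \<Omega> \<Longrightarrow> F x = 0"
    and B: "\<And>x. x \<in> \<Omega> \<Longrightarrow> \<bar>W x\<bar> \<le> B" "\<And>x. x \<in> \<Omega> \<Longrightarrow> norm (grad W x) \<le> B"
  shows "H10 \<Omega> W (grad W)"
  unfolding H10_def
proof (intro conjI H1_of_C1[OF \<Omega> W B])
  have F': "\<forall>x\<in>\<Omega>. F x = W x" "\<forall>x\<in>frontier \<Omega>. F x = 0" using F(2,3) by auto
  obtain \<psi> where \<psi>0: "\<forall>j. test_fun \<Omega> (\<psi> j)" "\<forall>j. \<forall>x\<in>\<Omega>. \<bar>\<psi> j x\<bar> \<le> \<bar>W x\<bar>"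
     "\<forall>j. \<forall>x\<in>\<Omega>. norm (grad (\<psi> j) x) \<le> 9 * norm (grad W x)"
     "\<forall>x\<in>\<Omega>. (\<lambda>j::nat. \<psi> j x) \<longlonglongrightarrow> W x"
     "AE x in lebesgue_on \<Omega>. (\<lambda>j. grad (\<psi> j) x) \<longlonglongrightarrow> grad W x"
    using trunc_approximation[OF \<Omega> W F(1) F'] by (elim exE conjE) (rule that)
  note \<psi> = \<psi>0(1-4)[rule_format] \<psi>0(5)
  interpret finite_measure "lebesgue_on \<Omega>" by (rule finite_measure_bounded_open[OF \<Omega>])
  have mW: "W \<in> borel_measurable (lebesgue_on \<Omega>)"
    using Ck_on_continuous[OF \<Omega>(1) W, of "[]"] by (intro continuous_on_measurable[OF \<Omega>(1)]) simp
  have mG: "grad W \<in> borel_measurable (lebesgue_on \<Omega>)"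
    by (intro continuous_on_measurable[OF \<Omega>(1)] continuous_on_grad[OF \<Omega>(1) W])
  have mp: "\<psi> j \<in> borel_measurable (lebesgue_on \<Omega>)" for j
    by (intro continuous_on_measurable[OF \<Omega>(1)] continuous_on_subset[OF test_fun_props(2)[OF \<psi>(1) \<Omega>(2)]]) auto
  have mgp: "grad (\<psi> j) \<in> borel_measurable (lebesgue_on \<Omega>)" for j
    by (intro continuous_on_measurable[OF \<Omega>(1)] continuous_on_subset[OF test_fun_props(3)[OF \<psi>(1) \<Omega>(2)]]) auto
  have 1: "(\<lambda>j. LINT x|lebesgue_on \<Omega>. (\<psi> j x - W x)\<^sup>2) \<longlonglongrightarrow> (LINT x|lebesgue_on \<Omega>. 0)"
  proof (rule integral_dominated_convergence[where w = "\<lambda>x. (2 * B)\<^sup>2"])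
    show "AE x in lebesgue_on \<Omega>. (\<lambda>j. (\<psi> j x - W x)\<^sup>2) \<longlonglongrightarrow> 0"
    proof (rule AE_I2)
      fix x assume "x \<in> space (lebesgue_on \<Omega>)"
      then have "(\<lambda>j. (\<psi> j x - W x)\<^sup>2) \<longlonglongrightarrow> (W x - W x)\<^sup>2" by (intro tendsto_intros \<psi>(4)) simp
      then show "(\<lambda>j. (\<psi> j x - W x)\<^sup>2) \<longlonglongrightarrow> 0" by simp
    qed
    show "AE x in lebesgue_on \<Omega>. norm ((\<psi> j x - W x)\<^sup>2) \<le> (2 * B)\<^sup>2" for j
    proof (rule AE_I2)
      fix x assume "x \<in> space (lebesgue_on \<Omega>)"
      then have x: "x \<in> \<Omega>" by simp
      have "\<bar>\<psi> j x - W x\<bar> \<le> 2 * B" using \<psi>(2)[OF x, of j] B(1)[OF x] by linarith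
      then have "\<bar>\<psi> j x - W x\<bar>\<^sup>2 \<le> (2 * B)\<^sup>2" by (intro power_mono) auto
      then show "norm ((\<psi> j x - W x)\<^sup>2) \<le> (2 * B)\<^sup>2" by simp
    qed
  qed (use mW mp in auto)
  have 2: "(\<lambda>j. LINT x|lebesgue_on \<Omega>. (norm (grad (\<psi> j) x - grad W x))\<^sup>2) \<longlonglongrightarrow> (LINT x|lebesgue_on \<Omega>. 0)"
  proof (rule integral_dominated_convergence[where w = "\<lambda>x. (10 * B)\<^sup>2"])
    show "AE x in lebesgue_on \<Omega>. (\<lambda>j. (norm (grad (\<psi> j) x - grad W x))\<^sup>2) \<longlonglongrightarrow> 0"
      using \<psi>(5)
    proof (rule AE_mp, intro AE_I2 impI)
      fix x assume "(\<lambda>j. grad (\<psi> j) x) \<longlonglongrightarrow> grad W x"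
      then have "(\<lambda>j. (norm (grad (\<psi> j) x - grad W x))\<^sup>2) \<longlonglongrightarrow> (norm (grad W x - grad W x))\<^sup>2"
        by (intro tendsto_intros)
      then show "(\<lambda>j. (norm (grad (\<psi> j) x - grad W x))\<^sup>2) \<longlonglongrightarrow> 0" by simp
    qed
    show "AE x in lebesgue_on \<Omega>. norm ((norm (grad (\<psi> j) x - grad W x))\<^sup>2) \<le> (10 * B)\<^sup>2" for j
    proof (rule AE_I2)
      fix x assume "x \<in> space (lebesgue_on \<Omega>)"
      then have x: "x \<in> \<Omega>" by simp
      have "norm (grad (\<psi> j) x - grad W x) \<le> 10 * B"
        using norm_triangle_ineq4[of "grad (\<psi> j) x" "grad W x"] \<psi>(3)[OF x, of j] B(2)[OF x] by linarith
      then have "(norm (grad (\<psi> j) x - grad W x))\<^sup>2 \<le> (10 * B)\<^sup>2" by (intro power_mono) auto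
      then show "norm ((norm (grad (\<psi> j) x - grad W x))\<^sup>2) \<le> (10 * B)\<^sup>2" by simp
    qed
  qed (use mG mgp in auto)
  have "(\<lambda>j. (LINT x|lebesgue_on \<Omega>. (\<psi> j x - W x)\<^sup>2)
       + (LINT x|lebesgue_on \<Omega>. (norm (grad (\<psi> j) x - grad W x))\<^sup>2)) \<longlonglongrightarrow> 0"
    using tendsto_add[OF 1 2] by simp
  then show "\<exists>\<psi>. (\<forall>j::nat. test_fun \<Omega> (\<psi> j)) \<and>
        (\<lambda>j. (LINT x|lebesgue_on \<Omega>. (\<psi> j x - W x)\<^sup>2) +
             (LINT x|lebesgue_on \<Omega>. (norm (grad (\<psi> j) x - grad W x))\<^sup>2)) \<longlonglongrightarrow> 0"
    using \<psi>(1) by blast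
qed

section \<open>Functions with vanishing Cauchy data\<close>

text \<open>The endpoints may lie on the boundary, where \<open>W\<close> is only continuous; hence
  differentiability is asked on the open segment alone, and the reference slope \<open>p\<close> can
  be the boundary value of the gradient.\<close>

lemma segment_increment_bound:
  fixes W :: "real^'n \<Rightarrow> real"
  assumes d: "\<And>s. 0 < s \<Longrightarrow> s < 1 \<Longrightarrow> W differentiable (at (a + s *\<^sub>R (b - a)))"
    and g: "\<And>s. 0 < s \<Longrightarrow> s < 1 \<Longrightarrow> norm (grad W (a + s *\<^sub>R (b - a)) - p) \<le> \<kappa>"
    and c: "continuous_on ((\<lambda>s. a + s *\<^sub>R (b - a)) ` {0..1}) W"
  shows "\<bar>W b - W a - p \<bullet> (b - a)\<bar> \<le> \<kappa> * norm (b - a)"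
proof -
  let ?f = "\<lambda>s. W (a + s *\<^sub>R (b - a)) - s * (p \<bullet> (b - a))"
  have cont: "continuous_on {0..1} ?f"
    by (intro continuous_intros continuous_on_compose2[OF c]) auto
  have der: "(?f has_real_derivative (grad W (a + s *\<^sub>R (b - a)) - p) \<bullet> (b - a)) (at s)" if "0 < s" "s < 1" for s
  proof -
    have "((\<lambda>s. W (a + s *\<^sub>R (b - a))) has_real_derivative grad W (a + s *\<^sub>R (b - a)) \<bullet> (b - a)) (at s)"
      using has_real_derivative_along_line[OF d[OF that]] nderiv_grad[OF d[OF that]] by simp
    then show ?thesis unfolding inner_diff_left by (auto intro!: derivative_eq_intros)
  qed
  have diff: "?f differentiable (at s)" if "0 < s" "s < 1" for s
    using der[OF that] real_differentiable_def by blast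
  have "\<exists>l s. 0 < s \<and> s < 1 \<and> (?f has_real_derivative l) (at s) \<and> ?f 1 - ?f 0 = (1 - 0) * l"
    by (rule MVT[OF zero_less_one cont]) (rule diff)
  then obtain l s where ls: "0 < s" "s < 1" "(?f has_real_derivative l) (at s)" "?f 1 - ?f 0 = (1 - 0) * l"
    by (elim exE conjE) (rule that)
  have "l = (grad W (a + s *\<^sub>R (b - a)) - p) \<bullet> (b - a)" by (rule DERIV_unique[OF ls(3) der[OF ls(1,2)]])
  then have "W b - W a - p \<bullet> (b - a) = (grad W (a + s *\<^sub>R (b - a)) - p) \<bullet> (b - a)" using ls(4) by simp
  with ls(1,2) obtain s where s: "0 < s" "s < 1"
    "W b - W a - p \<bullet> (b - a) = (grad W (a + s *\<^sub>R (b - a)) - p) \<bullet> (b - a)" ..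
  have "\<bar>(grad W (a + s *\<^sub>R (b - a)) - p) \<bullet> (b - a)\<bar> \<le> norm (grad W (a + s *\<^sub>R (b - a)) - p) * norm (b - a)"
    by (rule Cauchy_Schwarz_ineq2)
  also have "\<dots> \<le> \<kappa> * norm (b - a)" using g[OF s(1,2)] by (intro mult_right_mono) auto
  finally show ?thesis using s(3) by simp
qed

section \<open>Boundary graphs and first order behaviour at boundary points\<close>

lemma bdry_graphD:
  assumes "bdry_graph \<Omega> x0 e r \<gamma>"
  shows "norm e = 1" and "0 < r" and "\<gamma> (x + t *\<^sub>R e) = \<gamma> x"
    and "\<Omega> \<inter> ball x0 r = {x \<in> ball x0 r. \<gamma> x < x \<bullet> e}"
proof -
  note g = assms[unfolded bdry_graph_def]
  show "norm e = 1" using g by (elim conjE)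
  show "0 < r" using g by (elim conjE)
  show "\<gamma> (x + t *\<^sub>R e) = \<gamma> x" using g by (elim conjE allE)
  show "\<Omega> \<inter> ball x0 r = {x \<in> ball x0 r. \<gamma> x < x \<bullet> e}" using g by (elim conjE)
qed

text \<open>A point strictly below the graph has a neighbourhood below it, so it is not in the
  closure of \<open>\<Omega>\<close>; a point on the graph enters \<open>\<Omega>\<close> when moved
  slightly along \<open>e\<close>.\<close>

lemma bdry_graph_frontier:
  assumes \<Omega>: "open \<Omega>" and g: "bdry_graph \<Omega> x0 e r \<gamma>" and y: "y \<in> ball x0 r" and c: "isCont \<gamma> y"
  shows "y \<in> frontier \<Omega> \<longleftrightarrow> \<gamma> y = y \<bullet> e"
proof -
  note G = bdry_graphD[OF g]
  have ee: "e \<bullet> e = 1" using G(1) by (simp add: dot_square_norm)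
  have mem: "x \<in> \<Omega> \<longleftrightarrow> \<gamma> x < x \<bullet> e" if "x \<in> ball x0 r" for x using G(4) that by blast
  have ob: "open (ball x0 r)" by simp
  obtain \<delta> where \<delta>: "\<delta> > 0" "ball y \<delta> \<subseteq> ball x0 r" using ob y open_contains_ball by blast
  show ?thesis
  proof
    assume f: "y \<in> frontier \<Omega>"
    then have "y \<notin> \<Omega>" using \<Omega> by (simp add: frontier_def interior_open)
    then have 1: "y \<bullet> e \<le> \<gamma> y" using mem[OF y] by simp
    have yc: "y \<in> closure \<Omega>" using f by (simp add: frontier_def)
    have "\<not> y \<bullet> e < \<gamma> y"
    proof
      assume lt: "y \<bullet> e < \<gamma> y"
      have "isCont (\<lambda>x. \<gamma> x - x \<bullet> e) y" using c by (intro continuous_intros)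
      then have "\<forall>\<^sub>F x in at y. 0 < \<gamma> x - x \<bullet> e"
        using lt by (intro order_tendstoD(1)[where y="\<gamma> y - y \<bullet> e"]) (auto simp: isCont_def)
      then obtain d where d: "d > 0" "\<And>x. x \<noteq> y \<Longrightarrow> dist x y < d \<Longrightarrow> 0 < \<gamma> x - x \<bullet> e"
        unfolding eventually_at by auto
      obtain z where z: "z \<in> \<Omega>" "dist z y < min d \<delta>"
        using yc closure_approachable[of y \<Omega>] d(1) \<delta>(1) by (meson min_less_iff_conj)
      have "z \<noteq> y" using z(1) \<open>y \<notin> \<Omega>\<close> by auto
      then have "0 < \<gamma> z - z \<bullet> e" using d(2)[of z] z(2) by simp
      moreover have "z \<in> ball x0 r" using z(2) \<delta>(2) by (auto simp: subset_iff dist_commute)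
      ultimately show False using mem z(1) by force
    qed
    then show "\<gamma> y = y \<bullet> e" using 1 by simp
  next
    assume eq: "\<gamma> y = y \<bullet> e"
    have "y \<notin> \<Omega>" using mem[OF y] eq by simp
    moreover have "y \<in> closure \<Omega>"
      unfolding closure_approachable
    proof (intro allI impI)
      fix \<epsilon> :: real assume \<epsilon>: "0 < \<epsilon>"
      define t where "t = min \<epsilon> \<delta> / 2"
      have t: "t > 0" "t < \<epsilon>" "t < \<delta>" using \<epsilon> \<delta>(1) by (auto simp: t_def)
      have "y + t *\<^sub>R e \<in> ball x0 r" using \<delta>(2) t G(1) by (auto simp: subset_iff dist_norm)
      then have "y + t *\<^sub>R e \<in> \<Omega>" using mem t eq G(3)[of y t] by (simp add: inner_add_left ee)
      then show "\<exists>z\<in>\<Omega>. dist z y < \<epsilon>" using t G(1) by (intro bexI) (auto simp: dist_norm)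
    qed
    ultimately show "y \<in> frontier \<Omega>" using \<Omega> by (simp add: frontier_def interior_open)
  qed
qed

text \<open>The partial derivatives extend continuously to the compact closed ball and are bounded;
  convexity of the ball makes the bound a Lipschitz constant.\<close>

lemma Ck_closure_1_local:
  fixes \<gamma> :: "real^'n \<Rightarrow> real"
  assumes \<gamma>: "Ck_closure 1 (ball x0 r) \<gamma>" and r: "0 < r"
  obtains L where "0 \<le> L" "\<And>y z. y \<in> ball x0 r \<Longrightarrow> z \<in> ball x0 r \<Longrightarrow> \<bar>\<gamma> y - \<gamma> z\<bar> \<le> L * norm (y - z)"
proof -
  have ck: "Ck_on 1 (ball x0 r) \<gamma>" using \<gamma> by (rule Ck_closure_imp_Ck_on)
  have d: "\<gamma> differentiable (at x)" if "x \<in> ball x0 r" for x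
    using Ck_on_differentiable[OF open_ball ck, of "[]" x] that by simp
  have "\<exists>B\<ge>0. \<forall>x\<in>ball x0 r. \<bar>grad \<gamma> x $ i\<bar> \<le> B" for i
  proof -
    have "has_cext (ball x0 r) (nderiv [axis i 1] \<gamma>)" by (rule Ck_closure_cext[OF open_ball \<gamma>]) simp
    then obtain B where "B \<ge> 0" "\<And>x. x \<in> ball x0 r \<Longrightarrow> \<bar>nderiv [axis i 1] \<gamma> x\<bar> \<le> B"
      by (rule has_cext_bounded) auto
    then show ?thesis by (intro exI[of _ B]) (auto simp: grad_def simp del: nderiv.simps)
  qed
  then obtain B where B: "\<And>i. B i \<ge> 0" "\<And>i x. x \<in> ball x0 r \<Longrightarrow> \<bar>grad \<gamma> x $ i\<bar> \<le> B i" by metis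
  let ?L = "sum B UNIV"
  have n: "norm (grad \<gamma> x) \<le> ?L" if "x \<in> ball x0 r" for x
    using norm_le_l1_cart[of "grad \<gamma> x"] sum_mono[of UNIV "\<lambda>i. \<bar>grad \<gamma> x $ i\<bar>" B] B(2)[OF that] by fastforce
  have "\<bar>\<gamma> y - \<gamma> z\<bar> \<le> ?L * norm (y - z)" if y: "y \<in> ball x0 r" and z: "z \<in> ball x0 r" for y z
  proof -
    have seg: "z + s *\<^sub>R (y - z) \<in> ball x0 r" if "0 \<le> s" "s \<le> 1" for s
      using convexD_alt[OF convex_ball z y that] by (simp add: algebra_simps)
    have cb: "continuous_on (ball x0 r) \<gamma>"
      using Ck_on_continuous[OF open_ball ck, of "[]"] by simp
    have "\<bar>\<gamma> y - \<gamma> z - 0 \<bullet> (y - z)\<bar> \<le> ?L * norm (y - z)"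
      by (rule segment_increment_bound)
         (use seg d n in \<open>auto intro!: continuous_on_subset[OF cb]\<close>)
    then show ?thesis by simp
  qed
  then show thesis using that[of ?L] B(1) by (simp add: sum_nonneg)
qed

text \<open>A function vanishing on the boundary has, up to the boundary, a first order expansion at boundary
  points: two points over the Lipschitz graph are joined inside \<open>\<Omega>\<close> by going up, across and down.\<close>

lemma boundary_expansion:
  fixes W :: "real^'n \<Rightarrow> real" and P :: "real^'n \<Rightarrow> real^'n"
  assumes \<Omega>: "open \<Omega>" and g: "bdry_graph \<Omega> x0 e r \<gamma>"
    and L: "0 \<le> L" "\<And>y z. y \<in> ball x0 r \<Longrightarrow> z \<in> ball x0 r \<Longrightarrow> \<bar>\<gamma> y - \<gamma> z\<bar> \<le> L * norm (y - z)"
    and x0: "x0 \<in> frontier \<Omega>"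
    and W: "\<And>x. x \<in> \<Omega> \<Longrightarrow> W differentiable (at x)" "continuous_on (closure \<Omega>) W"
      "\<And>x. x \<in> frontier \<Omega> \<Longrightarrow> W x = 0"
    and P: "continuous_on (closure \<Omega>) P" "\<And>x. x \<in> \<Omega> \<Longrightarrow> P x = grad W x"
    and \<kappa>: "0 < \<kappa>"
  shows "\<exists>\<sigma>>0. \<forall>y\<in>frontier \<Omega>. norm (y - x0) < \<sigma> \<longrightarrow> \<bar>P x0 \<bullet> (y - x0)\<bar> \<le> \<kappa> * (2 * L + 5) * norm (y - x0)"
proof -
  note G = bdry_graphD[OF g]
  have ee: "e \<bullet> e = 1" using G(1) by (simp add: dot_square_norm)
  have mem: "x \<in> \<Omega>" if "x \<in> ball x0 r" "\<gamma> x < x \<bullet> e" for x using G(4) that by blast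
  have cont: "isCont \<gamma> y" if y: "y \<in> ball x0 r" for y
  proof -
    have "L-lipschitz_on (ball x0 r) \<gamma>"
      using L by (intro lipschitz_onI) (auto simp: dist_norm)
    then have "continuous_on (ball x0 r) \<gamma>" by (rule lipschitz_on_continuous_on)
    then show ?thesis using y continuous_on_eq_continuous_at[OF open_ball] by blast
  qed
  have x0c: "x0 \<in> closure \<Omega>" using x0 by (simp add: frontier_def)
  obtain \<rho> where \<rho>: "\<rho> > 0" "\<And>y. y \<in> closure \<Omega> \<Longrightarrow> dist y x0 < \<rho> \<Longrightarrow> dist (P y) (P x0) < \<kappa>"
    using P(1) x0c \<kappa> unfolding continuous_on_iff by meson
  \<comment> \<open>With \<open>d\<close> the distance to \<open>y\<close> and ascent
    \<open>(L + 2) * d\<close>, this keeps the path well inside the radius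
    \<open>min \<rho> r\<close>: \<open>(L + 4) * d\<close> is one \<open>d\<close> more than its
    excursion can reach.\<close>
  define \<sigma> where "\<sigma> = min \<rho> r / (L + 4)"
  have \<sigma>: "\<sigma> > 0" using \<rho>(1) G(2) L(1) by (simp add: \<sigma>_def)
  show ?thesis
  proof (intro exI[of _ \<sigma>] conjI ballI impI \<sigma>)
    fix y assume y: "y \<in> frontier \<Omega>" and yn: "norm (y - x0) < \<sigma>"
    define d where "d = norm (y - x0)"
    \<comment> \<open>Between \<open>x0\<close> and \<open>y\<close> the graph rises by at most
      \<open>L * d\<close> and the coordinate along \<open>e\<close> drops by at most
      \<open>d\<close>; ascending by \<open>(L + 2) * d\<close> clears the graph with a
      margin.\<close>
    define K where "K = L + 2"
    have d0: "d \<ge> 0" by (simp add: d_def)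
    show "\<bar>P x0 \<bullet> (y - x0)\<bar> \<le> \<kappa> * (2 * L + 5) * norm (y - x0)"
    proof (cases "d = 0")
      case False
      then have dp: "d > 0" using d0 by simp
      have Kd: "(K + 1) * d + d < min \<rho> r"
        using yn L(1) by (simp add: K_def d_def \<sigma>_def less_divide_eq algebra_simps)
      have near: "x0 + s *\<^sub>R (y - x0) + t *\<^sub>R e \<in> ball x0 (min \<rho> r)" if "0 \<le> s" "s \<le> 1" "0 \<le> t" "t \<le> K * d" for s t
      proof -
        have "norm (s *\<^sub>R (y - x0) + t *\<^sub>R e) \<le> s * d + t"
          using norm_triangle_ineq[of "s *\<^sub>R (y - x0)" "t *\<^sub>R e"] that G(1) by (simp add: d_def)
        also have "\<dots> \<le> d + K * d" using that d0 by (intro add_mono mult_left_le_one_le) auto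
        also have "\<dots> < min \<rho> r" using Kd dp by (simp add: algebra_simps)
        finally show ?thesis by (simp add: dist_norm algebra_simps norm_minus_commute)
      qed
      have yb: "y \<in> ball x0 r" using near[of 1 0] dp L(1) by (auto simp: K_def)
      have gx: "\<gamma> x0 = x0 \<bullet> e" using bdry_graph_frontier[OF \<Omega> g _ cont] x0 G(2) by simp
      have gy: "\<gamma> y = y \<bullet> e" using bdry_graph_frontier[OF \<Omega> g yb cont[OF yb]] y by simp
      have inside: "x0 + s *\<^sub>R (y - x0) + t *\<^sub>R e \<in> \<Omega>"
        if "0 \<le> s" "s \<le> 1" "0 < t" "t \<le> K * d" "s = 0 \<or> s = 1 \<or> t = K * d" for s t
      proof (rule mem)
        show "x0 + s *\<^sub>R (y - x0) + t *\<^sub>R e \<in> ball x0 r" using near[of s t] that by simp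
        have b: "x0 + s *\<^sub>R (y - x0) \<in> ball x0 r" using near[of s 0] that dp L(1) by (simp add: K_def)
        have le: "\<gamma> (x0 + s *\<^sub>R (y - x0)) \<le> \<gamma> x0 + L * (s * d)"
          using L(2)[OF b, of x0] G(2) that by (simp add: d_def)
        have "- d \<le> (y - x0) \<bullet> e" using Cauchy_Schwarz_ineq2[of "y - x0" e] G(1) by (simp add: d_def)
        then have "s * (- d) \<le> s * ((y - x0) \<bullet> e)" using that(1) by (intro mult_left_mono)
        then have i: "- (s * d) \<le> s * ((y - x0) \<bullet> e)" by simp
        have "\<gamma> (x0 + s *\<^sub>R (y - x0)) < x0 \<bullet> e + s * ((y - x0) \<bullet> e) + t"
        proof -
          from that(5) show ?thesis
          proof (elim disjE)
            assume "s = 0" then show ?thesis using gx that by simp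
          next
            assume "s = 1" then show ?thesis using gy that by (simp add: inner_diff_left)
          next
            assume 3: "t = K * d"
            have "s * d \<le> d" using that d0 by (intro mult_left_le_one_le) auto
            moreover have "L * (s * d) \<le> L * d" using calculation L(1) by (rule mult_left_mono)
            moreover have "t = L * d + 2 * d" using 3 by (simp add: K_def algebra_simps)
            ultimately show ?thesis using le i gx dp by linarith
          qed
        qed
        then show "\<gamma> (x0 + s *\<^sub>R (y - x0) + t *\<^sub>R e) < (x0 + s *\<^sub>R (y - x0) + t *\<^sub>R e) \<bullet> e"
          unfolding G(3) by (simp add: inner_add_left ee)
      qed
      have bound: "\<bar>W b - W a - P x0 \<bullet> (b - a)\<bar> \<le> \<kappa> * norm (b - a)"
        if i: "\<And>s. 0 < s \<Longrightarrow> s < 1 \<Longrightarrow> a + s *\<^sub>R (b - a) \<in> \<Omega> \<inter> ball x0 \<rho>"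
          and c: "a \<in> closure \<Omega>" "b \<in> closure \<Omega>" for a b
      proof (rule segment_increment_bound)
        show "W differentiable at (a + s *\<^sub>R (b - a))" if "0 < s" "s < 1" for s using i[OF that] W(1) by blast
        show "norm (grad W (a + s *\<^sub>R (b - a)) - P x0) \<le> \<kappa>" if "0 < s" "s < 1" for s
        proof -
          let ?z = "a + s *\<^sub>R (b - a)"
          have z: "?z \<in> \<Omega>" "dist ?z x0 < \<rho>" using i[OF that] by (simp_all add: dist_commute)
          have "dist (P ?z) (P x0) < \<kappa>" using z closure_subset by (intro \<rho>(2)) blast
          then show ?thesis by (simp only: P(2)[OF z(1)] dist_norm less_imp_le)
        qed
        have "a + s *\<^sub>R (b - a) \<in> closure \<Omega>" if "s \<in> {0..1}" for s
        proof (cases "s = 0 \<or> s = 1")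
          case False
          then show ?thesis using i[of s] that closure_subset[of \<Omega>] by auto
        qed (use c in auto)
        then show "continuous_on ((\<lambda>s. a + s *\<^sub>R (b - a)) ` {0..1}) W"
          by (intro continuous_on_subset[OF W(2)]) auto
      qed
      let ?t = "K * d"
      have t: "?t > 0" using dp L(1) by (simp add: K_def)
      have yc: "y \<in> closure \<Omega>" using y by (simp add: frontier_def)
      have oc: "x \<in> \<Omega> \<Longrightarrow> x \<in> closure \<Omega>" for x using closure_subset by blast
      have in2: "x0 + s *\<^sub>R (y - x0) + t *\<^sub>R e \<in> \<Omega> \<inter> ball x0 \<rho>"
        if "0 \<le> s" "s \<le> 1" "0 < t" "t \<le> K * d" "s = 0 \<or> s = 1 \<or> t = K * d" for s t
        using inside[OF that] near[of s t] that by auto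
      let ?a = "x0 + ?t *\<^sub>R e" and ?b = "y + ?t *\<^sub>R e"
      have ac: "?a \<in> closure \<Omega>" and bc: "?b \<in> closure \<Omega>"
        using oc in2[of 0 ?t] in2[of 1 ?t] t by auto
      have 1: "\<bar>W ?a - W x0 - P x0 \<bullet> (?a - x0)\<bar> \<le> \<kappa> * norm (?a - x0)"
      proof (rule bound[OF _ x0c ac])
        fix s :: real assume s: "0 < s" "s < 1"
        then have "0 < s * ?t" "s * ?t \<le> ?t" using t by (auto intro: mult_left_le_one_le)
        then show "x0 + s *\<^sub>R (?a - x0) \<in> \<Omega> \<inter> ball x0 \<rho>" using in2[of 0 "s * ?t"] by simp
      qed
      have 2: "\<bar>W ?b - W ?a - P x0 \<bullet> (?b - ?a)\<bar> \<le> \<kappa> * norm (?b - ?a)"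
      proof (rule bound[OF _ ac bc])
        fix s :: real assume s: "0 < s" "s < 1"
        have "?a + s *\<^sub>R (?b - ?a) = x0 + s *\<^sub>R (y - x0) + ?t *\<^sub>R e" by (simp add: algebra_simps)
        moreover have "x0 + s *\<^sub>R (y - x0) + ?t *\<^sub>R e \<in> \<Omega> \<inter> ball x0 \<rho>"
          by (rule in2) (use s t in auto)
        ultimately show "?a + s *\<^sub>R (?b - ?a) \<in> \<Omega> \<inter> ball x0 \<rho>" by (simp only:)
      qed
      have 3: "\<bar>W ?b - W y - P x0 \<bullet> (?b - y)\<bar> \<le> \<kappa> * norm (?b - y)"
      proof (rule bound[OF _ yc bc])
        fix s :: real assume s: "0 < s" "s < 1"
        then have "0 < s * ?t" "s * ?t \<le> ?t" using t by (auto intro: mult_left_le_one_le)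
        then show "y + s *\<^sub>R (?b - y) \<in> \<Omega> \<inter> ball x0 \<rho>" using in2[of 1 "s * ?t"] by simp
      qed
      have n: "norm (?a - x0) = ?t" "norm (?b - y) = ?t" "norm (?b - ?a) = d"
        using t G(1) by (auto simp: d_def)
      have z: "W x0 = 0" "W y = 0" using W(3) x0 y by auto
      have s: "P x0 \<bullet> (y - x0) = P x0 \<bullet> (?a - x0) + P x0 \<bullet> (?b - ?a) - P x0 \<bullet> (?b - y)"
        by (simp add: algebra_simps)
      have "\<bar>P x0 \<bullet> (y - x0)\<bar> \<le> \<kappa> * ?t + \<kappa> * d + \<kappa> * ?t"
        using 1 2 3 unfolding n z s by linarith
      \<comment> \<open>Two vertical pieces of length \<open>K * d\<close> and a horizontal one of
        length \<open>d\<close>: \<open>2 * K + 1 = 2 * L + 5\<close>.\<close>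
      also have "\<dots> = \<kappa> * (2 * L + 5) * d" by (simp add: K_def algebra_simps)
      finally show ?thesis by (simp add: d_def)
    qed (simp add: d_def)
  qed
qed

text \<open>Split \<open>P x0\<close> into its part \<open>p\<close> along \<open>e\<close> and the
  orthogonal part \<open>\<tau>\<close>. A boundary curve with initial direction
  \<open>\<tau>\<close> has the tangent \<open>?z\<close>, and \<open>W = 0\<close> along it forces
  \<open>P x0 \<bullet> ?z = 0\<close>. Together with the normal condition this reads
  \<open>\<tau> \<bullet> \<tau> + p * p = 0\<close>, so no basis of tangent vectors has to be
  chosen.\<close>

lemma boundary_gradient_zero:
  fixes W :: "real^'n \<Rightarrow> real" and P :: "real^'n \<Rightarrow> real^'n"
  assumes \<Omega>: "open \<Omega>" and g: "bdry_graph \<Omega> x0 e r \<gamma>" and \<gamma>: "Ck_closure 1 (ball x0 r) \<gamma>"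
    and x0: "x0 \<in> frontier \<Omega>"
    and W: "\<And>x. x \<in> \<Omega> \<Longrightarrow> W differentiable (at x)" "continuous_on (closure \<Omega>) W"
      "\<And>x. x \<in> frontier \<Omega> \<Longrightarrow> W x = 0"
    and P: "continuous_on (closure \<Omega>) P" "\<And>x. x \<in> \<Omega> \<Longrightarrow> P x = grad W x"
    and normal: "(grad \<gamma> x0 - e) \<bullet> P x0 = 0"
  shows "P x0 = 0"
proof -
  note G = bdry_graphD[OF g]
  have ee: "e \<bullet> e = 1" using G(1) by (simp add: dot_square_norm)
  have ck: "Ck_on 1 (ball x0 r) \<gamma>" using \<gamma> by (rule Ck_closure_imp_Ck_on)
  have d: "\<gamma> differentiable (at x)" if "x \<in> ball x0 r" for x
    using Ck_on_differentiable[OF open_ball ck, of "[]" x] that by simp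
  have x0b: "x0 \<in> ball x0 r" using G(2) by simp
  have line: "((\<lambda>s. \<gamma> (x0 + s *\<^sub>R v)) has_real_derivative grad \<gamma> x0 \<bullet> v) (at 0)" for v
    using has_real_derivative_along_line[of \<gamma> x0 0 v] nderiv_grad[of \<gamma> x0 v] d[OF x0b] by simp
  have "grad \<gamma> x0 \<bullet> e = 0"
    using DERIV_unique[OF line[of e]] G(3)[of x0] by simp
  obtain L where L: "0 \<le> L" "\<And>y z. y \<in> ball x0 r \<Longrightarrow> z \<in> ball x0 r \<Longrightarrow> \<bar>\<gamma> y - \<gamma> z\<bar> \<le> L * norm (y - z)"
    using Ck_closure_1_local[OF \<gamma> G(2)] by blast
  have cg: "isCont \<gamma> y" if "y \<in> ball x0 r" for y
    using d[OF that] differentiable_imp_continuous_within by blast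
  have gx: "\<gamma> x0 = x0 \<bullet> e" using bdry_graph_frontier[OF \<Omega> g x0b cg[OF x0b]] x0 by simp
  define p where "p = P x0 \<bullet> e"
  define \<tau> where "\<tau> = P x0 - p *\<^sub>R e"
  have te: "\<tau> \<bullet> e = 0" by (simp add: \<tau>_def inner_diff_left p_def ee)
  \<comment> \<open>The straight line in direction \<open>\<tau>\<close>, lifted back onto the graph
    along \<open>e\<close>; invariance of \<open>\<gamma>\<close> under shifts along
    \<open>e\<close> puts it on the frontier.\<close>
  let ?y = "\<lambda>s. x0 + s *\<^sub>R \<tau> + (\<gamma> (x0 + s *\<^sub>R \<tau>) - \<gamma> x0) *\<^sub>R e"
  let ?z = "\<tau> + (grad \<gamma> x0 \<bullet> \<tau>) *\<^sub>R e"
  have q: "((\<lambda>s. (?y s - x0) /\<^sub>R s) \<longlongrightarrow> ?z) (at 0)"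
  proof -
    have "((\<lambda>s. (\<gamma> (x0 + s *\<^sub>R \<tau>) - \<gamma> x0) / s) \<longlongrightarrow> grad \<gamma> x0 \<bullet> \<tau>) (at 0)"
      using line[of \<tau>] by (simp add: DERIV_def)
    then have "((\<lambda>s. \<tau> + ((\<gamma> (x0 + s *\<^sub>R \<tau>) - \<gamma> x0) / s) *\<^sub>R e) \<longlongrightarrow> ?z) (at 0)"
      by (intro tendsto_intros)
    then show ?thesis
      by (rule Lim_transform_eventually)
         (auto simp: eventually_at_filter algebra_simps divide_inverse_commute)
  qed
  have y0: "(?y \<longlongrightarrow> x0) (at 0)"
  proof -
    have "((\<lambda>s. x0 + s *\<^sub>R ((?y s - x0) /\<^sub>R s)) \<longlongrightarrow> x0 + 0 *\<^sub>R ?z) (at 0)"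
      by (intro tendsto_intros q)
    then have "((\<lambda>s. x0 + s *\<^sub>R ((?y s - x0) /\<^sub>R s)) \<longlongrightarrow> x0) (at 0)" by simp
    then show ?thesis by (rule Lim_transform_eventually) (auto simp: eventually_at_filter)
  qed
  have fr: "\<forall>\<^sub>F s in at 0. ?y s \<in> frontier \<Omega>"
  proof -
    have "\<forall>\<^sub>F s in at 0. ?y s \<in> ball x0 r"
      using topological_tendstoD[OF y0 open_ball x0b] .
    then show ?thesis
    proof (rule eventually_mono)
      fix s assume b: "?y s \<in> ball x0 r"
      have "\<gamma> (?y s) = \<gamma> (x0 + s *\<^sub>R \<tau>)" by (rule G(3))
      also have "\<dots> = ?y s \<bullet> e" by (simp add: inner_add_left te ee gx)
      finally show "?y s \<in> frontier \<Omega>" using bdry_graph_frontier[OF \<Omega> g b cg[OF b]] by simp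
    qed
  qed
  \<comment> \<open>The boundary expansion divided by the curve parameter. As
    \<open>\<kappa>\<close> is arbitrary, the left-hand side must be 0.\<close>
  have key: "\<bar>P x0 \<bullet> ?z\<bar> \<le> \<kappa> * (2 * L + 5) * norm ?z" if \<kappa>: "\<kappa> > 0" for \<kappa>
  proof (rule tendsto_le)
    obtain \<sigma> where \<sigma>: "\<sigma> > 0" "\<And>y. y \<in> frontier \<Omega> \<Longrightarrow> norm (y - x0) < \<sigma> \<Longrightarrow>
        \<bar>P x0 \<bullet> (y - x0)\<bar> \<le> \<kappa> * (2 * L + 5) * norm (y - x0)"
      using boundary_expansion[OF \<Omega> g L x0 W P \<kappa>] by blast
    have "\<forall>\<^sub>F s in at 0. dist (?y s) x0 < \<sigma>" using tendstoD[OF y0 \<sigma>(1)] .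
    then show "\<forall>\<^sub>F s in at 0. \<bar>P x0 \<bullet> ((?y s - x0) /\<^sub>R s)\<bar> \<le> \<kappa> * (2 * L + 5) * norm ((?y s - x0) /\<^sub>R s)"
      using fr
    proof eventually_elim
      case (elim s)
      have "\<bar>P x0 \<bullet> (?y s - x0)\<bar> \<le> \<kappa> * (2 * L + 5) * norm (?y s - x0)"
        by (rule \<sigma>(2)) (use elim in \<open>auto simp: dist_norm\<close>)
      then have "inverse \<bar>s\<bar> * \<bar>P x0 \<bullet> (?y s - x0)\<bar> \<le> inverse \<bar>s\<bar> * (\<kappa> * (2 * L + 5) * norm (?y s - x0))"
        by (intro mult_left_mono) auto
      then show ?case
        unfolding inner_scaleR_right abs_mult norm_scaleR abs_inverse by (simp only: mult.left_commute)
    qed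
    show "((\<lambda>s. \<bar>P x0 \<bullet> ((?y s - x0) /\<^sub>R s)\<bar>) \<longlongrightarrow> \<bar>P x0 \<bullet> ?z\<bar>) (at 0)" by (intro tendsto_intros q)
    show "((\<lambda>s. \<kappa> * (2 * L + 5) * norm ((?y s - x0) /\<^sub>R s)) \<longlongrightarrow> \<kappa> * (2 * L + 5) * norm ?z) (at 0)"
      by (intro tendsto_intros q)
  qed simp
  have Pz: "P x0 \<bullet> ?z = 0"
  proof (rule ccontr)
    assume ne: "P x0 \<bullet> ?z \<noteq> 0"
    define c where "c = (2 * L + 5) * norm ?z + 1"
    have c: "c > 0" using L(1) by (simp add: c_def add_nonneg_pos)
    have k: "\<bar>P x0 \<bullet> ?z\<bar> / (2 * c) > 0" using ne c by simp
    have "\<bar>P x0 \<bullet> ?z\<bar> \<le> \<bar>P x0 \<bullet> ?z\<bar> / (2 * c) * ((2 * L + 5) * norm ?z)"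
      using key[OF k] by (simp only: mult.assoc)
    also have "\<dots> \<le> \<bar>P x0 \<bullet> ?z\<bar> / (2 * c) * c" using k by (intro mult_left_mono) (auto simp: c_def)
    also have "\<dots> = \<bar>P x0 \<bullet> ?z\<bar> / 2" using c by simp
    finally show False using ne by simp
  qed
  \<comment> \<open>Because \<open>\<gamma>\<close> is constant along \<open>e\<close>, its gradient
    is orthogonal to \<open>e\<close>, and the normal condition reduces to an equation for
    \<open>p\<close>.\<close>
  have pg: "p = grad \<gamma> x0 \<bullet> \<tau>"
    using normal \<open>grad \<gamma> x0 \<bullet> e = 0\<close> by (simp add: \<tau>_def p_def inner_diff_left inner_diff_right inner_commute)
  have "P x0 = \<tau> + p *\<^sub>R e" by (simp add: \<tau>_def)
  then have "P x0 \<bullet> \<tau> = \<tau> \<bullet> \<tau>" using te by (simp only: inner_add_left inner_scaleR_left inner_commute[of e \<tau>])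
  moreover have "P x0 \<bullet> ?z = P x0 \<bullet> \<tau> + p * p"
    unfolding pg[symmetric] inner_add_right inner_scaleR_right p_def ..
  ultimately have "\<tau> \<bullet> \<tau> + p * p = 0" using Pz by linarith
  then have "\<tau> \<bullet> \<tau> = 0 \<and> p * p = 0" using inner_ge_zero[of \<tau>] zero_le_square[of p] by linarith
  then show ?thesis by (simp add: \<tau>_def)
qed

section \<open>Variations of the Monge-Ampere equation\<close>

lemma nderiv_slice:
  fixes f :: "'a::euclidean_space \<times> 'b::euclidean_space \<Rightarrow> real"
  assumes \<Omega>: "open \<Omega>" and f: "Ck_on k (\<Omega> \<times> UNIV) f" and x: "x \<in> \<Omega>" and l: "length vs \<le> k"
  shows "nderiv vs (\<lambda>y. f (x, y)) y = nderiv (map (Pair 0) vs) f (x, y)"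
  using l
proof (induction vs arbitrary: y)
  case (Cons v vs)
  have U: "open (\<Omega> \<times> (UNIV :: 'b set))" using \<Omega> by (intro open_Times) auto
  let ?g = "nderiv (map (Pair 0) vs) f"
  have "?g differentiable (at (x, y))"
    using Cons.prems x by (intro Ck_on_differentiable[OF U f]) auto
  then have "(?g has_derivative frechet_derivative ?g (at (x, y))) (at (x, y))"
    by (simp only: frechet_derivative_works)
  then have "((\<lambda>y. ?g (x, y)) has_derivative (\<lambda>v. frechet_derivative ?g (at (x, y)) (0, v))) (at y)"
    by (rule has_derivative_compose[rotated]) (auto intro!: derivative_eq_intros)
  then have "frechet_derivative (\<lambda>y. ?g (x, y)) (at y) v = frechet_derivative ?g (at (x, y)) (0, v)"
    by (rule frechet_derivative_eqI)
  moreover have "nderiv vs (\<lambda>y. f (x, y)) = (\<lambda>y. ?g (x, y))" using Cons by auto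
  ultimately show ?case by simp
qed simp

lemma Ck_on_slice:
  fixes f :: "'a::euclidean_space \<times> 'b::euclidean_space \<Rightarrow> real"
  assumes \<Omega>: "open \<Omega>" and f: "Ck_on k (\<Omega> \<times> UNIV) f" and x: "x \<in> \<Omega>"
  shows "Ck_on k UNIV (\<lambda>y. f (x, y))"
  unfolding Ck_on_def
proof (intro conjI allI impI ballI)
  have U: "open (\<Omega> \<times> (UNIV :: 'b set))" using \<Omega> by (intro open_Times) auto
  {
    fix r y and vs :: "'b list" assume r: "r < k" and vs: "vs \<in> mindex r"
    let ?g = "nderiv (map (Pair 0) vs) f"
    have l: "length vs = r" using vs by (simp add: mindex_def)
    have "?g differentiable (at (x, y))" using r x l by (intro Ck_on_differentiable[OF U f]) auto
    then obtain D where "(?g has_derivative D) (at (x, y))" by (auto simp: differentiable_def)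
    then have "((\<lambda>y. ?g (x, y)) has_derivative (\<lambda>v. D (0, v))) (at y)"
      by (rule has_derivative_compose[rotated]) (auto intro!: derivative_eq_intros)
    moreover have "nderiv vs (\<lambda>y. f (x, y)) = (\<lambda>y. ?g (x, y))"
      using nderiv_slice[OF \<Omega> f x] l r by auto
    ultimately show "nderiv vs (\<lambda>y. f (x, y)) differentiable (at y)" by (auto simp: differentiable_def)
  next
    fix r and vs :: "'b list" assume r: "r \<le> k" and vs: "vs \<in> mindex r"
    have l: "length vs = r" using vs by (simp add: mindex_def)
    have "continuous_on UNIV (\<lambda>y. nderiv (map (Pair 0) vs) f (x, y))"
      using l r x by (intro continuous_on_compose2[OF Ck_on_continuous[OF U f]] continuous_intros) auto
    moreover have "nderiv vs (\<lambda>y. f (x, y)) = (\<lambda>y. nderiv (map (Pair 0) vs) f (x, y))"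
      using nderiv_slice[OF \<Omega> f x] l r by auto
    ultimately show "continuous_on UNIV (nderiv vs (\<lambda>y. f (x, y)))" by simp
  }
qed

lemma has_cext_nderiv_slice:
  fixes f :: "'a::euclidean_space \<times> 'b::euclidean_space \<Rightarrow> real"
  assumes \<Omega>: "open \<Omega>" and f: "Ck_closure k (\<Omega> \<times> UNIV) f" and J: "has_cext \<Omega> J" and l: "length vs \<le> k"
  shows "has_cext \<Omega> (\<lambda>x. nderiv vs (\<lambda>y. f (x, y)) (J x))"
proof -
  have U: "open (\<Omega> \<times> (UNIV :: 'b set))" using \<Omega> by (intro open_Times) auto
  obtain g where g: "continuous_on (closure (\<Omega> \<times> (UNIV :: 'b set))) g"
    "\<forall>z\<in>\<Omega> \<times> UNIV. g z = nderiv (map (Pair 0) vs) f z"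
    using Ck_closure_cext[OF U f, of "map (Pair 0) vs"] l by (auto simp: has_cext_def)
  obtain J' where J': "continuous_on (closure \<Omega>) J'" "\<forall>x\<in>\<Omega>. J' x = J x" using J by (auto simp: has_cext_def)
  have "continuous_on (closure \<Omega>) (\<lambda>x. g (x, J' x))"
    by (rule continuous_on_compose2[OF g(1)]) (auto intro!: continuous_intros J' simp: closure_Times)
  moreover have "\<forall>x\<in>\<Omega>. g (x, J' x) = nderiv vs (\<lambda>y. f (x, y)) (J x)"
    using g(2) J'(2) nderiv_slice[OF \<Omega> Ck_closure_imp_Ck_on[OF f] _ l] by auto
  ultimately show ?thesis unfolding has_cext_def by (intro exI[of _ "\<lambda>x. g (x, J' x)"] conjI)
qed

lemma continuous_eq_on_closure:
  fixes f g :: "'a::topological_space \<Rightarrow> real"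
  assumes "continuous_on (closure S) f" "continuous_on (closure S) g" "\<And>x. x \<in> S \<Longrightarrow> f x = g x" "x \<in> closure S"
  shows "f x = g x"
proof -
  have "f x - g x = 0"
    by (rule continuous_constant_on_closure[of S "\<lambda>x. f x - g x"]) (use assms in \<open>auto intro!: continuous_intros\<close>)
  then show ?thesis by simp
qed

text \<open>\<open>product_density\<close> asks for multilinear forms on the closed domain. Each
  instance of additivity, homogeneity or symmetry is an equation between continuous functions, valid
  on \<open>\<Omega>\<close> and hence on its closure.\<close>

lemma sym_multilinear_bdry_ext:
  fixes A :: "'x::euclidean_space \<Rightarrow> 'a::real_vector list \<Rightarrow> real"
  assumes A: "\<And>x. x \<in> \<Omega> \<Longrightarrow> sym_multilinear k (A x)"
    and c: "\<And>vs. length vs = k \<Longrightarrow> has_cext \<Omega> (\<lambda>x. A x vs)" and x: "x \<in> closure \<Omega>"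
  shows "sym_multilinear k (\<lambda>vs. bdry_ext \<Omega> (\<lambda>x. A x vs) x)"
proof -
  let ?B = "\<lambda>vs x. bdry_ext \<Omega> (\<lambda>x. A x vs) x"
  have cB: "continuous_on (closure \<Omega>) (?B vs)" if "length vs = k" for vs
    by (rule bdry_ext_continuous[OF c[OF that]])
  have lin: "linear (\<lambda>v. A y (vs[i := v]))" if "y \<in> \<Omega>" "length vs = k" "i < k" for vs i y
    using A[OF that(1)] that(2,3) unfolding sym_multilinear_def by blast
  have "linear (\<lambda>v. ?B (vs[i := v]) x)" if l: "length vs = k" and i: "i < k" for vs i
  proof (rule linearI)
    fix v w
    have c: "continuous_on (closure \<Omega>) (?B (vs[i := u]))" for u using l by (intro cB) simp
    show "?B (vs[i := v + w]) x = ?B (vs[i := v]) x + ?B (vs[i := w]) x"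
    proof (rule continuous_eq_on_closure[OF _ _ _ x])
      show "?B (vs[i := v + w]) y = ?B (vs[i := v]) y + ?B (vs[i := w]) y" if "y \<in> \<Omega>" for y
        using linear_add[OF lin[OF that l i]] by (simp only: bdry_ext_inside[OF that])
    qed (intro continuous_intros c)+
    fix r
    show "?B (vs[i := r *\<^sub>R v]) x = r *\<^sub>R ?B (vs[i := v]) x"
    proof (rule continuous_eq_on_closure[OF _ _ _ x])
      show "?B (vs[i := r *\<^sub>R v]) y = r *\<^sub>R ?B (vs[i := v]) y" if "y \<in> \<Omega>" for y
        using linear_scale[OF lin[OF that l i]] by (simp only: bdry_ext_inside[OF that])
    qed (intro continuous_intros c)+
  qed
  moreover have "?B vs x = ?B ws x" if l: "length vs = k" and m: "mset vs = mset ws" for vs ws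
  proof (rule continuous_eq_on_closure[OF _ _ _ x])
    show "continuous_on (closure \<Omega>) (?B vs)" "continuous_on (closure \<Omega>) (?B ws)"
      using cB l mset_eq_length[OF m] by auto
    show "?B vs y = ?B ws y" if "y \<in> \<Omega>" for y
      using A[OF that] l m unfolding bdry_ext_inside[OF that] sym_multilinear_def by blast
  qed
  ultimately show ?thesis unfolding sym_multilinear_def by blast
qed

text \<open>The \<open>r\<close>-th variation of \<open>det M = a(y)\<close>. Two families of solutions are compared, so that all terms of
  lower order cancel and no higher chain rule is needed.\<close>

lemma MA_variation:
  fixes a1 a2 :: "'a::euclidean_space \<Rightarrow> real" and M1 M2 :: "real \<Rightarrow> real^'n^'n" and y1 y2 :: "real \<Rightarrow> 'a"
  assumes a: "Ck_on k UNIV a1" "Ck_on k UNIV a2" and r: "1 \<le> r" "r \<le> k"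
    and M: "(M1 \<longlongrightarrow> M0) (at 0)" "(M2 \<longlongrightarrow> M0) (at 0)"
    and y: "(y1 \<longlongrightarrow> p) (at 0)" "(y2 \<longlongrightarrow> p) (at 0)"
    and Z: "((\<lambda>t. (M1 t - M2 t) /\<^sub>R t ^ r) \<longlongrightarrow> Z) (at 0)"
    and Y: "((\<lambda>t. (y1 t - y2 t) /\<^sub>R t ^ r) \<longlongrightarrow> Y) (at 0)"
    and v: "((\<lambda>t. (y2 t - p) /\<^sub>R t) \<longlongrightarrow> v) (at 0)"
    and low: "\<And>vs. length vs < r \<Longrightarrow> nderiv vs a1 p = nderiv vs a2 p"
    and eq: "\<forall>\<^sub>F t in at 0. det (M1 t) = a1 (y1 t)" "\<forall>\<^sub>F t in at 0. det (M2 t) = a2 (y2 t)"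
  shows "(\<Sum>i\<in>UNIV. \<Sum>j\<in>UNIV. cof M0 $ i $ j * Z $ i $ j)
     = nderiv [Y] a1 p + (nderiv (replicate r v) a1 p - nderiv (replicate r v) a2 p) / fact r"
proof -
  let ?D = "\<lambda>x. a1 x + (-1) * a2 x"
  have nd: "nderiv vs ?D x = nderiv vs a1 x - nderiv vs a2 x" if "length vs \<le> k" for vs x
    using nderiv_lincomb[OF open_UNIV a that, of x "-1"] by simp
  have D: "Ck_on r UNIV ?D"
    by (rule Ck_on_mono[OF Ck_on_lincomb[OF open_UNIV a] r(2)])
  have cc: "isCont (\<lambda>M. cof M $ i $ j) M0" for i j
    using continuous_on_cof continuous_on_eq_continuous_at[OF open_UNIV] by blast
  have 1: "((\<lambda>t. (det (M1 t) - det (M2 t)) / t ^ r) \<longlongrightarrow> (\<Sum>i\<in>UNIV. \<Sum>j\<in>UNIV. cof M0 $ i $ j * Z $ i $ j)) (at 0)"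
  proof (rule strict_difference_quotient[OF has_derivative_det_cof _ M Z])
    fix \<xi> w :: "real \<Rightarrow> real^'n^'n" assume xi: "(\<xi> \<longlongrightarrow> M0) (at 0)" and w: "(w \<longlongrightarrow> Z) (at 0)"
    have c: "((\<lambda>t. cof (\<xi> t) $ i $ j) \<longlongrightarrow> cof M0 $ i $ j) (at 0)" for i j
      by (rule isCont_tendsto_compose[OF cc xi])
    show "((\<lambda>t. \<Sum>i\<in>UNIV. \<Sum>j\<in>UNIV. cof (\<xi> t) $ i $ j * w t $ i $ j)
        \<longlongrightarrow> (\<Sum>i\<in>UNIV. \<Sum>j\<in>UNIV. cof M0 $ i $ j * Z $ i $ j)) (at 0)"
      by (intro tendsto_sum tendsto_mult c tendsto_vec_nth[OF tendsto_vec_nth[OF w]])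
  qed
  \<comment> \<open>The right-hand sides are compared as \<open>a1 (y1) - a1 (y2)\<close> plus
    \<open>(a1 - a2) (y2)\<close>: the first part sees only the difference of the families, the
    second only the leading Taylor term of \<open>a1 - a2\<close>.\<close>
  have 2: "((\<lambda>t. (a1 (y1 t) - a1 (y2 t)) / t ^ r) \<longlongrightarrow> nderiv [Y] a1 p) (at 0)"
    using r by (intro smooth_difference_quotient[OF a(1) _ y Y]) simp
  have 3: "((\<lambda>t. ?D (y2 t) / t ^ r) \<longlongrightarrow> nderiv (replicate r v) ?D p / fact r) (at 0)"
    by (rule taylor_leading_term[OF D r(1) v y(2)]) (use low nd r in auto)
  have "((\<lambda>t. (det (M1 t) - det (M2 t)) / t ^ r) \<longlongrightarrow> nderiv [Y] a1 p + nderiv (replicate r v) ?D p / fact r) (at 0)"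
  proof (rule Lim_transform_eventually[OF tendsto_add[OF 2 3]])
    show "\<forall>\<^sub>F t in at 0. (a1 (y1 t) - a1 (y2 t)) / t ^ r + ?D (y2 t) / t ^ r = (det (M1 t) - det (M2 t)) / t ^ r"
      using eq by eventually_elim (simp add: diff_divide_distrib)
  qed
  from tendsto_unique[OF _ 1 this] show ?thesis using nd[of "replicate r v"] r by simp
qed

section \<open>Algebra of polarization\<close>

lemma sym_multilinear_append_lincomb:
  assumes T: "sym_multilinear k T" and l: "length us + Suc (length ws) = k"
  shows "T (us @ (u + s *\<^sub>R v) # ws) = T (us @ u # ws) + s * T (us @ v # ws)"
proof -
  have "linear (\<lambda>x. T ((us @ u # ws)[length us := x]))"
    using T l unfolding sym_multilinear_def by (elim conjE allE[of _ "us @ u # ws"] allE[of _ "length us"]) simp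
  then have "linear (\<lambda>x. T (us @ x # ws))" by (simp add: list_update_append)
  then have lin: "linear (\<lambda>x. T (us @ x # ws))" .
  show ?thesis using linear_add[OF lin, of u "s *\<^sub>R v"] linear_scale[OF lin, of s v] by simp
qed

text \<open>The binomial theorem with a fixed prefix \<open>us\<close>. The prefix is what lets the
  induction split off one argument: both summands of the first factor join it, and Pascal's rule
  merges the two sums.\<close>

lemma sym_multilinear_binomial:
  assumes T: "sym_multilinear k T" and l: "length us + n = k"
  shows "T (us @ replicate n (u + s *\<^sub>R v))
     = (\<Sum>i\<le>n. real (n choose i) * s ^ i * T (us @ replicate i v @ replicate (n - i) u))"
  using l
proof (induction n arbitrary: us)
  case (Suc n)
  let ?G = "\<lambda>i. T (us @ replicate i v @ replicate (Suc n - i) u)"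
  have sym: "T xs = T ys" if "mset xs = mset ys" "length xs = k" for xs ys
    using T that unfolding sym_multilinear_def by blast
  have "T (us @ replicate (Suc n) (u + s *\<^sub>R v))
     = T ((us @ [u]) @ replicate n (u + s *\<^sub>R v)) + s * T ((us @ [v]) @ replicate n (u + s *\<^sub>R v))"
    using sym_multilinear_append_lincomb[OF T, of us "replicate n (u + s *\<^sub>R v)" u s v] Suc.prems by simp
  also have "T ((us @ [u]) @ replicate n (u + s *\<^sub>R v))
     = (\<Sum>i\<le>n. real (n choose i) * s ^ i * T ((us @ [u]) @ replicate i v @ replicate (n - i) u))"
    by (rule Suc.IH) (use Suc.prems in simp)
  also have "\<dots> = (\<Sum>i\<le>n. real (n choose i) * s ^ i * ?G i)"
    using Suc.prems by (intro sum.cong refl arg_cong2[where f = "(*)"] sym) (auto simp: Suc_diff_le)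
  \<comment> \<open>The added term is 0 since \<open>n choose Suc n = 0\<close>; the longer range
    allows the index shift that aligns the two sums.\<close>
  also have "\<dots> = (\<Sum>i\<le>Suc n. real (n choose i) * s ^ i * ?G i)" by simp
  also have "\<dots> = ?G 0 + (\<Sum>i\<le>n. real (n choose Suc i) * s ^ Suc i * ?G (Suc i))"
    by (subst sum.atMost_Suc_shift) simp
  also have "T ((us @ [v]) @ replicate n (u + s *\<^sub>R v))
     = (\<Sum>i\<le>n. real (n choose i) * s ^ i * T ((us @ [v]) @ replicate i v @ replicate (n - i) u))"
    by (rule Suc.IH) (use Suc.prems in simp)
  also have "s * \<dots> = (\<Sum>i\<le>n. real (n choose i) * s ^ Suc i * ?G (Suc i))"
    unfolding sum_distrib_left
  proof (intro sum.cong refl)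
    fix i assume "i \<in> {..n}"
    then have "T ((us @ [v]) @ replicate i v @ replicate (n - i) u) = ?G (Suc i)"
      using Suc.prems by (intro sym) auto
    then show "s * (real (n choose i) * s ^ i * T ((us @ [v]) @ replicate i v @ replicate (n - i) u))
        = real (n choose i) * s ^ Suc i * ?G (Suc i)" by (simp only: power_Suc ac_simps)
  qed
  also have "?G 0 + (\<Sum>i\<le>n. real (n choose Suc i) * s ^ Suc i * ?G (Suc i)) + (\<Sum>i\<le>n. real (n choose i) * s ^ Suc i * ?G (Suc i))
     = ?G 0 + (\<Sum>i\<le>n. real (Suc n choose Suc i) * s ^ Suc i * ?G (Suc i))"
    unfolding add.assoc sum.distrib[symmetric] by (simp add: distrib_right add.commute del: power_Suc)
  also have "\<dots> = (\<Sum>i\<le>Suc n. real (Suc n choose i) * s ^ i * ?G i)"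
    by (subst sum.atMost_Suc_shift) simp
  finally show ?case .
qed simp

lemma polynomial_zero_linear_coeff:
  fixes c :: "nat \<Rightarrow> real"
  assumes "\<And>s. (\<Sum>i\<le>n. c i * s ^ i) = 0" "i \<le> n" shows "c i = 0"
  using assms polyfun_eq_0[of c n] by auto

section \<open>The weak pairing with adjoint solutions\<close>

lemma has_cext_continuous_on:
  fixes f :: "'a::topological_space \<Rightarrow> 'b::t2_space"
  assumes "has_cext \<Omega> f" shows "continuous_on \<Omega> f"
proof -
  obtain g where "continuous_on (closure \<Omega>) g" "\<forall>x\<in>\<Omega>. g x = f x" using assms by (auto simp: has_cext_def)
  then show ?thesis using closure_subset continuous_on_subset continuous_on_eq by metis
qed

lemma has_cext_compose_matrix:
  fixes M :: "'a::topological_space \<Rightarrow> real^'n^'m" and G :: "real^'n^'m \<Rightarrow> real"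
  assumes G: "continuous_on UNIV G" and M: "\<And>i j. has_cext \<Omega> (\<lambda>x. M x $ i $ j)"
  shows "has_cext \<Omega> (\<lambda>x. G (M x))"
proof -
  have "\<forall>i j. \<exists>g. continuous_on (closure \<Omega>) g \<and> (\<forall>x\<in>\<Omega>. g x = M x $ i $ j)"
    using M by (simp add: has_cext_def)
  then obtain g where g: "\<forall>i j. continuous_on (closure \<Omega>) (g i j) \<and> (\<forall>x\<in>\<Omega>. g i j x = M x $ i $ j)"
    by metis
  have "continuous_on (closure \<Omega>) (\<lambda>x. \<chi> i j. g i j x)"
    using g by (intro continuous_on_vec_lambda) auto
  then have "continuous_on (closure \<Omega>) (\<lambda>x. G (\<chi> i j. g i j x))"
    by (rule continuous_on_compose2[OF G]) simp
  moreover have "(\<chi> i j. g i j x) = M x" if "x \<in> \<Omega>" for x using g that by (simp add: vec_eq_iff)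
  ultimately show ?thesis unfolding has_cext_def by (intro exI[of _ "\<lambda>x. G (\<chi> i j. g i j x)"]) auto
qed

lemma continuous_on_cof2: "continuous_on UNIV (\<lambda>M :: real^'n^'n. cof2 M i j k l)"
proof (cases "k = i")
  case False
  have r: "continuous_on UNIV (\<lambda>M :: real^'n^'n. row_upd M i v)" for i v
    unfolding row_upd_def
  proof (intro continuous_on_vec_lambda)
    show "continuous_on UNIV (\<lambda>M :: real^'n^'n. if k = i then v else M $ k)" for k
      by (cases "k = i") (auto intro!: continuous_intros)
  qed
  have "continuous_on UNIV (\<lambda>M :: real^'n^'n. row_upd (row_upd M i (axis j 1)) k (axis l 1))"
    by (rule continuous_on_compose2[OF r r]) simp
  then have "continuous_on UNIV (\<lambda>M :: real^'n^'n. det (row_upd (row_upd M i (axis j 1)) k (axis l 1)))"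
    by (rule continuous_on_compose2[OF continuous_on_det]) simp
  then show ?thesis using False by (simp add: cof2_def)
qed (simp add: cof2_def)

section \<open>Derivatives of the cofactors of a Hessian\<close>

lemma hess_nth: "hess u x $ i $ j = nderiv [axis i 1, axis j 1] u x"
  by (simp add: hess_def)

lemma has_derivative_matrix_entries:
  fixes M :: "'a::euclidean_space \<Rightarrow> real^'n^'m"
  assumes "\<And>i j. ((\<lambda>x. M x $ i $ j) has_derivative (\<lambda>v. D v $ i $ j)) (at x)"
  shows "(M has_derivative D) (at x)"
proof (subst has_derivative_componentwise_within, intro ballI)
  fix b :: "real^'n^'m" assume "b \<in> Basis"
  then obtain i c where c: "c \<in> Basis" "b = axis i c" by (auto simp: Basis_vec_def)
  then obtain j where "c = axis j 1" by (auto simp: Basis_vec_def)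
  then show "((\<lambda>x. M x \<bullet> b) has_derivative (\<lambda>v. D v \<bullet> b)) (at x)"
    using assms[of i j] c by (simp add: inner_axis)
qed

lemma cof_hess_derivative:
  fixes \<Phi> :: "real^'n \<Rightarrow> real"
  assumes \<Omega>: "open \<Omega>" and \<Phi>: "Ck_on 3 \<Omega> \<Phi>" and x: "x \<in> \<Omega>"
  shows "((\<lambda>x. cof (hess \<Phi> x) $ i $ j) has_derivative
     (\<lambda>v. \<Sum>k\<in>UNIV. \<Sum>l\<in>UNIV. cof2 (hess \<Phi> x) i j k l * nderiv [v, axis k 1, axis l 1] \<Phi> x)) (at x)"
proof -
  have "((\<lambda>x. hess \<Phi> x $ k $ l) has_derivative (\<lambda>v. nderiv [v, axis k 1, axis l 1] \<Phi> x)) (at x)" for k l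
    using Ck_on_differentiable[OF \<Omega> \<Phi>, of "[axis k 1, axis l 1]" x] x
    by (simp add: hess_nth[abs_def] frechet_derivative_works)
  then have "(hess \<Phi> has_derivative (\<lambda>v. \<chi> k l. nderiv [v, axis k 1, axis l 1] \<Phi> x)) (at x)"
    by (intro has_derivative_matrix_entries) (simp del: nderiv.simps)
  from has_derivative_compose[OF this has_derivative_cof]
  show ?thesis by (simp del: nderiv.simps)
qed

text \<open>Third derivatives of \<open>\<Phi>\<close> make the cofactors C^1 up to the boundary.
  The last claim is the Piola identity: the third derivatives are symmetric in \<open>j\<close> and
  \<open>l\<close>, the second cofactors antisymmetric.\<close>

lemma cof_hess_Ck:
  fixes \<Phi> :: "real^'n \<Rightarrow> real"
  assumes \<Omega>: "open \<Omega>" and \<Phi>: "Ck_closure 3 \<Omega> \<Phi>"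
  shows "Ck_on 1 \<Omega> (\<lambda>x. cof (hess \<Phi> x) $ i $ j)"
    and "has_cext \<Omega> (\<lambda>x. cof (hess \<Phi> x) $ i $ j)"
    and "has_cext \<Omega> (nderiv [v] (\<lambda>x. cof (hess \<Phi> x) $ i $ j))"
    and "x \<in> \<Omega> \<Longrightarrow> (\<Sum>j\<in>UNIV. nderiv [axis j 1] (\<lambda>x. cof (hess \<Phi> x) $ i $ j) x) = 0"
proof -
  note c = Ck_closure_imp_Ck_on[OF \<Phi>]
  have h: "has_cext \<Omega> (\<lambda>x. hess \<Phi> x $ k $ l)" for k l
    unfolding hess_nth by (rule Ck_closure_cext[OF \<Omega> \<Phi>]) simp
  have nd: "nderiv [v] (\<lambda>x. cof (hess \<Phi> x) $ i $ j) x
      = (\<Sum>k\<in>UNIV. \<Sum>l\<in>UNIV. cof2 (hess \<Phi> x) i j k l * nderiv [v, axis k 1, axis l 1] \<Phi> x)" if "x \<in> \<Omega>" for v x j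
    using frechet_derivative_eqI[OF cof_hess_derivative[OF \<Omega> c that]] by simp
  show "has_cext \<Omega> (\<lambda>x. cof (hess \<Phi> x) $ i $ j)"
    by (rule has_cext_compose_matrix[OF continuous_on_cof h])
  have ext: "has_cext \<Omega> (nderiv [v] (\<lambda>x. cof (hess \<Phi> x) $ i $ j))" for v
  proof (rule has_cext_cong)
    show "has_cext \<Omega> (\<lambda>x. \<Sum>k\<in>UNIV. \<Sum>l\<in>UNIV. cof2 (hess \<Phi> x) i j k l * nderiv [v, axis k 1, axis l 1] \<Phi> x)"
      by (intro has_cext_sum has_cext_mult has_cext_compose_matrix[OF continuous_on_cof2 h]
          Ck_closure_cext[OF \<Omega> \<Phi>]) auto
  qed (simp only: nd)
  then show "has_cext \<Omega> (nderiv [v] (\<lambda>x. cof (hess \<Phi> x) $ i $ j))" .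
  show "Ck_on 1 \<Omega> (\<lambda>x. cof (hess \<Phi> x) $ i $ j)"
    using cof_hess_derivative[OF \<Omega> c] has_cext_continuous_on[OF ext]
    by (intro Ck_on_1I) (auto simp: differentiable_def simp del: nderiv.simps)
  show "(\<Sum>j\<in>UNIV. nderiv [axis j 1] (\<lambda>x. cof (hess \<Phi> x) $ i $ j) x) = 0" if x: "x \<in> \<Omega>"
  proof -
    have sym: "nderiv [axis j 1, axis k 1, axis l 1] \<Phi> x = nderiv [axis l 1, axis k 1, axis j 1] \<Phi> x" for j k l
      by (rule nderiv_mset_cong[OF \<Omega> c _ _ x]) auto
    have "(\<Sum>j\<in>UNIV. \<Sum>k\<in>UNIV. \<Sum>l\<in>UNIV. cof2 (hess \<Phi> x) i j k l * nderiv [axis j 1, axis k 1, axis l 1] \<Phi> x) = 0"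
      by (rule cof_divergence_zero[of "\<lambda>k l j. nderiv [axis j 1, axis k 1, axis l 1] \<Phi> x"]) (rule sym)
    then show ?thesis by (simp only: nd[OF x])
  qed
qed

section \<open>Pairing a function with zero Cauchy data against an adjoint solution\<close>

lemma Ck_on_1_sum:
  fixes f :: "'i \<Rightarrow> 'a::euclidean_space \<Rightarrow> real"
  assumes U: "open U" and "finite I" "\<And>i. i \<in> I \<Longrightarrow> Ck_on 1 U (f i)"
  shows "Ck_on 1 U (\<lambda>x. \<Sum>i\<in>I. f i x) \<and> (\<forall>x\<in>U. \<forall>v. nderiv [v] (\<lambda>x. \<Sum>i\<in>I. f i x) x = (\<Sum>i\<in>I. nderiv [v] (f i) x))"
  using assms(2,3)
proof (induction I)
  case empty
  have "Ck_on 1 U (\<lambda>x. 0)" by (rule Ck_on_1I) auto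
  then show ?case by simp
next
  case (insert i I)
  then have I: "Ck_on 1 U (\<lambda>x. \<Sum>i\<in>I. f i x)"
    "\<And>x v. x \<in> U \<Longrightarrow> nderiv [v] (\<lambda>x. \<Sum>i\<in>I. f i x) x = (\<Sum>i\<in>I. nderiv [v] (f i) x)" and i: "Ck_on 1 U (f i)"
    by (auto simp del: nderiv.simps)
  have e: "(\<lambda>x. \<Sum>i\<in>insert i I. f i x) = (\<lambda>x. f i x + 1 * (\<Sum>i\<in>I. f i x))" using insert by simp
  show ?case unfolding e
    using Ck_on_lincomb[OF U i I(1), of 1] nderiv_lincomb[OF U i I(1), of "[_]" _ 1] I(2) insert(1,2)
    by (auto simp del: nderiv.simps)
qed

lemma sum_has_cext_bounded:
  fixes f :: "real^'n \<Rightarrow> real^'m"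
  assumes "\<And>i. has_cext \<Omega> (\<lambda>x. f x $ i)" "bounded \<Omega>"
  shows "\<exists>B. \<forall>x\<in>\<Omega>. norm (f x) \<le> B"
proof -
  have "\<forall>i. \<exists>B. \<forall>x\<in>\<Omega>. \<bar>f x $ i\<bar> \<le> B"
    using has_cext_bounded[OF assms(1) assms(2)] by metis
  then obtain B where B: "\<forall>i. \<forall>x\<in>\<Omega>. \<bar>f x $ i\<bar> \<le> B i" by metis
  have "norm (f x) \<le> sum B UNIV" if "x \<in> \<Omega>" for x
    using norm_le_l1_cart[of "f x"] sum_mono[of UNIV "\<lambda>i. \<bar>f x $ i\<bar>" B] B that by fastforce
  then show ?thesis by blast
qed

text \<open>Two uses of the vanishing Cauchy data. \<open>W = 0\<close> on the boundary makes
  \<open>W\<close> an admissible test function in the weak equation. Zero boundary gradient makes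
  the components of \<open>cof D^2\<Phi> \<nabla>W\<close> vanish there, so they can be paired with
  the weak gradient of \<open>w\<close>. The gradient terms of the two identities cancel.\<close>

lemma weak_pairing_zero:
  fixes \<Omega> :: "(real^'n) set" and \<Phi> W w R :: "real^'n \<Rightarrow> real"
  assumes \<Omega>: "open \<Omega>" "bounded \<Omega>" and \<Phi>: "Ck_closure 3 \<Omega> \<Phi>" and W: "Ck_closure 3 \<Omega> W"
    and sym: "\<And>x. x \<in> \<Omega> \<Longrightarrow> transpose (C_lin \<Phi> x) = C_lin \<Phi> x"
    and W0: "\<And>x. x \<in> frontier \<Omega> \<Longrightarrow> W x = 0"
    and P0: "\<And>x i. x \<in> frontier \<Omega> \<Longrightarrow> bdry_ext \<Omega> (nderiv [axis i 1] W) x = 0"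
    and w: "adjoint_weak_solution \<Omega> a \<Phi> w"
    and R: "has_cext \<Omega> R" "\<And>x. x \<in> \<Omega> \<Longrightarrow> L_lin a \<Phi> W x = R x"
  shows "(LINT x|lebesgue_on \<Omega>. R x * w x) = 0"
proof -
  obtain g where g: "H1 \<Omega> w g" "\<And>\<zeta> d. H10 \<Omega> \<zeta> d \<Longrightarrow>
      (LINT x|lebesgue_on \<Omega>. (C_lin \<Phi> x *v g x) \<bullet> d x + w x * (b_lin a \<Phi> x \<bullet> d x) + q_lin a \<Phi> x * w x * \<zeta> x) = 0"
    using w unfolding adjoint_weak_solution_def by blast
  note cW = Ck_closure_imp_Ck_on[OF W] and cf = cof_hess_Ck[OF \<Omega>(1) \<Phi>]
  have W1: "Ck_on 1 \<Omega> W" by (rule Ck_on_mono[OF cW]) simp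
  have contW: "continuous_on (closure \<Omega>) W" using W by (simp add: Ck_closure_def)
  have eW: "has_cext \<Omega> (nderiv vs W)" if "length vs \<le> 3" for vs by (rule Ck_closure_cext[OF \<Omega>(1) W that])
  have dW1: "Ck_on 1 \<Omega> (nderiv [axis i 1] W)" for i
    by (rule Ck_on_nderiv[OF \<Omega>(1) cW]) simp
  define c where "c i j x = cof (hess \<Phi> x) $ i $ j" for i j x
  define D where "D i = nderiv [axis i 1] W" for i
  \<comment> \<open>Summing over the first cofactor index leaves the second for the divergence,
    which is where the Piola identity is available.\<close>
  define F where "F j = (\<lambda>x. \<Sum>i\<in>UNIV. c i j x * D i x)" for j
  have ck: "Ck_on 1 \<Omega> (\<lambda>x. c i j x * D i x)" for i j
    unfolding c_def D_def by (rule Ck_on_1_mult(1)[OF \<Omega>(1) cf(1) dW1])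
  have sm: "Ck_on 1 \<Omega> (\<lambda>x. \<Sum>i\<in>UNIV. c i j x * D i x) \<and> (\<forall>x\<in>\<Omega>. \<forall>v.
      nderiv [v] (\<lambda>x. \<Sum>i\<in>UNIV. c i j x * D i x) x = (\<Sum>i\<in>UNIV. nderiv [v] (\<lambda>x. c i j x * D i x) x))" for j
    by (rule Ck_on_1_sum[OF \<Omega>(1) finite ck])
  have F1: "Ck_on 1 \<Omega> (F j)" for j
    unfolding F_def using sm[of j] by (rule conjunct1)
  have ndF: "nderiv [v] (F j) x = (\<Sum>i\<in>UNIV. c i j x * nderiv [v] (D i) x + nderiv [v] (c i j) x * D i x)" if "x \<in> \<Omega>" for v j x
  proof -
    have "nderiv [v] (F j) x = (\<Sum>i\<in>UNIV. nderiv [v] (\<lambda>x. c i j x * D i x) x)"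
      unfolding F_def using sm[of j, THEN conjunct2] that by blast
    also have "\<dots> = (\<Sum>i\<in>UNIV. c i j x * nderiv [v] (D i) x + nderiv [v] (c i j) x * D i x)"
      unfolding c_def D_def by (intro sum.cong refl Ck_on_1_mult(2)[OF \<Omega>(1) cf(1) dW1 that])
    finally show ?thesis .
  qed
  have ec: "has_cext \<Omega> (c i j)" "has_cext \<Omega> (nderiv [v] (c i j))" for i j v
    using cf(2,3) by (auto simp: c_def[abs_def] simp del: nderiv.simps)
  have eD: "has_cext \<Omega> (D i)" "has_cext \<Omega> (nderiv [v] (D i))" for i v
    unfolding D_def nderiv_append[symmetric] by (intro eW; simp)+
  have eF: "has_cext \<Omega> (F j)" for j
    unfolding F_def by (intro has_cext_sum has_cext_mult ec eD) simp
  have eFd: "has_cext \<Omega> (nderiv [v] (F j))" for j v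
  proof (rule has_cext_cong)
    have "has_cext \<Omega> (\<lambda>x. \<Sum>i\<in>UNIV. c i j x * nderiv [v] (D i) x + 1 * (nderiv [v] (c i j) x * D i x))"
      by (intro has_cext_sum has_cext_lincomb has_cext_mult ec eD) simp
    then show "has_cext \<Omega> (\<lambda>x. \<Sum>i\<in>UNIV. c i j x * nderiv [v] (D i) x + nderiv [v] (c i j) x * D i x)"
      by (simp only: mult_1)
  qed (simp only: ndF)
  have parts: "(LINT x|lebesgue_on \<Omega>. w x * grad (F j) x $ j) = - (LINT x|lebesgue_on \<Omega>. g x $ j * F j x)" for j
  proof -
    obtain B1 where B1: "B1 \<ge> 0" "\<And>x. x \<in> \<Omega> \<Longrightarrow> \<bar>F j x\<bar> \<le> B1" by (rule has_cext_bounded[OF eF \<Omega>(2)]) blast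
    obtain B2 where B2: "\<forall>x\<in>\<Omega>. norm (grad (F j) x) \<le> B2"
      using sum_has_cext_bounded[of \<Omega> "grad (F j)"] eFd \<Omega>(2) unfolding grad_nth by blast
    \<comment> \<open>Each factor extends continuously on its own; on the frontier the factors
      coming from the gradient of \<open>W\<close> are 0.\<close>
    let ?F = "\<lambda>x. \<Sum>i\<in>UNIV. bdry_ext \<Omega> (c i j) x * bdry_ext \<Omega> (D i) x"
    show ?thesis
    proof (rule H1_by_parts[OF \<Omega> g(1) F1, where F = ?F and B = "max B1 B2"])
      show "continuous_on (closure \<Omega>) ?F"
        by (intro continuous_on_sum continuous_on_mult bdry_ext_continuous ec eD)
      show "?F x = F j x" if "x \<in> \<Omega>" for x using that by (simp add: F_def bdry_ext_inside)
      show "?F x = 0" if "x \<in> frontier \<Omega>" for x using P0[OF that] by (simp add: D_def del: nderiv.simps)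
      show "\<bar>F j x\<bar> \<le> max B1 B2" if "x \<in> \<Omega>" for x using B1(2)[OF that] by simp
      show "norm (grad (F j) x) \<le> max B1 B2" if "x \<in> \<Omega>" for x using bspec[OF B2 that] by simp
    qed
  qed
  have H: "H10 \<Omega> W (grad W)"
  proof -
    have e0: "has_cext \<Omega> W" using eW[of "[]"] by simp
    obtain B1 where B1: "B1 \<ge> 0" "\<And>x. x \<in> \<Omega> \<Longrightarrow> \<bar>W x\<bar> \<le> B1" by (rule has_cext_bounded[OF e0 \<Omega>(2)]) blast
    obtain B2 where B2: "\<forall>x\<in>\<Omega>. norm (grad W x) \<le> B2"
      using sum_has_cext_bounded[of \<Omega> "grad W"] eW[of "[_]"] \<Omega>(2) unfolding grad_nth by auto
    show ?thesis
      by (rule H10_of_zero_boundary[OF \<Omega> W1 contW _ W0, of "max B1 B2"])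
         (use B1(2) B2 in \<open>auto simp: le_max_iff_disj\<close>)
  qed
  have iw: "integrable (lebesgue_on \<Omega>) w" using g(1) L2_fun_integrable[OF \<Omega>] by (auto simp: H1_def)
  have "integrable (lebesgue_on \<Omega>) g" using g(1) L2_fun_integrable[OF \<Omega>] by (auto simp: H1_def)
  then have ig: "integrable (lebesgue_on \<Omega>) (\<lambda>x. g x $ j)" for j
    using integrable_iff_component[of \<Omega> g] \<Omega>(1) by auto
  have im: "integrable (lebesgue_on \<Omega>) (\<lambda>x. u x * h x)"
    if iu: "integrable (lebesgue_on \<Omega>) u" and eh: "has_cext \<Omega> h" for u h :: "real^'n \<Rightarrow> real"
  proof -
    obtain B where B: "B \<ge> 0" "\<And>x. x \<in> \<Omega> \<Longrightarrow> \<bar>h x\<bar> \<le> B" by (rule has_cext_bounded[OF eh \<Omega>(2)]) blast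
    show ?thesis
      by (rule integrable_mult_bounded[OF iu continuous_on_measurable[OF \<Omega>(1) has_cext_continuous_on[OF eh]], of B])
         (use B in simp)
  qed
  have i1: "integrable (lebesgue_on \<Omega>) (\<lambda>x. w x * grad (F j) x $ j)" for j
    unfolding grad_nth by (rule im[OF iw eFd])
  have i2: "integrable (lebesgue_on \<Omega>) (\<lambda>x. g x $ j * F j x)" for j by (rule im[OF ig eF])
  have iR: "integrable (lebesgue_on \<Omega>) (\<lambda>x. R x * w x)" using im[OF iw R(1)] by (simp add: mult.commute)
  let ?E = "\<lambda>x. \<Sum>j\<in>UNIV. w x * grad (F j) x $ j + g x $ j * F j x"
  let ?Q = "\<lambda>x. (C_lin \<Phi> x *v g x) \<bullet> grad W x + w x * (b_lin a \<Phi> x \<bullet> grad W x) + q_lin a \<Phi> x * w x * W x"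
  have iE: "integrable (lebesgue_on \<Omega>) ?E"
    by (intro Bochner_Integration.integrable_sum Bochner_Integration.integrable_add i1 i2)
  have E0: "(LINT x|lebesgue_on \<Omega>. ?E x) = 0"
    by (simp add: Bochner_Integration.integral_sum Bochner_Integration.integral_add i1 i2 parts)
  have Q0: "(LINT x|lebesgue_on \<Omega>. ?Q x) = 0" by (rule g(2)[OF H])
  \<comment> \<open>In \<open>?E\<close> the Piola identity removes the derivatives of the
    cofactors, so the divergence is the trace term of \<open>L_lin\<close>. Symmetry of the cofactor
    matrix matches the gradient terms of \<open>?E\<close> and \<open>?Q\<close>.\<close>
  have pt: "R x * w x = ?E x - ?Q x" if x: "x \<in> \<Omega>" for x
  proof -
    have "(\<Sum>j\<in>UNIV. grad (F j) x $ j)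
        = (\<Sum>j\<in>UNIV. \<Sum>i\<in>UNIV. c i j x * nderiv [axis j 1] (D i) x) + (\<Sum>j\<in>UNIV. \<Sum>i\<in>UNIV. nderiv [axis j 1] (c i j) x * D i x)"
      unfolding grad_nth ndF[OF x] by (simp only: sum.distrib)
    also have "(\<Sum>j\<in>UNIV. \<Sum>i\<in>UNIV. nderiv [axis j 1] (c i j) x * D i x) = 0"
    proof -
      have "(\<Sum>j\<in>UNIV. \<Sum>i\<in>UNIV. nderiv [axis j 1] (c i j) x * D i x)
          = (\<Sum>i\<in>UNIV. (\<Sum>j\<in>UNIV. nderiv [axis j 1] (c i j) x) * D i x)"
        unfolding sum_distrib_right by (rule sum.swap)
      also have "\<dots> = 0" using cf(4)[OF x] by (simp add: c_def[abs_def] del: nderiv.simps)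
      finally show ?thesis .
    qed
    also have "(\<Sum>j\<in>UNIV. \<Sum>i\<in>UNIV. c i j x * nderiv [axis j 1] (D i) x) = trace (C_lin \<Phi> x ** hess W x)"
      by (simp add: trace_def matrix_matrix_mult_def c_def C_lin_def D_def hess_nth
          del: nderiv.simps flip: nderiv_append) (rule sum.swap)
    finally have div: "(\<Sum>j\<in>UNIV. grad (F j) x $ j) = trace (C_lin \<Phi> x ** hess W x)" by simp
    have Fc: "F j x = (C_lin \<Phi> x *v grad W x) $ j" for j
      using transpose_eq_nth[OF sym[OF x]]
      by (simp add: F_def c_def C_lin_def D_def matrix_vector_mult_def grad_nth del: nderiv.simps)
    have "(\<Sum>j\<in>UNIV. g x $ j * F j x) = g x \<bullet> (C_lin \<Phi> x *v grad W x)"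
      by (simp add: Fc inner_vec_def)
    also have "\<dots> = (C_lin \<Phi> x *v g x) \<bullet> grad W x"
      using dot_lmul_matrix[of "g x" "C_lin \<Phi> x" "grad W x"] sym[OF x] by (metis transpose_matrix_vector)
    finally have gF: "(\<Sum>j\<in>UNIV. g x $ j * F j x) = (C_lin \<Phi> x *v g x) \<bullet> grad W x" .
    have "?E x = w x * trace (C_lin \<Phi> x ** hess W x) + (C_lin \<Phi> x *v g x) \<bullet> grad W x"
      unfolding sum.distrib sum_distrib_left[symmetric] div gF ..
    then show ?thesis unfolding R(2)[OF x, symmetric] L_lin_def by (simp add: algebra_simps)
  qed
  \<comment> \<open>Integrability of the weak form is read off the pointwise identity: it is a
    difference of two functions already known to be integrable.\<close>
  have iQ: "integrable (lebesgue_on \<Omega>) ?Q"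
  proof -
    have "integrable (lebesgue_on \<Omega>) (\<lambda>x. ?E x - R x * w x)"
      by (rule Bochner_Integration.integrable_diff[OF iE iR])
    then show ?thesis
      by (rule Bochner_Integration.integrable_cong[OF refl, THEN iffD1, rotated]) (use pt in simp)
  qed
  have "(LINT x|lebesgue_on \<Omega>. R x * w x) = (LINT x|lebesgue_on \<Omega>. ?E x - ?Q x)"
    by (rule Bochner_Integration.integral_cong[OF refl]) (use pt in simp)
  also have "\<dots> = 0" unfolding Bochner_Integration.integral_diff[OF iE iQ] E0 Q0 by simp
  finally show ?thesis .
qed

section \<open>Linearization of the solution operators\<close>

lemma Ck_closure_mono: "Ck_closure k U f \<Longrightarrow> j \<le> k \<Longrightarrow> Ck_closure j U f"
  unfolding Ck_closure_def by (meson le_trans order_less_le_trans)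

lemma has_cext_Pair:
  fixes f :: "'a::topological_space \<Rightarrow> 'b::t2_space" and g :: "'a \<Rightarrow> 'c::t2_space"
  assumes "has_cext U f" "has_cext U g" shows "has_cext U (\<lambda>x. (f x, g x))"
proof -
  obtain f' where f': "continuous_on (closure U) f'" "\<forall>x\<in>U. f' x = f x" using assms(1) by (auto simp: has_cext_def)
  obtain g' where g': "continuous_on (closure U) g'" "\<forall>x\<in>U. g' x = g x" using assms(2) by (auto simp: has_cext_def)
  show ?thesis unfolding has_cext_def
    by (intro exI[of _ "\<lambda>x. (f' x, g' x)"]) (use f' g' in \<open>auto intro!: continuous_intros\<close>)
qed

lemma has_cext_vec:
  fixes f :: "'a::topological_space \<Rightarrow> ('b::metric_space)^'n"
  assumes "\<And>i. has_cext U (\<lambda>x. f x $ i)" shows "has_cext U f"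
proof -
  have "\<forall>i. \<exists>g. continuous_on (closure U) g \<and> (\<forall>x\<in>U. g x = f x $ i)" using assms by (simp add: has_cext_def)
  then obtain g where g: "\<forall>i. continuous_on (closure U) (g i) \<and> (\<forall>x\<in>U. g i x = f x $ i)" by metis
  show ?thesis unfolding has_cext_def
    by (intro exI[of _ "\<lambda>x. \<chi> i. g i x"]) (use g in \<open>auto intro!: continuous_on_vec_lambda simp: vec_eq_iff\<close>)
qed

lemma has_cext_jet:
  fixes u :: "real^'n \<Rightarrow> real"
  assumes "open U" "Ck_closure k U u" "1 \<le> k"
  shows "has_cext U (grad u)" and "has_cext U (\<lambda>x. (u x, grad u x))"
proof -
  have "has_cext U (\<lambda>x. grad u x $ i)" for i
    unfolding grad_nth by (rule Ck_closure_cext[OF assms(1,2)]) (use assms(3) in simp)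
  then show g: "has_cext U (grad u)" by (rule has_cext_vec)
  have "has_cext U (nderiv [] u)" by (rule Ck_closure_cext[OF assms(1,2)]) simp
  then show "has_cext U (\<lambda>x. (u x, grad u x))" using g by (intro has_cext_Pair) simp_all
qed

abbreviation (input) uncurry3 :: "('a \<Rightarrow> 'b \<Rightarrow> 'c \<Rightarrow> 'd) \<Rightarrow> 'a \<times> 'b \<times> 'c \<Rightarrow> 'd" where
  "uncurry3 a \<equiv> (\<lambda>(x, z, p). a x z p)"

lemma dzp_slice: "dzp vs a x z p = nderiv vs (\<lambda>y. uncurry3 a (x, y)) (z, p)"
proof -
  have "(\<lambda>(z', p'). a x z' p') = (\<lambda>y. uncurry3 a (x, y))" by (simp add: fun_eq_iff split_beta)
  then show ?thesis by (simp only: dzp_def)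
qed

lemma jet_derivative_expand:
  fixes a :: "real^'n \<Rightarrow> real \<Rightarrow> real^'n \<Rightarrow> real"
  assumes \<Omega>: "open \<Omega>" and a: "Ck_on k (\<Omega> \<times> UNIV) (uncurry3 a)" "1 \<le> k" and x: "x \<in> \<Omega>"
  shows "dzp [(s, \<xi>)] a x (\<Phi> x) (grad \<Phi> x) = b_lin a \<Phi> x \<bullet> \<xi> + q_lin a \<Phi> x * s"
proof -
  let ?f = "\<lambda>y. uncurry3 a (x, y)" and ?p = "(\<Phi> x, grad \<Phi> x)"
  have "?f differentiable (at ?p)"
    using Ck_on_differentiable[OF open_UNIV Ck_on_slice[OF \<Omega> a(1) x], of "[]" ?p] a(2) by simp
  then have lin: "linear (\<lambda>v. nderiv [v] ?f ?p)" by (simp add: linear_frechet_derivative)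
  have "(s, \<xi>) = s *\<^sub>R (1, 0) + (\<Sum>i\<in>UNIV. (\<xi> $ i) *\<^sub>R (0, axis i 1))"
  proof -
    have "(\<Sum>i\<in>UNIV. (\<xi> $ i) *\<^sub>R ((0::real), axis i (1::real))) = (0, \<Sum>i\<in>UNIV. (\<xi> $ i) *\<^sub>R axis i 1)"
      by (simp add: sum_prod)
    also have "(\<Sum>i\<in>UNIV. (\<xi> $ i) *\<^sub>R axis i 1) = \<xi>"
      using basis_expansion[of \<xi>] by (simp add: scalar_mult_eq_scaleR)
    finally show ?thesis by simp
  qed
  then have "nderiv [(s, \<xi>)] ?f ?p = nderiv [s *\<^sub>R (1, 0) + (\<Sum>i\<in>UNIV. (\<xi> $ i) *\<^sub>R (0, axis i 1))] ?f ?p"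
    by (rule arg_cong)
  also have "\<dots> = s * nderiv [(1, 0)] ?f ?p + (\<Sum>i\<in>UNIV. \<xi> $ i * nderiv [(0, axis i 1)] ?f ?p)"
    by (simp only: linear_add[OF lin] linear_sum[OF lin] linear_scale[OF lin] real_scaleR_def)
  finally have "nderiv [(s, \<xi>)] ?f ?p = s * nderiv [(1, 0)] ?f ?p + (\<Sum>i\<in>UNIV. \<xi> $ i * nderiv [(0, axis i 1)] ?f ?p)" .
  then show ?thesis
    by (simp add: dzp_slice b_lin_def q_lin_def inner_vec_def mult.commute del: nderiv.simps)
qed

lemma has_cext_dzp:
  fixes a :: "real^'n \<Rightarrow> real \<Rightarrow> real^'n \<Rightarrow> real"
  assumes "open \<Omega>" "Ck_closure k (\<Omega> \<times> UNIV) (uncurry3 a)" "Ck_closure j \<Omega> \<Phi>" "1 \<le> j" "length vs \<le> k"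
  shows "has_cext \<Omega> (\<lambda>x. dzp vs a x (\<Phi> x) (grad \<Phi> x))"
  unfolding dzp_slice
  by (rule has_cext_nderiv_slice[OF assms(1,2) has_cext_jet(2)[OF assms(1,3,4)] assms(5)])

section \<open>One well-posed problem along a line of boundary data\<close>

lemma tendsto_of_quotient:
  fixes u :: "real \<Rightarrow> real"
  assumes "((\<lambda>t. (u t - c) / t) \<longlongrightarrow> d) (at 0)" shows "(u \<longlongrightarrow> c) (at 0)"
proof -
  have "((\<lambda>t. c + t * ((u t - c) / t)) \<longlongrightarrow> c + 0 * d) (at 0)" by (intro tendsto_intros assms)
  then have "((\<lambda>t. c + t * ((u t - c) / t)) \<longlongrightarrow> c) (at 0)" by simp
  then show ?thesis by (rule Lim_transform_eventually) (auto simp: eventually_at_filter)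
qed

text \<open>One nonlinearity with one direction \<open>h\<close> of boundary data. The functional is
  left open, so that \<open>line\<close> can supply \<open>frechet_line\<close> for derivatives at
  interior points and for values at boundary points alike.\<close>

locale MA_solution_line =
  fixes \<Omega> :: "(real^'n) set" and m :: nat and \<alpha> \<delta> :: real and a \<phi> \<Phi> V S dS h
  assumes \<Omega>: "open \<Omega>" "\<Omega> \<noteq> {}"
    and phi: "\<phi> \<in> fcarrier (holder_bdry_space (m + 2) \<alpha> \<Omega>)"
    and h: "h \<in> fcarrier (holder_bdry_space (m + 2) \<alpha> \<Omega>)"
    and so: "solution_operator m \<alpha> \<Omega> a \<phi> \<Phi> \<delta> V S dS"
begin

abbreviation "X \<equiv> holder_bdry_space (m + 2) \<alpha> \<Omega>"
abbreviation "Y \<equiv> holder_space (m + 2) \<alpha> \<Omega>"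

lemma frechet: "has_frechet_derivs (m + 1) X Y \<phi> S dS"
  using so unfolding solution_operator_def Let_def by (elim conjE)

lemma line:
  assumes ev: "bounded_functional Y ev" shows "frechet_line (m + 1) X Y \<phi> h S dS ev"
proof
  show "has_frechet_derivs (m + 1) X Y \<phi> S dS" by (rule frechet)
  show "(\<lambda>x. f x + c * g x) \<in> fcarrier X" if "f \<in> fcarrier X" "g \<in> fcarrier X" for f g c
    by (rule holder_bdry_space_lincomb[OF \<Omega>(1) that])
  show "0 \<le> fnorm X f" if "f \<in> fcarrier X" for f by (rule fnorm_bdry_nonneg[OF \<Omega> that])
  show "fnorm X (\<lambda>x. c * f x) \<le> \<bar>c\<bar> * fnorm X f" if "f \<in> fcarrier X" for f c
    by (rule fnorm_bdry_cmult_le[OF \<Omega> that])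
  show "(\<lambda>x. f x + c * g x) \<in> fcarrier Y" if "f \<in> fcarrier Y" "g \<in> fcarrier Y" for f g c
    by (rule holder_space_lincomb[OF \<Omega>(1) that])
  show "\<phi> \<in> fcarrier X" "h \<in> fcarrier X" "bounded_functional Y ev" by (rule phi h ev)+
qed

lemma background: "\<forall>x\<in>closure \<Omega>. S \<phi> x = \<Phi> x"
  using so unfolding solution_operator_def Let_def by (elim conjE)

text \<open>The estimate does not mention a functional, but \<open>frechet_line\<close> carries one;
  evaluation at any point of the closure serves.\<close>

lemma small:
  assumes "0 < \<rho>" shows "\<exists>\<tau>>0. \<forall>t. \<bar>t\<bar> < \<tau> \<longrightarrow> fnorm X (\<lambda>x. t * h x) < \<rho>"
proof -
  obtain x where x: "x \<in> closure \<Omega>" using \<Omega>(2) closure_subset by blast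
  show ?thesis by (rule frechet_line.eta_near[OF line[OF bounded_functional_closure[OF \<Omega> x]] assms])
qed

lemma eventually_solution: "\<forall>\<^sub>F t in at 0. MA_solution \<Omega> a (\<lambda>x. \<phi> x + t * h x) (S (\<lambda>x. \<phi> x + t * h x))"
proof -
  have d: "0 < \<delta>" using so unfolding solution_operator_def Let_def by (elim conjE)
  have sol: "\<forall>\<eta>\<in>fcarrier X. fnorm X (\<lambda>x. \<eta> x - \<phi> x) < \<delta> \<longrightarrow>
     S \<eta> \<in> V \<and> MA_solution \<Omega> a \<eta> (S \<eta>) \<and> (\<forall>u\<in>V. MA_solution \<Omega> a \<eta> u \<longrightarrow> (\<forall>x\<in>closure \<Omega>. u x = S \<eta> x))"
    using so unfolding solution_operator_def Let_def by (elim conjE)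
  obtain \<tau> where \<tau>: "\<tau> > 0" "\<forall>t. \<bar>t\<bar> < \<tau> \<longrightarrow> fnorm X (\<lambda>x. t * h x) < \<delta>" using small[OF d] by blast
  have "MA_solution \<Omega> a (\<lambda>x. \<phi> x + t * h x) (S (\<lambda>x. \<phi> x + t * h x))" if "\<bar>t\<bar> < \<tau>" for t
  proof -
    have c: "(\<lambda>x. \<phi> x + t * h x) \<in> fcarrier X" by (rule holder_bdry_space_lincomb[OF \<Omega>(1) phi h])
    have "fnorm X (\<lambda>x. (\<phi> x + t * h x) - \<phi> x) < \<delta>" using \<tau>(2) that by simp
    from sol[THEN bspec, OF c, THEN mp, OF this] show ?thesis by (elim conjE)
  qed
  then show ?thesis unfolding eventually_at using \<tau>(1)
    by (intro exI[of _ \<tau>] conjI ballI impI) (simp_all add: dist_real_def)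
qed

lemma derivative_carrier:
  assumes r: "r \<le> m + 1" and hs: "set hs \<subseteq> fcarrier X" "length hs = r"
  shows "dS r \<phi> hs \<in> fcarrier Y"
proof -
  obtain \<rho> where \<rho>: "\<rho> > 0" "\<forall>\<eta>\<in>fcarrier X. fnorm X (\<lambda>x. \<eta> x - \<phi> x) < \<rho> \<longrightarrow>
      (\<forall>r\<le>m + 1. bounded_multilinear X Y r (dS r \<eta>))"
  proof -
    obtain \<rho> where "\<rho> > 0" and n: "\<forall>\<eta>\<in>fcarrier X. fnorm X (\<lambda>x. \<eta> x - \<phi> x) < \<rho> \<longrightarrow>
        S \<eta> \<in> fcarrier Y \<and> fnorm Y (\<lambda>y. dS 0 \<eta> [] y - S \<eta> y) = 0 \<and>
        (\<forall>r\<le>m + 1. bounded_multilinear X Y r (dS r \<eta>)) \<and>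
        (\<forall>r<m + 1. \<forall>\<epsilon>>0. \<exists>d>0. \<forall>h\<in>fcarrier X. fnorm X h < d \<longrightarrow>
           (\<forall>hs. set hs \<subseteq> fcarrier X \<and> length hs = r \<longrightarrow>
              fnorm Y (\<lambda>y. dS r (\<lambda>x. \<eta> x + h x) hs y - dS r \<eta> hs y - dS (Suc r) \<eta> (h # hs) y)
                \<le> \<epsilon> * fnorm X h * prod_list (map (fnorm X) hs))) \<and>
        (\<forall>\<epsilon>>0. \<exists>d>0. \<forall>h\<in>fcarrier X. fnorm X h < d \<longrightarrow>
           (\<forall>hs. set hs \<subseteq> fcarrier X \<and> length hs = m + 1 \<longrightarrow>
              fnorm Y (\<lambda>y. dS (m + 1) (\<lambda>x. \<eta> x + h x) hs y - dS (m + 1) \<eta> hs y)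
                \<le> \<epsilon> * prod_list (map (fnorm X) hs)))"
      using frechet unfolding has_frechet_derivs_def by (elim exE conjE) (rule that)
    show ?thesis
    proof (rule that[OF \<open>\<rho> > 0\<close>], intro ballI impI)
      fix \<eta> assume "\<eta> \<in> fcarrier X" "fnorm X (\<lambda>x. \<eta> x - \<phi> x) < \<rho>"
      from n[THEN bspec, OF this(1), THEN mp, OF this(2)]
      show "\<forall>r\<le>m + 1. bounded_multilinear X Y r (dS r \<eta>)" by (elim conjE)
    qed
  qed
  obtain \<tau> where \<tau>: "\<tau> > 0" "\<forall>t. \<bar>t\<bar> < \<tau> \<longrightarrow> fnorm X (\<lambda>x. t * h x) < \<rho>" using small[OF \<rho>(1)] by blast
  \<comment> \<open>The zero function has small norm: it is \<open>t * h\<close> for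
    \<open>t = 0\<close>.\<close>
  have "fnorm X (\<lambda>x. \<phi> x - \<phi> x) < \<rho>" using \<tau>(2)[rule_format, of 0] \<tau>(1) by simp
  then have "bounded_multilinear X Y r (dS r \<phi>)" using \<rho>(2) phi r by blast
  then have "\<forall>hs. set hs \<subseteq> fcarrier X \<and> length hs = r \<longrightarrow> dS r \<phi> hs \<in> fcarrier Y"
    unfolding bounded_multilinear_def by (elim conjE)
  then show ?thesis using hs by blast
qed

text \<open>The zeroth derivative and the operator itself are tied only by a difference of seminorm
  0; a functional cannot tell them apart.\<close>

lemma ev_zeroth:
  assumes "bounded_functional Y ev" shows "ev (dS 0 \<phi> []) = ev (S \<phi>)"
proof -
  have eta: "frechet_line.\<eta> \<phi> h 0 = \<phi>" using frechet_line.\<eta>_def[OF line[OF assms]] by simp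
  obtain \<tau> where "0 < \<tau>" "\<forall>t. \<bar>t\<bar> < \<tau> \<longrightarrow> ev (dS 0 (frechet_line.\<eta> \<phi> h t) []) = ev (S (frechet_line.\<eta> \<phi> h t))"
    using frechet_line.has_derivative_along[OF line[OF assms]] by (elim exE conjE) (rule that)
  then have "ev (dS 0 (frechet_line.\<eta> \<phi> h 0) []) = ev (S (frechet_line.\<eta> \<phi> h 0))" by simp
  then show ?thesis unfolding eta .
qed

lemma zeroth_closure:
  assumes "x \<in> closure \<Omega>" shows "dS 0 \<phi> [] x = \<Phi> x"
  using ev_zeroth[OF bounded_functional_closure[OF \<Omega> assms]] bspec[OF background assms] by (rule trans)

lemma zeroth_nderiv:
  assumes "x \<in> \<Omega>" "length vs \<le> m + 2" shows "nderiv vs (dS 0 \<phi> []) x = nderiv vs \<Phi> x"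
proof (rule nderiv_cong_open[OF \<Omega>(1) _ assms(1)])
  show "dS 0 \<phi> [] y = \<Phi> y" if "y \<in> \<Omega>" for y using that closure_subset by (intro zeroth_closure) blast
qed

lemma first_quotient_nderiv:
  assumes x: "x \<in> \<Omega>" and l: "length vs \<le> m + 2"
  shows "((\<lambda>t. (nderiv vs (S (\<lambda>x. \<phi> x + t * h x)) x - nderiv vs \<Phi> x) / t) \<longlongrightarrow> nderiv vs (dS 1 \<phi> [h]) x) (at 0)"
  by (rule frechet_first_quotient[OF line[OF bounded_functional_nderiv[OF \<Omega>(1) x l]]])
     (simp, rule zeroth_nderiv[OF x l])

lemma tendsto_nderiv:
  assumes x: "x \<in> \<Omega>" and l: "length vs \<le> m + 2"
  shows "((\<lambda>t. nderiv vs (S (\<lambda>x. \<phi> x + t * h x)) x) \<longlongrightarrow> nderiv vs \<Phi> x) (at 0)"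
  by (rule tendsto_of_quotient[OF first_quotient_nderiv[OF x l]])

text \<open>The solutions have boundary values exactly \<open>\<phi> + t h\<close>, so at a frontier
  point the difference quotient is constantly \<open>h x\<close> for small nonzero
  \<open>t\<close>.\<close>

lemma first_variation_boundary:
  assumes x: "x \<in> frontier \<Omega>" and b: "\<Phi> x = \<phi> x" shows "dS 1 \<phi> [h] x = h x"
proof -
  have xc: "x \<in> closure \<Omega>" using x by (simp add: frontier_def)
  have "((\<lambda>t. (S (\<lambda>x. \<phi> x + t * h x) x - \<Phi> x) / t) \<longlongrightarrow> dS 1 \<phi> [h] x) (at 0)"
    by (rule frechet_first_quotient[OF line[OF bounded_functional_closure[OF \<Omega> xc]]])
       (simp, rule zeroth_closure[OF xc])
  moreover have "((\<lambda>t. (S (\<lambda>x. \<phi> x + t * h x) x - \<Phi> x) / t) \<longlongrightarrow> h x) (at 0)"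
  proof (rule Lim_transform_eventually[OF tendsto_const])
    show "\<forall>\<^sub>F t in at 0. h x = (S (\<lambda>x. \<phi> x + t * h x) x - \<Phi> x) / t"
      using eventually_solution eventually_neq_at_within[of 0 0 UNIV]
      by eventually_elim (use x b in \<open>simp add: MA_solution_def\<close>)
  qed
  ultimately show ?thesis by (rule tendsto_unique[OF trivial_limit_at])
qed

end

text \<open>\<open>MA_variation\<close> at a fixed point \<open>x\<close>, with the Hessians as
  matrices and the pairs of value and gradient as arguments. The hypothesis on lower derivatives
  includes the empty list, that is, equality of the two nonlinearities themselves along the
  background.\<close>

lemma variation_equation:
  fixes \<Omega> :: "(real^'n) set"
  assumes 1: "MA_solution_line \<Omega> m \<alpha> \<delta>1 a1 \<phi> \<Phi> V1 S1 dS1 h"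
    and 2: "MA_solution_line \<Omega> m \<alpha> \<delta>2 a2 \<phi> \<Phi> V2 S2 dS2 h"
    and a: "Ck_on k (\<Omega> \<times> UNIV) (uncurry3 a1)" "Ck_on k (\<Omega> \<times> UNIV) (uncurry3 a2)"
    and r: "1 \<le> r" "r \<le> k" "k \<le> m + 1" and x: "x \<in> \<Omega>"
    and agree: "\<And>i vs. i < r \<Longrightarrow> length vs \<le> 2 \<Longrightarrow>
       nderiv vs (dS1 i \<phi> (replicate i h)) x = nderiv vs (dS2 i \<phi> (replicate i h)) x"
    and low: "\<And>vs. length vs < r \<Longrightarrow> dzp vs a1 x (\<Phi> x) (grad \<Phi> x) = dzp vs a2 x (\<Phi> x) (grad \<Phi> x)"
    and sym: "transpose (C_lin \<Phi> x) = C_lin \<Phi> x"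
  defines "W \<equiv> \<lambda>y. dS1 r \<phi> (replicate r h) y - dS2 r \<phi> (replicate r h) y" and "v \<equiv> dS2 1 \<phi> [h]"
  shows "L_lin a1 \<Phi> W x = dzp (replicate r (v x, grad v x)) a1 x (\<Phi> x) (grad \<Phi> x)
      - dzp (replicate r (v x, grad v x)) a2 x (\<Phi> x) (grad \<Phi> x)"
proof -
  interpret s1: MA_solution_line \<Omega> m \<alpha> \<delta>1 a1 \<phi> \<Phi> V1 S1 dS1 h by (rule 1)
  interpret s2: MA_solution_line \<Omega> m \<alpha> \<delta>2 a2 \<phi> \<Phi> V2 S2 dS2 h by (rule 2)
  note \<Omega> = s1.\<Omega>
  let ?\<eta> = "\<lambda>t x. \<phi> x + t * h x"
  define u1 where "u1 t = S1 (?\<eta> t)" for t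
  define u2 where "u2 t = S2 (?\<eta> t)" for t
  let ?p = "(\<Phi> x, grad \<Phi> x)"
  have hX: "set (replicate r h) \<subseteq> fcarrier (holder_bdry_space (m + 2) \<alpha> \<Omega>)" using s1.h by auto
  have c1: "dS1 r \<phi> (replicate r h) \<in> fcarrier s1.Y" using r by (intro s1.derivative_carrier hX) auto
  have c2: "dS2 r \<phi> (replicate r h) \<in> fcarrier s1.Y" using r by (intro s2.derivative_carrier hX) auto
  have Wnd: "nderiv vs W x = nderiv vs (dS1 r \<phi> (replicate r h)) x - nderiv vs (dS2 r \<phi> (replicate r h)) x"
    if "length vs \<le> 2" for vs
    using nderiv_lincomb[OF \<Omega>(1) holder_space_Ck_on[OF c1] holder_space_Ck_on[OF c2] _ x, of vs "-1"] that
    by (simp add: W_def)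
  have l2: "length vs \<le> m + 2" if "length vs \<le> 2" for vs :: "(real^'n) list" using that by simp
  have q: "((\<lambda>t. (nderiv vs (u1 t) x - nderiv vs (u2 t) x) / t ^ r) \<longlongrightarrow> nderiv vs W x / fact r) (at 0)"
    if "length vs \<le> 2" for vs
    unfolding Wnd[OF that] u1_def u2_def
    by (rule frechet_difference_quotient[OF
        s1.line[OF bounded_functional_nderiv[OF \<Omega>(1) x l2[OF that]]]
        s2.line[OF bounded_functional_nderiv[OF \<Omega>(1) x l2[OF that]]]])
       (use r agree that in auto)
  have t1: "((\<lambda>t. nderiv vs (u1 t) x) \<longlongrightarrow> nderiv vs \<Phi> x) (at 0)" if "length vs \<le> 2" for vs
    unfolding u1_def by (rule s1.tendsto_nderiv[OF x l2[OF that]])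
  have t2: "((\<lambda>t. nderiv vs (u2 t) x) \<longlongrightarrow> nderiv vs \<Phi> x) (at 0)" if "length vs \<le> 2" for vs
    unfolding u2_def by (rule s2.tendsto_nderiv[OF x l2[OF that]])
  have f2: "((\<lambda>t. (nderiv vs (u2 t) x - nderiv vs \<Phi> x) / t) \<longlongrightarrow> nderiv vs v x) (at 0)" if "length vs \<le> 2" for vs
    unfolding u2_def v_def by (rule s2.first_quotient_nderiv[OF x l2[OF that]])
  have ge: "grad u x $ i = nderiv [axis i 1] u x" for u i by (rule grad_nth)
  \<comment> \<open>The quotients by \<open>t ^ r\<close> converge to Taylor coefficients, so
    Hessian and jet of \<open>W\<close> arrive divided by \<open>fact r\<close>. The third term
    carries the same factor, which is cancelled at the end.\<close>
  have key: "(\<Sum>i\<in>UNIV. \<Sum>j\<in>UNIV. cof (hess \<Phi> x) $ i $ j * (hess W x /\<^sub>R fact r) $ i $ j)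
     = nderiv [(W x, grad W x) /\<^sub>R fact r] (\<lambda>y. uncurry3 a1 (x, y)) ?p
     + (nderiv (replicate r (v x, grad v x)) (\<lambda>y. uncurry3 a1 (x, y)) ?p
        - nderiv (replicate r (v x, grad v x)) (\<lambda>y. uncurry3 a2 (x, y)) ?p) / fact r"
  proof (rule MA_variation[OF Ck_on_slice[OF \<Omega>(1) a(1) x] Ck_on_slice[OF \<Omega>(1) a(2) x] r(1,2),
        where ?M1.0 = "\<lambda>t. hess (u1 t) x" and ?M2.0 = "\<lambda>t. hess (u2 t) x"
          and ?y1.0 = "\<lambda>t. (u1 t x, grad (u1 t) x)" and ?y2.0 = "\<lambda>t. (u2 t x, grad (u2 t) x)"])
    show "((\<lambda>t. hess (u1 t) x) \<longlongrightarrow> hess \<Phi> x) (at 0)" "((\<lambda>t. hess (u2 t) x) \<longlongrightarrow> hess \<Phi> x) (at 0)"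
      unfolding hess_def by (intro tendsto_vec_lambda t1 t2; simp)+
    show "((\<lambda>t. (u1 t x, grad (u1 t) x)) \<longlongrightarrow> ?p) (at 0)"
      using t1[of "[]"] t1[of "[axis _ 1]"] unfolding grad_def
      by (intro tendsto_Pair tendsto_vec_lambda) (simp_all del: nderiv.simps(2))
    show "((\<lambda>t. (u2 t x, grad (u2 t) x)) \<longlongrightarrow> ?p) (at 0)"
      using t2[of "[]"] t2[of "[axis _ 1]"] unfolding grad_def
      by (intro tendsto_Pair tendsto_vec_lambda) (simp_all del: nderiv.simps(2))
    have "(hess (u1 t) x - hess (u2 t) x) /\<^sub>R t ^ r
        = (\<chi> i j. (nderiv [axis i 1, axis j 1] (u1 t) x - nderiv [axis i 1, axis j 1] (u2 t) x) / t ^ r)" for t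
      by (simp add: vec_eq_iff hess_nth divide_inverse_commute del: nderiv.simps)
    moreover have "hess W x /\<^sub>R fact r = (\<chi> i j. nderiv [axis i 1, axis j 1] W x / fact r)"
      by (simp add: vec_eq_iff hess_nth divide_inverse_commute del: nderiv.simps)
    ultimately show "((\<lambda>t. (hess (u1 t) x - hess (u2 t) x) /\<^sub>R t ^ r) \<longlongrightarrow> hess W x /\<^sub>R fact r) (at 0)"
      by (simp only:) (intro tendsto_vec_lambda q, simp)
    have "((u1 t x, grad (u1 t) x) - (u2 t x, grad (u2 t) x)) /\<^sub>R t ^ r
        = ((nderiv [] (u1 t) x - nderiv [] (u2 t) x) / t ^ r,
           \<chi> i. (nderiv [axis i 1] (u1 t) x - nderiv [axis i 1] (u2 t) x) / t ^ r)" for t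
      by (simp add: vec_eq_iff ge divide_inverse_commute del: nderiv.simps(2))
    moreover have "(W x, grad W x) /\<^sub>R fact r = (nderiv [] W x / fact r, \<chi> i. nderiv [axis i 1] W x / fact r)"
      by (simp add: vec_eq_iff ge divide_inverse_commute del: nderiv.simps(2))
    ultimately show "((\<lambda>t. ((u1 t x, grad (u1 t) x) - (u2 t x, grad (u2 t) x)) /\<^sub>R t ^ r)
        \<longlongrightarrow> (W x, grad W x) /\<^sub>R fact r) (at 0)"
      by (simp only:) (intro tendsto_Pair tendsto_vec_lambda q; simp)
    have "((u2 t x, grad (u2 t) x) - ?p) /\<^sub>R t
        = ((nderiv [] (u2 t) x - nderiv [] \<Phi> x) / t,
           \<chi> i. (nderiv [axis i 1] (u2 t) x - nderiv [axis i 1] \<Phi> x) / t)" for t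
      by (simp add: vec_eq_iff ge divide_inverse_commute del: nderiv.simps(2))
    moreover have "(v x, grad v x) = (nderiv [] v x, \<chi> i. nderiv [axis i 1] v x)"
      by (simp add: vec_eq_iff ge del: nderiv.simps(2))
    ultimately show "((\<lambda>t. ((u2 t x, grad (u2 t) x) - ?p) /\<^sub>R t) \<longlongrightarrow> (v x, grad v x)) (at 0)"
      by (simp only:) (intro tendsto_Pair tendsto_vec_lambda f2; simp)
    show "nderiv vs (\<lambda>y. uncurry3 a1 (x, y)) ?p = nderiv vs (\<lambda>y. uncurry3 a2 (x, y)) ?p" if "length vs < r" for vs
      using low[OF that] unfolding dzp_slice .
    show "\<forall>\<^sub>F t in at 0. det (hess (u1 t) x) = uncurry3 a1 (x, u1 t x, grad (u1 t) x)"
      using s1.eventually_solution by eventually_elim (use x in \<open>simp add: MA_solution_def u1_def\<close>)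
    show "\<forall>\<^sub>F t in at 0. det (hess (u2 t) x) = uncurry3 a2 (x, u2 t x, grad (u2 t) x)"
      using s2.eventually_solution by eventually_elim (use x in \<open>simp add: MA_solution_def u2_def\<close>)
  qed
  have f0: "fact r \<noteq> (0::real)" by simp
  have tr: "(\<Sum>i\<in>UNIV. \<Sum>j\<in>UNIV. cof (hess \<Phi> x) $ i $ j * (hess W x /\<^sub>R fact r) $ i $ j)
      = trace (C_lin \<Phi> x ** hess W x) / fact r"
    unfolding trace_mul_sym[OF sym] by (simp add: C_lin_def divide_inverse sum_distrib_left sum_distrib_right ac_simps)
  have "nderiv [(W x, grad W x) /\<^sub>R fact r] (\<lambda>y. uncurry3 a1 (x, y)) ?p
      = dzp [(W x / fact r, grad W x /\<^sub>R fact r)] a1 x (\<Phi> x) (grad \<Phi> x)"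
    by (simp add: dzp_slice divide_inverse_commute del: nderiv.simps)
  also have "\<dots> = (b_lin a1 \<Phi> x \<bullet> grad W x + q_lin a1 \<Phi> x * W x) / fact r"
    using r by (subst jet_derivative_expand[OF \<Omega>(1) a(1) _ x]) (auto simp: divide_inverse algebra_simps)
  finally have "trace (C_lin \<Phi> x ** hess W x) / fact r = (b_lin a1 \<Phi> x \<bullet> grad W x + q_lin a1 \<Phi> x * W x) / fact r
      + (dzp (replicate r (v x, grad v x)) a1 x (\<Phi> x) (grad \<Phi> x)
        - dzp (replicate r (v x, grad v x)) a2 x (\<Phi> x) (grad \<Phi> x)) / fact r"
    using key unfolding tr dzp_slice by simp
  then have "trace (C_lin \<Phi> x ** hess W x) = b_lin a1 \<Phi> x \<bullet> grad W x + q_lin a1 \<Phi> x * W x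
      + (dzp (replicate r (v x, grad v x)) a1 x (\<Phi> x) (grad \<Phi> x)
        - dzp (replicate r (v x, grad v x)) a2 x (\<Phi> x) (grad \<Phi> x))"
    using f0 by (simp only: add_divide_distrib[symmetric] divide_cancel_right simp_thms)
  then show ?thesis by (simp add: L_lin_def)
qed

text \<open>The case \<open>r = 1\<close> with the constant family \<open>\<Phi>\<close> as the
  second one: its first variation is 0, both nonlinearities are \<open>a\<close>, and the source
  term disappears.\<close>

lemma first_variation_equation:
  fixes \<Omega> :: "(real^'n) set"
  assumes 1: "MA_solution_line \<Omega> m \<alpha> \<delta> a \<phi> \<Phi> V S dS h"
    and a: "Ck_on 1 (\<Omega> \<times> UNIV) (uncurry3 a)" and x: "x \<in> \<Omega>"
    and sol: "det (hess \<Phi> x) = a x (\<Phi> x) (grad \<Phi> x)"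
    and sym: "transpose (C_lin \<Phi> x) = C_lin \<Phi> x"
  shows "L_lin a \<Phi> (dS 1 \<phi> [h]) x = 0"
proof -
  interpret s1: MA_solution_line \<Omega> m \<alpha> \<delta> a \<phi> \<Phi> V S dS h by (rule 1)
  note \<Omega> = s1.\<Omega>
  define u where "u t = S (\<lambda>x. \<phi> x + t * h x)" for t
  define v where "v = dS 1 \<phi> [h]"
  let ?p = "(\<Phi> x, grad \<Phi> x)"
  have f: "((\<lambda>t. (nderiv vs (u t) x - nderiv vs \<Phi> x) / t) \<longlongrightarrow> nderiv vs v x) (at 0)" if "length vs \<le> 2" for vs
    unfolding u_def v_def by (rule s1.first_quotient_nderiv[OF x]) (use that in simp)
  have t: "((\<lambda>t. nderiv vs (u t) x) \<longlongrightarrow> nderiv vs \<Phi> x) (at 0)" if "length vs \<le> 2" for vs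
    by (rule tendsto_of_quotient[OF f[OF that]])
  have ge: "grad u x $ i = nderiv [axis i 1] u x" for u i by (rule grad_nth)
  have "(\<Sum>i\<in>UNIV. \<Sum>j\<in>UNIV. cof (hess \<Phi> x) $ i $ j * hess v x $ i $ j)
     = nderiv [(v x, grad v x)] (\<lambda>y. uncurry3 a (x, y)) ?p
     + (nderiv (replicate 1 0) (\<lambda>y. uncurry3 a (x, y)) ?p
        - nderiv (replicate 1 0) (\<lambda>y. uncurry3 a (x, y)) ?p) / fact 1"
  proof (rule MA_variation[OF Ck_on_slice[OF \<Omega>(1) a x] Ck_on_slice[OF \<Omega>(1) a x] order_refl order_refl,
        where ?M1.0 = "\<lambda>t. hess (u t) x" and ?M2.0 = "\<lambda>t. hess \<Phi> x"
          and ?y1.0 = "\<lambda>t. (u t x, grad (u t) x)" and ?y2.0 = "\<lambda>t. ?p"])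
    show "((\<lambda>t. hess (u t) x) \<longlongrightarrow> hess \<Phi> x) (at 0)"
      unfolding hess_def by (intro tendsto_vec_lambda t) simp
    show "((\<lambda>t. (u t x, grad (u t) x)) \<longlongrightarrow> ?p) (at 0)"
      using t[of "[]"] t[of "[axis _ 1]"] unfolding grad_def
      by (intro tendsto_Pair tendsto_vec_lambda) (simp_all del: nderiv.simps(2))
    have "(hess (u t) x - hess \<Phi> x) /\<^sub>R t ^ 1
        = (\<chi> i j. (nderiv [axis i 1, axis j 1] (u t) x - nderiv [axis i 1, axis j 1] \<Phi> x) / t)" for t
      by (simp add: vec_eq_iff hess_nth divide_inverse_commute del: nderiv.simps)
    moreover have "hess v x = (\<chi> i j. nderiv [axis i 1, axis j 1] v x)"
      by (simp add: vec_eq_iff hess_nth del: nderiv.simps)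
    ultimately show "((\<lambda>t. (hess (u t) x - hess \<Phi> x) /\<^sub>R t ^ 1) \<longlongrightarrow> hess v x) (at 0)"
      by (simp only:) (intro tendsto_vec_lambda f, simp)
    have "((u t x, grad (u t) x) - ?p) /\<^sub>R t ^ 1
        = ((nderiv [] (u t) x - nderiv [] \<Phi> x) / t,
           \<chi> i. (nderiv [axis i 1] (u t) x - nderiv [axis i 1] \<Phi> x) / t)" for t
      by (simp add: vec_eq_iff ge divide_inverse_commute del: nderiv.simps(2))
    moreover have "(v x, grad v x) = (nderiv [] v x, \<chi> i. nderiv [axis i 1] v x)"
      by (simp add: vec_eq_iff ge del: nderiv.simps(2))
    ultimately show "((\<lambda>t. ((u t x, grad (u t) x) - ?p) /\<^sub>R t ^ 1) \<longlongrightarrow> (v x, grad v x)) (at 0)"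
      by (simp only:) (intro tendsto_Pair tendsto_vec_lambda f; simp)
    show "((\<lambda>t. (?p - ?p) /\<^sub>R t) \<longlongrightarrow> 0) (at 0)" by simp
    show "\<forall>\<^sub>F t in at 0. det (hess (u t) x) = uncurry3 a (x, u t x, grad (u t) x)"
      using s1.eventually_solution by eventually_elim (use x in \<open>simp add: MA_solution_def u_def\<close>)
    show "\<forall>\<^sub>F t in at (0::real). det (hess \<Phi> x) = uncurry3 a (x, ?p)" using sol by simp
  qed (auto intro: tendsto_const)
  then have "(\<Sum>i\<in>UNIV. \<Sum>j\<in>UNIV. cof (hess \<Phi> x) $ i $ j * hess v x $ i $ j)
      = b_lin a \<Phi> x \<bullet> grad v x + q_lin a \<Phi> x * v x"
    using jet_derivative_expand[OF \<Omega>(1) a _ x, of "v x" "grad v x" \<Phi>] by (simp add: dzp_slice del: nderiv.simps)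
  then show ?thesis unfolding L_lin_def v_def[symmetric] trace_mul_sym[OF sym] by (simp add: C_lin_def)
qed

text \<open>Both families take the same boundary values \<open>\<phi> + t h\<close>, so their
  difference is 0 at \<open>x\<close> for small \<open>t\<close>, and so is the limit of its
  quotient by \<open>t ^ r\<close>.\<close>

lemma boundary_variation_zero:
  fixes \<Omega> :: "(real^'n) set"
  assumes 1: "MA_solution_line \<Omega> m \<alpha> \<delta>1 a1 \<phi> \<Phi> V1 S1 dS1 h"
    and 2: "MA_solution_line \<Omega> m \<alpha> \<delta>2 a2 \<phi> \<Phi> V2 S2 dS2 h"
    and r: "1 \<le> r" "r \<le> m + 1" and x: "x \<in> frontier \<Omega>"
    and agree: "\<And>i. i < r \<Longrightarrow> dS1 i \<phi> (replicate i h) x = dS2 i \<phi> (replicate i h) x"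
  shows "dS1 r \<phi> (replicate r h) x - dS2 r \<phi> (replicate r h) x = 0"
proof -
  interpret s1: MA_solution_line \<Omega> m \<alpha> \<delta>1 a1 \<phi> \<Phi> V1 S1 dS1 h by (rule 1)
  interpret s2: MA_solution_line \<Omega> m \<alpha> \<delta>2 a2 \<phi> \<Phi> V2 S2 dS2 h by (rule 2)
  have xc: "x \<in> closure \<Omega>" using x by (simp add: frontier_def)
  note bf = bounded_functional_closure[OF s1.\<Omega> xc]
  have "((\<lambda>t. (S1 (\<lambda>x. \<phi> x + t * h x) x - S2 (\<lambda>x. \<phi> x + t * h x) x) / t ^ r)
     \<longlongrightarrow> (dS1 r \<phi> (replicate r h) x - dS2 r \<phi> (replicate r h) x) / fact r) (at 0)"
    by (rule frechet_difference_quotient[OF s1.line[OF bf] s2.line[OF bf] r]) (rule agree)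
  moreover have "((\<lambda>t. (S1 (\<lambda>x. \<phi> x + t * h x) x - S2 (\<lambda>x. \<phi> x + t * h x) x) / t ^ r) \<longlongrightarrow> 0) (at 0)"
  proof (rule Lim_transform_eventually[OF tendsto_const])
    show "\<forall>\<^sub>F t in at 0. 0 = (S1 (\<lambda>x. \<phi> x + t * h x) x - S2 (\<lambda>x. \<phi> x + t * h x) x) / t ^ r"
      using s1.eventually_solution s2.eventually_solution
      by eventually_elim (use x in \<open>simp add: MA_solution_def\<close>)
  qed
  ultimately have "(dS1 r \<phi> (replicate r h) x - dS2 r \<phi> (replicate r h) x) / fact r = 0"
    by (rule tendsto_unique[OF trivial_limit_at])
  then show ?thesis by simp
qed

text \<open>The graph representation behind the \<open>SOME\<close> in
  \<open>exterior_normal\<close> is extracted and used itself as the graph for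
  \<open>boundary_gradient_zero\<close>, so the normal condition refers to the right
  \<open>\<gamma>\<close> and \<open>e\<close>.\<close>

lemma gradient_zero_of_normal_deriv:
  fixes \<Omega> :: "(real^'n) set"
  assumes dom: "holder_domain k \<alpha> \<Omega>" and k: "1 \<le> k" and W12: "Ck_closure k \<Omega> W1" "Ck_closure k \<Omega> W2"
    and zero: "\<And>x. x \<in> frontier \<Omega> \<Longrightarrow> W1 x - W2 x = 0" and x0: "x0 \<in> frontier \<Omega>"
    and normal: "normal_deriv \<Omega> W1 x0 = normal_deriv \<Omega> W2 x0"
  shows "bdry_ext \<Omega> (nderiv [axis i 1] (\<lambda>x. W1 x - W2 x)) x0 = 0"
proof -
  have \<Omega>: "open \<Omega>" using dom by (simp add: holder_domain_def)
  let ?W = "\<lambda>x. W1 x - W2 x"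
  define P where "P x = bdry_ext \<Omega> (grad W1) x - bdry_ext \<Omega> (grad W2) x" for x
  have x0c: "x0 \<in> closure \<Omega>" using x0 by (simp add: frontier_def)
  have "\<exists>e r \<gamma>. bdry_graph \<Omega> x0 e r \<gamma> \<and> \<gamma> \<in> fcarrier (holder_space k \<alpha> (ball x0 r))"
    using dom x0 unfolding holder_domain_def by (elim conjE) (rule bspec)
  then obtain e r \<gamma> where "bdry_graph \<Omega> x0 e r \<gamma>" "Ck_closure 1 (ball x0 r) \<gamma>"
    using Ck_closure_mono[OF holder_spaceD(1) k] by blast
  then have "\<exists>\<nu> e r \<gamma>. bdry_graph \<Omega> x0 e r \<gamma> \<and> Ck_closure 1 (ball x0 r) \<gamma> \<and> \<nu> = (grad \<gamma> x0 - e) /\<^sub>R norm (grad \<gamma> x0 - e)"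
    by blast
  from someI_ex[OF this] obtain e r \<gamma> where g: "bdry_graph \<Omega> x0 e r \<gamma>" "Ck_closure 1 (ball x0 r) \<gamma>"
    and nu: "exterior_normal \<Omega> x0 = (grad \<gamma> x0 - e) /\<^sub>R norm (grad \<gamma> x0 - e)"
    unfolding exterior_normal_def[symmetric] by blast
  have "exterior_normal \<Omega> x0 \<bullet> P x0 = 0"
    using normal by (simp add: P_def normal_deriv_def inner_diff_right)
  then have n0: "(grad \<gamma> x0 - e) \<bullet> P x0 = 0" unfolding nu by auto
  have c: "Ck_on k \<Omega> W1" "Ck_on k \<Omega> W2" using W12 Ck_closure_imp_Ck_on by auto
  have nd: "nderiv vs ?W x = nderiv vs W1 x - nderiv vs W2 x" if "length vs \<le> 1" "x \<in> \<Omega>" for vs x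
    using nderiv_lincomb[OF \<Omega> c _ that(2), of vs "-1"] that(1) k by simp
  have Pin: "P x = grad ?W x" if "x \<in> \<Omega>" for x
    using that nd[OF _ that, of "[_]"] by (simp add: P_def bdry_ext_inside vec_eq_iff grad_nth del: nderiv.simps)
  have cP: "continuous_on (closure \<Omega>) P"
    unfolding P_def by (intro continuous_on_diff bdry_ext_continuous has_cext_jet(1)[OF \<Omega> W12(1) k] has_cext_jet(1)[OF \<Omega> W12(2) k])
  have "P x0 = 0"
  proof (rule boundary_gradient_zero[OF \<Omega> g x0 _ _ zero cP Pin n0])
    show "?W differentiable (at x)" if "x \<in> \<Omega>" for x
      using Ck_on_differentiable[OF \<Omega> c(1), of "[]" x] Ck_on_differentiable[OF \<Omega> c(2), of "[]" x] that k by auto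
    show "continuous_on (closure \<Omega>) ?W" using W12 by (intro continuous_on_diff) (auto simp: Ck_closure_def)
  qed
  moreover have "bdry_ext \<Omega> (nderiv [axis i 1] ?W) x0 = P x0 $ i"
    by (rule bdry_ext_eq[OF _ _ x0c]) (auto intro!: continuous_intros cP simp: Pin grad_nth simp del: nderiv.simps)
  ultimately show ?thesis by simp
qed

text \<open>Polarization under the integral. Replacing the repeated argument \<open>u\<close> by
  \<open>u + s * v\<close> gives a polynomial in \<open>s\<close> that vanishes identically; its
  linear coefficient contains \<open>v\<close> once. Iterating frees the arguments one after
  another.\<close>

lemma polarized_integral_zero:
  fixes A :: "'x \<Rightarrow> 'b::real_vector list \<Rightarrow> real" and J :: "('x \<Rightarrow> real) \<Rightarrow> 'x \<Rightarrow> 'b"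
  assumes lin: "\<And>u v s. u \<in> Sol \<Longrightarrow> v \<in> Sol \<Longrightarrow> (\<lambda>x. u x + s * v x) \<in> Sol"
    and J: "\<And>u v s x. u \<in> Sol \<Longrightarrow> v \<in> Sol \<Longrightarrow> x \<in> space M \<Longrightarrow> J (\<lambda>x. u x + s * v x) x = J u x + s *\<^sub>R J v x"
    and A: "\<And>x. x \<in> space M \<Longrightarrow> sym_multilinear k (A x)"
    and int: "\<And>us. set us \<subseteq> Sol \<Longrightarrow> length us = k \<Longrightarrow> integrable M (\<lambda>x. A x (map (\<lambda>u. J u x) us) * w x)"
    and diag: "\<And>u. u \<in> Sol \<Longrightarrow> (LINT x|M. A x (replicate k (J u x)) * w x) = 0"
    and us: "set us \<subseteq> Sol" "length us = k" "1 \<le> k"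
  shows "(LINT x|M. A x (map (\<lambda>u. J u x) us) * w x) = 0"
proof -
  define I where "I us = (LINT x|M. A x (map (\<lambda>u. J u x) us) * w x)" for us
  have *: "I (us @ replicate n u) = 0"
    if "set us \<subseteq> Sol" "u \<in> Sol" "length us + n = k" for us u n
    using that
  proof (induction us arbitrary: u n rule: rev_induct)
    case Nil
    then show ?case using diag by (simp add: I_def)
  next
    case (snoc v us)
    let ?g = "\<lambda>i. us @ replicate i v @ replicate (Suc n - i) u"
    have set: "set (?g i) \<subseteq> Sol" for i using snoc.prems by auto
    have poly: "(\<Sum>i\<le>Suc n. (real (Suc n choose i) * I (?g i)) * s ^ i) = 0" for s
    proof -
      let ?w = "\<lambda>x. u x + s * v x"
      have wS: "?w \<in> Sol" using snoc.prems by (intro lin) auto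
      have "0 = I (us @ replicate (Suc n) ?w)"
        using snoc.prems by (subst snoc.IH[OF _ wS]) auto
      also have "\<dots> = (LINT x|M. (\<Sum>i\<le>Suc n. real (Suc n choose i) * s ^ i * (A x (map (\<lambda>u. J u x) (?g i)) * w x)))"
        unfolding I_def
      proof (rule Bochner_Integration.integral_cong[OF refl])
        fix x assume x: "x \<in> space M"
        have "A x (map (\<lambda>u. J u x) (us @ replicate (Suc n) ?w))
            = A x (map (\<lambda>u. J u x) us @ replicate (Suc n) (J u x + s *\<^sub>R J v x))"
          using J[OF _ _ x, of u v s] snoc.prems by simp
        also have "\<dots> = (\<Sum>i\<le>Suc n. real (Suc n choose i) * s ^ i *
            A x (map (\<lambda>u. J u x) us @ replicate i (J v x) @ replicate (Suc n - i) (J u x)))"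
          by (rule sym_multilinear_binomial[OF A[OF x]]) (use snoc.prems in simp)
        finally show "A x (map (\<lambda>u. J u x) (us @ replicate (Suc n) ?w)) * w x
            = (\<Sum>i\<le>Suc n. real (Suc n choose i) * s ^ i * (A x (map (\<lambda>u. J u x) (?g i)) * w x))"
          by (simp only: sum_distrib_right mult.assoc map_append map_replicate)
      qed
      also have "\<dots> = (\<Sum>i\<le>Suc n. real (Suc n choose i) * s ^ i * I (?g i))"
        unfolding I_def
      proof (subst Bochner_Integration.integral_sum)
        show "integrable M (\<lambda>x. real (Suc n choose i) * s ^ i * (A x (map (\<lambda>u. J u x) (?g i)) * w x))"
          if "i \<in> {..Suc n}" for i
          using that snoc.prems set by (intro Bochner_Integration.integrable_mult_right int) auto
      qed simp
      finally show ?thesis by (simp only: mult.assoc mult.commute[of "s ^ _"])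
    qed
    \<comment> \<open>Index 1 turns exactly one copy of \<open>u\<close> into \<open>v\<close>,
      leaving \<open>n\<close> copies of \<open>u\<close> behind the longer list; the factor
      \<open>Suc n\<close> is nonzero.\<close>
    have "real (Suc n choose 1) * I (?g 1) = 0"
      by (rule polynomial_zero_linear_coeff[where c = "\<lambda>i. real (Suc n choose i) * I (?g i)", OF poly]) simp
    then show ?case by simp
  qed
  \<comment> \<open>The claim is used with no repeated argument left; the head of \<open>us\<close>
    only fills the place of \<open>u\<close>.\<close>
  have "us \<noteq> []" using us by auto
  then have "hd us \<in> Sol" using us(1) hd_in_set by blast
  then show ?thesis using *[of us "hd us" 0] us by (simp add: I_def)
qed

section \<open>The background solution: uniform ellipticity and uniqueness for its
  linearization\<close>

locale MA_background =
  fixes \<Omega> :: "(real^'n) set" and m :: nat and \<alpha> c0 :: real and a \<phi> \<Phi>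
  assumes dom: "holder_domain (m + 2) \<alpha> \<Omega>" and m: "1 \<le> m"
    and a_reg: "uncurry3 a \<in> fcarrier (holder_space (2 * m + 1) \<alpha> (\<Omega> \<times> UNIV))"
    and a_pos: "\<And>x z p. x \<in> closure \<Omega> \<Longrightarrow> 0 < a x z p"
    and Phi_reg: "\<Phi> \<in> fcarrier (holder_space (m + 2) \<alpha> \<Omega>)"
    and c0_pos: "0 < c0"
    and Phi_convex: "\<And>x \<xi>. x \<in> closure \<Omega> \<Longrightarrow> c0 * (norm \<xi>)\<^sup>2 \<le> \<xi> \<bullet> (bdry_ext \<Omega> (hess \<Phi>) x *v \<xi>)"
    and sol: "MA_solution \<Omega> a \<phi> \<Phi>"
    and q_nonneg: "\<And>x. x \<in> \<Omega> \<Longrightarrow> 0 \<le> q_lin a \<Phi> x"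
begin

lemma domain: "open \<Omega>" "bounded \<Omega>" "\<Omega> \<noteq> {}"
  using dom by (auto simp: holder_domain_def)

lemma a_closure: "j \<le> 2 * m + 1 \<Longrightarrow> Ck_closure j (\<Omega> \<times> UNIV) (uncurry3 a)"
  by (rule Ck_closure_mono[OF holder_spaceD(1)[OF a_reg]])

lemma Y_closure: "u \<in> fcarrier (holder_space (m + 2) \<alpha> \<Omega>) \<Longrightarrow> j \<le> m + 2 \<Longrightarrow> Ck_closure j \<Omega> u"
  by (rule Ck_closure_mono[OF holder_spaceD(1)])

lemma det_hess_pos: assumes "x \<in> \<Omega>" shows "0 < det (hess \<Phi> x)"
proof -
  have "x \<in> closure \<Omega>" using assms closure_subset by blast
  then show ?thesis
    unfolding bspec[OF conjunct1[OF sol[unfolded MA_solution_def]] assms] by (rule a_pos)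
qed

lemma Phi_Ck2: "Ck_on 2 \<Omega> \<Phi>"
  by (rule Ck_closure_imp_Ck_on[OF Y_closure[OF Phi_reg]]) simp

lemma C_sym: "x \<in> \<Omega> \<Longrightarrow> transpose (C_lin \<Phi> x) = C_lin \<Phi> x"
  unfolding C_lin_def using det_hess_pos[of x]
  by (intro transpose_cof_sym transpose_hess[OF domain(1) Phi_Ck2]) auto

lemma hess_cext: "has_cext \<Omega> (hess \<Phi>)"
  by (intro has_cext_vec) (simp add: hess_nth Ck_closure_cext[OF domain(1) Y_closure[OF Phi_reg order_refl]] del: nderiv.simps)

text \<open>Positivity is wanted on the closed domain, so that compactness can make it uniform.
  Symmetry and a nonnegative determinant pass to the boundary by continuity; strict convexity gives
  a trivial kernel, which excludes determinant 0.\<close>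

lemma cof_closure_pos:
  assumes x: "x \<in> closure \<Omega>" and \<xi>: "\<xi> \<noteq> 0"
  shows "0 < \<xi> \<bullet> (cof (bdry_ext \<Omega> (hess \<Phi>) x) *v \<xi>)"
proof -
  let ?E = "bdry_ext \<Omega> (hess \<Phi>)"
  note cE = bdry_ext_continuous[OF hess_cext]
  have pos: "0 < \<zeta> \<bullet> (?E x *v \<zeta>)" if "\<zeta> \<noteq> 0" for \<zeta>
  proof -
    have "0 < c0 * (norm \<zeta>)\<^sup>2" using c0_pos that by simp
    then show ?thesis using Phi_convex[OF x, of \<zeta>] by linarith
  qed
  have "?E x $ i $ j = ?E x $ j $ i" for i j
  proof (rule continuous_eq_on_closure[OF _ _ _ x])
    show "?E y $ i $ j = ?E y $ j $ i" if "y \<in> \<Omega>" for y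
      using transpose_eq_nth[OF transpose_hess[OF domain(1) Phi_Ck2 that]] by (simp add: bdry_ext_inside[OF that])
  qed (intro continuous_intros cE)+
  then have sym: "transpose (?E x) = ?E x" by (simp add: transpose_def vec_eq_iff)
  have "0 \<le> det (?E x)"
  proof (rule continuous_ge_on_closure[OF _ x])
    show "continuous_on (closure \<Omega>) (\<lambda>x. det (?E x))"
      by (rule continuous_on_compose2[OF continuous_on_det cE]) simp
    show "0 \<le> det (?E y)" if "y \<in> \<Omega>" for y
      using det_hess_pos[OF that] by (simp add: bdry_ext_inside[OF that])
  qed
  moreover have "det (?E x) \<noteq> 0"
  proof -
    have "\<zeta> = 0" if "?E x *v \<zeta> = 0" for \<zeta>
    proof (rule ccontr)
      assume "\<zeta> \<noteq> 0" from pos[OF this] that show False by simp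
    qed
    then have "\<exists>B. B ** ?E x = mat 1" unfolding matrix_left_invertible_ker by blast
    then show ?thesis using invertible_left_inverse invertible_det_nz by blast
  qed
  ultimately have "0 < det (?E x)" by simp
  from cof_positive[OF sym this pos \<xi>] show ?thesis .
qed

lemma C_psd: assumes "x \<in> \<Omega>" shows "0 \<le> \<xi> \<bullet> (C_lin \<Phi> x *v \<xi>)"
proof (cases "\<xi> = 0")
  case False
  have "x \<in> closure \<Omega>" using assms closure_subset by blast
  from cof_closure_pos[OF this False] show ?thesis by (simp add: C_lin_def bdry_ext_inside[OF assms])
qed simp

text \<open>A positive continuous function attains its minimum on the compact closure; this is the
  ellipticity constant that the barrier uses.\<close>

lemma C_lower: "\<exists>c>0. \<forall>x\<in>\<Omega>. c \<le> C_lin \<Phi> x $ p $ p"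
proof -
  let ?f = "\<lambda>x. cof (bdry_ext \<Omega> (hess \<Phi>) x) $ p $ p"
  have "continuous_on (closure \<Omega>) ?f"
    by (rule continuous_on_compose2[OF continuous_on_cof bdry_ext_continuous[OF hess_cext]]) simp
  moreover have "compact (closure \<Omega>)" "closure \<Omega> \<noteq> {}" using domain by auto
  ultimately obtain y where y: "y \<in> closure \<Omega>" "\<forall>x\<in>closure \<Omega>. ?f y \<le> ?f x"
    using continuous_attains_inf[of "closure \<Omega>" ?f] by blast
  have "axis p (1::real) \<noteq> 0" by (simp add: axis_eq_0_iff)
  from cof_closure_pos[OF y(1) this] have "0 < ?f y"
    by (simp add: matrix_vector_mult_basis column_def inner_axis')
  moreover have "?f y \<le> C_lin \<Phi> x $ p $ p" if "x \<in> \<Omega>" for x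
  proof -
    have "x \<in> closure \<Omega>" using that closure_subset by blast
    moreover have "C_lin \<Phi> x $ p $ p = ?f x" by (simp add: C_lin_def bdry_ext_inside[OF that])
    ultimately show ?thesis using y(2) by simp
  qed
  ultimately show ?thesis by blast
qed

lemma dzp_cext: "length vs \<le> 2 * m + 1 \<Longrightarrow> has_cext \<Omega> (\<lambda>x. dzp vs a x (\<Phi> x) (grad \<Phi> x))"
  by (rule has_cext_dzp[OF domain(1) a_closure[OF order_refl] Y_closure[OF Phi_reg order_refl]]) auto

lemma uniqueness:
  assumes W: "W \<in> fcarrier (holder_space (m + 2) \<alpha> \<Omega>)" and L: "\<And>x. x \<in> \<Omega> \<Longrightarrow> L_lin a \<Phi> W x = 0"
    and z: "\<And>x. x \<in> frontier \<Omega> \<Longrightarrow> W x = 0" and x: "x \<in> closure \<Omega>"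
  shows "W x = 0"
proof (cases "x \<in> \<Omega>")
  case True
  \<comment> \<open>Any coordinate can carry the barrier of the maximum principle; types being
    nonempty, there is one.\<close>
  fix p :: 'n
  obtain c where c: "c > 0" "\<forall>x\<in>\<Omega>. c \<le> C_lin \<Phi> x $ p $ p" using C_lower by blast
  have "has_cext \<Omega> (\<lambda>x. b_lin a \<Phi> x $ p)" unfolding b_lin_def using dzp_cext[of "[(0, axis p 1)]"] by simp
  then obtain B where B: "B \<ge> 0" "\<And>x. x \<in> \<Omega> \<Longrightarrow> \<bar>b_lin a \<Phi> x $ p\<bar> \<le> B" by (rule has_cext_bounded[OF _ domain(2)]) blast
  have "has_cext \<Omega> (q_lin a \<Phi>)" unfolding q_lin_def using dzp_cext[of "[(1, 0)]"] by simp
  then obtain Q where Q: "Q \<ge> 0" "\<And>x. x \<in> \<Omega> \<Longrightarrow> \<bar>q_lin a \<Phi> x\<bar> \<le> Q" by (rule has_cext_bounded[OF _ domain(2)]) blast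
  note cl = Y_closure[OF W, of 2]
  show ?thesis
  proof (rule dirichlet_uniqueness[OF domain(1,2) _ _ z C_sym C_psd c(1) _ B(2) q_nonneg _ _ True])
    show "Ck_on 2 \<Omega> W" using cl by (intro Ck_closure_imp_Ck_on) simp
    show "continuous_on (closure \<Omega>) W" using cl by (simp add: Ck_closure_def)
    show "c \<le> C_lin \<Phi> x $ p $ p" if "x \<in> \<Omega>" for x using c(2) that by blast
    show "q_lin a \<Phi> x \<le> Q" if "x \<in> \<Omega>" for x using Q(2)[OF that] by simp
    show "trace (C_lin \<Phi> x ** hess W x) - b_lin a \<Phi> x \<bullet> grad W x - q_lin a \<Phi> x * W x = 0" if "x \<in> \<Omega>" for x
      using L[OF that] by (simp add: L_lin_def)
  qed
next
  case False
  then have "x \<in> frontier \<Omega>" using x domain(1) by (simp add: frontier_def interior_open)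
  then show ?thesis by (rule z)
qed

lemma jet_lincomb:
  assumes u: "u \<in> fcarrier (holder_space (m + 2) \<alpha> \<Omega>)" and v: "v \<in> fcarrier (holder_space (m + 2) \<alpha> \<Omega>)" and x: "x \<in> \<Omega>"
  shows "grad (\<lambda>x. u x + s * v x) x = grad u x + s *\<^sub>R grad v x"
    and "L_lin a \<Phi> (\<lambda>x. u x + s * v x) x = L_lin a \<Phi> u x + s * L_lin a \<Phi> v x"
proof -
  have nd: "nderiv vs (\<lambda>x. u x + s * v x) x = nderiv vs u x + s * nderiv vs v x" if "length vs \<le> 2" for vs
    by (rule nderiv_lincomb[OF domain(1) holder_space_Ck_on[OF u] holder_space_Ck_on[OF v] _ x]) (use that in simp)
  show g: "grad (\<lambda>x. u x + s * v x) x = grad u x + s *\<^sub>R grad v x"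
    using nd[of "[_]"] by (simp add: vec_eq_iff grad_nth del: nderiv.simps)
  have h: "hess (\<lambda>x. u x + s * v x) x = hess u x + s *\<^sub>R hess v x"
    using nd[of "[_, _]"] by (simp add: vec_eq_iff hess_nth del: nderiv.simps)
  have t: "trace (C ** (M + s *\<^sub>R N)) = trace (C ** M) + s * trace (C ** N)" for C M N :: "real^'n^'n"
    by (simp add: trace_def matrix_matrix_mult_def distrib_left sum.distrib sum_distrib_left mult.left_commute)
  show "L_lin a \<Phi> (\<lambda>x. u x + s * v x) x = L_lin a \<Phi> u x + s * L_lin a \<Phi> v x"
    unfolding L_lin_def g h t by (simp add: inner_add_right algebra_simps)
qed

end

section \<open>Continuity up to the boundary of forms evaluated on jets\<close>

lemma has_cext_prod_list_inner:
  fixes J :: "('x \<Rightarrow> real) \<Rightarrow> 'x::topological_space \<Rightarrow> 'b::{real_inner}"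
  assumes "\<And>u. u \<in> set us \<Longrightarrow> has_cext \<Omega> (J u)" "length bs = length us"
  shows "has_cext \<Omega> (\<lambda>x. prod_list (map2 (\<bullet>) (map (\<lambda>u. J u x) us) bs))"
  using assms
proof (induction us arbitrary: bs)
  case Nil
  then show ?case by (simp add: has_cext_const)
next
  case (Cons u us)
  obtain b bs' where bs: "bs = b # bs'" using Cons.prems(2) by (cases bs) auto
  obtain g where "continuous_on (closure \<Omega>) g" "\<forall>x\<in>\<Omega>. g x = J u x" using Cons.prems(1)[of u] by (auto simp: has_cext_def)
  then have "has_cext \<Omega> (\<lambda>x. J u x \<bullet> b)"
    unfolding has_cext_def by (intro exI[of _ "\<lambda>x. g x \<bullet> b"]) (auto intro!: continuous_intros)
  moreover have "has_cext \<Omega> (\<lambda>x. prod_list (map2 (\<bullet>) (map (\<lambda>u. J u x) us) bs'))"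
    using Cons.prems by (intro Cons.IH) (auto simp: bs)
  ultimately show ?case unfolding bs by (simp add: has_cext_mult)
qed

text \<open>The directions themselves vary with \<open>x\<close>. Expansion over basis multi-indices
  separates them into products of jet components, leaving forms with fixed directions.\<close>

lemma has_cext_dzp_jets:
  fixes a :: "real^'n \<Rightarrow> real \<Rightarrow> real^'n \<Rightarrow> real"
  assumes \<Omega>: "open \<Omega>" and a: "Ck_closure k (\<Omega> \<times> UNIV) (uncurry3 a)" and \<Phi>: "Ck_closure j \<Omega> \<Phi>" "1 \<le> j"
    and us: "\<And>u. u \<in> set us \<Longrightarrow> Ck_closure j \<Omega> u" "length us \<le> k"
  shows "has_cext \<Omega> (\<lambda>x. dzp (map (\<lambda>u. (u x, grad u x)) us) a x (\<Phi> x) (grad \<Phi> x))"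
proof (rule has_cext_cong)
  show "has_cext \<Omega> (\<lambda>x. \<Sum>bs\<in>mindex (length us).
      prod_list (map2 (\<bullet>) (map (\<lambda>u. (u x, grad u x)) us) bs) * dzp bs a x (\<Phi> x) (grad \<Phi> x))"
  proof (intro has_cext_sum finite_mindex has_cext_mult)
    fix bs :: "(real \<times> (real^'n)) list" assume "bs \<in> mindex (length us)"
    then have l: "length bs = length us" by (simp add: mindex_def)
    show "has_cext \<Omega> (\<lambda>x. prod_list (map2 (\<bullet>) (map (\<lambda>u. (u x, grad u x)) us) bs))"
      by (rule has_cext_prod_list_inner[where J = "\<lambda>u x. (u x, grad u x)", OF has_cext_jet(2)[OF \<Omega> us(1) \<Phi>(2)] l])
    show "has_cext \<Omega> (\<lambda>x. dzp bs a x (\<Phi> x) (grad \<Phi> x))"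
      by (rule has_cext_dzp[OF \<Omega> a \<Phi>]) (use l us(2) in simp)
  qed
  fix x assume x: "x \<in> \<Omega>"
  show "(\<Sum>bs\<in>mindex (length us).
      prod_list (map2 (\<bullet>) (map (\<lambda>u. (u x, grad u x)) us) bs) * dzp bs a x (\<Phi> x) (grad \<Phi> x))
      = dzp (map (\<lambda>u. (u x, grad u x)) us) a x (\<Phi> x) (grad \<Phi> x)"
    using nderiv_expand[OF open_UNIV Ck_on_slice[OF \<Omega> Ck_closure_imp_Ck_on[OF a] x],
        of "map (\<lambda>u. (u x, grad u x)) us" "(\<Phi> x, grad \<Phi> x)"] us(2)
    by (simp only: dzp_slice length_map UNIV_I)
qed

lemma sym_multilinear_diff:
  assumes S: "sym_multilinear k S" and T: "sym_multilinear k T" shows "sym_multilinear k (\<lambda>vs. S vs - T vs)"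
  unfolding sym_multilinear_def
proof (intro conjI allI impI)
  show "linear (\<lambda>v. S (vs[i := v]) - T (vs[i := v]))" if "length vs = k \<and> i < k" for vs i
    using S T that unfolding sym_multilinear_def by (intro linear_compose_sub) blast+
  show "S vs - T vs = S ws - T ws" if "length vs = k \<and> mset vs = mset ws" for vs ws
  proof -
    have "S vs = S ws" "T vs = T ws" using S T that unfolding sym_multilinear_def by blast+
    then show ?thesis by simp
  qed
qed

theorem theorem7p9:
  fixes \<Omega> :: "(real^'n) set" and m k :: nat and \<alpha> c0 \<delta>1 \<delta>2 :: real
    and a1 a2 :: "real^'n \<Rightarrow> real \<Rightarrow> real^'n \<Rightarrow> real"
    and \<phi> \<Phi> :: "real^'n \<Rightarrow> real"
    and V1 V2 :: "(real^'n \<Rightarrow> real) set"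
    and S1 S2 :: "(real^'n \<Rightarrow> real) \<Rightarrow> real^'n \<Rightarrow> real"
    and dS1 dS2 :: "nat \<Rightarrow> (real^'n \<Rightarrow> real) \<Rightarrow> (real^'n \<Rightarrow> real) list \<Rightarrow> real^'n \<Rightarrow> real"
  assumes alpha: "0 < \<alpha>" "\<alpha> < 1"
    and dom: "holder_domain (m + 2) \<alpha> \<Omega>"
    and a1_reg: "(\<lambda>(x, z, p). a1 x z p) \<in> fcarrier (holder_space (2 * m + 1) \<alpha> (\<Omega> \<times> UNIV))"
    and a2_reg: "(\<lambda>(x, z, p). a2 x z p) \<in> fcarrier (holder_space (2 * m + 1) \<alpha> (\<Omega> \<times> UNIV))"
    and a1_pos: "\<And>x z p. x \<in> closure \<Omega> \<Longrightarrow> 0 < a1 x z p"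
    and a2_pos: "\<And>x z p. x \<in> closure \<Omega> \<Longrightarrow> 0 < a2 x z p"
    and phi_reg: "\<phi> \<in> fcarrier (holder_bdry_space (m + 2) \<alpha> \<Omega>)"
    and Phi_reg: "\<Phi> \<in> fcarrier (holder_space (m + 2) \<alpha> \<Omega>)"
    and c0_pos: "0 < c0"
    and Phi_convex: "\<And>x \<xi>. x \<in> closure \<Omega> \<Longrightarrow> c0 * (norm \<xi>)\<^sup>2 \<le> \<xi> \<bullet> (bdry_ext \<Omega> (hess \<Phi>) x *v \<xi>)"
    and Phi_sol1: "MA_solution \<Omega> a1 \<phi> \<Phi>"
    and Phi_sol2: "MA_solution \<Omega> a2 \<phi> \<Phi>"
    and q1_nonneg: "\<And>x. x \<in> \<Omega> \<Longrightarrow> 0 \<le> q_lin a1 \<Phi> x"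
    and q2_nonneg: "\<And>x. x \<in> \<Omega> \<Longrightarrow> 0 \<le> q_lin a2 \<Phi> x"
    and b_agree: "\<And>x. x \<in> \<Omega> \<Longrightarrow> b_lin a1 \<Phi> x = b_lin a2 \<Phi> x"
    and q_agree: "\<And>x. x \<in> \<Omega> \<Longrightarrow> q_lin a1 \<Phi> x = q_lin a2 \<Phi> x"
    and k: "2 \<le> k" "k \<le> m + 1"
    and lower_agree: "\<And>r x vs. 1 \<le> r \<Longrightarrow> r \<le> k - 1 \<Longrightarrow> x \<in> \<Omega> \<Longrightarrow> length vs = r \<Longrightarrow>
          dzp vs a1 x (\<Phi> x) (grad \<Phi> x) = dzp vs a2 x (\<Phi> x) (grad \<Phi> x)"
    and density: "product_density m \<alpha> k \<Omega> a1 \<Phi>"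
    and S1: "solution_operator m \<alpha> \<Omega> a1 \<phi> \<Phi> \<delta>1 V1 S1 dS1"
    and S2: "solution_operator m \<alpha> \<Omega> a2 \<phi> \<Phi> \<delta>2 V2 S2 dS2"
    and same_variations: "\<And>r hs x. 1 \<le> r \<Longrightarrow> r \<le> k \<Longrightarrow>
          set hs \<subseteq> fcarrier (holder_bdry_space (m + 2) \<alpha> \<Omega>) \<Longrightarrow> length hs = r \<Longrightarrow> x \<in> frontier \<Omega> \<Longrightarrow>
          normal_deriv \<Omega> (dS1 r \<phi> hs) x = normal_deriv \<Omega> (dS2 r \<phi> hs) x"
  shows "\<forall>x\<in>\<Omega>. \<forall>vs. length vs = k \<longrightarrow>
          dzp vs a1 x (\<Phi> x) (grad \<Phi> x) = dzp vs a2 x (\<Phi> x) (grad \<Phi> x)"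
proof -
  let ?X = "holder_bdry_space (m + 2) \<alpha> \<Omega>" and ?Y = "holder_space (m + 2) \<alpha> \<Omega>"
  let ?J = "\<lambda>u x. (u x, grad u x)"
  \<comment> \<open>Thus \<open>m + 2\<close> is at least 3, the regularity the Piola identity asks
    of \<open>\<Phi>\<close>.\<close>
  have m1: "1 \<le> m" using k by simp
  interpret bg: MA_background \<Omega> m \<alpha> c0 a1 \<phi> \<Phi>
    by (rule MA_background.intro[OF dom m1 a1_reg a1_pos Phi_reg c0_pos Phi_convex Phi_sol1 q1_nonneg])
  note \<Omega> = bg.domain
  have a1c: "Ck_closure k (\<Omega> \<times> UNIV) (uncurry3 a1)" using k by (intro bg.a_closure) simp
  have a2c: "Ck_closure k (\<Omega> \<times> UNIV) (uncurry3 a2)"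
    using k by (intro Ck_closure_mono[OF holder_spaceD(1)[OF a2_reg]]) simp
  note ck = Ck_closure_imp_Ck_on[OF a1c] Ck_closure_imp_Ck_on[OF a2c]
  have line1: "MA_solution_line \<Omega> m \<alpha> \<delta>1 a1 \<phi> \<Phi> V1 S1 dS1 h" if "h \<in> fcarrier ?X" for h
    by (rule MA_solution_line.intro[OF \<Omega>(1,3) phi_reg that S1])
  have line2: "MA_solution_line \<Omega> m \<alpha> \<delta>2 a2 \<phi> \<Phi> V2 S2 dS2 h" if "h \<in> fcarrier ?X" for h
    by (rule MA_solution_line.intro[OF \<Omega>(1,3) phi_reg that S2])
  have bdry: "\<Phi> x = \<phi> x" if "x \<in> frontier \<Omega>" for x using Phi_sol1 that by (simp add: MA_solution_def)
  \<comment> \<open>\<open>lower_agree\<close> starts at order 1. Order 0 holds because both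
    nonlinearities equal the determinant of the same Hessian along the background.\<close>
  have low: "dzp vs a1 x (\<Phi> x) (grad \<Phi> x) = dzp vs a2 x (\<Phi> x) (grad \<Phi> x)" if "length vs < k" "x \<in> \<Omega>" for vs x
  proof (cases "vs = []")
    case True
    have "a1 x (\<Phi> x) (grad \<Phi> x) = a2 x (\<Phi> x) (grad \<Phi> x)"
      using bspec[OF conjunct1[OF Phi_sol1[unfolded MA_solution_def]] that(2)]
        bspec[OF conjunct1[OF Phi_sol2[unfolded MA_solution_def]] that(2)] by simp
    then show ?thesis using True by (simp add: dzp_def)
  next
    case False
    then have "1 \<le> length vs" by (cases vs) auto
    then show ?thesis using that by (intro lower_agree[of "length vs"]) auto
  qed
  define A0 where "A0 x vs = dzp vs a1 x (\<Phi> x) (grad \<Phi> x) - dzp vs a2 x (\<Phi> x) (grad \<Phi> x)" for x vs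
  define W where "W r h = (\<lambda>y. dS1 r \<phi> (replicate r h) y - dS2 r \<phi> (replicate r h) y)" for r h
  have rep: "set (replicate r h) \<subseteq> fcarrier ?X" if "h \<in> fcarrier ?X" for r h using that by auto
  have car1: "dS1 r \<phi> (replicate r h) \<in> fcarrier ?Y" if "h \<in> fcarrier ?X" "r \<le> m + 1" for r h
    by (rule MA_solution_line.derivative_carrier[OF line1[OF that(1)] that(2) rep[OF that(1)]]) simp
  have car2: "dS2 r \<phi> (replicate r h) \<in> fcarrier ?Y" if "h \<in> fcarrier ?X" "r \<le> m + 1" for r h
    by (rule MA_solution_line.derivative_carrier[OF line2[OF that(1)] that(2) rep[OF that(1)]]) simp
  have Wcar: "W r h \<in> fcarrier ?Y" if "h \<in> fcarrier ?X" "r \<le> m + 1" for r h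
    using holder_space_lincomb[OF \<Omega>(1) car1[OF that] car2[OF that], of "-1"] by (simp add: W_def)
  have W0: "W 0 h x = 0" if "h \<in> fcarrier ?X" "x \<in> closure \<Omega>" for h x
    using MA_solution_line.zeroth_closure[OF line1[OF that(1)] that(2)]
      MA_solution_line.zeroth_closure[OF line2[OF that(1)] that(2)] by (simp add: W_def)
  have eqn: "L_lin a1 \<Phi> (W r h) x = A0 x (replicate r (?J (dS2 1 \<phi> [h]) x))"
    if h: "h \<in> fcarrier ?X" and r: "1 \<le> r" "r \<le> k" and x: "x \<in> \<Omega>"
      and z: "\<And>i y. i < r \<Longrightarrow> y \<in> closure \<Omega> \<Longrightarrow> W i h y = 0" for r h x
    unfolding W_def A0_def
  proof (rule variation_equation[OF line1[OF h] line2[OF h] ck r k(2) x _ _ bg.C_sym[OF x]])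
    fix i and vs :: "(real^'n) list" assume i: "i < r"
    show "nderiv vs (dS1 i \<phi> (replicate i h)) x = nderiv vs (dS2 i \<phi> (replicate i h)) x"
    proof (rule nderiv_cong_open[OF \<Omega>(1) _ x])
      fix y assume "y \<in> \<Omega>"
      then have "y \<in> closure \<Omega>" using closure_subset by blast
      from z[OF i this] show "dS1 i \<phi> (replicate i h) y = dS2 i \<phi> (replicate i h) y" by (simp add: W_def)
    qed
  next
    fix vs :: "(real \<times> (real^'n)) list" assume "length vs < r"
    then show "dzp vs a1 x (\<Phi> x) (grad \<Phi> x) = dzp vs a2 x (\<Phi> x) (grad \<Phi> x)" using r(2) x by (intro low) auto
  qed
  have Wb: "W r h x = 0"
    if h: "h \<in> fcarrier ?X" and r: "1 \<le> r" "r \<le> k" and x: "x \<in> frontier \<Omega>"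
      and z: "\<And>i y. i < r \<Longrightarrow> y \<in> closure \<Omega> \<Longrightarrow> W i h y = 0" for r h x
    unfolding W_def
  proof (rule boundary_variation_zero[OF line1[OF h] line2[OF h] r(1) _ x])
    show "r \<le> m + 1" using r k by simp
    have "x \<in> closure \<Omega>" using x by (simp add: frontier_def)
    then show "dS1 i \<phi> (replicate i h) x = dS2 i \<phi> (replicate i h) x" if "i < r" for i
      using z[OF that] by (simp add: W_def)
  qed
  \<comment> \<open>Strong induction: if all earlier differences vanish on the closure,
    \<open>eqn\<close> applies, and its source is 0 since its \<open>r < k\<close> directions fall
    under \<open>low\<close>. With zero boundary values from \<open>Wb\<close>, uniqueness gives the
    next difference.\<close>
  have below: "W r h x = 0" if h: "h \<in> fcarrier ?X" and r: "r < k" and x: "x \<in> closure \<Omega>" for r h x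
    using r x
  proof (induction r arbitrary: x rule: less_induct)
    case (less r)
    show ?case
    proof (cases "r = 0")
      case True
      then show ?thesis using W0[OF h less.prems(2)] by simp
    next
      case False
      then have r1: "1 \<le> r" "r \<le> k" using less.prems by auto
      have z: "W i h y = 0" if "i < r" "y \<in> closure \<Omega>" for i y using less.IH[OF that(1) _ that(2)] that less.prems by simp
      show ?thesis
      proof (rule bg.uniqueness[OF Wcar[OF h] _ Wb[OF h r1 _ z] less.prems(2)])
        show "r \<le> m + 1" using r1 k by simp
        show "L_lin a1 \<Phi> (W r h) y = 0" if "y \<in> \<Omega>" for y
          using eqn[OF h r1 that z] low[of "replicate r (?J (dS2 1 \<phi> [h]) y)" y] less.prems(1) that by (simp add: A0_def)
      qed
    qed
  qed
  have Acext: "has_cext \<Omega> (\<lambda>x. A0 x (map (\<lambda>u. ?J u x) us))"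
    if "set us \<subseteq> fcarrier ?Y" "length us = k" for us
  proof -
    have "has_cext \<Omega> (\<lambda>x. dzp (map (\<lambda>u. ?J u x) us) a1 x (\<Phi> x) (grad \<Phi> x)
        + (-1) * dzp (map (\<lambda>u. ?J u x) us) a2 x (\<Phi> x) (grad \<Phi> x))"
      using that
      by (intro has_cext_lincomb has_cext_dzp_jets[OF \<Omega>(1) a1c bg.Y_closure[OF Phi_reg order_refl]]
          has_cext_dzp_jets[OF \<Omega>(1) a2c bg.Y_closure[OF Phi_reg order_refl]] bg.Y_closure) auto
    then show ?thesis by (simp add: A0_def)
  qed
  have Acext': "has_cext \<Omega> (\<lambda>x. A0 x vs)" if "length vs = k" for vs
  proof -
    have "has_cext \<Omega> (\<lambda>x. dzp vs a1 x (\<Phi> x) (grad \<Phi> x) + (-1) * dzp vs a2 x (\<Phi> x) (grad \<Phi> x))"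
      using that m1
      by (intro has_cext_lincomb has_cext_dzp[OF \<Omega>(1) a1c bg.Y_closure[OF Phi_reg order_refl]]
          has_cext_dzp[OF \<Omega>(1) a2c bg.Y_closure[OF Phi_reg order_refl]]) auto
    then show ?thesis by (simp add: A0_def)
  qed
  have Asym: "sym_multilinear k (A0 x)" if "x \<in> \<Omega>" for x
    unfolding A0_def[abs_def] dzp_slice
    by (intro sym_multilinear_diff nderiv_sym_multilinear[OF open_UNIV Ck_on_slice[OF \<Omega>(1) ck(1) that]]
        nderiv_sym_multilinear[OF open_UNIV Ck_on_slice[OF \<Omega>(1) ck(2) that]] UNIV_I)
  \<comment> \<open>At order \<open>k\<close> the source may be nonzero, but \<open>below\<close>
    still supplies everything \<open>eqn\<close> and \<open>Wb\<close> require. The Cauchy data at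
    order \<open>k\<close> provide the vanishing boundary gradient.\<close>
  have pairing: "(LINT x|lebesgue_on \<Omega>. A0 x (replicate k (?J (dS2 1 \<phi> [h]) x)) * w x) = 0"
    if h: "h \<in> fcarrier ?X" and w: "adjoint_weak_solution \<Omega> a1 \<Phi> w" for h w
  proof (rule weak_pairing_zero[OF \<Omega>(1,2) bg.Y_closure[OF Phi_reg] bg.Y_closure[OF Wcar[OF h]] bg.C_sym _ _ w])
    have k1: "1 \<le> k" using k by simp
    note z = below[OF h]
    show "3 \<le> m + 2" "3 \<le> m + 2" "k \<le> m + 1" using k by auto
    show W_fr: "W k h x = 0" if "x \<in> frontier \<Omega>" for x by (rule Wb[OF h k1 order_refl that z])
    show "L_lin a1 \<Phi> (W k h) x = A0 x (replicate k (?J (dS2 1 \<phi> [h]) x))" if "x \<in> \<Omega>" for x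
      by (rule eqn[OF h k1 order_refl that z])
    have "dS2 1 \<phi> (replicate 1 h) \<in> fcarrier ?Y" by (rule car2[OF h]) simp
    then have "set (replicate k (dS2 1 \<phi> [h])) \<subseteq> fcarrier ?Y" by auto
    from Acext[OF this] show "has_cext \<Omega> (\<lambda>x. A0 x (replicate k (?J (dS2 1 \<phi> [h]) x)))" by simp
    show "bdry_ext \<Omega> (nderiv [axis i 1] (W k h)) x = 0" if "x \<in> frontier \<Omega>" for x i
      unfolding W_def
    proof (rule gradient_zero_of_normal_deriv[OF dom])
      show "Ck_closure (m + 2) \<Omega> (dS1 k \<phi> (replicate k h))" "Ck_closure (m + 2) \<Omega> (dS2 k \<phi> (replicate k h))"
        using car1[OF h k(2)] car2[OF h k(2)] bg.Y_closure by auto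
      show "dS1 k \<phi> (replicate k h) x - dS2 k \<phi> (replicate k h) x = 0" if "x \<in> frontier \<Omega>" for x
        using W_fr[OF that] by (simp add: W_def)
      show "normal_deriv \<Omega> (dS1 k \<phi> (replicate k h)) x = normal_deriv \<Omega> (dS2 k \<phi> (replicate k h)) x"
        using h that k1 by (intro same_variations) auto
    qed (use that in auto)
  qed
  define Sol where "Sol = {v \<in> fcarrier ?Y. \<forall>x\<in>\<Omega>. L_lin a1 \<Phi> v x = 0}"
  have diag: "(LINT x|lebesgue_on \<Omega>. A0 x (replicate k (?J v x)) * w x) = 0"
    if v: "v \<in> Sol" and w: "adjoint_weak_solution \<Omega> a1 \<Phi> w" for v w
  proof -
    have vY: "v \<in> fcarrier ?Y" and vL: "\<And>x. x \<in> \<Omega> \<Longrightarrow> L_lin a1 \<Phi> v x = 0" using v by (auto simp: Sol_def)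
    have vX: "v \<in> fcarrier ?X" by (rule holder_bdry_spaceI[OF vY])
    let ?v1 = "dS1 1 \<phi> [v]" and ?v2 = "dS2 1 \<phi> [v]"
    have v1Y: "?v1 \<in> fcarrier ?Y" using car1[OF vX, of 1] by simp
    have L1: "L_lin a1 \<Phi> ?v1 x = 0" if "x \<in> \<Omega>" for x
    proof (rule first_variation_equation[OF line1[OF vX] _ that _ bg.C_sym[OF that]])
      show "Ck_on 1 (\<Omega> \<times> UNIV) (uncurry3 a1)" using k by (intro Ck_on_mono[OF ck(1)]) simp
      show "det (hess \<Phi> x) = a1 x (\<Phi> x) (grad \<Phi> x)" using Phi_sol1 that by (simp add: MA_solution_def)
    qed
    \<comment> \<open>The boundary datum fed into the operator is \<open>v\<close> itself, so
      \<open>?v1\<close> solves the same homogeneous equation with the same boundary values, and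
      uniqueness identifies the two.\<close>
    have d: "?v1 x + (-1) * v x = 0" if "x \<in> closure \<Omega>" for x
    proof (rule bg.uniqueness[OF holder_space_lincomb[OF \<Omega>(1) v1Y vY] _ _ that])
      show "L_lin a1 \<Phi> (\<lambda>x. ?v1 x + (-1) * v x) x = 0" if "x \<in> \<Omega>" for x
        using bg.jet_lincomb(2)[OF v1Y vY that, of "-1"] L1[OF that] vL[OF that] by simp
      show "?v1 x + (-1) * v x = 0" if "x \<in> frontier \<Omega>" for x
        using MA_solution_line.first_variation_boundary[OF line1[OF vX] that bdry[OF that]] by simp
    qed
    \<comment> \<open>Order 1 lies below \<open>k\<close>, so the first variations of the two
      operators coincide; \<open>pairing\<close> is stated for the second one.\<close>
    have eq: "?v2 x = v x" if "x \<in> closure \<Omega>" for x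
      using below[OF vX _ that, of 1] d[OF that] k by (simp add: W_def)
    have "?J ?v2 x = ?J v x" if x: "x \<in> \<Omega>" for x
    proof -
      have o: "?v2 y = v y" if "y \<in> \<Omega>" for y using eq that closure_subset by blast
      have "nderiv vs ?v2 x = nderiv vs v x" for vs by (rule nderiv_cong_open[OF \<Omega>(1) o x])
      then show ?thesis using o[OF x] by (simp add: grad_def del: nderiv.simps)
    qed
    then have "(LINT x|lebesgue_on \<Omega>. A0 x (replicate k (?J v x)) * w x)
        = (LINT x|lebesgue_on \<Omega>. A0 x (replicate k (?J ?v2 x)) * w x)"
      by (intro Bochner_Integration.integral_cong refl) simp
    then show ?thesis using pairing[OF vX w] by simp
  qed
  have pol: "(LINT x|lebesgue_on \<Omega>. A0 x (map (\<lambda>u. ?J u x) us) * w x) = 0"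
    if us: "set us \<subseteq> Sol" "length us = k" and w: "adjoint_weak_solution \<Omega> a1 \<Phi> w" for us w
  proof (rule polarized_integral_zero[where J = ?J and Sol = Sol and k = k])
    fix u v s assume uv: "u \<in> Sol" "v \<in> Sol"
    then have Y: "u \<in> fcarrier ?Y" "v \<in> fcarrier ?Y" by (auto simp: Sol_def)
    show "(\<lambda>x. u x + s * v x) \<in> Sol"
      using uv holder_space_lincomb[OF \<Omega>(1) Y, of s] bg.jet_lincomb(2)[OF Y, of _ s] by (auto simp: Sol_def)
    show "?J (\<lambda>x. u x + s * v x) x = ?J u x + s *\<^sub>R ?J v x" if "x \<in> space (lebesgue_on \<Omega>)" for x
      using bg.jet_lincomb(1)[OF Y, of x s] that by simp
  next
    fix us :: "((real^'n) \<Rightarrow> real) list" assume u: "set us \<subseteq> Sol" "length us = k"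
    have c: "has_cext \<Omega> (\<lambda>x. A0 x (map (\<lambda>u. ?J u x) us))" using u by (intro Acext) (auto simp: Sol_def)
    obtain B where B: "B \<ge> 0" "\<And>x. x \<in> \<Omega> \<Longrightarrow> \<bar>A0 x (map (\<lambda>u. ?J u x) us)\<bar> \<le> B" by (rule has_cext_bounded[OF c \<Omega>(2)]) blast
    have "integrable (lebesgue_on \<Omega>) w"
      using w L2_fun_integrable[OF \<Omega>(1,2)] by (auto simp: adjoint_weak_solution_def H1_def)
    then have "integrable (lebesgue_on \<Omega>) (\<lambda>x. w x * A0 x (map (\<lambda>u. ?J u x) us))"
      by (rule integrable_mult_bounded[where B = B])
         (use B continuous_on_measurable[OF \<Omega>(1) has_cext_continuous_on[OF c]] in auto)
    then show "integrable (lebesgue_on \<Omega>) (\<lambda>x. A0 x (map (\<lambda>u. ?J u x) us) * w x)" by (simp add: mult.commute)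
  qed (use us k Asym diag[OF _ w] in auto)
  \<comment> \<open>\<open>A0\<close> is controlled only inside \<open>\<Omega>\<close>, while
    \<open>product_density\<close> asks for a continuous field on the closure. The boundary
    extension supplies it and leaves the integrals over \<open>\<Omega>\<close> unchanged.\<close>
  let ?A = "\<lambda>x vs. bdry_ext \<Omega> (\<lambda>y. A0 y vs) x"
  have "\<forall>x\<in>\<Omega>. \<forall>vs. length vs = k \<longrightarrow> ?A x vs = 0"
  proof (rule density[unfolded product_density_def, THEN spec[of _ ?A], THEN mp, THEN mp, THEN mp])
    show "\<forall>x\<in>closure \<Omega>. sym_multilinear k (\<lambda>vs. ?A x vs)"
      using sym_multilinear_bdry_ext[of \<Omega> k A0, OF Asym Acext'] by blast
    show "\<forall>vs. length vs = k \<longrightarrow> continuous_on (closure \<Omega>) (\<lambda>x. ?A x vs)"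
      using bdry_ext_continuous[OF Acext'] by blast
    show "\<forall>v w. (\<forall>l<k. v l \<in> fcarrier ?Y \<and> (\<forall>x\<in>\<Omega>. L_lin a1 \<Phi> (v l) x = 0)) \<longrightarrow>
               adjoint_weak_solution \<Omega> a1 \<Phi> w \<longrightarrow>
               (LINT x|lebesgue_on \<Omega>. ?A x (map (\<lambda>l. (v l x, grad (v l) x)) [0..<k]) * w x) = 0"
    proof (intro allI impI)
      fix v :: "nat \<Rightarrow> real^'n \<Rightarrow> real" and w
      assume v: "\<forall>l<k. v l \<in> fcarrier ?Y \<and> (\<forall>x\<in>\<Omega>. L_lin a1 \<Phi> (v l) x = 0)" and w: "adjoint_weak_solution \<Omega> a1 \<Phi> w"
      have "(LINT x|lebesgue_on \<Omega>. ?A x (map (\<lambda>l. (v l x, grad (v l) x)) [0..<k]) * w x)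
          = (LINT x|lebesgue_on \<Omega>. A0 x (map (\<lambda>u. ?J u x) (map v [0..<k])) * w x)"
        by (intro Bochner_Integration.integral_cong refl) (simp add: bdry_ext_inside o_def)
      also have "\<dots> = 0" using v by (intro pol[OF _ _ w]) (auto simp: Sol_def)
      finally show "(LINT x|lebesgue_on \<Omega>. ?A x (map (\<lambda>l. (v l x, grad (v l) x)) [0..<k]) * w x) = 0" .
    qed
  qed
  then show ?thesis by (simp add: bdry_ext_inside A0_def)
qed

end
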